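(* Let $M\geq2$, let $\mathsf{A}=(A_1,\ldots,A_M)\in M_d(\mathbb{R})^M$ be irreducible and suppose that none of the matrices $A_i$ is equal to the zero matrix. Let $s>0$ and let $\mu$ be the equilibrium state of $(\mathsf{A},s)$. Then the following three conditions are equivalent: (i) The measure $\mu$ is a fully-supported Bernoulli measure, and each of the matrices $A_1,\ldots,A_M$ is invertible. (ii) The Lyapunov exponents \[\lambda_i(\mathsf{A},\mu):=\lim_{n\to\infty}\frac1n\int_{\Sigma_M}\log\alpha_i(A_{x_n}\cdots A_{x_1})\,d\mu(x)\] satisfy $\lambda_1(\mathsf{A},\mu)=\lambda_2(\mathsf{A},\mu)=\cdots=\lambda_d(\mathsf{A},\mu)$. (iii) There exists $B\in GL_d(\mathbb{R})$ such that $|\det A_i|^{-1/d}B^{-1}A_iB\in O(d)$ for every $i=1,\ldots,M$.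
   Context: $\Sigma_M:=\{1,\ldots,M\}^{\mathbb{N}}$ with the product topology; $\sigma$ is the shift $\sigma[(x_n)_{n=1}^\infty]=(x_{n+1})_{n=1}^\infty$; $\mathcal{M}_\sigma$ is the set of $\sigma$-invariant Borel probability measures on $\Sigma_M$; $h(\nu)$ is the metric entropy of $\nu\in\mathcal{M}_\sigma$. $M_d(\mathbb{R})$ is the set of real $d\times d$ matrices and $\|\cdot\|$ is the operator norm induced by the Euclidean norm. The top Lyapunov exponent is $\Lambda(\mathsf{A},\nu):=\lim_{n\to\infty}\frac1n\int_{\Sigma_M}\log\|A_{x_n}\cdots A_{x_1}\|\,d\nu(x)\in[-\infty,\infty)$ (with $\log 0=-\infty$). An equilibrium state of $(\mathsf{A},s)$ is a measure $\mu\in\mathcal{M}_\sigma$ attaining $\sup_{\nu\in\mathcal{M}_\sigma}\bigl(h(\nu)+s\Lambda(\mathsf{A},\nu)\bigr)$. $\mathsf{A}$ is irreducible if there is no linear subspace $U\subset\mathbb{R}^d$ with $0<\dim U<d$ and $A_iU\subseteq U$ for all $i$; under the hypotheses of the claim the equilibrium state is known to exist and be unique (Feng–Käenmäki for $d\geq2$; classical for $d=1$). The singular values $\alpha_1(A)\geq\cdots\geq\alpha_d(A)$ of $A\in M_d(\mathbb{R})$ are the non-negative square roots of the eigenvalues of $A^TA$, repeated according to multiplicity; the Lyapunov exponents take values in $[-\infty,\infty)$. A Bernoulli measure on $\Sigma_M$ is a measure of the form $p^{\mathbb{N}}$ with $p$ a probability measure on $\{1,\ldots,M\}$. $O(d)$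 is the real orthogonal group. Condition (iii) is understood to include $\det A_i\neq0$ for every $i$. *)

theory Defs
  imports
    "HOL-Analysis.Analysis"
    "HOL-Probability.Probability"
begin

section \<open>The full shift\<close>

text \<open>Sequences are indexed from 0, so the entry written \<open>x\<^sub>n\<close> with \<open>n \<ge> 1\<close> is \<open>x (n - 1)\<close> here.\<close>

definition full_shift :: "nat \<Rightarrow> (nat \<Rightarrow> nat) topology" where
  "full_shift M = product_topology (\<lambda>_. discrete_topology {1..M}) UNIV"

definition borel_shift :: "nat \<Rightarrow> (nat \<Rightarrow> nat) measure" where
  "borel_shift M = sigma (topspace (full_shift M)) {U. openin (full_shift M) U}"

definition shift :: "(nat \<Rightarrow> nat) \<Rightarrow> nat \<Rightarrow> nat" where
  "shift x = (\<lambda>n. x (Suc n))"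

definition invariant_measures :: "nat \<Rightarrow> (nat \<Rightarrow> nat) measure set" where
  "invariant_measures M =
     {\<nu>. prob_space \<nu> \<and> sets \<nu> = sets (borel_shift M) \<and>
         (\<forall>B\<in>sets \<nu>. emeasure \<nu> (shift -` B \<inter> space \<nu>) = emeasure \<nu> B)}"

definition bernoulli_measure :: "nat \<Rightarrow> (nat \<Rightarrow> nat) measure \<Rightarrow> bool" where
  "bernoulli_measure M \<mu> \<longleftrightarrow>
     (\<exists>p. prob_space p \<and> sets p = sets (count_space {1..M}) \<and> \<mu> = PiM UNIV (\<lambda>_. p))"

definition fully_supported :: "nat \<Rightarrow> (nat \<Rightarrow> nat) measure \<Rightarrow> bool" where
  "fully_supported M \<mu> \<longleftrightarrow> (\<forall>U. openin (full_shift M) U \<and> U \<noteq> {} \<longrightarrow> emeasure \<mu> U > 0)"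


section \<open>Metric entropy\<close>

text \<open>Kolmogorov--Sinai entropy with natural logarithms. Since \<open>ln 0 = 0\<close> in HOL, null cells
  contribute \<open>0\<close>.\<close>

definition partition_entropy :: "'a measure \<Rightarrow> 'a set set \<Rightarrow> real" where
  "partition_entropy \<nu> P = - (\<Sum>B\<in>P. measure \<nu> B * ln (measure \<nu> B))"

text \<open>The join of \<open>T\<^sup>-\<^sup>k P\<close> for \<open>k < n\<close>; the library's common refinement discards empty cells.\<close>

definition iterated_join :: "'a measure \<Rightarrow> ('a \<Rightarrow> 'a) \<Rightarrow> 'a set set \<Rightarrow> nat \<Rightarrow> 'a set set" where
  "iterated_join \<nu> T P n =
     common_refinement ((\<lambda>k. (\<lambda>B. (T ^^ k) -` B \<inter> space \<nu>) ` P) ` {..<n})"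

definition entropy_wrt :: "'a measure \<Rightarrow> ('a \<Rightarrow> 'a) \<Rightarrow> 'a set set \<Rightarrow> real" where
  "entropy_wrt \<nu> T P = lim (\<lambda>n. partition_entropy \<nu> (iterated_join \<nu> T P n) / real n)"

definition metric_entropy :: "'a measure \<Rightarrow> ('a \<Rightarrow> 'a) \<Rightarrow> ereal" where
  "metric_entropy \<nu> T =
     (SUP P \<in> {P. finite P \<and> P \<subseteq> sets \<nu> \<and> partition_on (space \<nu>) P}. ereal (entropy_wrt \<nu> T P))"


section \<open>Extended-real logarithms and integrals\<close>

definition elog :: "real \<Rightarrow> ereal" where
  "elog r = (if r = 0 then - \<infinity> else ereal (ln r))"

text \<open>Integral of the positive part minus integral of the negative part (\<open>e2ennreal\<close> truncates
  negative values to \<open>0\<close>). It is only applied to functions that are bounded above on a probability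
  space, so \<open>\<infinity> - \<infinity>\<close> does not occur.\<close>

definition extended_integral :: "'a measure \<Rightarrow> ('a \<Rightarrow> ereal) \<Rightarrow> ereal" where
  "extended_integral \<nu> f =
     enn2ereal (\<integral>\<^sup>+ x. e2ennreal (f x) \<partial>\<nu>) - enn2ereal (\<integral>\<^sup>+ x. e2ennreal (- f x) \<partial>\<nu>)"


section \<open>Singular values and Lyapunov exponents\<close>

definition charpoly :: "real^'n^'n \<Rightarrow> real poly" where
  "charpoly A = det (mat [:0, 1:] - (\<chi> i j. [:A $ i $ j:]))"

text \<open>\<open>singular_value i A\<close> is the \<open>i\<close>-th largest singular value, for \<open>1 \<le> i \<le> CARD('n)\<close>; multiplicities
  are those of the roots of the characteristic polynomial of \<open>A\<^sup>T A\<close>.\<close>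

definition singular_value :: "nat \<Rightarrow> real^'n^'n \<Rightarrow> real" where
  "singular_value i A =
     rev (sorted_list_of_multiset (image_mset sqrt (proots (charpoly (transpose A ** A))))) ! (i - 1)"

primrec cocycle :: "(nat \<Rightarrow> real^'n^'n) \<Rightarrow> nat \<Rightarrow> (nat \<Rightarrow> nat) \<Rightarrow> real^'n^'n" where
  "cocycle A 0 x = mat 1"
| "cocycle A (Suc n) x = A (x n) ** cocycle A n x"

definition top_lyapunov :: "(nat \<Rightarrow> real^'n^'n) \<Rightarrow> (nat \<Rightarrow> nat) measure \<Rightarrow> ereal" where
  "top_lyapunov A \<nu> =
     lim (\<lambda>n. ereal (1 / real n) *
            extended_integral \<nu> (\<lambda>x. elog (onorm ((*v) (cocycle A n x)))))"

definition lyapunov_exponent :: "(nat \<Rightarrow> real^'n^'n) \<Rightarrow> (nat \<Rightarrow> nat) measure \<Rightarrow> nat \<Rightarrow> ereal" where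
  "lyapunov_exponent A \<nu> i =
     lim (\<lambda>n. ereal (1 / real n) *
            extended_integral \<nu> (\<lambda>x. elog (singular_value i (cocycle A n x))))"


section \<open>Irreducibility and equilibrium states\<close>

text \<open>Only the matrices \<open>A 1, \<dots>, A M\<close> matter; other values of \<open>A\<close> are never used.\<close>

definition irreducible_tuple :: "nat \<Rightarrow> (nat \<Rightarrow> real^'n^'n) \<Rightarrow> bool" where
  "irreducible_tuple M A \<longleftrightarrow>
     \<not> (\<exists>U. subspace U \<and> 0 < dim U \<and> dim U < CARD('n) \<and> (\<forall>i\<in>{1..M}. (*v) (A i) ` U \<subseteq> U))"

definition free_energy :: "(nat \<Rightarrow> real^'n^'n) \<Rightarrow> real \<Rightarrow> (nat \<Rightarrow> nat) measure \<Rightarrow> ereal" where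
  "free_energy A s \<nu> = metric_entropy \<nu> shift + ereal s * top_lyapunov A \<nu>"

definition equilibrium_state ::
    "nat \<Rightarrow> (nat \<Rightarrow> real^'n^'n) \<Rightarrow> real \<Rightarrow> (nat \<Rightarrow> nat) measure \<Rightarrow> bool" where
  "equilibrium_state M A s \<mu> \<longleftrightarrow>
     \<mu> \<in> invariant_measures M \<and>
     free_energy A s \<mu> = (SUP \<nu>\<in>invariant_measures M. free_energy A s \<nu>)"

end

theory Submission
  imports Defs "HOL-Real_Asymp.Real_Asymp"
begin

text \<open>
  Let \<open>P\<close> be the value of \<open>h(\<mu>) + s \<Lambda>(A, \<mu>)\<close> and let \<open>mprod A w\<close> be the product of the matrices
  along a word \<open>w\<close>. Irreducibility gives a bound \<open>(\<Sum>w\<in>words M n. mnorm (mprod A w) powr s) \<le> C * exp (n * P)\<close>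
  without subexponential corrections (\<open>sum_norms_le_exp_pressure\<close>): if the sum over the words whose products
  point in a similar direction were much larger, a measure made of independent blocks of such words
  would have a larger value than \<open>P\<close>. The three conditions are then proved in a cycle.

  From (i) to (iii). Let \<open>\<mu>\<close> be a product measure with probabilities \<open>p i\<close> and put
  \<open>r i = (p i * exp P) powr (1 / s)\<close>. The normalised sums of norms define a superharmonic
  function on matrices. Along the random products the mean logarithm of this function, corrected by the
  probabilities of the words, decreases, and it is bounded because \<open>\<mu>\<close> attains the supremum; so in the limit
  there is a nonzero matrix from which the products grow at most like \<open>\<Prod>k. r (w ! k)\<close>, and
  irreducibility extends the bound to \<open>mprod A w\<close> itself (\<open>norm_le_prod_rate\<close>). Hence the matrices
  \<open>A i / r i\<close> generate a bounded irreducible semigroup, whose products do not become small in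
  the mean. Averaging the Euclidean form over the semigroup gives a positive definite form
  that is preserved in the mean, and a maximum principle shows that each generator preserves it
  (\<open>bounded_irreducible_invariant_form\<close>). A basis orthonormal for this form conjugates every \<open>A i / r i\<close>
  into the orthogonal group (\<open>conformal\<close>).

  From (iii) to (ii). In suitable coordinates \<open>A i\<close> multiplies all lengths by the same number \<open>r i\<close>, so all
  singular values of \<open>mprod A w\<close> agree with the product of these numbers up to a constant
  (\<open>conformal_exponents_equal\<close>).

  From (ii) to (i). If the exponents coincide, they are equal to the mean of \<open>ln \<bar>det\<bar>\<close> divided by
  the dimension \<open>d\<close>. So \<open>P\<close> is attained with the additive potential \<open>(s / d) * ln \<bar>det (A i)\<bar>\<close> in place of the norms.
  As \<open>\<bar>det X\<bar>\<close> is at most \<open>mnorm X ^ d\<close>, the weights \<open>exp (- P) * \<bar>det (A i)\<bar> powr (s / d)\<close> have total mass at most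
  one, and the Gibbs inequality identifies \<open>\<mu>\<close> with their product measure (\<open>equal_exponents_product_law\<close>).
  The growth bound of the first step, applied to one-letter words, shows that no weight vanishes, so every
  \<open>A i\<close> is invertible and \<open>\<mu>\<close> has full support.
\<close>

section \<open>Matrix norms, words and irreducibility\<close>

abbreviation mnorm :: "real^'n^'n \<Rightarrow> real" where
  "mnorm A \<equiv> onorm ((*v) A)"

lemma mnorm_nonneg: "0 \<le> mnorm A"
  by (simp add: onorm_pos_le)

lemma norm_matrix_vector_le: "norm (A *v x) \<le> mnorm A * norm x"
  for A :: "real^'n^'n"
  by (simp add: onorm)

lemma mnorm_least:
  fixes A :: "real^'n^'n"
  assumes "\<And>x. norm (A *v x) \<le> b * norm x"
  shows "mnorm A \<le> b"
  using assms by (rule onorm_le)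

lemma mnorm_eq_0_iff: "mnorm A = 0 \<longleftrightarrow> A = 0" for A :: "real^'n^'n"
  by (metis matrix_vector_mul_bounded_linear matrix_vector_mul_linear matrix_eq
      matrix_vector_mult_0 onorm_eq_0)

lemma mnorm_pos_iff: "0 < mnorm A \<longleftrightarrow> A \<noteq> 0" for A :: "real^'n^'n"
  using mnorm_eq_0_iff mnorm_nonneg by (metis less_eq_real_def less_numeral_extra(3))

lemma mnorm_mult: "mnorm (A ** B) \<le> mnorm A * mnorm B" for A :: "real^'n^'n"
proof (rule mnorm_least)
  fix x
  have "norm ((A ** B) *v x) = norm (A *v (B *v x))"
    by (simp add: matrix_vector_mul_assoc)
  also have "\<dots> \<le> mnorm A * norm (B *v x)"
    by (rule norm_matrix_vector_le)
  also have "\<dots> \<le> mnorm A * (mnorm B * norm x)"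
    by (intro mult_left_mono norm_matrix_vector_le mnorm_nonneg)
  finally show "norm ((A ** B) *v x) \<le> mnorm A * mnorm B * norm x"
    by (simp add: mult.assoc)
qed

lemma mnorm_scaleR: "mnorm (c *\<^sub>R A) = \<bar>c\<bar> * mnorm A" for A :: "real^'n^'n"
proof -
  have "(*v) (c *\<^sub>R A) = (\<lambda>x. c *\<^sub>R (A *v x))"
    by (auto simp: scaleR_matrix_vector_assoc)
  then show ?thesis
    by (simp add: onorm_scaleR)
qed

lemma mnorm_triangle: "mnorm (A + B) \<le> mnorm A + mnorm B" for A :: "real^'n^'n"
proof (rule mnorm_least)
  fix x
  have "norm ((A + B) *v x) \<le> norm (A *v x) + norm (B *v x)"
    by (simp add: matrix_vector_mult_add_rdistrib norm_triangle_ineq)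
  also have "\<dots> \<le> mnorm A * norm x + mnorm B * norm x"
    by (intro add_mono norm_matrix_vector_le)
  finally show "norm ((A + B) *v x) \<le> (mnorm A + mnorm B) * norm x"
    by (simp add: algebra_simps)
qed

lemma mnorm_triangle_minus: "mnorm (A - B) \<le> mnorm A + mnorm B" for A :: "real^'n^'n"
  using mnorm_triangle[of A "- B"] mnorm_scaleR[of "-1" B] by simp

lemma mnorm_mat_1: "mnorm (mat 1 :: real^'n^'n) = 1"
proof -
  have "(*v) (mat 1 :: real^'n^'n) = (\<lambda>x. x)"
    by auto
  then show ?thesis
    using onorm_id[where 'a = "real^'n"] by simp
qed

lemma mnorm_le_norm: "mnorm A \<le> norm A" for A :: "real^'n^'n"
proof (rule mnorm_least)
  fix x :: "real^'n"
  have "norm (A *v x) = L2_set (\<lambda>i. norm ((A *v x) $ i)) UNIV"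
    by (simp add: norm_vec_def)
  also have "\<dots> \<le> L2_set (\<lambda>i. norm (A $ i) * norm x) UNIV"
    by (rule L2_set_mono)
      (auto simp: matrix_vector_mul_component Cauchy_Schwarz_ineq2)
  also have "\<dots> = norm A * norm x"
    by (simp add: norm_vec_def L2_set_left_distrib)
  finally show "norm (A *v x) \<le> norm A * norm x" .
qed

lemma norm_le_mnorm: "norm A \<le> real (CARD('n) * CARD('n)) * mnorm A" for A :: "real^'n^'n"
proof -
  have "norm A \<le> (\<Sum>i\<in>UNIV. norm (A $ i))"
    unfolding norm_vec_def[of A] by (rule L2_set_le_sum) simp
  also have "\<dots> \<le> (\<Sum>i\<in>(UNIV::'n set). \<Sum>j\<in>(UNIV::'n set). \<bar>A $ i $ j\<bar>)"
    by (intro sum_mono norm_le_l1_cart)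
  also have "\<dots> \<le> (\<Sum>i\<in>(UNIV::'n set). \<Sum>j\<in>(UNIV::'n set). mnorm A)"
    by (intro sum_mono matrix_component_le_onorm)
  finally show ?thesis
    by (simp add: mult.assoc)
qed

lemma mnorm_tendsto:
  fixes X :: "nat \<Rightarrow> real^'n^'n"
  assumes "X \<longlonglongrightarrow> L"
  shows "(\<lambda>n. mnorm (X n)) \<longlonglongrightarrow> mnorm L"
proof (rule Lim_transform_eventually[rotated])
  have "(\<lambda>n. norm (X n - L)) \<longlonglongrightarrow> 0"
    using assms by (simp add: LIM_zero tendsto_norm_zero)
  moreover have "\<forall>n. norm (mnorm (X n) - mnorm L) \<le> norm (norm (X n - L)) * 1"
  proof
    fix n
    show "norm (mnorm (X n) - mnorm L) \<le> norm (norm (X n - L)) * 1"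
    using mnorm_triangle[of "X n - L" L] mnorm_triangle_minus[of "X n" "X n - L"]
      mnorm_le_norm[of "X n - L"] by simp
  qed
  ultimately have "(\<lambda>n. mnorm (X n) - mnorm L) \<longlonglongrightarrow> 0"
    by (rule tendsto_0_le[OF _ always_eventually])
  then show "(\<lambda>n. mnorm (X n)) \<longlonglongrightarrow> mnorm L"
    by (simp add: LIM_zero_iff)
qed simp

lemma matrix_add_rdistrib: "(A + B) ** C = A ** C + B ** C"
  for A B C :: "real^'n^'n"
  by (simp add: matrix_matrix_mult_def vec_eq_iff sum.distrib distrib_right)

lemma tendsto_matrix_matrix_mult:
  fixes X :: "'b \<Rightarrow> real^'n^'n"
  assumes "(X \<longlongrightarrow> L) F" "(Y \<longlongrightarrow> K) F"
  shows "((\<lambda>n. X n ** Y n) \<longlongrightarrow> L ** K) F"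
  unfolding matrix_matrix_mult_def
  by (intro tendsto_vec_lambda tendsto_sum tendsto_mult tendsto_vec_nth assms)

text \<open>The pointwise bounded case of the Banach--Steinhaus theorem, which in finite dimension only
  needs the bounds at the basis vectors.\<close>

lemma pointwise_bounded_imp_mnorm_bounded:
  fixes G :: "(real^'n^'n) set"
  assumes "\<And>x. \<exists>C. \<forall>g\<in>G. norm (g *v x) \<le> C"
  obtains C where "C > 0" "\<And>g. g \<in> G \<Longrightarrow> mnorm g \<le> C"
proof -
  obtain c where c: "\<And>x g. g \<in> G \<Longrightarrow> norm (g *v x) \<le> c x"
    using assms by metis
  define C where "C = (\<Sum>b\<in>Basis. \<bar>c b\<bar>) + 1"
  have "mnorm g \<le> C" if g: "g \<in> G" for g
  proof (rule mnorm_least)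
    fix x :: "real^'n"
    have "g *v x = g *v (\<Sum>b\<in>Basis. (x \<bullet> b) *\<^sub>R b)"
      by (simp add: euclidean_representation)
    also have "\<dots> = (\<Sum>b\<in>Basis. (x \<bullet> b) *\<^sub>R (g *v b))"
      by (simp add: linear_sum[OF matrix_vector_mul_linear] matrix_vector_mult_scaleR)
    finally have "norm (g *v x) \<le> (\<Sum>b\<in>Basis. norm ((x \<bullet> b) *\<^sub>R (g *v b)))"
      by (simp only: norm_sum)
    also have "\<dots> \<le> (\<Sum>b\<in>Basis. \<bar>c b\<bar> * norm x)"
    proof (rule sum_mono)
      fix b :: "real^'n" assume b: "b \<in> Basis"
      have "\<bar>x \<bullet> b\<bar> * norm (g *v b) \<le> norm x * \<bar>c b\<bar>"
        using c[OF g, of b] Basis_le_norm[OF b, of x] by (intro mult_mono) auto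
      then show "norm ((x \<bullet> b) *\<^sub>R (g *v b)) \<le> \<bar>c b\<bar> * norm x"
        by (simp add: mult.commute)
    qed
    also have "\<dots> = (\<Sum>b\<in>(Basis :: (real^'n) set). \<bar>c b\<bar>) * norm x"
      by (simp add: sum_distrib_right)
    also have "\<dots> \<le> C * norm x"
      by (simp add: C_def mult_right_mono)
    finally show "norm (g *v x) \<le> C * norm x" .
  qed
  moreover have "C > 0"
    unfolding C_def by (simp add: add_nonneg_pos sum_nonneg)
  ultimately show ?thesis
    using that by blast
qed

definition words :: "nat \<Rightarrow> nat \<Rightarrow> nat list set" where
  "words M n = {w. set w \<subseteq> {1..M} \<and> length w = n}"

text \<open>The first letter of a word acts first, as in the cocycle.\<close>

primrec mprod :: "(nat \<Rightarrow> real^'n^'n) \<Rightarrow> nat list \<Rightarrow> real^'n^'n" where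
  "mprod A [] = mat 1"
| "mprod A (i # w) = mprod A w ** A i"

lemma mprod_append: "mprod A (u @ v) = mprod A v ** mprod A u"
  by (induction u) (auto simp: matrix_mul_assoc)

lemma mprod_single [simp]: "mprod A [i] = A i"
  by simp

lemma cocycle_eq_mprod: "cocycle A n x = mprod A (map x [0..<n])"
  by (induction n) (auto simp: mprod_append)

lemma finite_words [simp, intro]: "finite (words M n)"
  unfolding words_def by (rule finite_lists_length_eq) simp

lemma words_0 [simp]: "words M 0 = {[]}"
  by (auto simp: words_def)

lemma card_words: "card (words M n) = M ^ n"
  unfolding words_def by (simp add: card_lists_length_eq)

lemma words_1: "words M 1 = (\<lambda>i. [i]) ` {1..M}"
  by (auto simp: words_def length_Suc_conv)

lemma sum_words_add:
  "(\<Sum>w\<in>words M (m + n). f w) = (\<Sum>u\<in>words M m. \<Sum>v\<in>words M n. f (u @ v))"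
proof -
  have "(\<Sum>w\<in>words M (m + n). f w) = (\<Sum>p\<in>words M m \<times> words M n. f (fst p @ snd p))"
  proof (rule sum.reindex_bij_witness[where j = "\<lambda>w. (take m w, drop m w)"
        and i = "\<lambda>p. fst p @ snd p"])
  qed (auto simp: words_def dest: in_set_takeD in_set_dropD)
  then show ?thesis
    by (simp add: sum.cartesian_product split_def)
qed

lemma sum_words_1: "(\<Sum>w\<in>words M 1. f w) = (\<Sum>i\<in>{1..M}. f [i])"
  unfolding words_1 by (subst sum.reindex) (auto simp: inj_on_def)

lemma sum_words_Suc:
  "(\<Sum>w\<in>words M (Suc n). f w) = (\<Sum>i\<in>{1..M}. \<Sum>v\<in>words M n. f (i # v))"
  using sum_words_add[of f M 1 n] sum_words_1[of "\<lambda>u. \<Sum>v\<in>words M n. f (u @ v)" M] by simp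

lemma sum_words_prod_list:
  fixes g :: "nat \<Rightarrow> 'a::comm_semiring_1"
  shows "(\<Sum>w\<in>words M n. prod_list (map g w)) = (\<Sum>i\<in>{1..M}. g i) ^ n"
proof (induction n)
  case (Suc n)
  have "(\<Sum>w\<in>words M (Suc n). prod_list (map g w))
      = (\<Sum>i\<in>{1..M}. g i * (\<Sum>v\<in>words M n. prod_list (map g v)))"
    by (simp add: sum_words_Suc sum_distrib_left)
  then show ?case
    using Suc by (simp add: sum_distrib_right)
qed simp

lemma mnorm_mprod_le:
  fixes A :: "nat \<Rightarrow> real^'b^'b"
  assumes "\<And>i. i \<in> {1..M} \<Longrightarrow> mnorm (A i) \<le> K" "K \<ge> 0" "set w \<subseteq> {1..M}"
  shows "mnorm (mprod A w) \<le> K ^ length w"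
  using assms(3)
proof (induction w)
  case Nil
  have "mnorm (mprod A []) = 1"
    unfolding mprod.simps by (rule mnorm_mat_1)
  then show ?case by (simp del: mprod.simps)
next
  case (Cons i w)
  have "mnorm (mprod A (i # w)) \<le> mnorm (mprod A w) * mnorm (A i)"
    by (simp add: mnorm_mult)
  also have "\<dots> \<le> K ^ length w * K"
    using Cons assms by (intro mult_mono mnorm_nonneg) auto
  finally show ?case by (simp add: mult.commute)
qed

lemma irreducible_invariant_subspace:
  fixes A :: "nat \<Rightarrow> real^'n^'n"
  assumes "irreducible_tuple M A" "subspace U" "x \<in> U" "x \<noteq> 0"
    and "\<And>i y. i \<in> {1..M} \<Longrightarrow> y \<in> U \<Longrightarrow> A i *v y \<in> U"
  shows "U = UNIV"
proof -
  have "\<not> (0 < dim U \<and> dim U < CARD('n))"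
    using assms unfolding irreducible_tuple_def by (auto simp: image_subset_iff)
  moreover have "dim U \<noteq> 0"
    using assms(3,4) by (auto simp: dim_eq_0)
  moreover have "dim U \<le> CARD('n)"
    using dim_subset_UNIV[of U] by simp
  ultimately have "dim U = DIM(real^'n)"
    by simp
  then have "span U = UNIV"
    by (simp only: dim_eq_full)
  then show ?thesis
    using assms(2) by (metis span_eq_iff)
qed

lemma irreducible_orbit_spans:
  fixes A :: "nat \<Rightarrow> real^'n^'n"
  assumes "irreducible_tuple M A" "x \<noteq> 0"
  shows "span ((\<lambda>w. mprod A w *v x) ` lists {1..M}) = UNIV"
proof -
  have x: "x \<in> span ((\<lambda>w. mprod A w *v x) ` lists {1..M})"
    by (rule span_base) (auto intro!: image_eqI[where x = "[]"])
  have "A i *v y \<in> span ((\<lambda>w. mprod A w *v x) ` lists {1..M})"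
    if i: "i \<in> {1..M}" and y: "y \<in> span ((\<lambda>w. mprod A w *v x) ` lists {1..M})" for i y
  proof -
    have "A i *v y \<in> span ((*v) (A i) ` ((\<lambda>w. mprod A w *v x) ` lists {1..M}))"
    using y by (simp add: linear_span_image)
  also have "\<dots> \<subseteq> span ((\<lambda>w. mprod A w *v x) ` lists {1..M})"
  proof (rule span_mono, rule subsetI)
    fix z assume "z \<in> (*v) (A i) ` ((\<lambda>w. mprod A w *v x) ` lists {1..M})"
    then obtain w where w: "w \<in> lists {1..M}" "z = A i *v (mprod A w *v x)"
      by blast
    have "w @ [i] \<in> lists {1..M}" using i w(1) by auto
    moreover have "z = mprod A (w @ [i]) *v x"
      by (simp add: w(2) mprod_append matrix_vector_mul_assoc)
    ultimately show "z \<in> (\<lambda>w. mprod A w *v x) ` lists {1..M}"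
      by blast
  qed
  finally show ?thesis .
  qed
  then show ?thesis
    by (rule irreducible_invariant_subspace[OF assms(1) subspace_span x assms(2)])
qed

text \<open>The orbit of a nonzero vector in the range of \<open>Y\<close> spans the space, so \<open>X\<close> cannot vanish on it.\<close>

lemma irreducible_connecting_word:
  fixes A :: "nat \<Rightarrow> real^'n^'n"
  assumes "irreducible_tuple M A" "X \<noteq> 0" "Y \<noteq> 0"
  obtains k where "k \<in> lists {1..M}" "X ** mprod A k ** Y \<noteq> 0"
proof -
  obtain y where y: "Y *v y \<noteq> 0"
    using assms(3) by (metis matrix_eq matrix_vector_mult_0)
  have "\<exists>k\<in>lists {1..M}. X *v (mprod A k *v (Y *v y)) \<noteq> 0"
  proof (rule ccontr)
    assume *: "\<not> ?thesis"
    have "X *v z = 0" for z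
    proof -
      have "z \<in> span ((\<lambda>w. mprod A w *v (Y *v y)) ` lists {1..M})"
        using irreducible_orbit_spans[OF assms(1) y] by simp
      then show ?thesis
        by (rule linear_eq_0_on_span[OF matrix_vector_mul_linear, rotated]) (use * in auto)
    qed
    then show False
      using assms(2) by (metis matrix_eq matrix_vector_mult_0)
  qed
  then obtain k where k: "k \<in> lists {1..M}" "(X ** mprod A k ** Y) *v y \<noteq> 0"
    by (auto simp: matrix_vector_mul_assoc matrix_mul_assoc)
  moreover from k(2) have "X ** mprod A k ** Y \<noteq> 0"
    by (metis matrix_vector_mult_0)
  ultimately show ?thesis
    using that by blast
qed

text \<open>Finitely many connecting words suffice because the products of the matrices span a
  finite-dimensional space; the uniform constant then comes from compactness of the unit spheres.\<close>

lemma irreducible_uniform_connection: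
  fixes A :: "nat \<Rightarrow> real^'n^'n"
  assumes irr: "irreducible_tuple M A"
  obtains K \<delta> where "finite K" "K \<subseteq> lists {1..M}" "\<delta> > 0"
    "\<And>X Y. \<exists>k\<in>K. \<delta> * mnorm X * mnorm Y \<le> mnorm (X ** mprod A k ** Y)"
proof -
  define P where "P = mprod A ` lists {1..M}"
  obtain \<B> where B: "\<B> \<subseteq> P" "independent \<B>" "P \<subseteq> span \<B>"
    using maximal_independent_subset[of P] by metis
  have finB: "finite \<B>"
    using B(2) by (simp add: independent_bound)
  then obtain K where K: "finite K" "K \<subseteq> lists {1..M}" "\<B> = mprod A ` K"
    using B(1) finite_subset_image[of \<B> "mprod A" "lists {1..M}"] unfolding P_def by blast
  define \<psi> where "\<psi> p = (\<Sum>k\<in>K. norm (fst p ** mprod A k ** snd p))"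
    for p :: "(real^'n^'n) \<times> (real^'n^'n)"
  define S where "S = sphere (0::real^'n^'n) 1 \<times> sphere (0::real^'n^'n) 1"
  have pos: "\<psi> p > 0" if "p \<in> S" for p
  proof (rule ccontr)
    assume "\<not> \<psi> p > 0"
    moreover have "\<psi> p \<ge> 0" unfolding \<psi>_def by (simp add: sum_nonneg)
    ultimately have "\<psi> p = 0" by simp
    then have zero: "fst p ** mprod A k ** snd p = 0" if "k \<in> K" for k
      using that K(1) unfolding \<psi>_def by (subst (asm) sum_nonneg_eq_0_iff) auto
    have lin: "linear (\<lambda>Z. fst p ** Z ** snd p)"
      by (rule linearI) (auto simp: matrix_add_ldistrib matrix_add_rdistrib
          matrix_scalar_ac simp flip: scalar_matrix_assoc)
    have all: "fst p ** mprod A w ** snd p = 0" if "w \<in> lists {1..M}" for w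
    proof -
      have "mprod A w \<in> span \<B>"
        using that B(3) unfolding P_def by auto
      then show ?thesis
        by (rule linear_eq_0_on_span[OF lin, rotated]) (use zero K(3) in auto)
    qed
    have "fst p \<noteq> 0" "snd p \<noteq> 0"
      using that unfolding S_def by auto
    then show False
      using all irreducible_connecting_word[OF irr] by metis
  qed
  have contm: "continuous_on T (\<lambda>p. fst p ** (Z::real^'n^'n) ** snd p)"
    for T :: "((real^'n^'n) \<times> (real^'n^'n)) set" and Z
    unfolding continuous_on_def
    by (intro ballI tendsto_matrix_matrix_mult tendsto_const tendsto_fst tendsto_snd tendsto_ident_at)
  have "compact S"
    unfolding S_def by (intro compact_Times compact_sphere)
  moreover have "S \<noteq> {}"
    unfolding S_def by (simp only: Times_empty sphere_eq_empty) simp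
  moreover have "continuous_on S \<psi>"
    unfolding \<psi>_def by (intro continuous_on_sum continuous_on_norm contm)
  ultimately obtain p0 where p0: "p0 \<in> S" "\<And>p. p \<in> S \<Longrightarrow> \<psi> p0 \<le> \<psi> p"
    using continuous_attains_inf by metis
  define N where "N = real (CARD('n) * CARD('n))"
  have N: "N \<ge> 1"
  proof -
    have "1 \<le> CARD('n) * CARD('n)" by (simp add: Suc_le_eq)
    then show ?thesis unfolding N_def by linarith
  qed
  have "K \<noteq> {}"
    using pos[OF p0(1)] unfolding \<psi>_def by auto
  then have cK: "real (card K) > 0"
    using K(1) by (simp add: card_gt_0_iff)
  define \<delta> where "\<delta> = \<psi> p0 / (real (card K) * N)"
  have \<delta>: "\<delta> > 0"
    unfolding \<delta>_def using pos[OF p0(1)] cK N by simp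
  have "\<exists>k\<in>K. \<delta> * mnorm X * mnorm Y \<le> mnorm (X ** mprod A k ** Y)" for X Y :: "real^'n^'n"
  proof (cases "X = 0 \<or> Y = 0")
    case True
    then have "\<delta> * mnorm X * mnorm Y = 0"
      by (auto simp: mnorm_eq_0_iff)
    then show ?thesis
      using \<open>K \<noteq> {}\<close> mnorm_nonneg by (metis ex_in_conv)
  next
    case False
    define p where "p = (X /\<^sub>R norm X, Y /\<^sub>R norm Y)"
    have "p \<in> S" unfolding p_def S_def using False by simp
    then have "\<psi> p0 \<le> \<psi> p" by (rule p0(2))
    also have "\<psi> p = (\<Sum>k\<in>K. norm (X ** mprod A k ** Y) / (norm X * norm Y))"
      unfolding \<psi>_def p_def
      by (intro sum.cong refl)
        (simp add: matrix_scalar_ac divide_simps flip: scalar_matrix_assoc)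
    finally have 1: "\<psi> p0 * (norm X * norm Y) \<le> (\<Sum>k\<in>K. norm (X ** mprod A k ** Y))"
      using False by (simp add: divide_simps flip: sum_divide_distrib)
    have "\<exists>k\<in>K. \<psi> p0 * (norm X * norm Y) / card K \<le> norm (X ** mprod A k ** Y)"
    proof (rule ccontr)
      assume "\<not> ?thesis"
      then have "(\<Sum>k\<in>K. norm (X ** mprod A k ** Y)) < (\<Sum>k\<in>K. \<psi> p0 * (norm X * norm Y) / card K)"
        using K(1) \<open>K \<noteq> {}\<close> by (intro sum_strict_mono) auto
      then show False using 1 cK by simp
    qed
    then obtain k where k: "k \<in> K" "\<psi> p0 * (norm X * norm Y) / card K \<le> norm (X ** mprod A k ** Y)"
      by blast
    have "\<psi> p0 * (mnorm X * mnorm Y) / card K \<le> \<psi> p0 * (norm X * norm Y) / card K"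
      using pos[OF p0(1)] by (intro divide_right_mono mult_left_mono mult_mono mnorm_le_norm mnorm_nonneg) auto
    also note k(2)
    also note norm_le_mnorm[of "X ** mprod A k ** Y"]
    finally have "\<psi> p0 * (mnorm X * mnorm Y) / card K / N \<le> mnorm (X ** mprod A k ** Y)"
      unfolding N_def[symmetric] using N by (subst pos_divide_le_eq) (auto simp: mult.commute)
    moreover have "\<delta> * mnorm X * mnorm Y = \<psi> p0 * (mnorm X * mnorm Y) / card K / N"
      unfolding \<delta>_def by simp
    ultimately show ?thesis using k(1) by metis
  qed
  then show ?thesis
    using that[OF K(1,2) \<delta>] by blast
qed


section \<open>Entropy of finite random variables\<close>

text \<open>Each summand \<open>Y v - p v + p v * ln (p v / Y v)\<close> is nonnegative because \<open>ln t \<le> t - 1\<close>, and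
  they add up to at most the relative entropy, so each of them is small when the latter is.\<close>

lemma relative_entropy_summand_le:
  fixes p Y :: "'a \<Rightarrow> real"
  assumes "finite I" "\<And>i. i \<in> I \<Longrightarrow> 0 \<le> p i" "sum p I = 1"
    and "\<And>i. i \<in> I \<Longrightarrow> 0 \<le> Y i" "sum Y I \<le> 1" "\<And>i. i \<in> I \<Longrightarrow> p i > 0 \<Longrightarrow> Y i > 0"
    and "v \<in> I"
  shows "Y v - p v + p v * ln (p v / Y v) \<le> (\<Sum>i\<in>I. p i * ln (p i / Y i))"
    and "0 \<le> Y v - p v + p v * ln (p v / Y v)"
proof -
  define t where "t i = Y i - p i + p i * ln (p i / Y i)" for i
  have t: "0 \<le> t i" if i: "i \<in> I" for i
  proof (cases "p i = 0")
    case True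
    then show ?thesis using assms(4)[OF i] by (simp add: t_def)
  next
    case False
    then have pos: "p i > 0" "Y i > 0" using assms(2,6)[OF i] by (auto simp: less_le)
    have "ln (Y i / p i) \<le> Y i / p i - 1"
      using pos by (intro ln_le_minus_one) simp
    then have "p i * ln (Y i / p i) \<le> p i * (Y i / p i - 1)"
      using pos by (intro mult_left_mono) auto
    moreover have "ln (p i / Y i) = - ln (Y i / p i)"
      using pos by (simp add: ln_div)
    ultimately show ?thesis
      using pos by (simp add: t_def algebra_simps)
  qed
  have "t v \<le> sum t I"
    using t assms(1,7) by (intro member_le_sum) auto
  also have "sum t I = sum Y I - sum p I + (\<Sum>i\<in>I. p i * ln (p i / Y i))"
    by (simp add: t_def sum.distrib sum_subtractf)
  finally show "Y v - p v + p v * ln (p v / Y v) \<le> (\<Sum>i\<in>I. p i * ln (p i / Y i))"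
    using assms(3,5) by (simp add: t_def)
  show "0 \<le> Y v - p v + p v * ln (p v / Y v)"
    using t[OF assms(7)] by (simp add: t_def)
qed

lemma relative_entropy_nonneg:
  fixes p Y :: "'a \<Rightarrow> real"
  assumes "finite I" "\<And>i. i \<in> I \<Longrightarrow> 0 \<le> p i" "sum p I = 1"
    and "\<And>i. i \<in> I \<Longrightarrow> 0 \<le> Y i" "sum Y I \<le> 1" "\<And>i. i \<in> I \<Longrightarrow> p i > 0 \<Longrightarrow> Y i > 0"
  shows "0 \<le> (\<Sum>i\<in>I. p i * ln (p i / Y i))"
proof -
  obtain v where v: "v \<in> I"
    using assms(3) by (metis all_not_in_conv sum.empty zero_neq_one)
  show ?thesis
    using relative_entropy_summand_le[OF assms v] by linarith
qed

text \<open>Estimating the logarithm by its tangent at \<open>2\<close> instead of \<open>1\<close> leaves half of \<open>Y v\<close> over, which can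
  then be bounded by the relative entropy.\<close>

lemma relative_entropy_imp_le:
  fixes p Y :: "'a \<Rightarrow> real"
  assumes "finite I" "\<And>i. i \<in> I \<Longrightarrow> 0 \<le> p i" "sum p I = 1"
    and "\<And>i. i \<in> I \<Longrightarrow> 0 \<le> Y i" "sum Y I \<le> 1" "\<And>i. i \<in> I \<Longrightarrow> p i > 0 \<Longrightarrow> Y i > 0"
    and "(\<Sum>i\<in>I. p i * ln (p i / Y i)) \<le> \<epsilon>" "v \<in> I"
  shows "Y v \<le> 2 * p v + 2 * \<epsilon>"
proof -
  have *: "Y v - p v + p v * ln (p v / Y v) \<le> \<epsilon>"
    using relative_entropy_summand_le(1)[OF assms(1-6,8)] assms(7) by simp
  show ?thesis
  proof (cases "p v = 0")
    case True
    then show ?thesis using * assms(4)[OF assms(8)] by simp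
  next
    case False
    then have pos: "p v > 0" "Y v > 0" using assms(2,6)[OF assms(8)] by (auto simp: less_le)
    have "ln (Y v / p v / 2) \<le> Y v / p v / 2 - 1"
      using pos by (intro ln_le_minus_one) simp
    moreover have "ln (Y v / p v) = ln (Y v / p v / 2 * 2)"
      by simp
    then have "ln (Y v / p v) = ln (Y v / p v / 2) + ln 2"
      using pos by (subst (asm) ln_mult_pos) auto
    ultimately have "ln (Y v / p v) \<le> Y v / p v / 2 - 1 + ln 2"
      by simp
    also have "\<dots> \<le> Y v / p v / 2"
      using ln_le_minus_one[of 2] by simp
    finally have "p v * ln (Y v / p v) \<le> p v * (Y v / p v / 2)"
      using pos by (intro mult_left_mono) auto
    moreover have "ln (p v / Y v) = - ln (Y v / p v)"
      using pos by (simp add: ln_div)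
    ultimately show ?thesis using * pos by (simp add: algebra_simps)
  qed
qed

lemma relative_entropy_nonpos_imp_eq:
  fixes p Y :: "'a \<Rightarrow> real"
  assumes "finite I" "\<And>i. i \<in> I \<Longrightarrow> 0 \<le> p i" "sum p I = 1"
    and "\<And>i. i \<in> I \<Longrightarrow> 0 \<le> Y i" "sum Y I \<le> 1" "\<And>i. i \<in> I \<Longrightarrow> p i > 0 \<Longrightarrow> Y i > 0"
    and "(\<Sum>i\<in>I. p i * ln (p i / Y i)) \<le> 0" "v \<in> I"
  shows "Y v = p v"
proof -
  have *: "Y v - p v + p v * ln (p v / Y v) = 0"
    using relative_entropy_summand_le[OF assms(1-6,8)] assms(7) by linarith
  show ?thesis
  proof (cases "p v = 0")
    case True
    then show ?thesis using * by simp
  next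
    case False
    then have pos: "p v > 0" "Y v > 0" using assms(2,6)[OF assms(8)] by (auto simp: less_le)
    have "ln (p v / Y v) = - ln (Y v / p v)"
      using pos by (simp add: ln_div)
    with * have "p v * ln (Y v / p v) = p v * (Y v / p v - 1)"
      using pos by (simp add: algebra_simps)
    then have "ln (Y v / p v) = Y v / p v - 1"
      using pos by simp
    then have "Y v / p v = 1"
      using pos by (intro ln_eq_minus_one) auto
    then show ?thesis using pos by simp
  qed
qed

definition law :: "'a measure \<Rightarrow> ('a \<Rightarrow> 'b) \<Rightarrow> 'b \<Rightarrow> real" where
  "law N X b = measure N (X -` {b} \<inter> space N)"

definition rv_entropy :: "'a measure \<Rightarrow> ('a \<Rightarrow> 'b) \<Rightarrow> real" where
  "rv_entropy N X = - (\<Sum>b\<in>X ` space N. law N X b * ln (law N X b))"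

lemma law_nonneg [simp]: "0 \<le> law N X b"
  by (simp add: law_def)

lemma law_outside: "b \<notin> X ` space N \<Longrightarrow> law N X b = 0"
proof -
  assume "b \<notin> X ` space N"
  then have "X -` {b} \<inter> space N = {}" by auto
  then show ?thesis by (simp add: law_def)
qed

lemma law_cong: "(\<And>x. x \<in> space N \<Longrightarrow> X x = Y x) \<Longrightarrow> law N X = law N Y"
  unfolding law_def fun_eq_iff by (intro allI arg_cong[of _ _ "measure N"]) auto

lemma rv_entropy_cong: "(\<And>x. x \<in> space N \<Longrightarrow> X x = Y x) \<Longrightarrow> rv_entropy N X = rv_entropy N Y"
  using law_cong[of N X Y] image_cong[of "space N" "space N" X Y] by (simp add: rv_entropy_def)

lemma sum_law_superset:
  fixes g :: "'b \<Rightarrow> real"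
  assumes "finite I" "X ` space N \<subseteq> I"
  shows "(\<Sum>b\<in>X ` space N. law N X b * g b) = (\<Sum>b\<in>I. law N X b * g b)"
  using assms by (intro sum.mono_neutral_left) (auto simp: law_outside)

lemma rv_entropy_eq:
  assumes "finite I" "X ` space N \<subseteq> I"
  shows "rv_entropy N X = - (\<Sum>b\<in>I. law N X b * ln (law N X b))"
  unfolding rv_entropy_def by (simp add: sum_law_superset[OF assms])

lemma partition_entropy_fibres:
  "partition_entropy N ((\<lambda>b. X -` {b} \<inter> space N) ` (X ` space N)) = rv_entropy N X"
proof -
  have "inj_on (\<lambda>b. X -` {b} \<inter> space N) (X ` space N)"
    by (rule inj_onI) blast
  then show ?thesis
    unfolding partition_entropy_def rv_entropy_def law_def by (subst sum.reindex) auto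
qed

context prob_space
begin

lemma law_comp:
  assumes "simple_function M X"
  shows "law M (\<lambda>x. f (X x)) c = (\<Sum>b\<in>{b \<in> X ` space M. f b = c}. law M X b)"
proof -
  have "(\<lambda>x. f (X x)) -` {c} \<inter> space M = (\<Union>b\<in>{b \<in> X ` space M. f b = c}. X -` {b} \<inter> space M)"
    by auto
  then show ?thesis
    unfolding law_def using assms
    by (simp only:)
      (rule finite_measure_finite_Union, auto simp: simple_function_def disjoint_family_on_def)
qed

lemma sum_law_comp:
  fixes g :: "'c \<Rightarrow> real"
  assumes "simple_function M X"
  shows "(\<Sum>b\<in>X ` space M. law M X b * g (f b))
    = (\<Sum>c\<in>(\<lambda>x. f (X x)) ` space M. law M (\<lambda>x. f (X x)) c * g c)"
proof -
  have fin: "finite (X ` space M)"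
    using assms by (simp add: simple_function_def)
  have "(\<Sum>b\<in>X ` space M. law M X b * g (f b))
      = (\<Sum>c\<in>f ` X ` space M. \<Sum>b\<in>{b \<in> X ` space M. f b = c}. law M X b * g (f b))"
    using fin by (intro sum.group[symmetric]) auto
  also have "\<dots> = (\<Sum>c\<in>f ` X ` space M. (\<Sum>b\<in>{b \<in> X ` space M. f b = c}. law M X b) * g c)"
    by (intro sum.cong refl) (auto simp: sum_distrib_right)
  finally show ?thesis
    by (simp add: law_comp[OF assms] image_image)
qed

lemma sum_law:
  assumes "simple_function M X" "finite I" "X ` space M \<subseteq> I"
  shows "sum (law M X) I = 1"
proof -
  have "sum (law M X) I = (\<Sum>b\<in>X ` space M. law M X b)"
    using sum_law_superset[OF assms(2,3), of "\<lambda>_. 1"] by simp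
  also have "\<dots> = law M (\<lambda>x. (\<lambda>_. ()) (X x)) ()"
    by (subst law_comp[OF assms(1)]) simp
  also have "\<dots> = 1"
    by (simp add: law_def prob_space)
  finally show ?thesis .
qed

lemma law_le_law_comp:
  assumes "simple_function M X"
  shows "law M X b \<le> law M (\<lambda>x. f (X x)) (f b)"
proof (cases "b \<in> X ` space M")
  case True
  then show ?thesis
    unfolding law_comp[OF assms] using assms
    by (intro member_le_sum) (auto simp: simple_function_def)
qed (simp add: law_outside)

text \<open>The Gibbs inequality. All upper bounds for entropies below come from a suitable guess \<open>h\<close> for the law.\<close>

lemma rv_entropy_le_cross_entropy:
  assumes X: "simple_function M X" "finite I" "X ` space M \<subseteq> I"
    and h: "\<And>b. b \<in> I \<Longrightarrow> 0 \<le> h b" "sum h I \<le> 1" "\<And>b. b \<in> I \<Longrightarrow> law M X b > 0 \<Longrightarrow> h b > 0"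
  shows "rv_entropy M X \<le> - (\<Sum>b\<in>I. law M X b * ln (h b))"
proof -
  have "0 \<le> (\<Sum>b\<in>I. law M X b * ln (law M X b / h b))"
    using assms by (intro relative_entropy_nonneg sum_law) auto
  also have "\<dots> = (\<Sum>b\<in>I. law M X b * ln (law M X b) - law M X b * ln (h b))"
  proof (rule sum.cong)
    fix b assume b: "b \<in> I"
    show "law M X b * ln (law M X b / h b) = law M X b * ln (law M X b) - law M X b * ln (h b)"
      using h(3)[OF b] law_nonneg[of M X b]
      by (cases "law M X b = 0") (auto simp: ln_div right_diff_distrib less_le)
  qed simp
  finally show ?thesis
    by (simp add: rv_entropy_eq[OF X(2,3)] sum_subtractf)
qed

lemma rv_entropy_comp_le:
  assumes "simple_function M X"
  shows "rv_entropy M (\<lambda>x. f (X x)) \<le> rv_entropy M X"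
proof -
  have "(\<Sum>b\<in>X ` space M. law M X b * ln (law M X b))
      \<le> (\<Sum>b\<in>X ` space M. law M X b * ln (law M (\<lambda>x. f (X x)) (f b)))"
  proof (rule sum_mono)
    fix b
    show "law M X b * ln (law M X b) \<le> law M X b * ln (law M (\<lambda>x. f (X x)) (f b))"
    proof (cases "law M X b = 0")
      case False
      then have "law M X b > 0"
        using law_nonneg[of M X b] by linarith
      then show ?thesis
        using law_le_law_comp[OF assms, of b f] by (intro mult_left_mono) auto
    qed simp
  qed
  also have "\<dots> = (\<Sum>c\<in>(\<lambda>x. f (X x)) ` space M.
      law M (\<lambda>x. f (X x)) c * ln (law M (\<lambda>x. f (X x)) c))"
    by (rule sum_law_comp[OF assms])
  finally show ?thesis
    by (simp add: rv_entropy_def)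
qed

lemma rv_entropy_Pair_le:
  assumes X: "simple_function M X" and Y: "simple_function M Y"
  shows "rv_entropy M (\<lambda>x. (X x, Y x)) \<le> rv_entropy M X + rv_entropy M Y"
proof -
  let ?Z = "\<lambda>x. (X x, Y x)" and ?I = "X ` space M \<times> Y ` space M"
  have Z: "simple_function M ?Z"
    using X Y by (rule simple_function_Pair)
  have fin: "finite (X ` space M)" "finite (Y ` space M)"
    using X Y by (auto simp: simple_function_def)
  have le: "law M ?Z b \<le> law M X (fst b)" "law M ?Z b \<le> law M Y (snd b)" for b
    using law_le_law_comp[OF Z, of b fst] law_le_law_comp[OF Z, of b snd] by auto
  have "rv_entropy M ?Z \<le> - (\<Sum>b\<in>?I. law M ?Z b * ln (law M X (fst b) * law M Y (snd b)))"
  proof (rule rv_entropy_le_cross_entropy[OF Z])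
    have "(\<Sum>b\<in>?I. law M X (fst b) * law M Y (snd b))
        = (\<Sum>a\<in>X ` space M. law M X a) * (\<Sum>b\<in>Y ` space M. law M Y b)"
      by (simp add: sum_product sum.cartesian_product split_def)
    also have "\<dots> = 1"
      using sum_law[OF X fin(1)] sum_law[OF Y fin(2)] by simp
    finally show "(\<Sum>b\<in>?I. law M X (fst b) * law M Y (snd b)) \<le> 1" by simp
    show "0 < law M X (fst b) * law M Y (snd b)" if "law M ?Z b > 0" for b
      using that le[of b] by simp
  qed (use fin in auto)
  also have "(\<Sum>b\<in>?I. law M ?Z b * ln (law M X (fst b) * law M Y (snd b)))
      = (\<Sum>b\<in>?I. law M ?Z b * (ln (law M X (fst b)) + ln (law M Y (snd b))))"
  proof (rule sum.cong)
    fix b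
    show "law M ?Z b * ln (law M X (fst b) * law M Y (snd b))
        = law M ?Z b * (ln (law M X (fst b)) + ln (law M Y (snd b)))"
    proof (cases "law M ?Z b = 0")
      case False
      then have "law M ?Z b > 0" by (simp add: less_le)
      then show ?thesis using le[of b] by (subst ln_mult_pos) auto
    qed simp
  qed simp
  also have "\<dots> = (\<Sum>b\<in>?Z ` space M. law M ?Z b * ln (law M X (fst b)))
      + (\<Sum>b\<in>?Z ` space M. law M ?Z b * ln (law M Y (snd b)))"
    unfolding distrib_left sum.distrib
    by (intro arg_cong2[of _ _ _ _ "(+)"] sum_law_superset[symmetric]) (use fin in auto)
  also have "\<dots> = - rv_entropy M X - rv_entropy M Y"
    using sum_law_comp[OF Z, of "\<lambda>a. ln (law M X a)" fst] sum_law_comp[OF Z, of "\<lambda>a. ln (law M Y a)" snd]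
    by (simp add: rv_entropy_def)
  finally show ?thesis by simp
qed

lemma law_le_1: "law M X b \<le> 1"
  by (simp add: law_def)

lemma rv_entropy_nonneg: "rv_entropy M X \<ge> 0"
proof -
  have "law M X b * ln (law M X b) \<le> 0" for b
  proof (cases "law M X b = 0")
    case False
    then have "law M X b > 0"
      using law_nonneg[of M X b] by linarith
    then show ?thesis
      using law_le_1[of X b] by (simp add: mult_nonneg_nonpos)
  qed simp
  then show ?thesis
    unfolding rv_entropy_def by (simp add: sum_nonpos)
qed

lemma rv_entropy_le_ln_card:
  assumes "simple_function M X" "finite I" "X ` space M \<subseteq> I"
  shows "rv_entropy M X \<le> ln (card I)"
proof -
  have "I \<noteq> {}" using assms(3) not_empty by auto
  then have card: "real (card I) > 0" using assms(2) by (simp add: card_gt_0_iff)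
  have "rv_entropy M X \<le> - (\<Sum>b\<in>I. law M X b * ln (1 / card I))"
    using card by (intro rv_entropy_le_cross_entropy assms) auto
  also have "\<dots> = - (sum (law M X) I * ln (1 / card I))"
    by (simp add: sum_distrib_right)
  also have "\<dots> = ln (card I)"
    using card by (simp add: sum_law[OF assms] ln_div)
  finally show ?thesis .
qed

end

definition cell :: "'a set set \<Rightarrow> 'a \<Rightarrow> 'a set" where
  "cell P x = (THE B. B \<in> P \<and> x \<in> B)"

definition itinerary :: "('a \<Rightarrow> 'a) \<Rightarrow> ('a \<Rightarrow> 'b) \<Rightarrow> nat \<Rightarrow> 'a \<Rightarrow> 'b list" where
  "itinerary T X n x = map (\<lambda>k. X ((T ^^ k) x)) [0..<n]"

lemma cell_eqI:
  assumes "partition_on S P" "B \<in> P" "x \<in> B"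
  shows "cell P x = B"
  unfolding cell_def
proof (rule the_equality)
  fix C assume "C \<in> P \<and> x \<in> C"
  then show "C = B"
    using assms by (auto simp: partition_on_def disjoint_def)
qed (use assms in auto)

lemma cell_in:
  assumes "partition_on S P" "x \<in> S"
  shows "cell P x \<in> P" "x \<in> cell P x"
proof -
  obtain B where "B \<in> P" "x \<in> B"
    using assms by (auto simp: partition_on_def)
  then show "cell P x \<in> P" "x \<in> cell P x"
    using cell_eqI[OF assms(1)] by auto
qed

text \<open>Entropies of iterated joins thus are entropies of itineraries, which are random variables with values
  in lists.\<close>

lemma iterated_join_eq_fibres:
  assumes P: "partition_on (space N) P" and T: "\<And>x. x \<in> space N \<Longrightarrow> T x \<in> space N" and n: "n > 0"
  shows "iterated_join N T P n
    = (\<lambda>b. itinerary T (cell P) n -` {b} \<inter> space N) ` (itinerary T (cell P) n ` space N)"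
proof -
  define \<P> where "\<P> k = (\<lambda>B. (T ^^ k) -` B \<inter> space N) ` P" for k
  define X where "X = itinerary T (cell P) n"
  have Tk: "(T ^^ k) x \<in> space N" if "x \<in> space N" for k x
    by (induction k) (use that T in auto)
  have X_eq_iff: "X y = X x \<longleftrightarrow> (\<forall>k<n. cell P ((T ^^ k) y) = cell P ((T ^^ k) x))" for x y
    by (auto simp: X_def itinerary_def)
  (* an element of the k-th pulled back partition is determined by any of its points *)
  have elt: "B = (T ^^ k) -` cell P ((T ^^ k) x) \<inter> space N" if "B \<in> \<P> k" "x \<in> B" for B k x
    using that cell_eqI[OF P] unfolding \<P>_def by auto
  have elt_in: "(T ^^ k) -` cell P ((T ^^ k) x) \<inter> space N \<in> \<P> k"
      "x \<in> (T ^^ k) -` cell P ((T ^^ k) x) \<inter> space N" if "x \<in> space N" for k x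
    using that cell_in[OF P Tk[OF that]] unfolding \<P>_def by auto
  have fibre: "X -` {X x} \<inter> space N = (\<Inter>k<n. (T ^^ k) -` cell P ((T ^^ k) x) \<inter> space N)"
    if x: "x \<in> space N" for x
  proof (intro set_eqI iffI)
    fix y assume y: "y \<in> X -` {X x} \<inter> space N"
    then show "y \<in> (\<Inter>k<n. (T ^^ k) -` cell P ((T ^^ k) x) \<inter> space N)"
      using cell_in(2)[OF P Tk] X_eq_iff[of y x] by auto
  next
    fix y assume y: "y \<in> (\<Inter>k<n. (T ^^ k) -` cell P ((T ^^ k) x) \<inter> space N)"
    then have "cell P ((T ^^ k) y) = cell P ((T ^^ k) x)" if "k < n" for k
      using that cell_in(1)[OF P Tk[OF x]] by (intro cell_eqI[OF P]) (auto split: if_splits)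
    then show "y \<in> X -` {X x} \<inter> space N"
      using y n X_eq_iff[of y x] by (auto split: if_splits)
  qed
  have "common_refinement (\<P> ` {..<n}) = (\<lambda>x. X -` {X x} \<inter> space N) ` space N"
  proof (intro set_eqI iffI)
    fix E assume "E \<in> common_refinement (\<P> ` {..<n})"
    then obtain f where f: "\<And>Q. Q \<in> \<P> ` {..<n} \<Longrightarrow> f Q \<in> Q" "E = \<Inter> (f ` \<P> ` {..<n})" "E \<noteq> {}"
      unfolding common_refinement by auto
    then obtain x where x: "x \<in> E" by blast
    have fk: "f (\<P> k) \<in> \<P> k" "x \<in> f (\<P> k)" if "k < n" for k
      using f x that by auto
    have "x \<in> space N"
      using fk[OF n] unfolding \<P>_def by auto
    moreover have "E = (\<Inter>k<n. (T ^^ k) -` cell P ((T ^^ k) x) \<inter> space N)"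
    proof -
      have "E = (\<Inter>k<n. f (\<P> k))"
        using f(2) by (simp add: image_image)
      also have "\<dots> = (\<Inter>k<n. (T ^^ k) -` cell P ((T ^^ k) x) \<inter> space N)"
        by (rule INF_cong) (auto intro!: elt fk)
      finally show ?thesis .
    qed
    ultimately show "E \<in> (\<lambda>x. X -` {X x} \<inter> space N) ` space N"
      using fibre by auto
  next
    fix E assume "E \<in> (\<lambda>x. X -` {X x} \<inter> space N) ` space N"
    then obtain x where x: "x \<in> space N" "E = X -` {X x} \<inter> space N" by blast
    define f where "f Q = (SOME B. B \<in> Q \<and> x \<in> B)" for Q :: "'a set set"
    have f: "f (\<P> k) \<in> \<P> k \<and> x \<in> f (\<P> k)" for k
      unfolding f_def by (rule someI) (use elt_in[OF x(1)] in blast)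
    have "E = (\<Inter>k<n. (T ^^ k) -` cell P ((T ^^ k) x) \<inter> space N)"
      using x(2) fibre[OF x(1)] by simp
    also have "\<dots> = (\<Inter>k<n. f (\<P> k))"
      by (rule INF_cong) (use f in \<open>auto intro!: elt[symmetric]\<close>)
    finally have "E = \<Inter> (f ` \<P> ` {..<n})"
      by (simp add: image_image)
    moreover have "x \<in> E" using x by simp
    ultimately show "E \<in> common_refinement (\<P> ` {..<n})"
      unfolding common_refinement using f by auto
  qed
  then show ?thesis
    unfolding iterated_join_def \<P>_def X_def by (simp add: image_image)
qed

section \<open>Subadditive sequences\<close>

lemma subadditive_multiple_le:
  fixes u :: "nat \<Rightarrow> real"
  assumes "\<And>m n. u (m + n) \<le> u m + u n"
  shows "u (q * n + r) \<le> real q * u n + u r"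
proof (induction q)
  case (Suc q)
  have "u (Suc q * n + r) \<le> u n + u (q * n + r)"
    using assms[of n "q * n + r"] by (simp add: add.assoc)
  then show ?case using Suc by (simp add: algebra_simps)
qed simp

text \<open>Division with remainder by \<open>n\<close>; the finitely many remainders contribute a constant.\<close>

lemma Fekete_upper:
  fixes u :: "nat \<Rightarrow> real"
  assumes sub: "\<And>m n. u (m + n) \<le> u m + u n" and n: "n > 0" and e: "\<epsilon> > 0"
  shows "eventually (\<lambda>m. u m / m \<le> u n / n + \<epsilon>) sequentially"
proof -
  define c where "c = Max (u ` {..<n}) + \<bar>u n\<bar>"
  have r: "u r + \<bar>u n\<bar> \<le> c" if "r < n" for r
    unfolding c_def using that by (intro add_right_mono Max_ge) auto
  have "(\<lambda>m. c / real m) \<longlonglongrightarrow> 0"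
    by (rule lim_const_over_n)
  then have "eventually (\<lambda>m. c / real m < \<epsilon>) sequentially"
    using e by (rule order_tendstoD(2))
  moreover have "eventually (\<lambda>m. m > 0) sequentially"
    by (rule eventually_gt_at_top)
  ultimately show ?thesis
  proof eventually_elim
    case (elim m)
    define q r where "q = m div n" and "r = m mod n"
    have m: "m = q * n + r" and rn: "r < n"
      unfolding q_def r_def using n by auto
    have "u m \<le> real q * u n + u r"
      unfolding m by (rule subadditive_multiple_le[OF sub])
    also have "real q * u n = (real m - real r) / n * u n"
      using n by (simp add: m)
    also have "\<dots> = m * (u n / n) - (r / n) * u n"
      by (simp add: diff_divide_distrib left_diff_distrib)
    also have "- ((r / n) * u n) \<le> 1 * \<bar>u n\<bar>"
    proof -
      have "- ((r / n) * u n) \<le> \<bar>(r / n) * u n\<bar>" by (rule abs_ge_minus_self)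
      also have "\<dots> \<le> 1 * \<bar>u n\<bar>"
        unfolding abs_mult using rn by (intro mult_right_mono) auto
      finally show ?thesis .
    qed
    ultimately have "u m \<le> m * (u n / n) + c"
      using r[OF rn] by linarith
    then have "u m / m \<le> u n / n + c / m"
      using elim by (simp add: field_simps)
    then show ?case using elim by simp
  qed
qed

lemma Fekete_convergence:
  fixes u :: "nat \<Rightarrow> real"
  assumes sub: "\<And>m n. u (m + n) \<le> u m + u n"
  shows "(\<lambda>n. ereal (u n / n)) \<longlonglongrightarrow> (INF n\<in>{0<..}. ereal (u n / n))"
proof (rule Liminf_eq_Limsup)
  let ?I = "INF n\<in>{0<..}. ereal (u n / n)"
  have le: "?I \<le> liminf (\<lambda>n. ereal (u n / n))"
  proof (rule Liminf_bounded)
    show "eventually (\<lambda>n. ?I \<le> ereal (u n / n)) sequentially"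
      using eventually_gt_at_top[of 0] by eventually_elim (auto intro: INF_lower)
  qed
  have "limsup (\<lambda>m. ereal (u m / m)) \<le> ereal (u n / n)" if n: "n > 0" for n
  proof (rule ereal_le_epsilon2)
    fix e :: real assume "e > 0"
    then have "eventually (\<lambda>m. ereal (u m / m) \<le> ereal (u n / n) + ereal e) sequentially"
      using Fekete_upper[OF sub n] by simp
    then show "limsup (\<lambda>m. ereal (u m / m)) \<le> ereal (u n / n) + ereal e"
      by (rule Limsup_bounded)
  qed
  then have ge: "limsup (\<lambda>m. ereal (u m / m)) \<le> ?I"
    by (auto intro: INF_greatest)
  have "liminf (\<lambda>n. ereal (u n / n)) \<le> limsup (\<lambda>n. ereal (u n / n))"
    by (rule Liminf_le_Limsup) simp
  then show "liminf (\<lambda>n. ereal (u n / n)) = ?I" "limsup (\<lambda>n. ereal (u n / n)) = ?I"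
    using le ge by auto
qed simp


lemma Fekete_nonneg:
  fixes u :: "nat \<Rightarrow> real"
  assumes sub: "\<And>m n. u (m + n) \<le> u m + u n" and nonneg: "\<And>n. 0 \<le> u n"
  obtains L where "(\<lambda>n. u n / n) \<longlonglongrightarrow> L" "\<And>n. n > 0 \<Longrightarrow> L \<le> u n / n"
proof -
  let ?I = "INF n\<in>{0<..}. ereal (u n / n)"
  have "0 \<le> ?I"
    using nonneg by (auto intro!: INF_greatest)
  moreover have "?I \<le> ereal (u 1 / 1)"
    by (rule INF_lower2[of 1]) auto
  ultimately have "\<bar>?I\<bar> \<noteq> \<infinity>"
    by auto
  then obtain L where L: "?I = ereal L"
    by auto
  have "(\<lambda>n. ereal (u n / n)) \<longlonglongrightarrow> ereal L"
    using Fekete_convergence[OF sub] L by simp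
  moreover have "L \<le> u n / n" if "n > 0" for n
  proof -
    have "?I \<le> ereal (u n / n)"
      using that by (intro INF_lower) simp
    then show ?thesis using L by simp
  qed
  ultimately show ?thesis
    using that by simp
qed

section \<open>Measure-preserving maps\<close>

locale measure_preserving_map = prob_space +
  fixes T :: "'a \<Rightarrow> 'a"
  assumes T_measurable: "T \<in> measurable M M"
    and T_preserving: "B \<in> sets M \<Longrightarrow> measure M (T -` B \<inter> space M) = measure M B"
begin

lemma T_space: "x \<in> space M \<Longrightarrow> T x \<in> space M"
  using T_measurable by (rule measurable_space)

lemma funpow_T_space: "x \<in> space M \<Longrightarrow> (T ^^ k) x \<in> space M"
  by (induction k) (auto intro: T_space)

lemma funpow_T_measurable: "(T ^^ k) \<in> measurable M M"
  by (induction k) (use T_measurable in \<open>auto intro: measurable_compose simp: comp_def\<close>)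

lemma funpow_T_preserving:
  assumes "B \<in> sets M"
  shows "measure M ((T ^^ k) -` B \<inter> space M) = measure M B"
proof (induction k)
  case 0
  have "id -` B \<inter> space M = B"
    using sets.sets_into_space[OF assms] by auto
  then show ?case by simp
next
  case (Suc k)
  have eq: "(T ^^ Suc k) -` B \<inter> space M = T -` ((T ^^ k) -` B \<inter> space M) \<inter> space M"
    using T_space by (auto simp: funpow_Suc_right simp del: funpow.simps)
  have "(T ^^ k) -` B \<inter> space M \<in> sets M"
    using funpow_T_measurable assms by (rule measurable_sets)
  then show ?case
    unfolding eq Suc[symmetric] by (rule T_preserving)
qed

lemma simple_function_funpow_T:
  assumes "simple_function M X"
  shows "simple_function M (\<lambda>x. X ((T ^^ k) x))"
proof -
  have "X \<in> measurable M (count_space UNIV)"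
    using assms by (rule measurable_simple_function)
  then have "(\<lambda>x. X ((T ^^ k) x)) \<in> measurable M (count_space UNIV)"
    by (rule measurable_compose[OF funpow_T_measurable])
  moreover have "finite ((\<lambda>x. X ((T ^^ k) x)) ` space M)"
    using assms unfolding simple_function_def
    by (auto intro: finite_subset[of _ "X ` space M"] simp: funpow_T_space)
  ultimately show ?thesis
    unfolding simple_function_def by (auto intro!: measurable_sets)
qed

lemma law_funpow_T:
  assumes "simple_function M X"
  shows "law M (\<lambda>x. X ((T ^^ k) x)) = law M X"
proof
  fix b
  have eq: "(\<lambda>x. X ((T ^^ k) x)) -` {b} \<inter> space M = (T ^^ k) -` (X -` {b} \<inter> space M) \<inter> space M"
    using funpow_T_space by auto
  show "law M (\<lambda>x. X ((T ^^ k) x)) b = law M X b"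
    unfolding law_def eq by (rule funpow_T_preserving[OF simple_functionD(2)[OF assms]])
qed

lemma rv_entropy_funpow_T:
  assumes "simple_function M X"
  shows "rv_entropy M (\<lambda>x. X ((T ^^ k) x)) = rv_entropy M X"
proof -
  have "(\<lambda>x. X ((T ^^ k) x)) ` space M \<subseteq> X ` space M"
    using funpow_T_space by auto
  moreover have "finite (X ` space M)"
    using assms by (simp add: simple_function_def)
  ultimately show ?thesis
    by (simp add: rv_entropy_eq[of "X ` space M"] law_funpow_T[OF assms])
qed

lemma itinerary_add:
  "itinerary T X (m + n) x = itinerary T X m x @ itinerary T X n ((T ^^ m) x)"
proof (rule nth_equalityI)
  fix i assume i: "i < length (itinerary T X (m + n) x)"
  have "(T ^^ i) x = (T ^^ (i - m)) ((T ^^ m) x)" if "m \<le> i"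
    using that funpow_add[of "i - m" m T] by (simp add: fun_eq_iff)
  then show "itinerary T X (m + n) x ! i = (itinerary T X m x @ itinerary T X n ((T ^^ m) x)) ! i"
    using i by (simp add: itinerary_def nth_append)
qed (simp add: itinerary_def)

lemma simple_function_itinerary:
  assumes "simple_function M X"
  shows "simple_function M (itinerary T X n)"
proof (induction n)
  case 0
  have "simple_function M (\<lambda>x. [])" by simp
  then show ?case by (simp add: itinerary_def[abs_def])
next
  case (Suc n)
  have "simple_function M (\<lambda>x. (\<lambda>p. fst p @ [snd p]) (itinerary T X n x, X ((T ^^ n) x)))"
    by (intro simple_function_compose1[of _ _ "\<lambda>p. fst p @ [snd p]"] simple_function_Pair Suc
        simple_function_funpow_T assms)
  then show ?case by (simp add: itinerary_def[abs_def])
qed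

lemma rv_entropy_itinerary_subadditive:
  assumes X: "simple_function M X"
  shows "rv_entropy M (itinerary T X (m + n))
    \<le> rv_entropy M (itinerary T X m) + rv_entropy M (itinerary T X n)"
proof -
  let ?Y = "\<lambda>x. itinerary T X n ((T ^^ m) x)"
  have Y: "simple_function M ?Y"
    by (intro simple_function_funpow_T simple_function_itinerary X)
  have "rv_entropy M (itinerary T X (m + n))
      = rv_entropy M (\<lambda>x. (\<lambda>p. fst p @ snd p) (itinerary T X m x, ?Y x))"
    by (simp add: itinerary_add[abs_def])
  also have "\<dots> \<le> rv_entropy M (\<lambda>x. (itinerary T X m x, ?Y x))"
    by (intro rv_entropy_comp_le simple_function_Pair simple_function_itinerary X Y)
  also have "\<dots> \<le> rv_entropy M (itinerary T X m) + rv_entropy M ?Y"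
    by (intro rv_entropy_Pair_le simple_function_itinerary X Y)
  also have "rv_entropy M ?Y = rv_entropy M (itinerary T X n)"
    by (intro rv_entropy_funpow_T simple_function_itinerary X)
  finally show ?thesis .
qed

lemma simple_function_cell:
  assumes "finite P" "P \<subseteq> sets M" "partition_on (space M) P"
  shows "simple_function M (cell P)"
  unfolding simple_function_def
proof (intro conjI ballI)
  show "finite (cell P ` space M)"
    using assms(1) by (rule finite_subset[rotated]) (auto intro: cell_in[OF assms(3)])
  fix B assume "B \<in> cell P ` space M"
  then have "B \<in> P"
    using cell_in[OF assms(3)] by auto
  have "cell P -` {B} \<inter> space M = B"
  proof (intro set_eqI iffI)
    fix x assume "x \<in> cell P -` {B} \<inter> space M"
    then show "x \<in> B" using cell_in(2)[OF assms(3), of x] by simp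
  next
    fix x assume x: "x \<in> B"
    then have "x \<in> space M"
      using \<open>B \<in> P\<close> assms(2) sets.sets_into_space by blast
    then show "x \<in> cell P -` {B} \<inter> space M"
      using cell_eqI[OF assms(3) \<open>B \<in> P\<close> x] by simp
  qed
  then show "cell P -` {B} \<inter> space M \<in> sets M"
    using \<open>B \<in> P\<close> assms(2) by auto
qed

lemma entropy_wrt_limit:
  assumes P: "finite P" "P \<subseteq> sets M" "partition_on (space M) P"
  shows "(\<lambda>n. rv_entropy M (itinerary T (cell P) n) / n) \<longlonglongrightarrow> entropy_wrt M T P"
    and "n > 0 \<Longrightarrow> entropy_wrt M T P \<le> rv_entropy M (itinerary T (cell P) n) / n"
proof -
  let ?u = "\<lambda>n. rv_entropy M (itinerary T (cell P) n)"
  obtain L where L: "(\<lambda>n. ?u n / n) \<longlonglongrightarrow> L" "\<And>n. n > 0 \<Longrightarrow> L \<le> ?u n / n"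
    using Fekete_nonneg[of ?u, OF rv_entropy_itinerary_subadditive[OF simple_function_cell[OF P]]
        rv_entropy_nonneg] by blast
  have "partition_entropy M (iterated_join M T P n) / n = ?u n / n" for n
  proof (cases "n = 0")
    case False
    then show ?thesis
      by (subst iterated_join_eq_fibres[OF P(3) T_space]) (auto simp: partition_entropy_fibres)
  qed simp
  then have "entropy_wrt M T P = L"
    unfolding entropy_wrt_def using L(1) by (simp only: limI)
  then show "(\<lambda>n. ?u n / n) \<longlonglongrightarrow> entropy_wrt M T P"
    and "n > 0 \<Longrightarrow> entropy_wrt M T P \<le> ?u n / n"
    using L by auto
qed

text \<open>If two observables with values in \<open>{1..r}\<close> rarely differ, the itinerary of the first one is
  guessed from that of the second one by assuming, independently at each time, that they agree with
  probability \<open>1 - \<delta>\<close>; the cross entropy of this guess bounds the additional uncertainty.\<close>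

lemma rv_entropy_itinerary_close:
  fixes X Y :: "'a \<Rightarrow> nat"
  assumes X: "simple_function M X" "X ` space M \<subseteq> {1..r}"
    and Y: "simple_function M Y" "Y ` space M \<subseteq> {1..r}"
    and \<delta>: "0 < \<delta>" "\<delta> < 1" and \<theta>: "measure M {x \<in> space M. X x \<noteq> Y x} \<le> \<theta>"
  shows "rv_entropy M (itinerary T X m)
    \<le> rv_entropy M (itinerary T Y m) + m * (\<theta> * ln (r / \<delta>) - ln (1 - \<delta>))"
proof -
  have r: "r \<ge> 1"
    using X(2) not_empty by fastforce
  (* the guessed conditional probability of a given b *)
  define \<kappa> where "\<kappa> a b = (if a = b then 1 - \<delta> else \<delta> / r)" for a b :: nat
  have \<kappa>_pos: "\<kappa> a b > 0" for a b
    using \<delta> r by (simp add: \<kappa>_def)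
  have \<kappa>_sum: "(\<Sum>a\<in>{1..r}. \<kappa> a b) \<le> 1" if "b \<in> {1..r}" for b
  proof -
    have "(\<Sum>a\<in>{1..r}. \<kappa> a b) = \<kappa> b b + (\<Sum>a\<in>{1..r} - {b}. \<kappa> a b)"
      using that by (intro sum.remove) auto
    also have "(\<Sum>a\<in>{1..r} - {b}. \<kappa> a b) = (\<Sum>a\<in>{1..r} - {b}. \<delta> / r)"
      by (intro sum.cong) (auto simp: \<kappa>_def)
    also have "\<dots> = (r - 1) * (\<delta> / r)"
      using that by simp
    also have "\<dots> \<le> r * (\<delta> / r)"
      using \<delta> by (intro mult_right_mono) auto
    finally show ?thesis using r by (simp add: \<kappa>_def)
  qed
  define K where "K l l' = (\<Prod>j<length l'. \<kappa> (l ! j) (l' ! j))" for l l'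
  have Kpos: "K l l' > 0" for l l'
    unfolding K_def by (intro prod_pos) (auto intro: \<kappa>_pos)
  have K_sum: "(\<Sum>l\<in>words r (length l'). K l l') \<le> 1" if "set l' \<subseteq> {1..r}" for l'
    using that
  proof (induction l')
    case (Cons b l')
    have "(\<Sum>l\<in>words r (length (b # l')). K l (b # l'))
        = (\<Sum>a\<in>{1..r}. \<kappa> a b * (\<Sum>l\<in>words r (length l'). K l l'))"
      by (simp add: sum_words_Suc K_def prod.lessThan_Suc_shift sum_distrib_left
          del: prod.lessThan_Suc)
    also have "\<dots> = (\<Sum>a\<in>{1..r}. \<kappa> a b) * (\<Sum>l\<in>words r (length l'). K l l')"
      by (simp add: sum_distrib_right)
    also have "\<dots> \<le> 1 * 1"
      using Cons \<kappa>_sum[of b] \<kappa>_pos Kpos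
      by (intro mult_mono sum_nonneg) (auto intro: less_imp_le)
    finally show ?case by simp
  qed (simp add: K_def)
  let ?X = "itinerary T X m" and ?Y = "itinerary T Y m"
  let ?Z = "\<lambda>x. (?X x, ?Y x)" and ?I = "words r m \<times> words r m"
  have sX: "simple_function M ?X" and sY: "simple_function M ?Y"
    by (intro simple_function_itinerary X Y)+
  then have sZ: "simple_function M ?Z"
    by (rule simple_function_Pair)
  have inX: "?X ` space M \<subseteq> words r m" and inY: "?Y ` space M \<subseteq> words r m"
    using X(2) Y(2) funpow_T_space by (fastforce simp: words_def itinerary_def)+
  then have inZ: "?Z ` space M \<subseteq> ?I" by auto
  define h where "h p = law M ?Y (snd p) * K (fst p) (snd p)" for p
  have lawZ: "law M ?Y (snd p) > 0" if "law M ?Z p > 0" for p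
    using law_le_law_comp[OF sZ, of p snd] that by simp
  have "rv_entropy M ?X \<le> rv_entropy M ?Z"
    using rv_entropy_comp_le[OF sZ, of fst] by simp
  also have "rv_entropy M ?Z \<le> - (\<Sum>p\<in>?I. law M ?Z p * ln (h p))"
  proof (rule rv_entropy_le_cross_entropy[OF sZ _ inZ])
    have "sum h ?I = (\<Sum>l'\<in>words r m. \<Sum>l\<in>words r m. law M ?Y l' * K l l')"
      unfolding h_def by (subst sum.swap) (simp add: sum.cartesian_product split_def)
    also have "\<dots> = (\<Sum>l'\<in>words r m. law M ?Y l' * (\<Sum>l\<in>words r m. K l l'))"
      by (simp add: sum_distrib_left)
    also have "\<dots> \<le> (\<Sum>l'\<in>words r m. law M ?Y l' * 1)"
      using K_sum by (intro sum_mono mult_left_mono) (auto simp: words_def)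
    also have "\<dots> = 1"
      using sum_law[OF sY _ inY] by simp
    finally show "sum h ?I \<le> 1" .
    show "0 \<le> h p" for p
      using Kpos[of "fst p" "snd p"] by (simp add: h_def)
    show "0 < h p" if "law M ?Z p > 0" for p
      using lawZ[OF that] Kpos by (simp add: h_def)
  qed auto
  also have "(\<Sum>p\<in>?I. law M ?Z p * ln (h p))
      = (\<Sum>p\<in>?I. law M ?Z p * (ln (law M ?Y (snd p)) + (\<Sum>j<m. ln (\<kappa> (fst p ! j) (snd p ! j)))))"
  proof (rule sum.cong)
    fix p assume p: "p \<in> ?I"
    show "law M ?Z p * ln (h p)
        = law M ?Z p * (ln (law M ?Y (snd p)) + (\<Sum>j<m. ln (\<kappa> (fst p ! j) (snd p ! j))))"
    proof (cases "law M ?Z p = 0")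
      case False
      then have "law M ?Z p > 0"
        using law_nonneg[of M ?Z p] by linarith
      moreover have "ln (K (fst p) (snd p)) = (\<Sum>j<m. ln (\<kappa> (fst p ! j) (snd p ! j)))"
        using p less_imp_neq[OF \<kappa>_pos] unfolding K_def by (subst ln_prod) (auto simp: words_def)
      ultimately show ?thesis
        unfolding h_def using lawZ[of p] Kpos by (subst ln_mult_pos) auto
    qed simp
  qed simp
  also have "\<dots> = (\<Sum>p\<in>?Z ` space M. law M ?Z p * ln (law M ?Y (snd p)))
      + (\<Sum>j<m. \<Sum>p\<in>?Z ` space M. law M ?Z p * ln (\<kappa> (fst p ! j) (snd p ! j)))"
    by (simp add: sum_law_superset[OF _ inZ] distrib_left sum.distrib sum_distrib_left
        sum.swap[of _ ?I "{..<m}"])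
  also have "(\<Sum>p\<in>?Z ` space M. law M ?Z p * ln (law M ?Y (snd p))) = - rv_entropy M ?Y"
    using sum_law_comp[OF sZ, of "\<lambda>l. ln (law M ?Y l)" snd] by (simp add: rv_entropy_def)
  finally have main: "rv_entropy M ?X \<le> - (- rv_entropy M ?Y
      + (\<Sum>j<m. \<Sum>p\<in>?Z ` space M. law M ?Z p * ln (\<kappa> (fst p ! j) (snd p ! j))))" .
  have "(\<Sum>j<m. ln (1 - \<delta>) - \<theta> * ln (r / \<delta>))
      \<le> (\<Sum>j<m. \<Sum>p\<in>?Z ` space M. law M ?Z p * ln (\<kappa> (fst p ! j) (snd p ! j)))"
  proof (rule sum_mono)
    fix j assume j: "j \<in> {..<m}"
    define E where "E x \<longleftrightarrow> X x = Y x" for x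
    have sE: "simple_function M E"
      unfolding E_def[abs_def]
      using simple_function_compose1[OF simple_function_Pair[OF X(1) Y(1)], of "\<lambda>p. fst p = snd p"]
      by simp
    define g where "g e = (if e then ln (1 - \<delta>) else ln (\<delta> / r))" for e
    have "(\<Sum>p\<in>?Z ` space M. law M ?Z p * ln (\<kappa> (fst p ! j) (snd p ! j)))
        = (\<Sum>p\<in>?Z ` space M. law M ?Z p * g (fst p ! j = snd p ! j))"
      by (intro sum.cong) (auto simp: \<kappa>_def g_def)
    also have "\<dots> = (\<Sum>e\<in>UNIV. law M (\<lambda>x. fst (?Z x) ! j = snd (?Z x) ! j) e * g e)"
      by (subst sum_law_comp[OF sZ, of g "\<lambda>p. fst p ! j = snd p ! j"]) (rule sum_law_superset, auto)
    also have "law M (\<lambda>x. fst (?Z x) ! j = snd (?Z x) ! j) = law M (\<lambda>x. E ((T ^^ j) x))"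
      using j by (intro law_cong) (auto simp: itinerary_def E_def)
    also have "\<dots> = law M E"
      by (rule law_funpow_T[OF sE])
    also have "(\<Sum>e\<in>UNIV. law M E e * g e) = law M E True * ln (1 - \<delta>) + law M E False * ln (\<delta> / r)"
      by (simp add: UNIV_bool g_def)
    also have "\<dots> \<ge> 1 * ln (1 - \<delta>) + \<theta> * ln (\<delta> / r)"
    proof (intro add_mono mult_right_mono_neg)
      show "law M E True \<le> 1" by (rule law_le_1)
      have "x \<in> E -` {False} \<longleftrightarrow> X x \<noteq> Y x" for x
        by (simp add: E_def)
      then have "E -` {False} \<inter> space M = {x \<in> space M. X x \<noteq> Y x}"
        by blast
      then show "law M E False \<le> \<theta>"
        using \<theta> by (simp add: law_def)
      show "ln (1 - \<delta>) \<le> 0" using \<delta> by simp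
      show "ln (\<delta> / r) \<le> 0" using \<delta> r by simp
    qed
    also have "ln (\<delta> / r) = - ln (r / \<delta>)"
      using \<delta> r by (simp add: ln_div)
    finally show "ln (1 - \<delta>) - \<theta> * ln (r / \<delta>)
        \<le> (\<Sum>p\<in>?Z ` space M. law M ?Z p * ln (\<kappa> (fst p ! j) (snd p ! j)))"
      by simp
  qed
  with main show ?thesis
    by (simp add: algebra_simps)
qed

end

section \<open>Invariant measures on the full shift\<close>

definition cylinder :: "nat \<Rightarrow> nat list \<Rightarrow> (nat \<Rightarrow> nat) set" where
  "cylinder M w = {x \<in> topspace (full_shift M). map x [0..<length w] = w}"

lemma topspace_full_shift: "topspace (full_shift M) = {x. \<forall>n. x n \<in> {1..M}}"
  by (auto simp: full_shift_def PiE_def Pi_def)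

lemma space_borel_shift: "space (borel_shift M) = topspace (full_shift M)"
  unfolding borel_shift_def by (rule space_measure_of) (auto dest: openin_subset)

lemma sets_borel_shift_opens:
  "sets (borel_shift M) = sigma_sets (topspace (full_shift M)) {U. openin (full_shift M) U}"
  unfolding borel_shift_def by (rule sets_measure_of) (auto dest: openin_subset)

lemma openin_coordinate: "openin (full_shift M) {x \<in> topspace (full_shift M). x n \<in> S}"
proof -
  have eq: "{x \<in> topspace (full_shift M). x n \<in> S}
      = {x \<in> topspace (full_shift M). x n \<in> S \<inter> {1..M}}"
    unfolding topspace_full_shift by blast
  have "continuous_map (full_shift M) (discrete_topology {1..M}) (\<lambda>x. x n)"
    unfolding full_shift_def
    by (rule continuous_map_product_projection[of n UNIV "\<lambda>_. discrete_topology {1..M}", OF UNIV_I])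
  then show ?thesis
    unfolding eq
    by (rule openin_continuous_map_preimage) (unfold openin_discrete_topology, blast)
qed

lemma cylinder_eq_Inter:
  "cylinder M w = topspace (full_shift M)
    \<inter> (\<Inter>k<length w. {x \<in> topspace (full_shift M). x k \<in> {w ! k}})"
proof (intro set_eqI)
  fix x
  have "map x [0..<length w] = w \<longleftrightarrow> (\<forall>k<length w. x k = w ! k)"
    by (subst list_eq_iff_nth_eq) simp
  then show "x \<in> cylinder M w \<longleftrightarrow> x \<in> topspace (full_shift M)
      \<inter> (\<Inter>k<length w. {x \<in> topspace (full_shift M). x k \<in> {w ! k}})"
    by (auto simp: cylinder_def)
qed

lemma openin_cylinder: "openin (full_shift M) (cylinder M w)"
proof (cases "w = []")
  case True
  then show ?thesis by (simp add: cylinder_def)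
next
  case False
  then show ?thesis
    unfolding cylinder_eq_Inter
    by (intro openin_Int openin_topspace openin_INT2 openin_coordinate) auto
qed

lemma open_contains_cylinder:
  assumes U: "openin (full_shift M) U" and x: "x \<in> U"
  shows "\<exists>n. cylinder M (map x [0..<n]) \<subseteq> U"
proof -
  obtain V where V: "finite {i. V i \<noteq> topspace (discrete_topology {1..M})}"
      "x \<in> PiE UNIV V" "PiE UNIV V \<subseteq> U"
    using U x unfolding full_shift_def openin_product_topology_alt by fastforce
  obtain n where n: "\<And>i. V i \<noteq> {1..M} \<Longrightarrow> i < n"
    using V(1) by (auto simp: finite_nat_set_iff_bounded)
  have "cylinder M (map x [0..<n]) \<subseteq> PiE UNIV V"
  proof
    fix y assume y: "y \<in> cylinder M (map x [0..<n])"
    have "y i \<in> V i" for i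
    proof (cases "V i = {1..M}")
      case True
      then show ?thesis using y by (auto simp: cylinder_def topspace_full_shift)
    next
      case False
      then have "y i = x i"
        using n y by (auto simp: cylinder_def)
      then show ?thesis using V(2) by auto
    qed
    then show "y \<in> PiE UNIV V" by auto
  qed
  then show ?thesis using V(3) by blast
qed

lemma sets_borel_shift:
  "sets (borel_shift M) = sigma_sets (topspace (full_shift M)) (range (cylinder M))"
  unfolding sets_borel_shift_opens
proof (rule sigma_sets_eqI)
  fix U assume U: "U \<in> {U. openin (full_shift M) U}"
  have "U = (\<Union>w\<in>{w. cylinder M w \<subseteq> U}. cylinder M w)"
  proof
    show "U \<subseteq> (\<Union>w\<in>{w. cylinder M w \<subseteq> U}. cylinder M w)"
    proof
      fix x assume x: "x \<in> U"
      then obtain n where n: "cylinder M (map x [0..<n]) \<subseteq> U"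
        using open_contains_cylinder U by blast
      have "x \<in> cylinder M (map x [0..<n])"
        using U x openin_subset by (auto simp: cylinder_def)
      then show "x \<in> (\<Union>w\<in>{w. cylinder M w \<subseteq> U}. cylinder M w)"
        using n by blast
    qed
  qed auto
  also have "\<dots> \<in> sigma_sets (topspace (full_shift M)) (range (cylinder M))"
    by (rule sigma_sets_UNION) (auto intro: sigma_sets.Basic)
  finally show "U \<in> sigma_sets (topspace (full_shift M)) (range (cylinder M))" .
qed (auto intro!: sigma_sets.Basic openin_cylinder)

lemma cylinder_sets: "cylinder M w \<in> sets (borel_shift M)"
  unfolding sets_borel_shift by (auto intro: sigma_sets.Basic)

lemma space_PiM_letters: "space (PiM UNIV (\<lambda>_. count_space {1..M})) = topspace (full_shift M)"
  by (auto simp: space_PiM topspace_full_shift PiE_def Pi_def)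

lemma sets_borel_shift_eq_PiM:
  "sets (borel_shift M) = sets (PiM UNIV (\<lambda>_. count_space {1..M}))" (is "_ = sets ?P")
proof
  have "{x \<in> space ?P. x k \<in> S} \<in> sets ?P" for k S
  proof -
    have "(\<lambda>x. x k) \<in> measurable ?P (count_space {1..M})"
      by (rule measurable_component_singleton) simp
    moreover have "{x \<in> space ?P. x k \<in> S} = (\<lambda>x. x k) -` (S \<inter> {1..M}) \<inter> space ?P"
      unfolding space_PiM_letters by (auto simp: topspace_full_shift)
    ultimately show ?thesis
      by (metis (no_types, lifting) Int_lower2 PowI measurable_sets sets_count_space)
  qed
  then have "cylinder M w \<in> sets ?P" for w
  proof (cases "w = []")
    case True
    then have "cylinder M w = space ?P"
      unfolding space_PiM_letters by (simp add: cylinder_def)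
    then show ?thesis by simp
  next
    case False
    then show ?thesis
      unfolding cylinder_eq_Inter space_PiM_letters[symmetric]
      using \<open>\<And>k S. {x \<in> space ?P. x k \<in> S} \<in> sets ?P\<close>
      by (intro sets.Int sets.top sets.finite_INT) auto
  qed
  then show "sets (borel_shift M) \<subseteq> sets ?P"
    unfolding sets_borel_shift space_PiM_letters[symmetric]
    by (intro sets.sigma_sets_subset) auto
next
  have *: "{f \<in> topspace (full_shift M). f i \<in> S} \<in> sets (borel_shift M)" for i S
    unfolding sets_borel_shift_opens using openin_coordinate[of M i S] by (auto intro: sigma_sets.Basic)
  have top: "PiE UNIV (\<lambda>_. space (count_space {1..M})) = topspace (full_shift M)"
    using space_PiM_letters[of M] by (simp only: space_PiM)
  show "sets ?P \<subseteq> sets (borel_shift M)"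
    unfolding sets_PiM_single top
  proof (rule sets.sigma_sets_subset')
    show "topspace (full_shift M) \<in> sets (borel_shift M)"
      unfolding space_borel_shift[symmetric] by (rule sets.top)
  qed (use * in blast)
qed

text \<open>The sets that can be approximated form a sigma-algebra, because countable unions can be truncated
  in a finite measure.\<close>

lemma cylinder_approximation:
  fixes N :: "(nat \<Rightarrow> nat) measure"
  assumes "prob_space N" and sets_M: "sets N = sets (borel_shift k)" and B: "B \<in> sets N" and \<theta>: "\<theta> > 0"
  obtains n S where "measure N (B - {x \<in> space N. map x [0..<n] \<in> S}
    \<union> ({x \<in> space N. map x [0..<n] \<in> S} - B)) < \<theta>"
proof -
  interpret prob_space N by fact
  have space_M: "space N = topspace (full_shift k)"
    using sets_eq_imp_space_eq[OF sets_M] by (simp add: space_borel_shift)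
  define C where "C n S = {x \<in> space N. map x [0..<n] \<in> S}" for n S
  have C_UN: "C n S = (\<Union>w\<in>{w \<in> S. length w = n}. cylinder k w)" for n S
    by (auto simp: C_def cylinder_def space_M)
  have C_sets: "C n S \<in> sets N" for n S
    unfolding C_UN sets_M by (intro sets.countable_UN'') (auto intro: cylinder_sets)
  have C_mono: "C n S = C m {w. take n w \<in> S}" if "n \<le> m" for n m S
    using that by (auto simp: C_def take_map)
  have "\<forall>\<theta>>0. \<exists>n S. measure N (B - C n S \<union> (C n S - B)) < \<theta>"
    using B unfolding sets_M sets_borel_shift
  proof (induction rule: sigma_sets.induct)
    case (Basic a)
    then obtain w where w: "a = cylinder k w" by blast
    have "a = C (length w) {w}"
      by (auto simp: w C_def cylinder_def space_M)
    then show ?case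
      by (metis Diff_cancel Un_absorb measure_empty)
  next
    case Empty
    have "C 0 {} = {}" by (simp add: C_def)
    then show ?case
      by (metis Diff_cancel Un_absorb measure_empty)
  next
    case (Compl a)
    show ?case
    proof (intro allI impI)
      fix \<theta> :: real assume "\<theta> > 0"
      then obtain n S where nS: "measure N (a - C n S \<union> (C n S - a)) < \<theta>"
        using Compl by blast
      have "a \<in> sets N"
        using Compl(1) by (simp add: sets_M sets_borel_shift)
      then have "a \<subseteq> space N" by (rule sets.sets_into_space)
      then have "topspace (full_shift k) - a - C n (- S) \<union> (C n (- S) - (topspace (full_shift k) - a))
          = a - C n S \<union> (C n S - a)"
        by (auto simp: C_def space_M)
      then show "\<exists>n S. measure N (topspace (full_shift k) - a - C n S
          \<union> (C n S - (topspace (full_shift k) - a))) < \<theta>"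
        using nS by metis
    qed
  next
    case (Union a)
    have a_sets: "a i \<in> sets N" for i
      using Union(1) by (simp add: sets_M sets_borel_shift)
    show ?case
    proof (intro allI impI)
      fix \<theta> :: real assume \<theta>: "\<theta> > 0"
      define U where "U L = (\<Union>i<L. a i)" for L
      have U_sets: "U L \<in> sets N" for L
        using a_sets by (auto simp: U_def)
      have UN: "(\<Union>L. U L) = (\<Union>i. a i)"
        by (auto simp: U_def)
      have "(\<lambda>L. measure N (U L)) \<longlonglongrightarrow> measure N (\<Union>L. U L)"
        by (rule finite_Lim_measure_incseq) (use U_sets in \<open>auto simp: incseq_def U_def\<close>, fastforce)
      then have "eventually (\<lambda>L. measure N (U L) > measure N (\<Union>L. U L) - \<theta> / 2) sequentially"
        using \<theta> by (intro order_tendstoD(1)) auto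
      then obtain L where L: "measure N (U L) > measure N (\<Union>i. a i) - \<theta> / 2"
        unfolding UN by (auto simp: eventually_sequentially)
      have "\<forall>i. \<exists>n S. measure N (a i - C n S \<union> (C n S - a i)) < \<theta> / (2 * (real L + 1))"
        using Union.IH \<theta> by simp
      then obtain n S where nS:
        "\<And>i. measure N (a i - C (n i) (S i) \<union> (C (n i) (S i) - a i)) < \<theta> / (2 * (real L + 1))"
        by metis
      define m where "m = Max (insert 0 (n ` {..<L}))"
      have m: "n i \<le> m" if "i < L" for i
        unfolding m_def using that by (intro Max_ge) auto
      define S' where "S' = (\<Union>i<L. {w. take (n i) w \<in> S i})"
      have C': "C m S' = (\<Union>i<L. C (n i) (S i))"
      proof -
        have "C m S' = (\<Union>i<L. C m {w. take (n i) w \<in> S i})"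
          by (auto simp: C_def S'_def)
        also have "\<dots> = (\<Union>i<L. C (n i) (S i))"
          by (rule SUP_cong) (auto intro!: C_mono[symmetric] m)
        finally show ?thesis .
      qed
      let ?D = "\<lambda>i. a i - C (n i) (S i) \<union> (C (n i) (S i) - a i)"
      have "(\<Union>i. a i) - C m S' \<union> (C m S' - (\<Union>i. a i)) \<subseteq> ((\<Union>i. a i) - U L) \<union> (\<Union>i<L. ?D i)"
        unfolding C' U_def by auto
      then have "measure N ((\<Union>i. a i) - C m S' \<union> (C m S' - (\<Union>i. a i)))
          \<le> measure N (((\<Union>i. a i) - U L) \<union> (\<Union>i<L. ?D i))"
        using a_sets C_sets U_sets by (intro finite_measure_mono) auto
      also have "\<dots> \<le> measure N ((\<Union>i. a i) - U L) + measure N (\<Union>i<L. ?D i)"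
        using a_sets C_sets U_sets by (intro measure_Un_le) auto
      also have "measure N ((\<Union>i. a i) - U L) = measure N (\<Union>i. a i) - measure N (U L)"
        using a_sets U_sets by (intro finite_measure_Diff) (auto simp: U_def)
      also have "measure N (\<Union>i<L. ?D i) \<le> (\<Sum>i<L. measure N (?D i))"
        using a_sets C_sets by (intro measure_UNION_le) auto
      also have "\<dots> \<le> (\<Sum>i<L. \<theta> / (2 * (real L + 1)))"
        using nS by (intro sum_mono less_imp_le) auto
      also have "\<dots> \<le> \<theta> / 2"
        using \<theta> by (simp add: field_simps)
      finally have "measure N ((\<Union>i. a i) - C m S' \<union> (C m S' - (\<Union>i. a i))) < \<theta>"
        using L by simp
      then show "\<exists>n S. measure N ((\<Union>i. a i) - C n S \<union> (C n S - (\<Union>i. a i))) < \<theta>"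
        by blast
    qed
  qed
  then show ?thesis
    using \<theta> that unfolding C_def by blast
qed

definition wordof :: "nat \<Rightarrow> (nat \<Rightarrow> nat) \<Rightarrow> nat list" where
  "wordof n x = map x [0..<n]"

lemma funpow_shift: "(shift ^^ k) x = (\<lambda>n. x (n + k))"
  by (induction k) (auto simp: shift_def)

lemma itinerary_shift: "itinerary shift (\<lambda>x. x 0) n = wordof n"
  by (simp add: itinerary_def[abs_def] wordof_def[abs_def] funpow_shift fun_eq_iff)

locale shift_invariant =
  fixes M :: nat and \<nu> :: "(nat \<Rightarrow> nat) measure"
  assumes invariant: "\<nu> \<in> invariant_measures M"

sublocale shift_invariant \<subseteq> prob_space \<nu>
  using invariant by (simp add: invariant_measures_def)

context shift_invariant
begin

lemma sets_eq: "sets \<nu> = sets (borel_shift M)"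
  using invariant by (simp add: invariant_measures_def)

lemma space_eq: "space \<nu> = topspace (full_shift M)"
  using sets_eq_imp_space_eq[OF sets_eq] by (simp add: space_borel_shift)

lemma shift_in_space: "x \<in> space \<nu> \<Longrightarrow> shift x \<in> space \<nu>"
  by (auto simp: space_eq topspace_full_shift shift_def)

lemma letter_set: "{x \<in> space \<nu>. x n \<in> S} \<in> sets \<nu>"
  unfolding sets_eq sets_borel_shift_opens space_eq
  using openin_coordinate[of M n S] by (auto intro: sigma_sets.Basic)

lemma shift_measurable: "shift \<in> measurable \<nu> \<nu>"
proof -
  have 1: "sets \<nu> = sigma_sets (space \<nu>) (range (cylinder M))"
    by (simp add: sets_eq sets_borel_shift space_eq)
  show ?thesis
  proof (rule measurable_sigma_sets[OF 1])
    show "range (cylinder M) \<subseteq> Pow (space \<nu>)"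
      by (auto simp: cylinder_def space_eq)
    show "shift \<in> space \<nu> \<rightarrow> space \<nu>"
      using shift_in_space by auto
    fix C assume "C \<in> range (cylinder M)"
    then obtain w where C: "C = cylinder M w" by blast
    show "shift -` C \<inter> space \<nu> \<in> sets \<nu>"
    proof (cases "w = []")
      case True
      then have "shift -` C \<inter> space \<nu> = space \<nu>"
        using shift_in_space by (auto simp: C cylinder_def space_eq)
      then show ?thesis by simp
    next
      case False
      have "shift -` C \<inter> space \<nu> = (\<Inter>k<length w. {x \<in> space \<nu>. x (Suc k) \<in> {w ! k}})"
        using False shift_in_space unfolding C cylinder_eq_Inter
        by (auto simp: space_eq shift_def)
      also have "\<dots> \<in> sets \<nu>"
        using False by (intro sets.finite_INT letter_set) auto
      finally show ?thesis .
    qed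
  qed
qed

end

sublocale shift_invariant \<subseteq> measure_preserving_map \<nu> shift
proof
  show "shift \<in> measurable \<nu> \<nu>" by (rule shift_measurable)
  fix B assume "B \<in> sets \<nu>"
  then have "emeasure \<nu> (shift -` B \<inter> space \<nu>) = emeasure \<nu> B"
    using invariant by (simp add: invariant_measures_def)
  then show "prob (shift -` B \<inter> space \<nu>) = prob B"
    by (simp add: measure_def)
qed

context shift_invariant
begin

abbreviation block_entropy :: "nat \<Rightarrow> real" where
  "block_entropy n \<equiv> rv_entropy \<nu> (wordof n)"

lemma wordof_in_words: "x \<in> space \<nu> \<Longrightarrow> wordof n x \<in> words M n"
  by (auto simp: space_eq topspace_full_shift wordof_def words_def)

lemma wordof_image: "wordof n ` space \<nu> \<subseteq> words M n"
  using wordof_in_words by auto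

lemma simple_function_coordinate: "simple_function \<nu> (\<lambda>x. x 0)"
  unfolding simple_function_def
proof (intro conjI ballI)
  have "(\<lambda>x. x 0) ` space \<nu> \<subseteq> {1..M}"
    by (auto simp: space_eq topspace_full_shift)
  then show "finite ((\<lambda>x. x 0) ` space \<nu>)"
    by (rule finite_subset) simp
  fix b
  show "(\<lambda>x. x 0) -` {b} \<inter> space \<nu> \<in> sets \<nu>"
    using letter_set[of 0 "{b}"] by (simp add: vimage_def Int_def conj_commute)
qed

lemma simple_function_wordof: "simple_function \<nu> (wordof n)"
  using simple_function_itinerary[OF simple_function_coordinate] by (simp add: itinerary_shift)

lemma block_entropy_subadditive: "block_entropy (m + n) \<le> block_entropy m + block_entropy n"
  using rv_entropy_itinerary_subadditive[OF simple_function_coordinate] by (simp add: itinerary_shift)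

lemma sum_law_words: "sum (law \<nu> (wordof n)) (words M n) = 1"
  by (rule sum_law[OF simple_function_wordof _ wordof_image]) simp

lemma block_entropy_eq:
  "block_entropy n = - (\<Sum>w\<in>words M n. law \<nu> (wordof n) w * ln (law \<nu> (wordof n) w))"
  by (rule rv_entropy_eq[OF _ wordof_image]) simp

text \<open>The Kolmogorov--Sinai theorem for the generator consisting of the cylinders of length one:
  every finite partition is close to one that is measurable with respect to words of some length
  \<open>k\<close>, so its itinerary of length \<open>m\<close> is almost determined by the word of length \<open>m + k\<close>.\<close>

lemma entropy_wrt_le_block_entropy:
  assumes P: "finite P" "P \<subseteq> sets \<nu>" "partition_on (space \<nu>) P" and n: "n > 0"
  shows "entropy_wrt \<nu> shift P \<le> block_entropy n / n"
proof -
  obtain H where H: "(\<lambda>n. block_entropy n / n) \<longlonglongrightarrow> H" "\<And>n. n > 0 \<Longrightarrow> H \<le> block_entropy n / n"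
    using Fekete_nonneg[of block_entropy, OF block_entropy_subadditive rv_entropy_nonneg] by blast
  define r where "r = card P"
  obtain f where f: "bij_betw f {1..r} P"
    using ex_bij_betw_nat_finite_1[OF P(1)] unfolding r_def by blast
  have "P \<noteq> {}"
    using P(3) not_empty by (auto simp: partition_on_def)
  then have r: "r \<ge> 1"
    using P(1) by (simp add: r_def Suc_le_eq card_gt_0_iff)
  define X where "X x = the_inv_into {1..r} f (cell P x)" for x
  have X_cell: "f (X x) = cell P x" "X x \<in> {1..r}" if "x \<in> space \<nu>" for x
  proof -
    have *: "inj_on f {1..r}" "cell P x \<in> f ` {1..r}"
      using f cell_in(1)[OF P(3) that] by (auto simp: bij_betw_def)
    show "f (X x) = cell P x"
      unfolding X_def by (rule f_the_inv_into_f[OF *])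
    show "X x \<in> {1..r}"
      unfolding X_def by (rule the_inv_into_into[OF * subset_refl])
  qed
  have sX: "simple_function \<nu> X"
    unfolding X_def[abs_def] by (rule simple_function_compose1[OF simple_function_cell[OF P]])
  have imX: "X ` space \<nu> \<subseteq> {1..r}"
    using X_cell by auto
  have cell_le: "rv_entropy \<nu> (itinerary shift (cell P) m) \<le> rv_entropy \<nu> (itinerary shift X m)" for m
  proof -
    have "rv_entropy \<nu> (itinerary shift (cell P) m) = rv_entropy \<nu> (\<lambda>x. map f (itinerary shift X m x))"
      by (rule rv_entropy_cong) (auto simp: itinerary_def X_cell funpow_T_space)
    also have "\<dots> \<le> rv_entropy \<nu> (itinerary shift X m)"
      by (rule rv_entropy_comp_le[OF simple_function_itinerary[OF sX]])
    finally show ?thesis .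
  qed
  have "entropy_wrt \<nu> shift P \<le> H + \<epsilon>" if \<epsilon>: "\<epsilon> > 0" for \<epsilon>
  proof -
    obtain \<delta> where \<delta>: "0 < \<delta>" "\<delta> < 1" "- ln (1 - \<delta>) \<le> \<epsilon> / 2"
    proof
      show "0 < 1 - exp (- (\<epsilon> / 2))" "1 - exp (- (\<epsilon> / 2)) < 1"
        using \<epsilon> by auto
      show "- ln (1 - (1 - exp (- (\<epsilon> / 2)))) \<le> \<epsilon> / 2" by simp
    qed
    (* disagreement on a set of this measure contributes at most epsilon / 2 *)
    define \<theta> where "\<theta> = \<epsilon> / (2 * (ln (r / \<delta>) + 1))"
    have lnr: "ln (r / \<delta>) \<ge> 0"
      using \<delta> r by (intro ln_ge_zero) (simp add: le_divide_eq)
    then have \<theta>: "\<theta> > 0" "\<theta> * ln (r / \<delta>) \<le> \<epsilon> / 2"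
      using \<epsilon> by (auto simp: \<theta>_def field_simps)
    define E where "E j p = f j - {x \<in> space \<nu>. wordof (fst p) x \<in> snd p}
        \<union> ({x \<in> space \<nu>. wordof (fst p) x \<in> snd p} - f j)" for j p
    have "\<exists>p. measure \<nu> (E j p) < \<theta> / r" if "j \<in> {1..r}" for j
    proof -
      have "f j \<in> sets \<nu>" using f P(2) that by (auto simp: bij_betw_def)
      moreover have "\<theta> / r > 0" using \<theta> r by simp
      ultimately obtain n S where "measure \<nu> (f j - {x \<in> space \<nu>. map x [0..<n] \<in> S}
          \<union> ({x \<in> space \<nu>. map x [0..<n] \<in> S} - f j)) < \<theta> / r"
        using cylinder_approximation[OF prob_space_axioms sets_eq] by blast
      then have "measure \<nu> (E j (n, S)) < \<theta> / r"
        by (simp add: E_def wordof_def)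
      then show ?thesis by blast
    qed
    then obtain p where p: "\<And>j. j \<in> {1..r} \<Longrightarrow> measure \<nu> (E j (p j)) < \<theta> / r"
      by metis
    define n S where "n j = fst (p j)" and "S j = snd (p j)" for j
    define k where "k = Max (n ` {1..r})"
    have k: "n j \<le> k" if "j \<in> {1..r}" for j
      unfolding k_def using that by (intro Max_ge) auto
    (* the value of G where no or several of the sets match matters only on the small sets D j below *)
    define G where "G w = (if \<exists>j\<in>{1..r}. take (n j) w \<in> S j
        then LEAST j. j \<in> {1..r} \<and> take (n j) w \<in> S j else 1)" for w
    define Y where "Y x = G (wordof k x)" for x
    have G: "G w \<in> {1..r}" for w
    proof (cases "\<exists>j\<in>{1..r}. take (n j) w \<in> S j")
      case True
      then have "(LEAST j. j \<in> {1..r} \<and> take (n j) w \<in> S j) \<in> {1..r}"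
        by (metis (mono_tags, lifting) LeastI)
      then show ?thesis using True by (simp add: G_def)
    qed (use r in \<open>simp add: G_def\<close>)
    have sY: "simple_function \<nu> Y"
      unfolding Y_def[abs_def] by (rule simple_function_compose1[OF simple_function_wordof])
    have take_wordof: "take (n j) (wordof k x) = wordof (n j) x" if "j \<in> {1..r}" for j x
      using k[OF that] by (simp add: wordof_def take_map)
    define D where "D j = f j - {x \<in> space \<nu>. wordof (n j) x \<in> S j}
        \<union> ({x \<in> space \<nu>. wordof (n j) x \<in> S j} - f j)" for j
    have D_sets: "D j \<in> sets \<nu>" if "j \<in> {1..r}" for j
    proof -
      have "f j \<in> sets \<nu>" using f P(2) that by (auto simp: bij_betw_def)
      moreover have "{x \<in> space \<nu>. wordof (n j) x \<in> S j} \<in> sets \<nu>"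
        using simple_functionD(2)[OF simple_function_wordof, of "n j" "S j"]
        by (simp add: vimage_def Int_def conj_commute)
      ultimately show ?thesis by (auto simp: D_def)
    qed
    have XY: "X x = Y x" if x: "x \<in> space \<nu>" "\<And>j. j \<in> {1..r} \<Longrightarrow> x \<notin> D j" for x
    proof -
      have mem: "take (n j) (wordof k x) \<in> S j \<longleftrightarrow> j = X x" if j: "j \<in> {1..r}" for j
      proof -
        have "take (n j) (wordof k x) \<in> S j \<longleftrightarrow> x \<in> f j"
          using x(2)[OF j] x(1) by (auto simp: D_def take_wordof[OF j])
        also have "\<dots> \<longleftrightarrow> f j = cell P x"
          using cell_eqI[OF P(3), of "f j" x] cell_in[OF P(3) x(1)] f j by (auto simp: bij_betw_def)
        also have "\<dots> \<longleftrightarrow> j = X x"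
          using X_cell[OF x(1)] inj_on_eq_iff[OF bij_betw_imp_inj_on[OF f] j X_cell(2)[OF x(1)]]
          by simp
        finally show ?thesis .
      qed
      have "(LEAST j. j \<in> {1..r} \<and> take (n j) (wordof k x) \<in> S j) = X x"
        using mem X_cell(2)[OF x(1)] by (intro Least_equality) auto
      then show ?thesis
        using mem X_cell(2)[OF x(1)] by (auto simp: Y_def G_def)
    qed
    have "measure \<nu> {x \<in> space \<nu>. X x \<noteq> Y x} \<le> measure \<nu> (\<Union>j\<in>{1..r}. D j)"
    proof (rule finite_measure_mono)
      show "{x \<in> space \<nu>. X x \<noteq> Y x} \<subseteq> (\<Union>j\<in>{1..r}. D j)"
        using XY by blast
    qed (use D_sets in blast)
    also have "\<dots> \<le> (\<Sum>j\<in>{1..r}. measure \<nu> (D j))"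
      using D_sets by (intro measure_UNION_le) auto
    also have "\<dots> \<le> (\<Sum>j\<in>{1..r}. \<theta> / r)"
      using p unfolding D_def E_def n_def S_def by (intro sum_mono less_imp_le) auto
    also have "\<dots> = \<theta>"
      using r by simp
    finally have close: "measure \<nu> {x \<in> space \<nu>. X x \<noteq> Y x} \<le> \<theta>" .
    have Y_le: "rv_entropy \<nu> (itinerary shift Y m) \<le> block_entropy m + block_entropy k" for m
    proof -
      have "rv_entropy \<nu> (itinerary shift Y m)
          = rv_entropy \<nu> (\<lambda>x. (\<lambda>w. map (\<lambda>j. G (take k (drop j w))) [0..<m]) (wordof (m + k) x))"
        by (rule rv_entropy_cong)
          (auto simp: itinerary_def Y_def funpow_shift wordof_def take_map drop_map
            intro!: arg_cong[of _ _ G] nth_equalityI simp: add.commute)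
      also have "\<dots> \<le> block_entropy (m + k)"
        by (rule rv_entropy_comp_le[OF simple_function_wordof])
      finally show ?thesis
        using block_entropy_subadditive[of m k] by simp
    qed
    have le: "rv_entropy \<nu> (itinerary shift (cell P) m) \<le> block_entropy m + block_entropy k + m * \<epsilon>" for m
    proof -
      have "rv_entropy \<nu> (itinerary shift X m)
          \<le> rv_entropy \<nu> (itinerary shift Y m) + m * (\<theta> * ln (r / \<delta>) - ln (1 - \<delta>))"
        using G by (intro rv_entropy_itinerary_close sX imX sY \<delta> close) (auto simp: Y_def)
      moreover have "m * (\<theta> * ln (r / \<delta>) - ln (1 - \<delta>)) \<le> m * \<epsilon>"
        using \<delta>(3) \<theta>(2) by (intro mult_left_mono) auto
      ultimately show ?thesis
        using cell_le[of m] Y_le[of m] by linarith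
    qed
    have "rv_entropy \<nu> (itinerary shift (cell P) m) / m
        \<le> block_entropy m / m + block_entropy k / m + \<epsilon>" if "m > 0" for m
      using le[of m] that by (simp add: field_simps)
    then have "eventually (\<lambda>m. rv_entropy \<nu> (itinerary shift (cell P) m) / m
        \<le> block_entropy m / m + block_entropy k / m + \<epsilon>) sequentially"
      by (rule eventually_mono[OF eventually_gt_at_top[of 0]])
    moreover have "(\<lambda>m. block_entropy m / m + block_entropy k / m + \<epsilon>) \<longlonglongrightarrow> H + 0 + \<epsilon>"
      by (intro tendsto_add H(1) tendsto_const lim_const_over_n)
    ultimately show ?thesis
      using tendsto_le[OF sequentially_bot _ entropy_wrt_limit(1)[OF P]] by fastforce
  qed
  then have "entropy_wrt \<nu> shift P \<le> H"
    by (rule field_le_epsilon)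
  then show ?thesis
    using H(2)[OF n] by simp
qed

lemma metric_entropy_le_block_entropy:
  assumes "n > 0"
  shows "metric_entropy \<nu> shift \<le> ereal (block_entropy n / n)"
  unfolding metric_entropy_def
  by (intro SUP_least) (use entropy_wrt_le_block_entropy assms in auto)

text \<open>The partition by the first letter realises the growth rate of the block entropies.\<close>

lemma block_entropy_growth_le_metric_entropy:
  assumes "\<And>n. h * n - c \<le> block_entropy n"
  shows "ereal h \<le> metric_entropy \<nu> shift"
proof -
  define P where "P = (\<lambda>b. (\<lambda>x. x 0) -` {b} \<inter> space \<nu>) ` ((\<lambda>x. x 0) ` space \<nu>)"
  have P: "finite P" "P \<subseteq> sets \<nu>" "partition_on (space \<nu>) P"
  proof -
    show "finite P" "P \<subseteq> sets \<nu>"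
      using simple_function_coordinate by (auto simp: P_def simple_function_def)
    show "partition_on (space \<nu>) P"
      by (rule partition_onI) (auto simp: P_def disjnt_def)
  qed
  have cell: "cell P x = (\<lambda>y. y 0) -` {x 0} \<inter> space \<nu>" if "x \<in> space \<nu>" for x
    by (rule cell_eqI[OF P(3)]) (use that in \<open>auto simp: P_def\<close>)
  have "block_entropy n \<le> rv_entropy \<nu> (itinerary shift (cell P) n)" for n
  proof -
    have "block_entropy n = rv_entropy \<nu> (\<lambda>x. map (\<lambda>B. (SOME y. y \<in> B) 0) (itinerary shift (cell P) n x))"
    proof (rule rv_entropy_cong)
      fix x assume x: "x \<in> space \<nu>"
      have "(SOME y. y \<in> cell P ((shift ^^ k) x)) 0 = x k" for k
      proof -
        have "(SOME y. y \<in> cell P ((shift ^^ k) x)) \<in> cell P ((shift ^^ k) x)"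
          using cell_in(2)[OF P(3) funpow_T_space[OF x], of k] by (rule someI[where P = "\<lambda>y. y \<in> _"])
        then show ?thesis
          unfolding cell[OF funpow_T_space[OF x]] by (simp add: funpow_shift)
      qed
      then show "wordof n x = map (\<lambda>B. (SOME y. y \<in> B) 0) (itinerary shift (cell P) n x)"
        by (simp add: wordof_def itinerary_def)
    qed
    also have "\<dots> \<le> rv_entropy \<nu> (itinerary shift (cell P) n)"
      by (intro rv_entropy_comp_le simple_function_itinerary simple_function_cell P)
    finally show ?thesis .
  qed
  then have "h * n - c \<le> rv_entropy \<nu> (itinerary shift (cell P) n)" for n
    using assms order_trans by blast
  then have "(h * n - c) / n \<le> rv_entropy \<nu> (itinerary shift (cell P) n) / n" for n
    by (rule divide_right_mono) simp
  then have "h - c / n \<le> rv_entropy \<nu> (itinerary shift (cell P) n) / n" if "n > 0" for n :: nat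
    using that by (metis diff_divide_distrib nonzero_mult_div_cancel_right of_nat_0_less_iff
        less_irrefl)
  then have "eventually (\<lambda>n. h - c / n \<le> rv_entropy \<nu> (itinerary shift (cell P) n) / n) sequentially"
    by (rule eventually_mono[OF eventually_gt_at_top[of 0]])
  moreover have "(\<lambda>n. h - c / real n) \<longlonglongrightarrow> h - 0"
    by (intro tendsto_diff tendsto_const lim_const_over_n)
  ultimately have "h \<le> entropy_wrt \<nu> shift P"
    using tendsto_le[OF sequentially_bot entropy_wrt_limit(1)[OF P]] by fastforce
  also have "ereal (entropy_wrt \<nu> shift P) \<le> metric_entropy \<nu> shift"
    unfolding metric_entropy_def by (rule SUP_upper) (use P in auto)
  finally show ?thesis by simp
qed

end

section \<open>Lyapunov exponents as limits of finite sums\<close>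

context shift_invariant
begin

lemma nn_integral_wordof:
  fixes G :: "nat list \<Rightarrow> ennreal"
  shows "(\<integral>\<^sup>+ x. G (wordof n x) \<partial>\<nu>) = (\<Sum>w\<in>words M n. G w * ennreal (law \<nu> (wordof n) w))"
proof -
  define C where "C w = wordof n -` {w} \<inter> space \<nu>" for w
  have C: "C w \<in> sets \<nu>" for w
    unfolding C_def by (rule simple_functionD(2)[OF simple_function_wordof])
  have "(\<integral>\<^sup>+ x. G (wordof n x) \<partial>\<nu>) = (\<integral>\<^sup>+ x. (\<Sum>w\<in>words M n. G w * indicator (C w) x) \<partial>\<nu>)"
  proof (rule nn_integral_cong)
    fix x assume x: "x \<in> space \<nu>"
    have "(\<Sum>w\<in>words M n. G w * indicator (C w) x) = (\<Sum>w\<in>words M n. if w = wordof n x then G w else 0)"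
      using x by (intro sum.cong refl) (auto simp: C_def indicator_def)
    also have "\<dots> = G (wordof n x)"
      using wordof_in_words[OF x] by (simp add: sum.delta)
    finally show "G (wordof n x) = (\<Sum>w\<in>words M n. G w * indicator (C w) x)" by simp
  qed
  also have "\<dots> = (\<Sum>w\<in>words M n. \<integral>\<^sup>+ x. G w * indicator (C w) x \<partial>\<nu>)"
    using C by (intro nn_integral_sum) auto
  also have "\<dots> = (\<Sum>w\<in>words M n. G w * emeasure \<nu> (C w))"
    using C by (intro sum.cong refl nn_integral_cmult_indicator)
  also have "\<dots> = (\<Sum>w\<in>words M n. G w * ennreal (law \<nu> (wordof n) w))"
    by (simp add: law_def C_def emeasure_eq_measure)
  finally show ?thesis .
qed

lemma extended_integral_wordof_finite:
  assumes F: "\<And>w. w \<in> words M n \<Longrightarrow> law \<nu> (wordof n) w > 0 \<Longrightarrow> F w = ereal (f w)"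
  shows "extended_integral \<nu> (\<lambda>x. F (wordof n x)) = ereal (\<Sum>w\<in>words M n. law \<nu> (wordof n) w * f w)"
proof -
  let ?p = "law \<nu> (wordof n)"
  have part: "(\<Sum>w\<in>words M n. e2ennreal (H w) * ennreal (?p w)) = ennreal (\<Sum>w\<in>words M n. ?p w * max 0 (h w))"
    if H: "\<And>w. w \<in> words M n \<Longrightarrow> ?p w > 0 \<Longrightarrow> H w = ereal (h w)" for H h
  proof -
    have "(\<Sum>w\<in>words M n. e2ennreal (H w) * ennreal (?p w)) = (\<Sum>w\<in>words M n. ennreal (?p w * max 0 (h w)))"
    proof (rule sum.cong)
      fix w assume w: "w \<in> words M n"
      show "e2ennreal (H w) * ennreal (?p w) = ennreal (?p w * max 0 (h w))"
      proof (cases "?p w = 0")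
        case False
        then have "?p w > 0"
          using law_nonneg[of \<nu> "wordof n" w] by linarith
        then show ?thesis
          using H[OF w] by (cases "h w \<ge> 0") (auto simp: ennreal_mult mult.commute e2ennreal_ereal ennreal_neg max_def)
      qed simp
    qed simp
    then show ?thesis
      by (simp add: sum_ennreal)
  qed
  have "extended_integral \<nu> (\<lambda>x. F (wordof n x))
      = enn2ereal (ennreal (\<Sum>w\<in>words M n. ?p w * max 0 (f w)))
        - enn2ereal (ennreal (\<Sum>w\<in>words M n. ?p w * max 0 (- f w)))"
    unfolding extended_integral_def nn_integral_wordof[of "\<lambda>w. e2ennreal (F w)"]
      nn_integral_wordof[of "\<lambda>w. e2ennreal (- F w)"]
    using part[of F f] part[of "\<lambda>w. - F w" "\<lambda>w. - f w"] F by simp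
  also have "\<dots> = ereal ((\<Sum>w\<in>words M n. ?p w * max 0 (f w)) - (\<Sum>w\<in>words M n. ?p w * max 0 (- f w)))"
    by (simp add: sum_nonneg)
  also have "(\<Sum>w\<in>words M n. ?p w * max 0 (f w)) - (\<Sum>w\<in>words M n. ?p w * max 0 (- f w))
      = (\<Sum>w\<in>words M n. ?p w * f w)"
    unfolding sum_subtractf[symmetric] right_diff_distrib[symmetric]
    by (intro sum.cong refl) (auto simp: max_def)
  finally show ?thesis .
qed

lemma extended_integral_wordof_minfty:
  assumes F: "\<And>w. w \<in> words M n \<Longrightarrow> F w \<noteq> \<infinity>"
    and w: "w \<in> words M n" "law \<nu> (wordof n) w > 0" "F w = - \<infinity>"
  shows "extended_integral \<nu> (\<lambda>x. F (wordof n x)) = - \<infinity>"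
proof -
  let ?p = "law \<nu> (wordof n)"
  have "e2ennreal (F v) \<noteq> \<infinity>" if "v \<in> words M n" for v
    using F[OF that] by (cases "F v") (auto simp: e2ennreal_ereal e2ennreal_neg)
  then have "(\<Sum>v\<in>words M n. e2ennreal (F v) * ennreal (?p v)) \<noteq> \<infinity>"
    by (auto simp: ennreal_mult_eq_top_iff)
  then obtain a where a: "(\<Sum>v\<in>words M n. e2ennreal (F v) * ennreal (?p v)) = ennreal a" "a \<ge> 0"
    by (cases "(\<Sum>v\<in>words M n. e2ennreal (F v) * ennreal (?p v))") auto
  have "e2ennreal (- F w) * ennreal (?p w) = \<infinity>"
    using w by (simp add: ennreal_mult_eq_top_iff)
  then have inf: "(\<Sum>v\<in>words M n. e2ennreal (- F v) * ennreal (?p v)) = \<infinity>"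
    using w(1) member_le_sum[of w "words M n" "\<lambda>v. e2ennreal (- F v) * ennreal (?p v)"]
    by (simp add: top_unique)
  then show ?thesis
    unfolding extended_integral_def nn_integral_wordof[of "\<lambda>w. e2ennreal (F w)"]
      nn_integral_wordof[of "\<lambda>w. e2ennreal (- F w)"] a(1) inf
    using a(2) by simp
qed

definition word_mean :: "nat \<Rightarrow> (nat list \<Rightarrow> real) \<Rightarrow> real" where
  "word_mean n f = (\<Sum>w\<in>words M n. law \<nu> (wordof n) w * f w)"

lemma word_mean_add: "word_mean n (\<lambda>w. f w + g w) = word_mean n f + word_mean n g"
  by (simp add: word_mean_def distrib_left sum.distrib)

lemma word_mean_cmult: "word_mean n (\<lambda>w. c * f w) = c * word_mean n f"
  by (simp add: word_mean_def sum_distrib_left mult.left_commute)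

lemma word_mean_const: "word_mean n (\<lambda>w. c) = c"
  using sum_law_words[of n] by (simp add: word_mean_def flip: sum_distrib_right)

lemma word_mean_mono:
  assumes "\<And>w. w \<in> words M n \<Longrightarrow> law \<nu> (wordof n) w > 0 \<Longrightarrow> f w \<le> g w"
  shows "word_mean n f \<le> word_mean n g"
  unfolding word_mean_def
proof (rule sum_mono)
  fix w assume w: "w \<in> words M n"
  show "law \<nu> (wordof n) w * f w \<le> law \<nu> (wordof n) w * g w"
    using assms[OF w] law_nonneg[of \<nu> "wordof n" w]
    by (cases "law \<nu> (wordof n) w = 0") (auto intro!: mult_left_mono simp: less_le)
qed

lemma word_mean_take_drop:
  "word_mean (m + n) (\<lambda>w. f (take m w)) = word_mean m f"
  "word_mean (m + n) (\<lambda>w. g (drop m w)) = word_mean n g"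
proof -
  have general: "word_mean k h = (\<Sum>w\<in>wordof k ` space \<nu>. law \<nu> (wordof k) w * h w)" for k h
    unfolding word_mean_def by (rule sum_law_superset[symmetric, OF _ wordof_image]) simp
  have "(\<lambda>x. take m (wordof (m + n) x)) = wordof m"
    by (simp add: wordof_def[abs_def] take_map)
  then show "word_mean (m + n) (\<lambda>w. f (take m w)) = word_mean m f"
    unfolding general using sum_law_comp[OF simple_function_wordof[of "m + n"], of f "take m"]
    by (simp only:)
  have drop: "(\<lambda>x. drop m (wordof (m + n) x)) = (\<lambda>x. wordof n ((shift ^^ m) x))"
    by (auto simp: wordof_def funpow_shift fun_eq_iff list_eq_iff_nth_eq add.commute)
  have "(\<Sum>w\<in>wordof (m + n) ` space \<nu>. law \<nu> (wordof (m + n)) w * g (drop m w))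
      = (\<Sum>w\<in>(\<lambda>x. wordof n ((shift ^^ m) x)) ` space \<nu>. law \<nu> (\<lambda>x. wordof n ((shift ^^ m) x)) w * g w)"
    using sum_law_comp[OF simple_function_wordof[of "m + n"], of g "drop m"] by (simp only: drop)
  also have "\<dots> = (\<Sum>w\<in>words M n. law \<nu> (\<lambda>x. wordof n ((shift ^^ m) x)) w * g w)"
    by (rule sum_law_superset) (auto intro: wordof_in_words funpow_T_space)
  also have "\<dots> = word_mean n g"
    by (simp add: word_mean_def law_funpow_T[OF simple_function_wordof])
  finally show "word_mean (m + n) (\<lambda>w. g (drop m w)) = word_mean n g"
    unfolding general[of "m + n"] .
qed

lemma word_mean_sum_list:
  "word_mean n (\<lambda>w. sum_list (map \<phi> w)) = n * word_mean 1 (\<lambda>w. \<phi> (hd w))"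
proof (induction n)
  case 0
  then show ?case by (simp add: word_mean_def)
next
  case (Suc n)
  have "word_mean (1 + n) (\<lambda>w. sum_list (map \<phi> w))
      = word_mean (1 + n) (\<lambda>w. \<phi> (hd (take 1 w)) + sum_list (map \<phi> (drop 1 w)))"
    unfolding word_mean_def by (intro sum.cong refl) (auto simp: words_def length_Suc_conv)
  also have "\<dots> = word_mean 1 (\<lambda>w. \<phi> (hd w)) + word_mean n (\<lambda>w. sum_list (map \<phi> w))"
    using word_mean_take_drop(1)[of 1 n "\<lambda>w. \<phi> (hd w)"]
      word_mean_take_drop(2)[of 1 n "\<lambda>w. sum_list (map \<phi> w)"]
    by (simp add: word_mean_add del: One_nat_def)
  finally show ?case
    using Suc by (simp add: algebra_simps)
qed

lemma extended_integral_elog: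
  assumes "\<And>w. w \<in> words M n \<Longrightarrow> law \<nu> (wordof n) w > 0 \<Longrightarrow> G w \<noteq> 0"
  shows "extended_integral \<nu> (\<lambda>x. elog (G (wordof n x))) = ereal (word_mean n (\<lambda>w. ln (G w)))"
  unfolding word_mean_def
  by (rule extended_integral_wordof_finite) (use assms in \<open>auto simp: elog_def\<close>)

lemma extended_integral_elog_minfty:
  assumes "w \<in> words M n" "law \<nu> (wordof n) w > 0" "G w = 0"
  shows "extended_integral \<nu> (\<lambda>x. elog (G (wordof n x))) = - \<infinity>"
  by (rule extended_integral_wordof_minfty[OF _ assms(1,2)]) (use assms(3) in \<open>auto simp: elog_def\<close>)

lemma positive_extension:
  assumes "w \<in> words M m" "law \<nu> (wordof m) w > 0"
  obtains v where "v \<in> words M n" "law \<nu> (wordof (m + n)) (w @ v) > 0"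
proof -
  have "law \<nu> (wordof m) w = law \<nu> (\<lambda>x. take m (wordof (m + n) x)) w"
    by (simp add: wordof_def[abs_def] take_map)
  also have "\<dots> = (\<Sum>b\<in>{b \<in> wordof (m + n) ` space \<nu>. take m b = w}. law \<nu> (wordof (m + n)) b)"
    by (rule law_comp[OF simple_function_wordof])
  finally have "\<exists>b\<in>{b \<in> wordof (m + n) ` space \<nu>. take m b = w}. law \<nu> (wordof (m + n)) b \<noteq> 0"
    using assms(2) by (metis (no_types, lifting) less_irrefl sum.neutral)
  then obtain b where b: "b \<in> words M (m + n)" "take m b = w" "law \<nu> (wordof (m + n)) b \<noteq> 0"
    using wordof_image by blast
  have "b = w @ drop m b"
    using b(2) by (metis append_take_drop_id)
  moreover have "drop m b \<in> words M n"
    using b(1) by (auto simp: words_def dest: in_set_dropD)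
  moreover have "law \<nu> (wordof (m + n)) b > 0"
    using b(3) law_nonneg[of \<nu> "wordof (m + n)" b] by linarith
  ultimately show ?thesis
    using that by metis
qed

lemma scaled_minfty_tendsto:
  fixes E :: "nat \<Rightarrow> ereal"
  assumes "\<And>n. n \<ge> n0 \<Longrightarrow> E n = - \<infinity>"
  shows "(\<lambda>n. ereal (1 / n) * E n) \<longlonglongrightarrow> - \<infinity>"
proof (rule tendsto_eventually)
  show "eventually (\<lambda>n. ereal (1 / n) * E n = - \<infinity>) sequentially"
    using eventually_ge_at_top[of "max 1 n0"]
    by eventually_elim (use assms in auto)
qed

text \<open>If no word of positive mass is annihilated by \<open>G\<close>, the means of \<open>ln (G w)\<close> are finite and
  subadditive in the length, and Fekete's lemma applies. Otherwise all longer means are \<open>- \<infinity>\<close>,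
  because every word of positive mass extends to longer ones.\<close>

lemma submultiplicative_exponent:
  fixes G :: "nat list \<Rightarrow> real"
  assumes nonneg: "\<And>w. 0 \<le> G w" and sub: "\<And>u v. G (u @ v) \<le> G u * G v"
  defines "E \<equiv> \<lambda>n. extended_integral \<nu> (\<lambda>x. elog (G (wordof n x)))"
  obtains L where "(\<lambda>n. ereal (1 / n) * E n) \<longlonglongrightarrow> L" "\<And>n. n > 0 \<Longrightarrow> L \<le> ereal (1 / n) * E n"
proof (cases "\<exists>n w. w \<in> words M n \<and> law \<nu> (wordof n) w > 0 \<and> G w = 0")
  case True
  then obtain m w where w: "w \<in> words M m" "law \<nu> (wordof m) w > 0" "G w = 0"
    by blast
  have "E n = - \<infinity>" if n: "n \<ge> m" for n
  proof -
    obtain v where v: "v \<in> words M (n - m)" "law \<nu> (wordof (m + (n - m))) (w @ v) > 0"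
      using positive_extension[OF w(1,2)] by blast
    have "G (w @ v) = 0"
      using sub[of w v] nonneg[of "w @ v"] w(3) by simp
    moreover have "w @ v \<in> words M n"
      using w(1) v(1) n by (auto simp: words_def)
    ultimately show ?thesis
      unfolding E_def using v(2) n by (intro extended_integral_elog_minfty) auto
  qed
  then have "(\<lambda>n. ereal (1 / n) * E n) \<longlonglongrightarrow> - \<infinity>"
    by (rule scaled_minfty_tendsto)
  then show ?thesis
    using that by force
next
  case False
  define u where "u n = word_mean n (\<lambda>w. ln (G w))" for n
  have E: "E n = ereal (u n)" for n
    unfolding E_def u_def using False by (intro extended_integral_elog) blast
  have pos: "G w > 0" if "w \<in> words M n" "law \<nu> (wordof n) w > 0" for w n
    using False nonneg[of w] that by (metis less_eq_real_def)
  have "u (m + n) \<le> u m + u n" for m n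
  proof -
    have "u (m + n) \<le> word_mean (m + n) (\<lambda>w. ln (G (take m w)) + ln (G (drop m w)))"
      unfolding u_def
    proof (rule word_mean_mono)
      fix w assume w: "w \<in> words M (m + n)" "law \<nu> (wordof (m + n)) w > 0"
      have le: "G w \<le> G (take m w) * G (drop m w)"
        using sub[of "take m w" "drop m w"] by simp
      with pos[OF w] have "G (take m w) * G (drop m w) > 0" by simp
      then have "G (take m w) > 0" "G (drop m w) > 0"
        using nonneg[of "take m w"] nonneg[of "drop m w"] by (auto simp: zero_less_mult_iff)
      moreover have "ln (G w) \<le> ln (G (take m w) * G (drop m w))"
        using le pos[OF w] by simp
      ultimately show "ln (G w) \<le> ln (G (take m w)) + ln (G (drop m w))"
        by (simp add: ln_mult_pos)
    qed
    also have "\<dots> = u m + u n"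
      by (simp add: word_mean_add u_def word_mean_take_drop(1)[where f = "\<lambda>w. ln (G w)"]
          word_mean_take_drop(2)[where g = "\<lambda>w. ln (G w)"])
    finally show ?thesis .
  qed
  note lim = Fekete_convergence[of u, OF this]
  show ?thesis
  proof (rule that)
    show "(\<lambda>n. ereal (1 / n) * E n) \<longlonglongrightarrow> (INF n\<in>{0<..}. ereal (u n / n))"
      using lim by (simp add: E)
    fix n :: nat assume "n > 0"
    then have "(INF n\<in>{0<..}. ereal (u n / n)) \<le> ereal (u n / n)"
      by (intro INF_lower) simp
    then show "(INF n\<in>{0<..}. ereal (u n / n)) \<le> ereal (1 / n) * E n"
      by (simp add: E)
  qed
qed

text \<open>The same dichotomy for the reversed inequality, with the opposite sign in Fekete's lemma. The
  least singular value is supermultiplicative, and its exponent need not be bounded below.\<close>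

lemma supermultiplicative_exponent_converges:
  fixes G :: "nat list \<Rightarrow> real"
  assumes nonneg: "\<And>w. 0 \<le> G w" and super: "\<And>u v. G u * G v \<le> G (u @ v)"
    and zero: "\<And>u v. G u = 0 \<Longrightarrow> G (u @ v) = 0"
      "\<And>u v. G v = 0 \<Longrightarrow> G (u @ v) = 0"
  defines "E \<equiv> \<lambda>n. extended_integral \<nu> (\<lambda>x. elog (G (wordof n x)))"
  obtains L where "(\<lambda>n. ereal (1 / n) * E n) \<longlonglongrightarrow> L"
proof (cases "\<exists>n w. w \<in> words M n \<and> law \<nu> (wordof n) w > 0 \<and> G w = 0")
  case True
  then obtain m w where w: "w \<in> words M m" "law \<nu> (wordof m) w > 0" "G w = 0"
    by blast
  have "E n = - \<infinity>" if n: "n \<ge> m" for n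
  proof -
    obtain v where v: "v \<in> words M (n - m)" "law \<nu> (wordof (m + (n - m))) (w @ v) > 0"
      using positive_extension[OF w(1,2)] by blast
    have "G (w @ v) = 0"
      using zero(1)[OF w(3)] .
    moreover have "w @ v \<in> words M n"
      using w(1) v(1) n by (auto simp: words_def)
    ultimately show ?thesis
      unfolding E_def using v(2) n by (intro extended_integral_elog_minfty) auto
  qed
  then have "(\<lambda>n. ereal (1 / n) * E n) \<longlonglongrightarrow> - \<infinity>"
    by (rule scaled_minfty_tendsto)
  then show ?thesis
    using that by blast
next
  case False
  define u where "u n = - word_mean n (\<lambda>w. ln (G w))" for n
  have E: "E n = - ereal (u n)" for n
    unfolding E_def u_def using False by (subst extended_integral_elog) auto
  have pos: "G w > 0" if "w \<in> words M n" "law \<nu> (wordof n) w > 0" for w n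
    using False nonneg[of w] that by (metis less_eq_real_def)
  have "u (m + n) \<le> u m + u n" for m n
  proof -
    have "word_mean (m + n) (\<lambda>w. ln (G (take m w)) + ln (G (drop m w))) \<le> - u (m + n)"
      unfolding u_def minus_minus
    proof (rule word_mean_mono)
      fix w assume w: "w \<in> words M (m + n)" "law \<nu> (wordof (m + n)) w > 0"
      have "G (take m w) \<noteq> 0" "G (drop m w) \<noteq> 0"
        using zero[of "take m w" "drop m w"] zero[of "drop m w" "take m w"] pos[OF w] by auto
      then have p: "G (take m w) > 0" "G (drop m w) > 0"
        using nonneg[of "take m w"] nonneg[of "drop m w"] by linarith+
      have "G (take m w) * G (drop m w) \<le> G w"
        using super[of "take m w" "drop m w"] by simp
      then have "ln (G (take m w) * G (drop m w)) \<le> ln (G w)"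
        using p pos[OF w] by simp
      then show "ln (G (take m w)) + ln (G (drop m w)) \<le> ln (G w)"
        using p by (simp add: ln_mult_pos)
    qed
    then show ?thesis
      by (simp add: word_mean_add u_def word_mean_take_drop(1)[where f = "\<lambda>w. ln (G w)"]
          word_mean_take_drop(2)[where g = "\<lambda>w. ln (G w)"])
  qed
  note lim = Fekete_convergence[of u, OF this]
  have "(\<lambda>n. ereal (1 / n) * E n) = (\<lambda>n. - ereal (u n / n))"
    by (auto simp: E)
  then have "(\<lambda>n. ereal (1 / n) * E n) \<longlonglongrightarrow> - (INF n\<in>{0<..}. ereal (u n / n))"
    using tendsto_uminus_ereal[OF lim] by simp
  then show ?thesis by (rule that)
qed

context
  fixes A :: "nat \<Rightarrow> real^'n^'n"
begin

abbreviation log_norm_integral :: "nat \<Rightarrow> ereal" where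
  "log_norm_integral n \<equiv> extended_integral \<nu> (\<lambda>x. elog (mnorm (mprod A (wordof n x))))"

lemma cocycle_wordof: "cocycle A n x = mprod A (wordof n x)"
  by (simp add: cocycle_eq_mprod wordof_def)

lemma top_lyapunov_limit:
  "(\<lambda>n. ereal (1 / n) * log_norm_integral n) \<longlonglongrightarrow> top_lyapunov A \<nu>"
  "n > 0 \<Longrightarrow> top_lyapunov A \<nu> \<le> ereal (1 / n) * log_norm_integral n"
proof -
  have sub: "mnorm (mprod A (u @ v)) \<le> mnorm (mprod A u) * mnorm (mprod A v)" for u v
    using mnorm_mult[of "mprod A v" "mprod A u"] by (simp add: mprod_append mult.commute)
  obtain L where L: "(\<lambda>n. ereal (1 / n) * log_norm_integral n) \<longlonglongrightarrow> L"
      "\<And>n. n > 0 \<Longrightarrow> L \<le> ereal (1 / n) * log_norm_integral n"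
    using submultiplicative_exponent[of "\<lambda>w. mnorm (mprod A w)", OF mnorm_nonneg sub] by blast
  have "top_lyapunov A \<nu> = L"
    unfolding top_lyapunov_def cocycle_wordof by (rule limI[OF L(1)])
  then show "(\<lambda>n. ereal (1 / n) * log_norm_integral n) \<longlonglongrightarrow> top_lyapunov A \<nu>"
    "n > 0 \<Longrightarrow> top_lyapunov A \<nu> \<le> ereal (1 / n) * log_norm_integral n"
    using L by auto
qed

lemma metric_entropy_bounds: "0 \<le> metric_entropy \<nu> shift" "metric_entropy \<nu> shift \<le> ereal (ln M)"
proof -
  have "ereal 0 \<le> metric_entropy \<nu> shift"
    by (rule block_entropy_growth_le_metric_entropy[where c = 0]) (simp add: rv_entropy_nonneg)
  then show "0 \<le> metric_entropy \<nu> shift" by (simp add: zero_ereal_def)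
  have "block_entropy 1 \<le> ln (card (words M 1))"
    by (rule rv_entropy_le_ln_card[OF simple_function_wordof _ wordof_image]) simp
  then have "block_entropy 1 \<le> ln M" by (simp add: card_words)
  then show "metric_entropy \<nu> shift \<le> ereal (ln M)"
    using metric_entropy_le_block_entropy[of 1] by (simp add: order_trans)
qed

lemma free_energy_less_top:
  assumes "s > 0"
  shows "free_energy A s \<nu> \<le> ereal (ln M + s * ln (Max (insert 1 (mnorm ` A ` {1..M}))))"
proof -
  define K where "K = Max (insert 1 (mnorm ` A ` {1..M}))"
  have K: "K \<ge> 1" "\<And>i. i \<in> {1..M} \<Longrightarrow> mnorm (A i) \<le> K"
    unfolding K_def by (rule Max_ge, simp, simp)+
  have "log_norm_integral 1 \<le> ereal (ln K)"
  proof (cases "\<exists>w\<in>words M 1. law \<nu> (wordof 1) w > 0 \<and> mnorm (mprod A w) = 0")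
    case True
    then show ?thesis
      using extended_integral_elog_minfty[of _ 1 "\<lambda>w. mnorm (mprod A w)"] by auto
  next
    case False
    then have "log_norm_integral 1 = ereal (word_mean 1 (\<lambda>w. ln (mnorm (mprod A w))))"
      by (intro extended_integral_elog) auto
    also have "word_mean 1 (\<lambda>w. ln (mnorm (mprod A w))) \<le> word_mean 1 (\<lambda>w. ln K)"
    proof (rule word_mean_mono)
      fix w assume w: "w \<in> words M 1" "law \<nu> (wordof 1) w > 0"
      have "mnorm (mprod A w) \<noteq> 0" using False w by auto
      then have "mnorm (mprod A w) > 0" using mnorm_nonneg[of "mprod A w"] by linarith
      moreover have "mnorm (mprod A w) \<le> K"
        using w(1) K(2) by (auto simp: words_1[unfolded One_nat_def])
      ultimately show "ln (mnorm (mprod A w)) \<le> ln K" by simp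
    qed
    finally show ?thesis by (simp add: word_mean_const)
  qed
  then have "top_lyapunov A \<nu> \<le> ereal (ln K)"
    using top_lyapunov_limit(2)[of 1] by simp
  then have "ereal s * top_lyapunov A \<nu> \<le> ereal s * ereal (ln K)"
    using assms by (intro ereal_mult_left_mono) auto
  then show ?thesis
    unfolding free_energy_def K_def[symmetric] plus_ereal.simps(1)[symmetric]
      times_ereal.simps(1)[symmetric]
    by (intro add_mono metric_entropy_bounds)
qed

text \<open>Entropy and top exponent are infima of their values at finite length, by subadditivity. So the
  free energy is bounded by the corresponding expression for words of any length \<open>n\<close>, without
  an error term. A word with vanishing product would make the exponent \<open>- \<infinity>\<close>.\<close>

lemma finite_free_energy_bounds:
  assumes fe: "free_energy A s \<nu> = ereal P" and s: "s > 0"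
  shows "w \<in> words M n \<Longrightarrow> law \<nu> (wordof n) w > 0 \<Longrightarrow> mprod A w \<noteq> 0"
    and "n * P \<le> block_entropy n + s * word_mean n (\<lambda>w. ln (mnorm (mprod A w)))"
    and "\<bar>top_lyapunov A \<nu>\<bar> \<noteq> \<infinity>"
proof -
  obtain h where h: "metric_entropy \<nu> shift = ereal h"
    using metric_entropy_bounds by (cases "metric_entropy \<nu> shift") auto
  show fin: "\<bar>top_lyapunov A \<nu>\<bar> \<noteq> \<infinity>"
    using fe s unfolding free_energy_def h by (cases "top_lyapunov A \<nu>") auto
  then obtain l where l: "top_lyapunov A \<nu> = ereal l"
    by auto
  have P: "P = h + s * l"
    using fe unfolding free_energy_def h l by simp
  have nz: "mprod A w \<noteq> 0" if w: "w \<in> words M n" "law \<nu> (wordof n) w > 0" for w n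
  proof
    assume 0: "mprod A w = 0"
    show False
    proof (cases "n = 0")
      case True
      then have "mnorm (mprod A w) = 1"
        using w(1) mnorm_mat_1[where 'n = 'n] by (simp del: onorm_eq_0)
      then show False using 0 mnorm_eq_0_iff[of "mprod A w"] by simp
    next
      case False
      have "mnorm (mprod A w) = 0"
        using 0 mnorm_eq_0_iff by blast
      then have "log_norm_integral n = - \<infinity>"
        by (rule extended_integral_elog_minfty[OF w])
      then have "top_lyapunov A \<nu> \<le> - \<infinity>"
        using top_lyapunov_limit(2)[of n] False by simp
      then show False using l by simp
    qed
  qed
  then show "w \<in> words M n \<Longrightarrow> law \<nu> (wordof n) w > 0 \<Longrightarrow> mprod A w \<noteq> 0" .
  show "n * P \<le> block_entropy n + s * word_mean n (\<lambda>w. ln (mnorm (mprod A w)))"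
  proof (cases "n = 0")
    case True
    have "ln (mnorm (mat 1 :: real^'n^'n)) = 0"
      by (subst mnorm_mat_1) simp
    then have "word_mean 0 (\<lambda>w. ln (mnorm (mprod A w))) = 0"
      by (simp add: word_mean_def)
    then show ?thesis
      using True rv_entropy_nonneg[of "wordof 0"] by simp
  next
    case False
    have "log_norm_integral n = ereal (word_mean n (\<lambda>w. ln (mnorm (mprod A w))))"
      using nz mnorm_eq_0_iff by (intro extended_integral_elog) blast
    then have "l \<le> 1 / n * word_mean n (\<lambda>w. ln (mnorm (mprod A w)))"
      using top_lyapunov_limit(2)[of n] False l by simp
    then have "n * (s * l) \<le> s * word_mean n (\<lambda>w. ln (mnorm (mprod A w)))"
      using False s by (simp add: field_simps)
    moreover have "h \<le> block_entropy n / n"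
      using metric_entropy_le_block_entropy[of n] h False by simp
    then have "n * h \<le> block_entropy n"
      using False by (simp add: field_simps)
    ultimately show ?thesis
      unfolding P by (simp add: distrib_left)
  qed
qed

text \<open>Conversely, linear growth of the finite expressions up to constants suffices for a lower bound.\<close>

lemma free_energy_ge:
  assumes s: "s > 0" and h: "\<And>n. h * n - c \<le> block_entropy n"
    and nz: "\<And>w n. w \<in> words M n \<Longrightarrow> law \<nu> (wordof n) w > 0 \<Longrightarrow> mprod A w \<noteq> 0"
    and l: "\<And>n. l * n - c' \<le> word_mean n (\<lambda>w. ln (mnorm (mprod A w)))"
  shows "ereal (h + s * l) \<le> free_energy A s \<nu>"
proof -
  have E: "log_norm_integral n = ereal (word_mean n (\<lambda>w. ln (mnorm (mprod A w))))" for n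
    using nz mnorm_eq_0_iff by (intro extended_integral_elog) blast
  have le: "ereal (l - c' / n) \<le> ereal (1 / n) * log_norm_integral n" if n: "n > 0" for n :: nat
  proof -
    have "l - c' / n = (l * n - c') / n" using n by (simp add: field_simps)
    also have "\<dots> \<le> word_mean n (\<lambda>w. ln (mnorm (mprod A w))) / n"
      by (rule divide_right_mono[OF l]) simp
    finally show ?thesis by (simp add: E)
  qed
  have "(\<lambda>n. l - c' / real n) \<longlonglongrightarrow> l - 0"
    by (intro tendsto_diff tendsto_const lim_const_over_n)
  then have lim: "(\<lambda>n. ereal (l - c' / real n)) \<longlonglongrightarrow> ereal l"
    by simp
  have "ereal l \<le> top_lyapunov A \<nu>"
    by (rule tendsto_le[OF sequentially_bot top_lyapunov_limit(1) lim])
      (rule eventually_mono[OF eventually_gt_at_top[of 0]], rule le)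
  then have "ereal s * ereal l \<le> ereal s * top_lyapunov A \<nu>"
    using s by (intro ereal_mult_left_mono) auto
  then show ?thesis
    unfolding free_energy_def plus_ereal.simps(1)[symmetric] times_ereal.simps(1)[symmetric]
    by (intro add_mono block_entropy_growth_le_metric_entropy[OF h])
qed

end

end

section \<open>Invariant measures from independent blocks\<close>

lemma average_measure:
  fixes \<eta> :: "nat \<Rightarrow> 'a measure"
  assumes L: "L > 0" and prob: "\<And>j. prob_space (\<eta> j)" and sets: "\<And>j. sets (\<eta> j) = sets S"
  obtains \<nu> where "prob_space \<nu>" "sets \<nu> = sets S"
    "\<And>E. E \<in> sets S \<Longrightarrow> measure \<nu> E = (\<Sum>j<L. measure (\<eta> j) E) / L"
proof -
  let ?J = "measure_pmf (pmf_of_set {..<L})"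
  define \<nu> where "\<nu> = ?J \<bind> \<eta>"
  have ne: "{..<L} \<noteq> {}" using L by (auto simp: lessThan_empty_iff)
  have sub: "\<eta> \<in> measurable ?J (subprob_algebra S)"
  proof -
    have "\<eta> j \<in> space (subprob_algebra S)" for j
      using prob[of j] sets[of j] by (auto simp: space_subprob_algebra intro: prob_space_imp_subprob_space)
    then show ?thesis by simp
  qed
  have sets_\<nu>: "sets \<nu> = sets S"
    unfolding \<nu>_def by (rule sets_bind) (use sets in auto)
  have prob_\<nu>: "prob_space \<nu>"
    unfolding \<nu>_def
    by (rule measure_pmf.prob_space_bind[OF _ sub]) (use prob in auto)
  interpret \<nu>: prob_space \<nu> by (rule prob_\<nu>)
  have "measure \<nu> E = (\<Sum>j<L. measure (\<eta> j) E) / L" if E: "E \<in> sets S" for E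
  proof -
    have "emeasure \<nu> E = (\<integral>\<^sup>+ j. emeasure (\<eta> j) E \<partial>?J)"
      unfolding \<nu>_def by (rule emeasure_bind[OF _ sub E]) simp
    also have "\<dots> = (\<Sum>j<L. emeasure (\<eta> j) E) / L"
      using ne by (simp add: nn_integral_pmf_of_set)
    also have "\<dots> = (\<Sum>j<L. ennreal (measure (\<eta> j) E)) / ennreal L"
      using finite_measure.emeasure_eq_measure[OF prob_space.finite_measure[OF prob]]
      by (simp add: ennreal_of_nat_eq_real_of_nat)
    also have "\<dots> = ennreal ((\<Sum>j<L. measure (\<eta> j) E) / L)"
      using L by (simp add: sum_ennreal divide_ennreal sum_nonneg)
    finally show ?thesis
      by (simp add: \<nu>.emeasure_eq_measure sum_nonneg)
  qed
  then show ?thesis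
    using that prob_\<nu> sets_\<nu> by blast
qed

lemma law_PiM_map:
  assumes N: "prob_space N" and w: "\<And>b. b \<in> set w \<Longrightarrow> {b} \<in> sets N"
  shows "law (PiM UNIV (\<lambda>_::nat. N)) (\<lambda>x. map x [a..<a + length w]) w
    = prod_list (map (\<lambda>b. measure N {b}) w)"
proof -
  interpret N: prob_space N by fact
  interpret product_prob_space "\<lambda>_::nat. N" UNIV by unfold_locales
  let ?P = "PiM UNIV (\<lambda>_::nat. N)" and ?J = "{a..<a + length w}"
  have eq: "(\<lambda>x. map x [a..<a + length w]) -` {w} \<inter> space ?P
      = {x \<in> space ?P. \<forall>i\<in>?J. x i \<in> {w ! (i - a)}}"
  proof -
    have "map x [a..<a + length w] = w \<longleftrightarrow> (\<forall>i\<in>?J. x i = w ! (i - a))" for x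
    proof
      assume "map x [a..<a + length w] = w"
      then show "\<forall>i\<in>?J. x i = w ! (i - a)"
        by (metis (no_types, lifting) add_diff_inverse_nat atLeastLessThan_iff length_map length_upt
            linorder_not_less nat_add_left_cancel_less nth_map nth_upt)
    qed (auto intro!: nth_equalityI)
    then show ?thesis by auto
  qed
  have "emeasure ?P ((\<lambda>x. map x [a..<a + length w]) -` {w} \<inter> space ?P)
      = (\<Prod>i\<in>?J. emeasure N {w ! (i - a)})"
    unfolding eq by (rule emeasure_PiM_Collect) (auto intro!: w)
  also have "\<dots> = (\<Prod>i\<in>?J. ennreal (measure N {w ! (i - a)}))"
    by (simp add: N.emeasure_eq_measure)
  also have "\<dots> = ennreal (\<Prod>i\<in>?J. measure N {w ! (i - a)})"
    by (simp add: prod_ennreal)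
  finally have "law ?P (\<lambda>x. map x [a..<a + length w]) w = (\<Prod>i\<in>?J. measure N {w ! (i - a)})"
    by (simp add: law_def P.emeasure_eq_measure prod_nonneg)
  also have "\<dots> = (\<Prod>k<length w. measure N {w ! k})"
    by (rule prod.reindex_bij_witness[where i = "\<lambda>k. k + a" and j = "\<lambda>i. i - a"]) auto
  also have "\<dots> = prod_list (map (\<lambda>b. measure N {b}) w)"
    by (simp add: prod.list_conv_set_nth atLeast0LessThan)
  finally show ?thesis .
qed

lemma concat_equal_lengths_nth:
  assumes "\<And>b. b \<in> set bs \<Longrightarrow> length b = L" "i < length bs * L"
  shows "concat bs ! i = bs ! (i div L) ! (i mod L)"
  using assms
proof (induction bs arbitrary: i)
  case (Cons b bs)
  have b: "length b = L" using Cons.prems by simp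
  show ?case
  proof (cases "i < L")
    case True
    then show ?thesis using b by (simp add: nth_append)
  next
    case False
    moreover have "L > 0" using Cons.prems(2) by (cases "L = 0") auto
    ultimately have "i div L = Suc ((i - L) div L)" "i mod L = (i - L) mod L"
      by (auto simp: le_div_geq le_mod_geq)
    then show ?thesis
      using False b Cons by (simp add: nth_append)
  qed
qed simp

lemma length_concat_equal_lengths:
  "(\<And>b. b \<in> set bs \<Longrightarrow> length b = L) \<Longrightarrow> length (concat bs) = length bs * L"
  by (induction bs) auto

lemma sum_law_const:
  assumes "prob_space N" "simple_function N X"
  shows "(\<Sum>b\<in>X ` space N. law N X b * c) = c"
proof -
  interpret prob_space N by fact
  have "(\<Sum>b\<in>X ` space N. law N X b) = 1"
    using assms(2) by (intro sum_law) (auto simp: simple_function_def)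
  then show ?thesis by (simp flip: sum_distrib_right)
qed

text \<open>The measure realising the bound concatenates independent words with law \<open>q\<close> and starts
  reading at a uniformly random position of the first one, which makes it shift invariant. Its
  words of length \<open>n\<close> determine about \<open>n / L\<close> complete blocks.\<close>

lemma block_measure_free_energy:
  fixes A :: "nat \<Rightarrow> real^'n^'n" and q g :: "nat list \<Rightarrow> real"
  assumes s: "s > 0" and L: "L > 0" and W: "finite W" "W \<subseteq> words M L"
    and q: "\<And>b. b \<in> W \<Longrightarrow> q b > 0" "sum q W = 1"
    and g: "\<And>b. b \<in> W \<Longrightarrow> g b > 0" and c0: "c0 > 0"
    and norms: "\<And>bs. set bs \<subseteq> W \<Longrightarrow> c0 * prod_list (map g bs) \<le> mnorm (mprod A (concat bs))"
  shows "\<exists>\<nu>\<in>invariant_measures M.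
    ereal ((\<Sum>b\<in>W. q b * (s * ln (g b) - ln (q b))) / L) \<le> free_energy A s \<nu>"
proof -
  define N where "N = point_measure W q"
  have "(\<Sum>b\<in>W. ennreal (q b)) = 1"
    using q by (subst sum_ennreal) (auto intro: less_imp_le)
  then have "prob_space N"
    unfolding N_def by (intro prob_space_point_measure W(1)) (auto intro: less_imp_le q)
  interpret N: prob_space N by fact
  have space_N: "space N = W" and sets_N: "sets N = Pow W"
    by (auto simp: N_def space_point_measure sets_point_measure)
  have measure_N: "measure N {b} = q b" if "b \<in> W" for b
    using that W(1) q(1) unfolding N_def
    by (subst measure_point_measure_finite_if) (auto intro: less_imp_le)
  define B where "B = PiM UNIV (\<lambda>_::nat. N)"
  interpret product_prob_space "\<lambda>_::nat. N" UNIV by unfold_locales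
  interpret B: prob_space B unfolding B_def by (rule P.prob_space_axioms)
  have space_B: "x \<in> space B \<longleftrightarrow> (\<forall>k. x k \<in> W)" for x
    by (auto simp: B_def space_PiM space_N)
  have len: "length b = L" "set b \<subseteq> {1..M}" if "b \<in> W" for b
    using that W(2) by (auto simp: words_def)
  have coord: "(\<lambda>x. x k) \<in> measurable B (count_space UNIV)" for k
  proof -
    have "(\<lambda>x. x k) \<in> measurable B N"
      unfolding B_def by (rule measurable_component_singleton) simp
    moreover have "(\<lambda>b. b) \<in> measurable N (count_space UNIV)"
      unfolding N_def by simp
    ultimately show ?thesis by (rule measurable_compose)
  qed
  have simple_coord: "simple_function B (\<lambda>x. x k)" for k
    unfolding simple_function_def
  proof (intro conjI ballI)
    show "finite ((\<lambda>x. x k) ` space B)"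
      using W(1) by (rule finite_subset[rotated]) (auto simp: space_B)
    show "(\<lambda>x. x k) -` {b} \<inter> space B \<in> sets B" for b
      by (rule measurable_sets[OF coord]) simp
  qed
  have simple_map: "simple_function B (\<lambda>x. map x [a..<a + r])" for a r
  proof (induction r)
    case (Suc r)
    have "simple_function B (\<lambda>x. (\<lambda>p. fst p @ [snd p]) (map x [a..<a + r], x (a + r)))"
      by (intro simple_function_compose1[of _ _ "\<lambda>p. fst p @ [snd p]"] simple_function_Pair Suc simple_coord)
    then show ?case by simp
  qed simp
  have law_map: "law B (\<lambda>x. map x [a..<a + r]) bs = prod_list (map q bs)"
    if "bs \<in> (\<lambda>x. map x [a..<a + r]) ` space B" for a r bs
  proof -
    have bs: "length bs = r" "set bs \<subseteq> W"
      using that by (auto simp: space_B)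
    have "law B (\<lambda>x. map x [a..<a + length bs]) bs = prod_list (map (\<lambda>b. measure N {b}) bs)"
      unfolding B_def by (rule law_PiM_map[OF \<open>prob_space N\<close>]) (use bs in \<open>auto simp: sets_N\<close>)
    also have "map (\<lambda>b. measure N {b}) bs = map q bs"
      using bs measure_N by auto
    finally show ?thesis using bs by simp
  qed
  have law_coord: "law B (\<lambda>x. x k) b = q b" if "b \<in> W" for k b
  proof -
    have "law B (\<lambda>x. map x [k..<k + length [b]]) [b] = prod_list (map (\<lambda>b. measure N {b}) [b])"
      unfolding B_def by (rule law_PiM_map[OF \<open>prob_space N\<close>]) (use that in \<open>auto simp: sets_N\<close>)
    then show ?thesis
      using that measure_N by (simp add: law_def vimage_def)
  qed
  have mean_coord: "(\<Sum>bs\<in>(\<lambda>x. map x [a..<a + r]) ` space B. law B (\<lambda>x. map x [a..<a + r]) bs * \<phi> (bs ! k))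
      = (\<Sum>b\<in>W. q b * \<phi> b)" if "k < r" for a r k and \<phi> :: "nat list \<Rightarrow> real"
  proof -
    have "(\<Sum>bs\<in>(\<lambda>x. map x [a..<a + r]) ` space B. law B (\<lambda>x. map x [a..<a + r]) bs * \<phi> (bs ! k))
        = (\<Sum>b\<in>(\<lambda>x. x (a + k)) ` space B. law B (\<lambda>x. x (a + k)) b * \<phi> b)"
      using B.sum_law_comp[OF simple_map[of a r], of \<phi> "\<lambda>bs. bs ! k"] that by simp
    also have "\<dots> = (\<Sum>b\<in>W. law B (\<lambda>x. x (a + k)) b * \<phi> b)"
      by (rule sum_law_superset[OF W(1)]) (auto simp: space_B)
    finally show ?thesis by (simp add: law_coord)
  qed
  have mean_sum: "(\<Sum>bs\<in>(\<lambda>x. map x [a..<a + r]) ` space B.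
        law B (\<lambda>x. map x [a..<a + r]) bs * (\<Sum>k<r. \<phi> (bs ! k))) = r * (\<Sum>b\<in>W. q b * \<phi> b)"
    for a r and \<phi> :: "nat list \<Rightarrow> real"
  proof -
    have "(\<Sum>bs\<in>(\<lambda>x. map x [a..<a + r]) ` space B.
          law B (\<lambda>x. map x [a..<a + r]) bs * (\<Sum>k<r. \<phi> (bs ! k)))
        = (\<Sum>k<r. \<Sum>bs\<in>(\<lambda>x. map x [a..<a + r]) ` space B. law B (\<lambda>x. map x [a..<a + r]) bs * \<phi> (bs ! k))"
      by (simp add: sum_distrib_left sum.swap[of _ "{..<r}"])
    also have "\<dots> = (\<Sum>k<r. \<Sum>b\<in>W. q b * \<phi> b)"
      by (intro sum.cong refl mean_coord) auto
    finally show ?thesis by simp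
  qed
  define H where "H = - (\<Sum>b\<in>W. q b * ln (q b))"
  have q_le: "q b \<le> 1" if "b \<in> W" for b
    using member_le_sum[of b W q] that W(1) q by (auto intro: less_imp_le)
  have H: "H \<ge> 0"
    unfolding H_def using q q_le
    by (auto intro!: sum_nonpos simp: mult_nonneg_nonpos less_imp_le)
  have entropy_blocks: "rv_entropy B (\<lambda>x. map x [a..<a + r]) = r * H" for a r
  proof -
    have "rv_entropy B (\<lambda>x. map x [a..<a + r])
        = - (\<Sum>bs\<in>(\<lambda>x. map x [a..<a + r]) ` space B.
            law B (\<lambda>x. map x [a..<a + r]) bs * (\<Sum>k<r. ln (q (bs ! k))))"
      unfolding rv_entropy_def
    proof (intro arg_cong[of _ _ uminus] sum.cong refl)
      fix bs assume bs: "bs \<in> (\<lambda>x. map x [a..<a + r]) ` space B"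
      have bsW: "length bs = r" "\<And>k. k < r \<Longrightarrow> bs ! k \<in> W"
        using bs by (auto simp: space_B)
      have "ln (prod_list (map q bs)) = ln (\<Prod>k<r. q (bs ! k))"
        using bsW by (simp add: prod.list_conv_set_nth atLeast0LessThan)
      also have "\<dots> = (\<Sum>k<r. ln (q (bs ! k)))"
        using bsW q(1) by (intro ln_prod) (auto simp: less_imp_neq[symmetric])
      finally show "law B (\<lambda>x. map x [a..<a + r]) bs * ln (law B (\<lambda>x. map x [a..<a + r]) bs)
          = law B (\<lambda>x. map x [a..<a + r]) bs * (\<Sum>k<r. ln (q (bs ! k)))"
        using law_map[OF bs] by simp
    qed
    then show ?thesis
      using mean_sum[of a r "\<lambda>b. ln (q b)"] by (simp add: H_def)
  qed
  (* the stream of letters read from position j of block 0 *)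
  define \<Psi> where "\<Psi> j x n = x ((n + j) div L) ! ((n + j) mod L)" for j n and x :: "nat \<Rightarrow> nat list"
  have \<Psi>_letter: "\<Psi> j x n \<in> {1..M}" if "x \<in> space B" for j x n
  proof -
    have "x ((n + j) div L) \<in> W" using that by (simp add: space_B)
    moreover have "(n + j) mod L < L" using L by simp
    ultimately show ?thesis
      using len[of "x ((n + j) div L)"] nth_mem unfolding \<Psi>_def by (metis subsetD)
  qed
  have \<Psi>_meas: "\<Psi> j \<in> measurable B (borel_shift M)" for j
  proof -
    have "\<Psi> j \<in> measurable B (PiM UNIV (\<lambda>_. count_space {1..M}))"
    proof (rule measurable_PiM_single')
      fix n
      have "(\<lambda>x. \<Psi> j x n) \<in> measurable B (count_space UNIV)"
        unfolding \<Psi>_def by (rule measurable_compose[OF coord]) simp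
      then have "(\<lambda>x. \<Psi> j x n) -` E \<inter> space B \<in> sets B" for E
        by (rule measurable_sets) simp
      then show "(\<lambda>x. \<Psi> j x n) \<in> measurable B (count_space {1..M})"
        using \<Psi>_letter by (intro measurableI) auto
    qed (use \<Psi>_letter in auto)
    then show ?thesis
      by (simp add: measurable_cong_sets[OF refl sets_borel_shift_eq_PiM])
  qed
  define \<eta> where "\<eta> j = distr B (borel_shift M) (\<Psi> j)" for j
  have prob_\<eta>: "prob_space (\<eta> j)" for j
    unfolding \<eta>_def by (rule B.prob_space_distr[OF \<Psi>_meas])
  have \<eta>_shift: "measure (\<eta> j) (shift -` E \<inter> space (borel_shift M)) = measure (\<eta> (Suc j)) E"
    if E: "E \<in> sets (borel_shift M)" "shift -` E \<inter> space (borel_shift M) \<in> sets (borel_shift M)" for j E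
  proof -
    have "\<Psi> j -` (shift -` E \<inter> space (borel_shift M)) \<inter> space B = \<Psi> (Suc j) -` E \<inter> space B"
    proof -
      have "shift (\<Psi> j x) = \<Psi> (Suc j) x" for x
        by (simp add: shift_def \<Psi>_def fun_eq_iff)
      then show ?thesis
        using measurable_space[OF \<Psi>_meas] by auto
    qed
    then show ?thesis
      unfolding \<eta>_def using E by (simp add: measure_distr[OF \<Psi>_meas])
  qed
  (* moving on by a whole block drops one block, which does not change the law of the blocks *)
  have \<eta>_period: "\<eta> L = \<eta> 0"
  proof -
    let ?\<tau> = "\<lambda>x. \<lambda>k\<in>UNIV. x (Suc k)"
    have d: "distr B B ?\<tau> = B"
      unfolding B_def
      using distr_PiM_reindex[of UNIV "\<lambda>_. N" Suc UNIV] \<open>prob_space N\<close> by simp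
    have \<tau>_meas: "?\<tau> \<in> measurable B B"
      unfolding B_def by (rule measurable_restrict) (rule measurable_component_singleton, simp)
    have "distr B (borel_shift M) (\<Psi> 0 \<circ> ?\<tau>) = distr (distr B B ?\<tau>) (borel_shift M) (\<Psi> 0)"
      by (rule distr_distr[symmetric, OF \<Psi>_meas \<tau>_meas])
    moreover have "\<Psi> 0 \<circ> ?\<tau> = \<Psi> L"
      using L by (auto simp: \<Psi>_def fun_eq_iff)
    ultimately show ?thesis
      unfolding \<eta>_def d by simp
  qed
  have sets_\<eta>: "sets (\<eta> j) = sets (borel_shift M)" for j
    by (simp add: \<eta>_def)
  obtain \<nu> where \<nu>: "prob_space \<nu>" "sets \<nu> = sets (borel_shift M)"
      "\<And>E. E \<in> sets (borel_shift M) \<Longrightarrow> measure \<nu> E = (\<Sum>j<L. measure (\<eta> j) E) / L"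
    using average_measure[where \<eta> = \<eta>, OF L prob_\<eta> sets_\<eta>] by metis
  interpret \<nu>: prob_space \<nu> by (rule \<nu>(1))
  have space_\<nu>: "space \<nu> = space (borel_shift M)"
    by (rule sets_eq_imp_space_eq[OF \<nu>(2)])
  have shift_sets: "shift -` E \<inter> space (borel_shift M) \<in> sets (borel_shift M)"
    if E: "E \<in> sets (borel_shift M)" for E
  proof -
    let ?P = "PiM UNIV (\<lambda>_. count_space {1..M})"
    have "shift \<in> measurable ?P ?P"
      unfolding shift_def by (rule measurable_PiM_single')
        (auto simp: space_PiM intro!: measurable_component_singleton)
    then show ?thesis
      using E sets_eq_imp_space_eq[OF sets_borel_shift_eq_PiM[of M]]
      unfolding sets_borel_shift_eq_PiM by (auto intro: measurable_sets)
  qed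
  have inv: "\<nu> \<in> invariant_measures M"
    unfolding invariant_measures_def
  proof (intro CollectI conjI ballI)
    fix E assume "E \<in> sets \<nu>"
    then have E: "E \<in> sets (borel_shift M)" by (simp add: \<nu>(2))
    have "measure \<nu> (shift -` E \<inter> space \<nu>) = (\<Sum>j<L. measure (\<eta> (Suc j)) E) / L"
      unfolding space_\<nu> using \<nu>(3)[OF shift_sets[OF E]] \<eta>_shift[OF E shift_sets[OF E]] by simp
    also have "(\<Sum>j<L. measure (\<eta> (Suc j)) E) = (\<Sum>j<L. measure (\<eta> j) E)"
      using sum_lessThan_telescope[of "\<lambda>j. measure (\<eta> j) E" L] \<eta>_period
      by (simp add: sum_subtractf)
    also have "\<dots> / L = measure \<nu> E"
      using \<nu>(3)[OF E] by simp
    finally show "emeasure \<nu> (shift -` E \<inter> space \<nu>) = emeasure \<nu> E"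
      by (simp add: \<nu>.emeasure_eq_measure)
  qed (use \<nu> in auto)
  interpret \<nu>: shift_invariant M \<nu>
    by unfold_locales (rule inv)
  define Z where "Z n j x = wordof n (\<Psi> j x)" for n j x
  have law_\<nu>: "law \<nu> (wordof n) w = (\<Sum>j<L. law B (Z n j) w) / L" for n w
  proof -
    have "wordof n -` {w} \<inter> space \<nu> \<in> sets (borel_shift M)"
      using simple_functionD(2)[OF \<nu>.simple_function_wordof] by (simp add: \<nu>(2))
    then have 1: "law \<nu> (wordof n) w = (\<Sum>j<L. measure (\<eta> j) (wordof n -` {w} \<inter> space \<nu>)) / L"
      unfolding law_def by (rule \<nu>(3))
    have 2: "measure (\<eta> j) (wordof n -` {w} \<inter> space \<nu>) = law B (Z n j) w" for j
    proof -
      have "\<Psi> j -` (wordof n -` {w} \<inter> space \<nu>) \<inter> space B = Z n j -` {w} \<inter> space B"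
        using measurable_space[OF \<Psi>_meas] by (auto simp: Z_def space_\<nu>)
      then show ?thesis
        unfolding \<eta>_def law_def using \<open>wordof n -` {w} \<inter> space \<nu> \<in> sets (borel_shift M)\<close>
        by (simp add: measure_distr[OF \<Psi>_meas])
    qed
    show ?thesis
      using 1 by (simp only: 2)
  qed
  have Z_words: "Z n j x \<in> words M n" if "x \<in> space B" for n j x
    using \<Psi>_letter[OF that] by (auto simp: Z_def wordof_def words_def)
  (* so many blocks cover n letters from any starting position in the first block *)
  define R where "R n = n div L + 2" for n
  have Z_concat: "Z n j x = take n (drop j (concat (map x [0..<R n])))"
    and Z_fits: "j + n \<le> length (concat (map x [0..<R n]))"
    if x: "x \<in> space B" and j: "j < L" for n j x
  proof -
    let ?bs = "map x [0..<R n]"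
    have lens: "length b = L" if "b \<in> set ?bs" for b
      using that x len(1) by (auto simp: space_B)
    have lenc: "length (concat ?bs) = (R n) * L"
      using length_concat_equal_lengths[of ?bs L, OF lens] by simp
    have "n < (n div L + 1) * L"
      using dividend_less_div_times[OF L, of n] by (simp add: algebra_simps)
    then have "j + n \<le> R n * L"
      using j unfolding R_def by (simp add: algebra_simps)
    then show fits: "j + n \<le> length (concat ?bs)"
      by (simp only: lenc)
    show "Z n j x = take n (drop j (concat ?bs))"
    proof (rule nth_equalityI)
      show "length (Z n j x) = length (take n (drop j (concat ?bs)))"
        using fits by (simp add: Z_def wordof_def)
      fix i assume "i < length (Z n j x)"
      then have i: "i < n" by (simp add: Z_def wordof_def)
      have lt: "j + i < length ?bs * L"
        using fits i lenc by simp
      then have "concat ?bs ! (j + i) = ?bs ! ((j + i) div L) ! ((j + i) mod L)"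
        using concat_equal_lengths_nth[of ?bs L "j + i", OF lens] by simp
      also have "(j + i) div L < R n"
        using lt L by (simp add: div_less_iff_less_mult)
      then have "?bs ! ((j + i) div L) = x ((j + i) div L)"
        by (metis add_0 length_upt diff_zero nth_map nth_upt)
      finally show "Z n j x ! i = take n (drop j (concat ?bs)) ! i"
        using i fits by (simp add: Z_def wordof_def \<Psi>_def add.commute)
    qed
  qed
  have simple_Z: "simple_function B (Z n j)" if j: "j < L" for n j
  proof -
    have "simple_function B (\<lambda>x. take n (drop j (concat (map x [0..<0 + (R n)]))))"
      by (rule simple_function_compose1[OF simple_map])
    then show ?thesis
      by (rule simple_function_cong[THEN iffD1, rotated]) (simp add: Z_concat[OF _ j])
  qed
  have ZI: "Z n j ` space B \<subseteq> words M n" for n j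
    using Z_words by auto
  (* complete blocks 1, ..., r are determined by the word read from position j *)
  have entropy_Z: "rv_entropy B (Z n j) \<ge> (n / L) * H - 2 * H" if j: "j < L" for n j
  proof -
    define r where "r = n div L - 1"
    have "rv_entropy B (\<lambda>x. map x [1..<1 + r])
        = rv_entropy B (\<lambda>x. (\<lambda>w. map (\<lambda>k. take L (drop (k * L - j) w)) [1..<1 + r]) (Z n j x))"
    proof (rule rv_entropy_cong)
      fix x assume x: "x \<in> space B"
      have "x k = take L (drop (k * L - j) (Z n j x))" if k: "1 \<le> k" "k < 1 + r" for k
      proof (rule nth_equalityI)
        have "k + 1 \<le> n div L" using k by (simp add: r_def)
        then have "(k + 1) * L \<le> n div L * L" by (rule mult_right_mono) simp
        also have "\<dots> \<le> n" by (rule div_times_less_eq_dividend)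
        finally have kn: "k * L + L \<le> n"
          by (simp add: algebra_simps)
        have kj: "j \<le> k * L"
          using j k by (metis less_imp_le mult.commute mult_le_mono2 nat_mult_1_right order_trans)
        have xk: "length (x k) = L"
          using x len by (simp add: space_B)
        show "length (x k) = length (take L (drop (k * L - j) (Z n j x)))"
          using kn xk by (simp add: Z_def wordof_def)
        fix i assume "i < length (x k)"
        then have i: "i < L" using xk by simp
        then have "take L (drop (k * L - j) (Z n j x)) ! i = Z n j x ! (k * L - j + i)"
          using kn by (simp add: Z_def wordof_def)
        also have "\<dots> = \<Psi> j x (k * L - j + i)"
          using kn i unfolding Z_def wordof_def by (subst nth_map) auto
        also have "\<dots> = x k ! i"
          using kj i L by (simp add: \<Psi>_def)
        finally show "x k ! i = take L (drop (k * L - j) (Z n j x)) ! i" by simp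
      qed
      then show "map x [1..<1 + r] = map (\<lambda>k. take L (drop (k * L - j) (Z n j x))) [1..<1 + r]"
        by (intro map_cong refl) auto
    qed
    also have "\<dots> \<le> rv_entropy B (Z n j)"
      by (rule B.rv_entropy_comp_le[OF simple_Z[OF j]])
    finally have "r * H \<le> rv_entropy B (Z n j)"
      unfolding entropy_blocks .
    moreover have "(n / L - 2) * H \<le> r * H"
    proof (rule mult_right_mono[OF _ H])
      have "real n < (real (n div L) + 1) * L"
        using dividend_less_div_times[OF L, of n] by (metis of_nat_1 of_nat_add of_nat_less_iff of_nat_mult
            add.commute mult.commute distrib_left mult.right_neutral)
      then have "n / L < real (n div L) + 1"
        using L by (simp add: divide_less_eq)
      then show "n / L - 2 \<le> real r"
        unfolding r_def by linarith
    qed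
    ultimately show ?thesis by (simp add: algebra_simps)
  qed
  (* concavity of the entropy: the law under nu serves as guess for each of the averaged laws *)
  have entropy_\<nu>: "(H / L) * n - 2 * H \<le> rv_entropy \<nu> (wordof n)" for n
  proof -
    let ?p = "law \<nu> (wordof n)"
    have "(\<Sum>j<L. rv_entropy B (Z n j)) \<le> (\<Sum>j<L. - (\<Sum>w\<in>words M n. law B (Z n j) w * ln (?p w)))"
    proof (rule sum_mono)
      fix j assume j: "j \<in> {..<L}"
      show "rv_entropy B (Z n j) \<le> - (\<Sum>w\<in>words M n. law B (Z n j) w * ln (?p w))"
      proof (rule B.rv_entropy_le_cross_entropy[OF simple_Z _ ZI])
        show "sum ?p (words M n) \<le> 1" by (simp add: \<nu>.sum_law_words)
        fix w assume w: "law B (Z n j) w > 0"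
        have "law B (Z n j) w \<le> (\<Sum>j<L. law B (Z n j) w)"
          using j by (intro member_le_sum) auto
        then show "?p w > 0" unfolding law_\<nu> using w L by simp
      qed (use j in auto)
    qed
    also have "\<dots> = - (\<Sum>w\<in>words M n. (\<Sum>j<L. law B (Z n j) w) * ln (?p w))"
      by (simp add: sum_negf sum_distrib_right sum.swap[of _ "{..<L}"])
    also have "\<dots> = - (\<Sum>w\<in>words M n. L * ?p w * ln (?p w))"
      using L by (simp add: law_\<nu>)
    also have "\<dots> = L * rv_entropy \<nu> (wordof n)"
      by (simp add: \<nu>.block_entropy_eq sum_distrib_left mult.assoc)
    finally have 1: "(\<Sum>j<L. rv_entropy B (Z n j)) \<le> L * rv_entropy \<nu> (wordof n)" .
    have "(\<Sum>j<L. (n / L) * H - 2 * H) \<le> (\<Sum>j<L. rv_entropy B (Z n j))"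
      using entropy_Z by (intro sum_mono) auto
    with 1 have "L * ((n / L) * H - 2 * H) \<le> L * rv_entropy \<nu> (wordof n)" by simp
    then show ?thesis using L by (simp add: mult.commute)
  qed
  define K where "K = Max (insert 1 (mnorm ` A ` {1..M}))"
  have K: "K \<ge> 1" "\<And>i. i \<in> {1..M} \<Longrightarrow> mnorm (A i) \<le> K"
    unfolding K_def by (rule Max_ge, simp, simp)+
  (* completing the word to whole blocks adds at most 2 L letters, each of norm at most K *)
  have norm_Z: "c0 * prod_list (map g (map x [0..<R n])) \<le> K ^ (3 * L) * mnorm (mprod A (Z n j x))"
    if x: "x \<in> space B" and j: "j < L" for n j x
  proof -
    let ?bs = "map x [0..<R n]"
    define c where "c = concat ?bs"
    define u v where "u = take j c" and "v = drop (j + n) c"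
    have c: "c = u @ Z n j x @ v"
      unfolding u_def v_def Z_concat[OF x j] c_def[symmetric]
      by (metis add.commute append_take_drop_id drop_drop)
    have lens: "length b = L" if "b \<in> set ?bs" for b
      using that x len(1) by (auto simp: space_B)
    have lenc: "length c = (R n) * L"
      unfolding c_def using length_concat_equal_lengths[of ?bs L, OF lens] by simp
    have "length c \<le> n + 2 * L"
      using lenc div_times_less_eq_dividend[of n L] unfolding R_def add_mult_distrib by linarith
    then have "length u + length v \<le> 3 * L"
      using j unfolding u_def v_def length_take length_drop by linarith
    have "set c \<subseteq> {1..M}"
      unfolding c_def using x len(2) by (auto simp: space_B)
    then have uv: "set u \<subseteq> {1..M}" "set v \<subseteq> {1..M}"
      unfolding u_def v_def by (auto dest: in_set_takeD in_set_dropD)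
    have "c0 * prod_list (map g ?bs) \<le> mnorm (mprod A c)"
      unfolding c_def using x by (intro norms) (auto simp: space_B)
    also have "\<dots> = mnorm (mprod A v ** mprod A (Z n j x) ** mprod A u)"
      by (subst c) (simp add: mprod_append matrix_mul_assoc)
    also have "\<dots> \<le> mnorm (mprod A v) * mnorm (mprod A (Z n j x)) * mnorm (mprod A u)"
      by (intro order_trans[OF mnorm_mult] mult_right_mono mnorm_mult mnorm_nonneg)
    also have "\<dots> \<le> K ^ length v * mnorm (mprod A (Z n j x)) * K ^ length u"
      using K uv by (intro mult_mono mnorm_mprod_le[where M = M] mnorm_nonneg mult_nonneg_nonneg) auto
    also have "\<dots> = K ^ (length u + length v) * mnorm (mprod A (Z n j x))"
      by (simp add: power_add)
    also have "\<dots> \<le> K ^ (3 * L) * mnorm (mprod A (Z n j x))"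
      using K \<open>length u + length v \<le> 3 * L\<close> by (intro mult_right_mono power_increasing mnorm_nonneg)
    finally show ?thesis .
  qed
  have prod_g_pos: "prod_list (map g (map x [0..<r])) > 0" if "x \<in> space B" for x r
    using that g by (induction r) (auto simp: space_B)
  have Z_nz: "mnorm (mprod A (Z n j x)) > 0" if x: "x \<in> space B" and j: "j < L" for n j x
  proof -
    have "0 < c0 * prod_list (map g (map x [0..<R n]))"
      using c0 prod_g_pos[OF x] by simp
    then have "0 < K ^ (3 * L) * mnorm (mprod A (Z n j x))"
      using norm_Z[OF x j, of n] by linarith
    then show ?thesis using K by (simp add: zero_less_mult_iff)
  qed
  define e where "e = (\<Sum>b\<in>W. q b * ln (g b))"
  have mean_Z: "(\<Sum>w\<in>words M n. law B (Z n j) w * ln (mnorm (mprod A w)))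
      \<ge> n / L * e - 2 * \<bar>e\<bar> + ln c0 - ln (K ^ (3 * L))" if j: "j < L" for n j
  proof -
    let ?R = "R n"
    let ?Y = "\<lambda>x. map x [0..<0 + ?R]"
    let ?h = "\<lambda>bs. take n (drop j (concat bs))"
    have "(\<Sum>w\<in>words M n. law B (Z n j) w * ln (mnorm (mprod A w)))
        = (\<Sum>w\<in>Z n j ` space B. law B (Z n j) w * ln (mnorm (mprod A w)))"
      by (rule sum_law_superset[symmetric, OF _ ZI]) simp
    also have "\<dots> = (\<Sum>w\<in>(\<lambda>x. ?h (?Y x)) ` space B. law B (\<lambda>x. ?h (?Y x)) w * ln (mnorm (mprod A w)))"
    proof -
      have "Z n j ` space B = (\<lambda>x. ?h (?Y x)) ` space B"
        by (rule image_cong) (simp_all add: Z_concat[OF _ j])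
      moreover have "law B (Z n j) = law B (\<lambda>x. ?h (?Y x))"
        by (rule law_cong) (simp add: Z_concat[OF _ j])
      ultimately show ?thesis by (simp only:)
    qed
    also have "\<dots> = (\<Sum>bs\<in>?Y ` space B. law B ?Y bs * ln (mnorm (mprod A (?h bs))))"
      by (rule B.sum_law_comp[OF simple_map, symmetric])
    finally have eq: "(\<Sum>w\<in>words M n. law B (Z n j) w * ln (mnorm (mprod A w)))
        = (\<Sum>bs\<in>?Y ` space B. law B ?Y bs * ln (mnorm (mprod A (?h bs))))" .
    have "(\<Sum>bs\<in>?Y ` space B. law B ?Y bs * ln (mnorm (mprod A (?h bs))))
        \<ge> (\<Sum>bs\<in>?Y ` space B. law B ?Y bs * ((\<Sum>k<?R. ln (g (bs ! k))) + (ln c0 - ln (K ^ (3 * L)))))"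
    proof (intro sum_mono mult_left_mono law_nonneg)
      fix bs assume "bs \<in> ?Y ` space B"
      then obtain x where x: "x \<in> space B" and bs: "bs = map x [0..<?R]" by auto
      have "ln (c0 * prod_list (map g bs)) \<le> ln (K ^ (3 * L) * mnorm (mprod A (Z n j x)))"
        using norm_Z[OF x j, of n] c0 prod_g_pos[OF x, of ?R] Z_nz[OF x j, of n] K unfolding bs
        by (intro ln_mono) auto
      moreover have "ln (c0 * prod_list (map g bs)) = ln c0 + ln (prod_list (map g bs))"
        using c0 prod_g_pos[OF x, of ?R] unfolding bs by (intro ln_mult_pos) auto
      moreover have "ln (K ^ (3 * L) * mnorm (mprod A (Z n j x)))
          = ln (K ^ (3 * L)) + ln (mnorm (mprod A (Z n j x)))"
        using Z_nz[OF x j, of n] K by (intro ln_mult_pos) auto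
      moreover have "ln (prod_list (map g bs)) = (\<Sum>k<?R. ln (g (bs ! k)))"
      proof -
        have "prod_list (map g bs) = (\<Prod>k<?R. g (bs ! k))"
          unfolding bs by (simp add: prod.list_conv_set_nth atLeast0LessThan)
        moreover have "g (bs ! k) \<noteq> 0" if "k < ?R" for k
        proof -
          have "bs ! k = x k" using that unfolding bs by (metis add_0 diff_zero length_upt nth_map nth_upt)
          then show ?thesis using x g by (simp add: space_B less_imp_neq[symmetric])
        qed
        ultimately show ?thesis by (simp only:) (rule ln_prod, auto)
      qed
      ultimately show "(\<Sum>k<?R. ln (g (bs ! k))) + (ln c0 - ln (K ^ (3 * L))) \<le> ln (mnorm (mprod A (?h bs)))"
        using Z_concat[OF x j] bs by simp
    qed
    also have "(\<Sum>bs\<in>?Y ` space B. law B ?Y bs * ((\<Sum>k<?R. ln (g (bs ! k))) + (ln c0 - ln (K ^ (3 * L)))))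
        = ?R * e + (ln c0 - ln (K ^ (3 * L)))"
      unfolding distrib_left sum.distrib
      using mean_sum[of 0 ?R "\<lambda>b. ln (g b)"] sum_law_const[OF B.prob_space_axioms simple_map[of 0 ?R]]
      by (simp add: e_def)
    moreover have "?R * e \<ge> n / L * e - 2 * \<bar>e\<bar>"
    proof -
      have "real n < (real (n div L) + 1) * L"
        using dividend_less_div_times[OF L, of n] by (metis of_nat_1 of_nat_add of_nat_less_iff of_nat_mult
            add.commute mult.commute distrib_left mult.right_neutral)
      then have "n / L < real (n div L) + 1"
        using L by (simp add: divide_less_eq)
      moreover have "real (n div L) \<le> n / L"
        by (rule of_nat_div_le_of_nat)
      ultimately have "\<bar>?R - n / L\<bar> \<le> 2" unfolding R_def by simp
      then have "\<bar>?R - n / L\<bar> * \<bar>e\<bar> \<le> 2 * \<bar>e\<bar>" by (rule mult_right_mono) simp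
      then have "\<bar>(?R - n / L) * e\<bar> \<le> 2 * \<bar>e\<bar>" by (simp add: abs_mult)
      then show ?thesis by (simp add: left_diff_distrib abs_le_iff)
    qed
    ultimately show ?thesis unfolding eq by simp
  qed
  have mean_\<nu>: "(e / L) * n - (2 * \<bar>e\<bar> - ln c0 + ln (K ^ (3 * L)))
      \<le> \<nu>.word_mean n (\<lambda>w. ln (mnorm (mprod A w)))" for n
  proof -
    have "L * \<nu>.word_mean n (\<lambda>w. ln (mnorm (mprod A w)))
        = (\<Sum>w\<in>words M n. L * (law \<nu> (wordof n) w * ln (mnorm (mprod A w))))"
      by (simp add: \<nu>.word_mean_def sum_distrib_left)
    also have "\<dots> = (\<Sum>w\<in>words M n. (\<Sum>j<L. law B (Z n j) w) * ln (mnorm (mprod A w)))"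
      using L by (simp add: law_\<nu>)
    also have "\<dots> = (\<Sum>j<L. \<Sum>w\<in>words M n. law B (Z n j) w * ln (mnorm (mprod A w)))"
      by (simp add: sum_distrib_right sum.swap[of _ "{..<L}"])
    finally have "L * \<nu>.word_mean n (\<lambda>w. ln (mnorm (mprod A w)))
        = (\<Sum>j<L. \<Sum>w\<in>words M n. law B (Z n j) w * ln (mnorm (mprod A w)))" .
    moreover have "(\<Sum>j<L. n / L * e - 2 * \<bar>e\<bar> + ln c0 - ln (K ^ (3 * L)))
        \<le> (\<Sum>j<L. \<Sum>w\<in>words M n. law B (Z n j) w * ln (mnorm (mprod A w)))"
      by (intro sum_mono mean_Z) auto
    ultimately have "L * (n / L * e - 2 * \<bar>e\<bar> + ln c0 - ln (K ^ (3 * L)))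
        \<le> L * \<nu>.word_mean n (\<lambda>w. ln (mnorm (mprod A w)))" by simp
    then have "n / L * e - 2 * \<bar>e\<bar> + ln c0 - ln (K ^ (3 * L))
        \<le> \<nu>.word_mean n (\<lambda>w. ln (mnorm (mprod A w)))"
      using L by (simp only: mult_le_cancel_left_pos of_nat_0_less_iff)
    then show ?thesis by (simp add: mult.commute)
  qed
  have "ereal (H / L + s * (e / L)) \<le> free_energy A s \<nu>"
  proof (rule \<nu>.free_energy_ge[OF s entropy_\<nu> _ mean_\<nu>])
    fix w n assume "law \<nu> (wordof n) w > 0"
    then have "\<exists>j\<in>{..<L}. law B (Z n j) w \<noteq> 0"
      unfolding law_\<nu> by (metis div_0 less_irrefl sum.neutral)
    then obtain j where j: "j < L" "law B (Z n j) w \<noteq> 0" by auto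
    have "w \<in> Z n j ` space B"
      using law_outside[of w "Z n j" B] j(2) by metis
    then obtain x where "x \<in> space B" "w = Z n j x"
      by auto
    then show "mprod A w \<noteq> 0"
      using Z_nz[of x j n] j mnorm_pos_iff by blast
  qed
  moreover have "H / L + s * (e / L) = (\<Sum>b\<in>W. q b * (s * ln (g b) - ln (q b))) / L"
    unfolding H_def e_def
    by (simp add: right_diff_distrib sum_subtractf sum_distrib_left mult.left_commute
        diff_divide_distrib)
  ultimately show ?thesis
    using inv by auto
qed

text \<open>The Gibbs weights \<open>q b\<close> proportional to \<open>g b powr s\<close> turn the mean in the previous bound into the
  logarithm of a sum.\<close>

lemma block_measure_pressure:
  fixes A :: "nat \<Rightarrow> real^'n^'n" and g :: "nat list \<Rightarrow> real"
  assumes s: "s > 0" and L: "L > 0" and W: "finite W" "W \<subseteq> words M L" "W \<noteq> {}"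
    and g: "\<And>b. b \<in> W \<Longrightarrow> g b > 0" and c0: "c0 > 0"
    and norms: "\<And>bs. set bs \<subseteq> W \<Longrightarrow> c0 * prod_list (map g bs) \<le> mnorm (mprod A (concat bs))"
  shows "\<exists>\<nu>\<in>invariant_measures M. ereal (ln (\<Sum>b\<in>W. g b powr s) / L) \<le> free_energy A s \<nu>"
proof -
  define Z where "Z = (\<Sum>b\<in>W. g b powr s)"
  have gs: "g b powr s > 0" if "b \<in> W" for b
    using g[OF that] by simp
  have Z: "Z > 0"
    unfolding Z_def by (intro sum_pos W gs)
  define q where "q b = g b powr s / Z" for b
  have q: "\<And>b. b \<in> W \<Longrightarrow> q b > 0" "sum q W = 1"
    using gs Z by (auto simp: q_def Z_def sum_divide_distrib[symmetric])
  have "(\<Sum>b\<in>W. q b * (s * ln (g b) - ln (q b))) = (\<Sum>b\<in>W. q b * ln Z)"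
  proof (intro sum.cong refl)
    fix b assume b: "b \<in> W"
    have "ln (q b) = s * ln (g b) - ln Z"
      unfolding q_def using gs[OF b] Z g[OF b] by (simp add: ln_div ln_powr)
    then show "q b * (s * ln (g b) - ln (q b)) = q b * ln Z" by simp
  qed
  also have "\<dots> = ln Z"
    using q(2) by (simp flip: sum_distrib_right)
  finally show ?thesis
    using block_measure_free_energy[OF s L W(1,2) q g c0 norms] unfolding Z_def by simp
qed

section \<open>The pressure bound for irreducible tuples\<close>

lemma linear_injective_if_dim_image_eq:
  fixes f :: "'a::euclidean_space \<Rightarrow> 'b::euclidean_space"
  assumes f: "linear f" and dim: "dim (f ` V) = dim V" and v: "v \<in> V" "f v = 0"
  shows "v = 0"
proof (rule ccontr)
  assume "v \<noteq> 0"
  then have "independent {v}" by simp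
  then obtain D where D: "{v} \<subseteq> D" "D \<subseteq> V" "independent D" "V \<subseteq> span D"
    using maximal_independent_subset_extend[of "{v}" V] v(1) by auto
  have fin: "finite D"
    using D(3) by (rule independent_imp_finite)
  have "f ` V \<subseteq> span (f ` (D - {v}))"
  proof -
    have "f ` D \<subseteq> insert 0 (f ` (D - {v}))"
      using v(2) by auto
    then have "span (f ` D) \<subseteq> span (f ` (D - {v}))"
      by (metis span_insert_0 span_mono)
    moreover have "f ` V \<subseteq> span (f ` D)"
      using D(4) f by (metis image_mono linear_span_image)
    ultimately show ?thesis by blast
  qed
  then have "dim (f ` V) \<le> card (f ` (D - {v}))"
    using fin by (intro dim_le_card) auto
  also have "\<dots> \<le> card (D - {v})"
    using fin by (intro card_image_le) simp
  also have "\<dots> < card D"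
    using D(1) fin by (intro psubset_card_mono) auto
  also have "card D = dim V"
    using D by (intro basis_card_eq_dim)
  finally show False using dim by simp
qed

text \<open>If \<open>T\<close> is injective on its range, then \<open>T\<close> maps a cone around the range strictly into itself
  and expands it by a definite factor; both properties survive small perturbations of \<open>T\<close>. This
  gives products of perturbations of \<open>T\<close> that cannot collapse, although \<open>T\<close> may be singular.\<close>

lemma perturbation_stable_cone:
  fixes T :: "real^'n^'n"
  assumes "T \<noteq> 0" and inj: "\<And>x. T *v (T *v x) = 0 \<Longrightarrow> T *v x = 0"
  obtains C x0 \<epsilon> c where "x0 \<in> C" "x0 \<noteq> 0" "\<epsilon> > 0" "c > 0"
    "\<And>S x. mnorm (S - T) \<le> \<epsilon> \<Longrightarrow> x \<in> C \<Longrightarrow> S *v x \<in> C \<and> c * norm x \<le> norm (S *v x)"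
    "\<And>a x. x \<in> C \<Longrightarrow> a *\<^sub>R x \<in> C"
proof -
  define V where "V = range ((*v) T)"
  have V: "subspace V"
    unfolding V_def by (rule linear_subspace_image[OF matrix_vector_mul_linear subspace_UNIV])
  obtain y0 where y0: "T *v y0 \<noteq> 0"
    using \<open>T \<noteq> 0\<close> by (metis matrix_eq matrix_vector_mult_0)
  obtain \<gamma> where \<gamma>: "\<gamma> > 0" "\<And>v. v \<in> V \<Longrightarrow> \<gamma> * norm v \<le> norm (T *v v)"
  proof -
    have "compact (V \<inter> sphere 0 1)"
      by (intro closed_Int_compact closed_subspace V compact_sphere)
    moreover have "(T *v y0) /\<^sub>R norm (T *v y0) \<in> V \<inter> sphere 0 1"
      using y0 V by (auto simp: V_def subspace_scale)
    then have "V \<inter> sphere 0 1 \<noteq> {}" by blast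
    moreover have "continuous_on (V \<inter> sphere 0 1) (\<lambda>x. norm (T *v x))"
      by (intro continuous_intros linear_continuous_on matrix_vector_mul_bounded_linear)
    ultimately obtain u where u: "u \<in> V \<inter> sphere 0 1"
        "\<And>v. v \<in> V \<inter> sphere 0 1 \<Longrightarrow> norm (T *v u) \<le> norm (T *v v)"
      using continuous_attains_inf by metis
    have "norm (T *v u) > 0"
    proof -
      obtain y where "u = T *v y" using u(1) by (auto simp: V_def)
      then show ?thesis using inj[of y] u(1) by auto
    qed
    moreover have "norm (T *v u) * norm v \<le> norm (T *v v)" if v: "v \<in> V" for v
    proof (cases "v = 0")
      case False
      have "norm (T *v u) \<le> norm (T *v (v /\<^sub>R norm v))"
        using v False V by (intro u(2)) (auto simp: subspace_scale)
      then show ?thesis using False by (simp add: matrix_vector_mult_scaleR field_simps)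
    qed simp
    ultimately show ?thesis using that by blast
  qed
  define \<tau> where "\<tau> = mnorm T"
  have \<tau>: "\<tau> > 0" unfolding \<tau>_def using \<open>T \<noteq> 0\<close> mnorm_pos_iff by blast
  (* with this aperture, leaving the range costs a quarter of gamma, and so does replacing T by S *)
  define \<theta> where "\<theta> = \<gamma> / (4 * (\<gamma> + \<tau>))"
  have \<theta>: "\<theta> > 0" unfolding \<theta>_def using \<gamma> \<tau> by simp
  have \<theta>_eq: "\<theta> * (\<gamma> + \<tau>) = \<gamma> / 4"
  proof -
    have "\<gamma> + \<tau> \<noteq> 0" using \<gamma>(1) \<tau> by simp
    then show ?thesis unfolding \<theta>_def by (simp add: divide_simps)
  qed
  define C where "C = {x. \<exists>v\<in>V. norm (x - v) \<le> \<theta> * norm x}"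
  define \<epsilon> where "\<epsilon> = min (\<gamma> / 4) (\<theta> * (\<gamma> / 2))"
  have \<epsilon>: "\<epsilon> > 0" "\<epsilon> \<le> \<gamma> / 4" "\<epsilon> \<le> \<theta> * (\<gamma> / 2)"
    using \<gamma> \<theta> by (auto simp: \<epsilon>_def)
  show ?thesis
  proof (rule that[of "T *v y0" C \<epsilon> "\<gamma> / 2"])
    show "T *v y0 \<in> C"
      unfolding C_def V_def using \<theta> by (intro CollectI bexI[of _ "T *v y0"]) auto
    show "a *\<^sub>R x \<in> C" if x: "x \<in> C" for a x
    proof -
      obtain v where v: "v \<in> V" "norm (x - v) \<le> \<theta> * norm x"
        using x by (auto simp: C_def)
      have "norm (a *\<^sub>R x - a *\<^sub>R v) = \<bar>a\<bar> * norm (x - v)"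
        by (simp flip: scaleR_diff_right)
      also have "\<dots> \<le> \<bar>a\<bar> * (\<theta> * norm x)"
        using v(2) by (intro mult_left_mono) auto
      finally have "norm (a *\<^sub>R x - a *\<^sub>R v) \<le> \<theta> * norm (a *\<^sub>R x)"
        by (simp add: mult.left_commute)
      moreover have "a *\<^sub>R v \<in> V" using V v(1) by (rule subspace_scale)
      ultimately show ?thesis by (auto simp: C_def)
    qed
    fix S x assume S: "mnorm (S - T) \<le> \<epsilon>" and x: "x \<in> C"
    obtain v where v: "v \<in> V" "norm (x - v) \<le> \<theta> * norm x"
      using x by (auto simp: C_def)
    have "norm x \<le> norm v + norm (x - v)"
      using norm_triangle_ineq[of v "x - v"] by simp
    then have "(1 - \<theta>) * norm x \<le> norm v"
      using v(2) by (simp add: algebra_simps)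
    then have "\<gamma> * ((1 - \<theta>) * norm x) \<le> \<gamma> * norm v"
      using \<gamma>(1) by (intro mult_left_mono) auto
    also have "\<dots> \<le> norm (T *v v)"
      by (rule \<gamma>(2)[OF v(1)])
    also have "T *v v = T *v x - T *v (x - v)"
      by (simp add: matrix_vector_mult_diff_distrib)
    also have "norm \<dots> \<le> norm (T *v x) + norm (T *v (x - v))"
      by (rule norm_triangle_ineq4)
    also have "norm (T *v (x - v)) \<le> \<tau> * (\<theta> * norm x)"
      using norm_matrix_vector_le[of T "x - v"] v(2) \<tau> unfolding \<tau>_def
      by (meson mult_left_mono less_imp_le order_trans)
    finally have "\<gamma> * norm x - \<theta> * (\<gamma> + \<tau>) * norm x \<le> norm (T *v x)"
      by (simp add: algebra_simps)
    then have Tx: "3 * \<gamma> / 4 * norm x \<le> norm (T *v x)"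
      unfolding \<theta>_eq by (simp add: algebra_simps)
    have "norm (S *v x - T *v x) = norm ((S - T) *v x)"
      by (simp add: matrix_vector_mult_diff_rdistrib)
    also have "\<dots> \<le> \<epsilon> * norm x"
      using norm_matrix_vector_le[of "S - T" x] S by (meson mult_right_mono norm_ge_zero order_trans)
    finally have diff: "norm (S *v x - T *v x) \<le> \<epsilon> * norm x" .
    have "norm (T *v x) \<le> norm (S *v x) + norm (S *v x - T *v x)"
      using norm_triangle_ineq4[of "S *v x" "S *v x - T *v x"] by simp
    moreover have "\<epsilon> * norm x \<le> \<gamma> / 4 * norm x"
      using \<epsilon>(2) by (intro mult_right_mono) auto
    ultimately have Sx: "\<gamma> / 2 * norm x \<le> norm (S *v x)"
      using Tx diff by linarith
    have "\<epsilon> * norm x \<le> \<theta> * (\<gamma> / 2) * norm x"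
      using \<epsilon>(3) by (intro mult_right_mono) auto
    also have "\<dots> = \<theta> * (\<gamma> / 2 * norm x)" by simp
    also have "\<dots> \<le> \<theta> * norm (S *v x)"
      using Sx \<theta> by (intro mult_left_mono) auto
    finally have "norm (S *v x - T *v x) \<le> \<theta> * norm (S *v x)"
      using diff by linarith
    then have "S *v x \<in> C"
      unfolding C_def V_def by blast
    then show "S *v x \<in> C \<and> \<gamma> / 2 * norm x \<le> norm (S *v x)"
      using Sx by simp
  qed (use y0 \<epsilon> \<gamma> in auto)
qed

definition near_words :: "nat \<Rightarrow> (nat \<Rightarrow> real^'n^'n) \<Rightarrow> real^'n^'n \<Rightarrow> real \<Rightarrow> nat \<Rightarrow> nat list set" where
  "near_words M A B \<eta> N = {w \<in> words M N. mprod A w \<noteq> 0 \<and>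
     mnorm (mprod A w - mnorm (mprod A w) *\<^sub>R B) \<le> \<eta> * mnorm (mprod A w)}"

text \<open>\<open>Z\<close> is realisable if the words of length \<open>N\<close> whose normalised product is near \<open>B\<close> can be
  assembled, \<open>n\<close> at a time and with fixed words in between, into longer words whose normalised
  product is near \<open>Z\<close>. The weights \<open>g\<close> replace the norms of the products because they multiply
  exactly.\<close>

definition assembled where
  "assembled M A s Z \<epsilon> l n W0 W g \<longleftrightarrow> W \<subseteq> words M l
     \<and> (\<forall>b\<in>W. g b > 0 \<and> mnorm (mprod A b - g b *\<^sub>R Z) \<le> \<epsilon> * g b)
     \<and> (\<Sum>b\<in>W. g b powr s) = (\<Sum>w\<in>W0. mnorm (mprod A w) powr s) ^ n"

definition realisable :: "nat \<Rightarrow> (nat \<Rightarrow> real^'n^'n) \<Rightarrow> real \<Rightarrow> real^'n^'n \<Rightarrow> real^'n^'n \<Rightarrow> bool" where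
  "realisable M A s B Z \<longleftrightarrow> (\<exists>n\<ge>1. \<exists>\<kappa>. \<forall>\<epsilon>>0. \<exists>\<eta>>0. \<forall>N. \<forall>W0\<subseteq>near_words M A B \<eta> N.
     \<exists>W g. assembled M A s Z \<epsilon> (n * N + \<kappa>) n W0 W g)"

lemma realisableI:
  assumes "n \<ge> 1"
    and "\<And>\<epsilon>. \<epsilon> > 0 \<Longrightarrow> \<exists>\<eta>>0. \<forall>N. \<forall>W0\<subseteq>near_words M A B \<eta> N.
      \<exists>W g. assembled M A s Z \<epsilon> (n * N + \<kappa>) n W0 W g"
  shows "realisable M A s B Z"
  using assms unfolding realisable_def by blast

lemma realisableE:
  assumes "realisable M A s B Z"
  obtains n \<kappa> where "n \<ge> 1"
    "\<And>\<epsilon>. \<epsilon> > 0 \<Longrightarrow> \<exists>\<eta>>0. \<forall>N. \<forall>W0\<subseteq>near_words M A B \<eta> N.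
      \<exists>W g. assembled M A s Z \<epsilon> (n * N + \<kappa>) n W0 W g"
  using assms unfolding realisable_def by blast

lemma realisable_base: "realisable M A s B B"
proof (rule realisableI[where n = 1 and \<kappa> = 0])
  fix \<epsilon> :: real assume \<epsilon>: "\<epsilon> > 0"
  have "assembled M A s B \<epsilon> (1 * N + 0) 1 W0 W0 (\<lambda>w. mnorm (mprod A w))"
    if W0: "W0 \<subseteq> near_words M A B \<epsilon> N" for N W0
  proof -
    have "mnorm (mprod A w) > 0" if "w \<in> W0" for w
      using W0 that mnorm_pos_iff by (auto simp: near_words_def)
    then show ?thesis
      using W0 by (auto simp: assembled_def near_words_def)
  qed
  then show "\<exists>\<eta>>0. \<forall>N. \<forall>W0\<subseteq>near_words M A B \<eta> N. \<exists>W g. assembled M A s B \<epsilon> (1 * N + 0) 1 W0 W g"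
    using \<epsilon> by blast
qed simp

lemma mnorm_product_perturbation:
  fixes X Y X' Y' :: "real^'n^'n"
  assumes X: "mnorm (X - a *\<^sub>R X') \<le> \<delta> * a" and Y: "mnorm (Y - b *\<^sub>R Y') \<le> \<delta> * b"
    and ab: "a > 0" "b > 0" and \<delta>: "0 \<le> \<delta>" "\<delta> \<le> 1"
  shows "mnorm (X ** Y - (a * b) *\<^sub>R (X' ** Y')) \<le> \<delta> * (mnorm X' + mnorm Y' + 1) * (a * b)"
proof -
  define E F where "E = X - a *\<^sub>R X'" and "F = Y - b *\<^sub>R Y'"
  have eq: "X ** Y - (a * b) *\<^sub>R (X' ** Y') = E ** Y + (a *\<^sub>R X') ** F"
  proof -
    have XY: "X = E + a *\<^sub>R X'" "Y = F + b *\<^sub>R Y'" by (auto simp: E_def F_def)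
    have "E ** Y + (a *\<^sub>R X') ** F + (a *\<^sub>R X') ** (b *\<^sub>R Y')
        = E ** Y + (a *\<^sub>R X') ** (F + b *\<^sub>R Y')"
      by (simp add: matrix_add_ldistrib add.assoc)
    also have "\<dots> = (E + a *\<^sub>R X') ** Y"
      by (simp add: matrix_add_rdistrib flip: XY(2))
    also have "\<dots> = X ** Y"
      by (simp flip: XY(1))
    finally have "X ** Y = E ** Y + (a *\<^sub>R X') ** F + (a *\<^sub>R X') ** (b *\<^sub>R Y')"
      by simp
    then show ?thesis
      by (simp add: matrix_scalar_ac flip: scalar_matrix_assoc)
  qed
  have "mnorm (X ** Y - (a * b) *\<^sub>R (X' ** Y')) \<le> mnorm E * mnorm Y + mnorm (a *\<^sub>R X') * mnorm F"
    unfolding eq by (rule order_trans[OF mnorm_triangle add_mono[OF mnorm_mult mnorm_mult]])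
  also have "\<dots> \<le> (\<delta> * a) * ((mnorm Y' + 1) * b) + (a * mnorm X') * (\<delta> * b)"
  proof (intro add_mono mult_mono mnorm_nonneg)
    have "mnorm Y \<le> mnorm F + mnorm (b *\<^sub>R Y')"
      using mnorm_triangle[of F "b *\<^sub>R Y'"] by (simp add: F_def)
    also have "\<dots> \<le> \<delta> * b + b * mnorm Y'"
      using Y ab by (simp add: F_def mnorm_scaleR)
    also have "\<dots> \<le> 1 * b + b * mnorm Y'"
      using ab \<delta> by (intro add_right_mono mult_right_mono) auto
    finally show "mnorm Y \<le> (mnorm Y' + 1) * b" by (simp add: algebra_simps)
  qed (use X Y ab \<delta> mnorm_nonneg[of X'] in \<open>auto simp: E_def F_def mnorm_scaleR\<close>)
  also have "\<dots> = \<delta> * (mnorm X' + mnorm Y' + 1) * (a * b)"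
    by (simp add: algebra_simps)
  finally show ?thesis .
qed

lemma near_words_mono:
  assumes "\<eta> \<le> \<eta>'"
  shows "near_words M A B \<eta> N \<subseteq> near_words M A B \<eta>' N"
  unfolding near_words_def
  using mult_right_mono[OF assms mnorm_nonneg] order_trans by blast

text \<open>Concatenating words for \<open>Z1\<close> with words for \<open>Z2\<close> multiplies both the products and the sums of the weights.\<close>

lemma realisable_mult:
  fixes A :: "nat \<Rightarrow> real^'n^'n"
  assumes "realisable M A s B Z1" "realisable M A s B Z2"
  shows "realisable M A s B (Z2 ** Z1)"
proof -
  obtain n1 \<kappa>1 where 1: "n1 \<ge> 1" "\<And>\<epsilon>. \<epsilon> > 0 \<Longrightarrow> \<exists>\<eta>>0. \<forall>N. \<forall>W0\<subseteq>near_words M A B \<eta> N.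
      \<exists>W g. assembled M A s Z1 \<epsilon> (n1 * N + \<kappa>1) n1 W0 W g"
    by (rule realisableE[OF assms(1)]) blast
  obtain n2 \<kappa>2 where 2: "n2 \<ge> 1" "\<And>\<epsilon>. \<epsilon> > 0 \<Longrightarrow> \<exists>\<eta>>0. \<forall>N. \<forall>W0\<subseteq>near_words M A B \<eta> N.
      \<exists>W g. assembled M A s Z2 \<epsilon> (n2 * N + \<kappa>2) n2 W0 W g"
    by (rule realisableE[OF assms(2)]) blast
  show ?thesis
  proof (rule realisableI[where n = "n1 + n2" and \<kappa> = "\<kappa>1 + \<kappa>2"])
    fix \<epsilon> :: real assume \<epsilon>: "\<epsilon> > 0"
    define \<delta> where "\<delta> = min 1 (\<epsilon> / (mnorm Z2 + mnorm Z1 + 1))"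
    have pos: "mnorm Z2 + mnorm Z1 + 1 > 0"
      using mnorm_nonneg[of Z1] mnorm_nonneg[of Z2] by linarith
    have \<delta>: "\<delta> > 0" "\<delta> \<le> 1" "\<delta> * (mnorm Z2 + mnorm Z1 + 1) \<le> \<epsilon>"
    proof -
      show "\<delta> > 0" "\<delta> \<le> 1" using \<epsilon> pos by (auto simp: \<delta>_def)
      have "\<delta> \<le> \<epsilon> / (mnorm Z2 + mnorm Z1 + 1)" by (simp add: \<delta>_def)
      then show "\<delta> * (mnorm Z2 + mnorm Z1 + 1) \<le> \<epsilon>"
        using pos by (simp only: pos_le_divide_eq)
    qed
    obtain \<eta>1 where \<eta>1: "\<eta>1 > 0" "\<forall>N. \<forall>W0\<subseteq>near_words M A B \<eta>1 N.
        \<exists>W g. assembled M A s Z1 \<delta> (n1 * N + \<kappa>1) n1 W0 W g"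
      using 1(2)[OF \<delta>(1)] by blast
    obtain \<eta>2 where \<eta>2: "\<eta>2 > 0" "\<forall>N. \<forall>W0\<subseteq>near_words M A B \<eta>2 N.
        \<exists>W g. assembled M A s Z2 \<delta> (n2 * N + \<kappa>2) n2 W0 W g"
      using 2(2)[OF \<delta>(1)] by blast
    have "\<exists>W g. assembled M A s (Z2 ** Z1) \<epsilon> ((n1 + n2) * N + (\<kappa>1 + \<kappa>2)) (n1 + n2) W0 W g"
      if W0: "W0 \<subseteq> near_words M A B (min \<eta>1 \<eta>2) N" for N W0
    proof -
      have "W0 \<subseteq> near_words M A B \<eta>1 N" "W0 \<subseteq> near_words M A B \<eta>2 N"
        using W0 near_words_mono[of "min \<eta>1 \<eta>2"] by (meson min.cobounded1 min.cobounded2 order_trans)+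
      then obtain W1 g1 W2 g2 where o1: "assembled M A s Z1 \<delta> (n1 * N + \<kappa>1) n1 W0 W1 g1"
          and o2: "assembled M A s Z2 \<delta> (n2 * N + \<kappa>2) n2 W0 W2 g2"
        using \<eta>1(2) \<eta>2(2) by blast
      define l where "l = n1 * N + \<kappa>1"
      define W where "W = (\<lambda>p. fst p @ snd p) ` (W1 \<times> W2)"
      define g where "g b = g1 (take l b) * g2 (drop l b)" for b
      have W1: "W1 \<subseteq> words M l" and W2: "W2 \<subseteq> words M (n2 * N + \<kappa>2)"
        using o1 o2 by (auto simp: assembled_def l_def)
      have len: "length u = l" if "u \<in> W1" for u
        using that W1 unfolding words_def by blast
      have g: "g (u @ v) = g1 u * g2 v" if "u \<in> W1" for u v
        using len[OF that] by (simp add: g_def)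
      have inj: "inj_on (\<lambda>p. fst p @ snd p) (W1 \<times> W2)"
      proof (rule inj_onI)
        fix p p' assume p: "p \<in> W1 \<times> W2" "p' \<in> W1 \<times> W2" "fst p @ snd p = fst p' @ snd p'"
        then have "length (fst p) = length (fst p')" using len by auto
        then show "p = p'" using p(3) by (simp add: prod_eq_iff)
      qed
      have "assembled M A s (Z2 ** Z1) \<epsilon> ((n1 + n2) * N + (\<kappa>1 + \<kappa>2)) (n1 + n2) W0 W g"
        unfolding assembled_def
      proof (intro conjI ballI)
        show "W \<subseteq> words M ((n1 + n2) * N + (\<kappa>1 + \<kappa>2))"
        proof
          fix b assume "b \<in> W"
          then obtain u v where "u \<in> W1" "v \<in> W2" "b = u @ v"
            unfolding W_def by auto
          then have "u \<in> words M l" "v \<in> words M (n2 * N + \<kappa>2)" "b = u @ v"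
            using W1 W2 by blast+
          then show "b \<in> words M ((n1 + n2) * N + (\<kappa>1 + \<kappa>2))"
            by (simp add: words_def l_def add_mult_distrib)
        qed
        fix b assume "b \<in> W"
        then obtain u v where uv: "u \<in> W1" "v \<in> W2" "b = u @ v" by (auto simp: W_def)
        have gu: "g1 u > 0" "mnorm (mprod A u - g1 u *\<^sub>R Z1) \<le> \<delta> * g1 u"
          and gv: "g2 v > 0" "mnorm (mprod A v - g2 v *\<^sub>R Z2) \<le> \<delta> * g2 v"
          using o1 o2 uv by (auto simp: assembled_def)
        show "g b > 0" unfolding uv(3) g[OF uv(1)] using gu gv by simp
        have "mnorm (mprod A v ** mprod A u - (g2 v * g1 u) *\<^sub>R (Z2 ** Z1))
            \<le> \<delta> * (mnorm Z2 + mnorm Z1 + 1) * (g2 v * g1 u)"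
          using gu gv \<delta> by (intro mnorm_product_perturbation) auto
        also have "\<dots> \<le> \<epsilon> * (g2 v * g1 u)"
          using \<delta>(3) gu gv by (intro mult_right_mono) auto
        finally show "mnorm (mprod A b - g b *\<^sub>R (Z2 ** Z1)) \<le> \<epsilon> * g b"
          unfolding uv(3) g[OF uv(1)] by (simp add: mprod_append mult.commute)
      next
        have "(\<Sum>b\<in>W. g b powr s) = (\<Sum>p\<in>W1 \<times> W2. g (fst p @ snd p) powr s)"
          unfolding W_def by (subst sum.reindex[OF inj]) simp
        also have "\<dots> = (\<Sum>p\<in>W1 \<times> W2. g1 (fst p) powr s * g2 (snd p) powr s)"
          using o1 o2 by (intro sum.cong refl) (auto simp: g powr_mult assembled_def less_imp_le)
        also have "\<dots> = (\<Sum>u\<in>W1. g1 u powr s) * (\<Sum>v\<in>W2. g2 v powr s)"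
          by (simp add: sum_product sum.cartesian_product split_def)
        also have "\<dots> = (\<Sum>w\<in>W0. mnorm (mprod A w) powr s) ^ (n1 + n2)"
          using o1 o2 by (simp add: assembled_def power_add)
        finally show "(\<Sum>b\<in>W. g b powr s) = (\<Sum>w\<in>W0. mnorm (mprod A w) powr s) ^ (n1 + n2)" .
      qed
      then show ?thesis by blast
    qed
    then show "\<exists>\<eta>>0. \<forall>N. \<forall>W0\<subseteq>near_words M A B \<eta> N.
        \<exists>W g. assembled M A s (Z2 ** Z1) \<epsilon> ((n1 + n2) * N + (\<kappa>1 + \<kappa>2)) (n1 + n2) W0 W g"
      using \<eta>1(1) \<eta>2(1) by (intro exI[of _ "min \<eta>1 \<eta>2"]) simp
  qed (use 1(1) in simp)
qed

text \<open>A fixed word in front changes neither the weights nor their sum, only the constant \<open>\<kappa>\<close>.\<close>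

lemma realisable_fixed_word:
  fixes A :: "nat \<Rightarrow> real^'n^'n"
  assumes Z: "realisable M A s B Z" and k: "k \<in> lists {1..M}"
  shows "realisable M A s B (Z ** mprod A k)"
proof -
  obtain n \<kappa> where n: "n \<ge> 1" "\<And>\<epsilon>. \<epsilon> > 0 \<Longrightarrow> \<exists>\<eta>>0. \<forall>N. \<forall>W0\<subseteq>near_words M A B \<eta> N.
      \<exists>W g. assembled M A s Z \<epsilon> (n * N + \<kappa>) n W0 W g"
    by (rule realisableE[OF Z]) blast
  define K where "K = mnorm (mprod A k) + 1"
  have K: "K > 0" "mnorm (mprod A k) \<le> K"
    using mnorm_nonneg[of "mprod A k"] by (auto simp: K_def)
  show ?thesis
  proof (rule realisableI[where n = n and \<kappa> = "\<kappa> + length k"])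
    fix \<epsilon> :: real assume "\<epsilon> > 0"
    then have \<epsilon>K: "\<epsilon> / K > 0" using K by simp
    obtain \<eta> where \<eta>: "\<eta> > 0" "\<forall>N. \<forall>W0\<subseteq>near_words M A B \<eta> N.
        \<exists>W g. assembled M A s Z (\<epsilon> / K) (n * N + \<kappa>) n W0 W g"
      using n(2)[OF \<epsilon>K] by blast
    have "\<exists>W g. assembled M A s (Z ** mprod A k) \<epsilon> (n * N + (\<kappa> + length k)) n W0 W g"
      if W0: "W0 \<subseteq> near_words M A B \<eta> N" for N W0
    proof -
      obtain W g where o: "assembled M A s Z (\<epsilon> / K) (n * N + \<kappa>) n W0 W g"
        using \<eta>(2) W0 by blast
      have W: "W \<subseteq> words M (n * N + \<kappa>)"
          "(\<Sum>b\<in>W. g b powr s) = (\<Sum>w\<in>W0. mnorm (mprod A w) powr s) ^ n"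
        using o by (auto simp: assembled_def)
      have Wb: "g b > 0" "mnorm (mprod A b - g b *\<^sub>R Z) \<le> \<epsilon> / K * g b" if "b \<in> W" for b
        using o that by (auto simp: assembled_def)
      have "assembled M A s (Z ** mprod A k) \<epsilon> (n * N + (\<kappa> + length k)) n W0 ((@) k ` W)
          (\<lambda>b. g (drop (length k) b))"
        unfolding assembled_def
      proof (intro conjI ballI)
        show "(@) k ` W \<subseteq> words M (n * N + (\<kappa> + length k))"
        proof
          fix b assume "b \<in> (@) k ` W"
          then obtain c where "c \<in> words M (n * N + \<kappa>)" "b = k @ c"
            using W(1) by auto
          then show "b \<in> words M (n * N + (\<kappa> + length k))"
            using k by (auto simp: words_def)
        qed
        show "(\<Sum>b\<in>(@) k ` W. g (drop (length k) b) powr s) = (\<Sum>w\<in>W0. mnorm (mprod A w) powr s) ^ n"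
          using W(2) by (subst sum.reindex) (auto simp: inj_on_def)
        fix b assume "b \<in> (@) k ` W"
        then obtain c where c: "c \<in> W" "b = k @ c" by blast
        show "g (drop (length k) b) > 0" using Wb(1)[OF c(1)] c(2) by simp
        have "mprod A c ** mprod A k - g c *\<^sub>R (Z ** mprod A k) = (mprod A c - g c *\<^sub>R Z) ** mprod A k"
          using matrix_add_rdistrib[of "mprod A c - g c *\<^sub>R Z" "g c *\<^sub>R Z" "mprod A k"]
          by (simp add: scalar_matrix_assoc)
        then have "mnorm (mprod A c ** mprod A k - g c *\<^sub>R (Z ** mprod A k))
            \<le> mnorm (mprod A c - g c *\<^sub>R Z) * mnorm (mprod A k)"
          by (simp add: mnorm_mult)
        also have "\<dots> \<le> (\<epsilon> / K * g c) * K"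
          using Wb[OF c(1)] K \<epsilon>K by (intro mult_mono mnorm_nonneg mult_nonneg_nonneg) auto
        also have "\<dots> = \<epsilon> * g c" using K by simp
        finally show "mnorm (mprod A b - g (drop (length k) b) *\<^sub>R (Z ** mprod A k)) \<le> \<epsilon> * g (drop (length k) b)"
          by (simp add: c(2) mprod_append)
      qed
      then show ?thesis by blast
    qed
    then show "\<exists>\<eta>>0. \<forall>N. \<forall>W0\<subseteq>near_words M A B \<eta> N.
        \<exists>W g. assembled M A s (Z ** mprod A k) \<epsilon> (n * N + (\<kappa> + length k)) n W0 W g"
      using \<eta>(1) by (intro exI[of _ \<eta>]) simp
  qed (rule n(1))
qed

text \<open>Among the realisable matrices choose a nonzero one of minimal rank: multiplying it by itself
  through a connecting word cannot lower the rank, hence is injective on the range.\<close>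

lemma realisable_injective_on_range:
  fixes A :: "nat \<Rightarrow> real^'n^'n"
  assumes irr: "irreducible_tuple M A" and B: "B \<noteq> 0"
  obtains T where "realisable M A s B T" "T \<noteq> 0" "\<And>x. T *v (T *v x) = 0 \<Longrightarrow> T *v x = 0"
proof -
  define R where "R = {Z. realisable M A s B Z \<and> Z \<noteq> 0}"
  have "B \<in> R" using B realisable_base by (auto simp: R_def)
  then obtain Z where Z: "Z \<in> R" "\<And>Y. Y \<in> R \<Longrightarrow> rank Z \<le> rank Y"
    using ex_has_least_nat[of "\<lambda>Z. Z \<in> R" B rank] by blast
  then have "Z \<noteq> 0" by (simp add: R_def)
  then obtain k where k: "k \<in> lists {1..M}" "Z ** mprod A k ** Z \<noteq> 0"
    using irreducible_connecting_word[OF irr] by blast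
  define T where "T = Z ** mprod A k"
  have T: "realisable M A s B T"
    unfolding T_def using Z(1) k(1) by (intro realisable_fixed_word) (auto simp: R_def)
  have TZ: "T ** Z \<in> R"
    using k(2) realisable_mult[OF _ T, of Z] Z(1) by (auto simp: R_def T_def)
  have "rank (T ** Z) \<le> rank Z" by (rule rank_mul_le_right)
  then have "rank (T ** Z) = rank Z"
    using Z(2)[OF TZ] by simp
  then have "dim ((*v) T ` range ((*v) Z)) = dim (range ((*v) Z))"
    by (simp add: rank_dim_range image_image matrix_vector_mul_assoc)
  moreover have "T *v x \<in> range ((*v) Z)" for x
    by (auto simp: T_def simp flip: matrix_vector_mul_assoc)
  ultimately have "T *v x = 0" if "T *v (T *v x) = 0" for x
    using linear_injective_if_dim_image_eq[OF matrix_vector_mul_linear[of T]] that by blast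
  moreover have "T \<noteq> 0" using k(2) by (auto simp: T_def)
  ultimately show ?thesis using that T by blast
qed

text \<open>The assembled words have products close to multiples of a matrix \<open>T\<close> with a stable cone. They map this
  cone into itself and expand it by at least \<open>c * g b\<close>, so the norms of arbitrary concatenations are bounded below
  by the products of the numbers \<open>c * g b\<close>, and the block measure applies.\<close>

lemma sum_near_direction_le:
  fixes A :: "nat \<Rightarrow> real^'n^'n"
  assumes irr: "irreducible_tuple M A" and s: "s > 0" and B: "B \<noteq> 0"
  obtains \<eta> n \<kappa> c where "\<eta> > 0" "n \<ge> 1" "c > 0"
    "\<And>N W0. N \<ge> 1 \<Longrightarrow> W0 \<subseteq> near_words M A B \<eta> N \<Longrightarrow> W0 \<noteq> {} \<Longrightarrow>
      \<exists>\<nu>\<in>invariant_measures M.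
        ereal ((n * ln (\<Sum>w\<in>W0. mnorm (mprod A w) powr s) + s * ln c) / real (n * N + \<kappa>))
          \<le> free_energy A s \<nu>"
proof -
  obtain T where T: "realisable M A s B T" "T \<noteq> 0" "\<And>x. T *v (T *v x) = 0 \<Longrightarrow> T *v x = 0"
    using realisable_injective_on_range[where s = s, OF irr B] by metis
  obtain C x0 \<epsilon> c where C: "x0 \<in> C" "x0 \<noteq> 0" "\<epsilon> > 0" "c > 0"
    "\<And>S x. mnorm (S - T) \<le> \<epsilon> \<Longrightarrow> x \<in> C \<Longrightarrow> S *v x \<in> C \<and> c * norm x \<le> norm (S *v x)"
    "\<And>a x. x \<in> C \<Longrightarrow> a *\<^sub>R x \<in> C"
    using perturbation_stable_cone[OF T(2,3)] by metis
  obtain n \<kappa> where n: "n \<ge> 1" "\<And>\<epsilon>. \<epsilon> > 0 \<Longrightarrow> \<exists>\<eta>>0. \<forall>N. \<forall>W0\<subseteq>near_words M A B \<eta> N.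
      \<exists>W g. assembled M A s T \<epsilon> (n * N + \<kappa>) n W0 W g"
    by (rule realisableE[OF T(1)]) blast
  obtain \<eta> where \<eta>: "\<eta> > 0" "\<forall>N. \<forall>W0\<subseteq>near_words M A B \<eta> N.
      \<exists>W g. assembled M A s T \<epsilon> (n * N + \<kappa>) n W0 W g"
    using n(2)[OF C(3)] by blast
  have "\<exists>\<nu>\<in>invariant_measures M.
      ereal ((n * ln (\<Sum>w\<in>W0. mnorm (mprod A w) powr s) + s * ln c) / real (n * N + \<kappa>))
        \<le> free_energy A s \<nu>"
    if N: "N \<ge> 1" and near: "W0 \<subseteq> near_words M A B \<eta> N" and "W0 \<noteq> {}" for N W0
  proof -
    obtain W g where "assembled M A s T \<epsilon> (n * N + \<kappa>) n W0 W g"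
      using \<eta>(2) near by blast
    then have W: "W \<subseteq> words M (n * N + \<kappa>)"
        "\<And>b. b \<in> W \<Longrightarrow> g b > 0 \<and> mnorm (mprod A b - g b *\<^sub>R T) \<le> \<epsilon> * g b"
        "(\<Sum>b\<in>W. g b powr s) = (\<Sum>w\<in>W0. mnorm (mprod A w) powr s) ^ n"
      by (auto simp: assembled_def)
    have W0: "W0 \<subseteq> words M N" "W0 \<noteq> {}"
      using near \<open>W0 \<noteq> {}\<close> by (auto simp: near_words_def)
    define \<Sigma> where "\<Sigma> = (\<Sum>w\<in>W0. mnorm (mprod A w) powr s)"
    have "mnorm (mprod A w) powr s > 0" if "w \<in> W0" for w
      using near that mnorm_pos_iff[of "mprod A w"] by (auto simp: near_words_def)
    then have \<Sigma>: "\<Sigma> > 0"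
      unfolding \<Sigma>_def using W0 finite_subset[OF W0(1)] by (intro sum_pos) auto
    have "W \<noteq> {}"
      using W(3) \<Sigma> unfolding \<Sigma>_def[symmetric] by auto
    have finW: "finite W" using W(1) finite_subset by blast
    have L: "n * N + \<kappa> > 0" using n(1) N by simp
    have step: "mprod A b *v x \<in> C \<and> c * g b * norm x \<le> norm (mprod A b *v x)"
      if b: "b \<in> W" and x: "x \<in> C" for b x
    proof -
      define S where "S = mprod A b /\<^sub>R g b"
      have gb: "g b > 0" using W(2)[OF b] by simp
      have eq: "S - T = (mprod A b - g b *\<^sub>R T) /\<^sub>R g b"
        using gb by (simp add: S_def scaleR_diff_right)
      have "mnorm (S - T) = mnorm (mprod A b - g b *\<^sub>R T) / g b"
        unfolding eq mnorm_scaleR using gb by (simp add: divide_inverse mult.commute)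
      also have "\<dots> \<le> \<epsilon>"
        using W(2)[OF b] gb by (simp add: pos_divide_le_eq)
      finally have "mnorm (S - T) \<le> \<epsilon>" .
      then have S: "S *v x \<in> C" "c * norm x \<le> norm (S *v x)"
        using C(5) x by blast+
      have Sx: "mprod A b *v x = g b *\<^sub>R (S *v x)"
        using gb by (simp add: S_def flip: scaleR_matrix_vector_assoc)
      have "g b * (c * norm x) \<le> g b * norm (S *v x)"
        using S(2) gb by (intro mult_left_mono) auto
      then show ?thesis
        unfolding Sx using C(6)[OF S(1)] gb by (simp add: mult_ac)
    qed
    have prod: "mprod A (concat bs) *v x0 \<in> C
        \<and> prod_list (map (\<lambda>b. c * g b) bs) * norm x0 \<le> norm (mprod A (concat bs) *v x0)"
      if "set bs \<subseteq> W" for bs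
      using that
    proof (induction bs rule: rev_induct)
      case Nil
      then show ?case using C(1) by simp
    next
      case (snoc b bs)
      let ?y = "mprod A (concat bs) *v x0"
      have b: "b \<in> W" and IH: "?y \<in> C" "prod_list (map (\<lambda>b. c * g b) bs) * norm x0 \<le> norm ?y"
        using snoc by auto
      have eq: "mprod A (concat (bs @ [b])) *v x0 = mprod A b *v ?y"
        by (simp add: mprod_append matrix_vector_mul_assoc)
      have "c * g b * (prod_list (map (\<lambda>b. c * g b) bs) * norm x0) \<le> c * g b * norm ?y"
        using IH(2) C(4) W(2)[OF b] by (intro mult_left_mono) auto
      also have "\<dots> \<le> norm (mprod A b *v ?y)"
        using step[OF b IH(1)] by simp
      finally show ?case
        unfolding eq using step[OF b IH(1)] by (simp add: mult_ac)
    qed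
    have "\<exists>\<nu>\<in>invariant_measures M. ereal (ln (\<Sum>b\<in>W. (c * g b) powr s) / real (n * N + \<kappa>)) \<le> free_energy A s \<nu>"
    proof (rule block_measure_pressure[OF s L finW W(1) \<open>W \<noteq> {}\<close> _ zero_less_one])
      show "c * g b > 0" if "b \<in> W" for b using W(2)[OF that] C(4) by simp
      fix bs assume "set bs \<subseteq> W"
      then have "prod_list (map (\<lambda>b. c * g b) bs) * norm x0 \<le> mnorm (mprod A (concat bs)) * norm x0"
        using prod norm_matrix_vector_le order_trans by blast
      then show "1 * prod_list (map (\<lambda>b. c * g b) bs) \<le> mnorm (mprod A (concat bs))"
        using C(2) by simp
    qed
    also have "(\<Sum>b\<in>W. (c * g b) powr s) = c powr s * \<Sigma> ^ n"
      using W C(4) unfolding \<Sigma>_def by (simp add: powr_mult less_imp_le flip: sum_distrib_left)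
    also have "ln (c powr s * \<Sigma> ^ n) = n * ln \<Sigma> + s * ln c"
      using C(4) \<Sigma> by (simp add: ln_mult_pos ln_powr ln_realpow)
    finally show ?thesis unfolding \<Sigma>_def .
  qed
  then show ?thesis
    using that[OF \<eta>(1) n(1) C(4)] by blast
qed

text \<open>The one-letter word \<open>[i]\<close> points exactly in its own direction and provides a nonempty set of words.\<close>

lemma exists_finite_free_energy:
  fixes A :: "nat \<Rightarrow> real^'n^'n"
  assumes irr: "irreducible_tuple M A" and s: "s > 0" and i: "i \<in> {1..M}" "A i \<noteq> 0"
  obtains \<nu> p where "\<nu> \<in> invariant_measures M" "ereal p \<le> free_energy A s \<nu>"
proof -
  define B where "B = A i /\<^sub>R mnorm (A i)"
  have pos: "mnorm (A i) > 0" using i(2) mnorm_pos_iff by blast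
  then have "B \<noteq> 0" using i(2) by (simp add: B_def)
  obtain \<eta> n \<kappa> c where *: "\<eta> > 0" "n \<ge> 1" "c > 0"
    "\<And>N W0. N \<ge> 1 \<Longrightarrow> W0 \<subseteq> near_words M A B \<eta> N \<Longrightarrow> W0 \<noteq> {} \<Longrightarrow>
      \<exists>\<nu>\<in>invariant_measures M.
        ereal ((n * ln (\<Sum>w\<in>W0. mnorm (mprod A w) powr s) + s * ln c) / real (n * N + \<kappa>))
          \<le> free_energy A s \<nu>"
    by (rule sum_near_direction_le[OF irr s \<open>B \<noteq> 0\<close>]) blast
  have "mprod A [i] - mnorm (mprod A [i]) *\<^sub>R B = 0"
    using pos by (simp add: B_def)
  then have "mnorm (mprod A [i] - mnorm (mprod A [i]) *\<^sub>R B) = 0"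
    using mnorm_eq_0_iff by blast
  then have "\<exists>\<nu>\<in>invariant_measures M.
        ereal ((n * ln (\<Sum>w\<in>{[i]}. mnorm (mprod A w) powr s) + s * ln c) / real (n * 1 + \<kappa>))
          \<le> free_energy A s \<nu>"
    using i *(1) mnorm_nonneg[of "A i"] by (intro *(4)) (auto simp: words_def near_words_def)
  then show ?thesis using that by blast
qed

lemma sum_UNION_le:
  fixes f :: "'a \<Rightarrow> real"
  assumes "finite D" "\<And>B. B \<in> D \<Longrightarrow> finite (S B)" "\<And>x. 0 \<le> f x"
  shows "sum f (\<Union>B\<in>D. S B) \<le> (\<Sum>B\<in>D. sum f (S B))"
  using assms(1,2)
proof (induction D rule: finite_induct)
  case (insert B D)
  have "sum f (\<Union>B\<in>insert B D. S B)
      = sum f (S B) + sum f (\<Union>B\<in>D. S B) - sum f (S B \<inter> (\<Union>B\<in>D. S B))"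
    using insert by (simp add: sum_Un)
  also have "\<dots> \<le> sum f (S B) + (\<Sum>B\<in>D. sum f (S B)) - 0"
    using insert assms(3) by (intro diff_mono add_left_mono sum_nonneg) auto
  finally show ?case using insert by simp
qed simp

text \<open>Covering the unit sphere of matrices by finitely many neighbourhoods as above gives the bound
  for all words.\<close>

lemma sum_norms_le_exp_pressure:
  fixes A :: "nat \<Rightarrow> real^'n^'n"
  assumes irr: "irreducible_tuple M A" and s: "s > 0"
    and P: "\<And>\<nu>. \<nu> \<in> invariant_measures M \<Longrightarrow> free_energy A s \<nu> \<le> ereal P"
  obtains C where "C > 0" "\<And>N. (\<Sum>w\<in>words M N. mnorm (mprod A w) powr s) \<le> C * exp (N * P)"
proof -
  define f where "f w = mnorm (mprod A w) powr s" for w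
  define near where "near B \<eta> N = near_words M A B \<eta> N" for B \<eta> N
  have local: "\<exists>\<eta>>0. \<exists>C\<ge>0. \<forall>N\<ge>1. (\<Sum>w\<in>near B \<eta> N. f w) \<le> C * exp (N * P)" if B: "B \<noteq> 0" for B
  proof -
    obtain \<eta> n \<kappa> c where *: "\<eta> > 0" "n \<ge> 1" "c > 0"
      "\<And>N W0. N \<ge> 1 \<Longrightarrow> W0 \<subseteq> near_words M A B \<eta> N \<Longrightarrow> W0 \<noteq> {} \<Longrightarrow>
        \<exists>\<nu>\<in>invariant_measures M.
          ereal ((n * ln (\<Sum>w\<in>W0. mnorm (mprod A w) powr s) + s * ln c) / real (n * N + \<kappa>))
            \<le> free_energy A s \<nu>"
      by (rule sum_near_direction_le[OF irr s B]) blast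
    have "(\<Sum>w\<in>near B \<eta> N. f w) \<le> exp ((\<kappa> * P - s * ln c) / n) * exp (N * P)" if N: "N \<ge> 1" for N
    proof (cases "near B \<eta> N = {}")
      case False
      define \<Sigma> where "\<Sigma> = (\<Sum>w\<in>near B \<eta> N. f w)"
      have "finite (near B \<eta> N)"
        by (rule finite_subset[OF _ finite_words[of M N]]) (auto simp: near_words_def near_def)
      then have \<Sigma>: "\<Sigma> > 0"
        unfolding \<Sigma>_def f_def using False
        by (intro sum_pos) (auto simp: near_words_def near_def mnorm_eq_0_iff)
      obtain \<nu> where \<nu>: "\<nu> \<in> invariant_measures M"
          "ereal ((n * ln \<Sigma> + s * ln c) / real (n * N + \<kappa>)) \<le> free_energy A s \<nu>"
        using *(4)[OF N _ False] unfolding \<Sigma>_def f_def near_def by blast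
      have "(n * ln \<Sigma> + s * ln c) / real (n * N + \<kappa>) \<le> P"
        using order_trans[OF \<nu>(2) P[OF \<nu>(1)]] by simp
      moreover have "real (n * N + \<kappa>) > 0"
        using *(2) N by (simp add: add_pos_nonneg)
      ultimately have "n * ln \<Sigma> + s * ln c \<le> P * real (n * N + \<kappa>)"
        by (simp only: pos_divide_le_eq)
      then have "ln \<Sigma> \<le> (\<kappa> * P - s * ln c) / n + N * P"
        using *(2) by (simp add: field_simps)
      then have "\<Sigma> \<le> exp ((\<kappa> * P - s * ln c) / n + N * P)"
        using \<Sigma> by (metis exp_le_cancel_iff exp_ln)
      then show ?thesis unfolding \<Sigma>_def by (simp add: exp_add)
    qed simp
    then show ?thesis
      using *(1) by (meson exp_ge_zero)
  qed
  define S where "S = {B :: real^'n^'n. mnorm B = 1}"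
  have nz: "B \<noteq> 0" if "B \<in> S" for B
    using that mnorm_eq_0_iff[of B] unfolding S_def by auto
  obtain \<eta> C where \<eta>C: "\<And>B. B \<in> S \<Longrightarrow> \<eta> B > 0 \<and> C B \<ge> 0
      \<and> (\<forall>N\<ge>1. (\<Sum>w\<in>near B (\<eta> B) N. f w) \<le> C B * exp (N * P))"
    using local[OF nz] by metis
  have comp: "compact S"
    unfolding compact_eq_bounded_closed
  proof
    show "bounded S"
      unfolding bounded_iff S_def using norm_le_mnorm by (metis (mono_tags, lifting) mem_Collect_eq mult.right_neutral)
    show "closed S"
      unfolding closed_sequential_limits
    proof (intro allI impI)
      fix X L assume X: "(\<forall>n. X n \<in> S) \<and> X \<longlonglongrightarrow> L"
      then have "(\<lambda>n. mnorm (X n)) \<longlonglongrightarrow> mnorm L"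
        by (intro mnorm_tendsto) auto
      then have "(\<lambda>n. 1) \<longlonglongrightarrow> mnorm L"
        using X by (simp add: S_def)
      then show "L \<in> S"
        by (simp add: S_def LIMSEQ_const_iff)
    qed
  qed
  have cov: "S \<subseteq> (\<Union>B\<in>S. ball B (\<eta> B))"
    using \<eta>C by (intro subsetI UN_I) auto
  have op: "open (ball B (\<eta> B))" if "B \<in> S" for B
    by simp
  obtain D where D: "D \<subseteq> S" "finite D" "S \<subseteq> (\<Union>B\<in>D. ball B (\<eta> B))"
    by (rule compactE_image[OF comp op cov])
  define C' where "C' = (\<Sum>B\<in>D. C B) + 1"
  have C'_pos: "C' > 0"
    unfolding C'_def using D \<eta>C by (intro add_nonneg_pos sum_nonneg) auto
  have "(\<Sum>w\<in>words M N. f w) \<le> C' * exp (N * P)" for N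
  proof (cases "N = 0")
    case True
    have "f [] = 1"
      unfolding f_def mprod.simps by (subst mnorm_mat_1) simp
    then show ?thesis
      using True D \<eta>C by (auto simp: C'_def intro!: sum_nonneg)
  next
    case False
    have "(\<Sum>w\<in>words M N. f w) = (\<Sum>w\<in>{w \<in> words M N. mprod A w \<noteq> 0}. f w)"
      by (intro sum.mono_neutral_right) (auto simp: f_def mnorm_eq_0_iff)
    also have "\<dots> \<le> (\<Sum>w\<in>(\<Union>B\<in>D. near B (\<eta> B) N). f w)"
    proof (rule sum_mono2)
      show "finite (\<Union>B\<in>D. near B (\<eta> B) N)"
        using D(2) finite_subset[OF _ finite_words[of M N]] by (auto simp: near_words_def near_def)
      show "{w \<in> words M N. mprod A w \<noteq> 0} \<subseteq> (\<Union>B\<in>D. near B (\<eta> B) N)"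
      proof
        fix w assume w: "w \<in> {w \<in> words M N. mprod A w \<noteq> 0}"
        define m where "m = mnorm (mprod A w)"
        have m: "m > 0" unfolding m_def using w mnorm_pos_iff by blast
        then have "mprod A w /\<^sub>R m \<in> S"
          by (simp add: S_def mnorm_scaleR m_def)
        then obtain B where B: "B \<in> D" "norm (mprod A w /\<^sub>R m - B) < \<eta> B"
          using D(3) by (auto simp: dist_norm norm_minus_commute)
        have "mprod A w - m *\<^sub>R B = m *\<^sub>R (mprod A w /\<^sub>R m - B)"
          using m by (simp add: scaleR_diff_right)
        then have "mnorm (mprod A w - m *\<^sub>R B) = m * mnorm (mprod A w /\<^sub>R m - B)"
          using m by (simp add: mnorm_scaleR)
        also have "\<dots> \<le> m * \<eta> B"
          using m B(2) mnorm_le_norm[of "mprod A w /\<^sub>R m - B"] by (intro mult_left_mono) auto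
        finally have "w \<in> near B (\<eta> B) N"
          using w by (simp add: near_words_def near_def m_def mult.commute)
        then show "w \<in> (\<Union>B\<in>D. near B (\<eta> B) N)" using B(1) by blast
      qed
    qed (simp add: f_def)
    also have "\<dots> \<le> (\<Sum>B\<in>D. \<Sum>w\<in>near B (\<eta> B) N. f w)"
      using D(2) finite_subset[OF _ finite_words[of M N]]
      by (intro sum_UNION_le) (auto simp: near_words_def near_def f_def)
    also have "\<dots> \<le> (\<Sum>B\<in>D. C B * exp (N * P))"
      using D(1) \<eta>C False by (intro sum_mono) (auto simp: Suc_le_eq)
    also have "\<dots> \<le> C' * exp (N * P)"
      by (simp add: C'_def distrib_right flip: sum_distrib_right)
    finally show ?thesis .
  qed
  then show ?thesis
    using that C'_pos unfolding f_def by blast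
qed

section \<open>Equilibrium states with product structure\<close>

text \<open>Suppose that the words of length \<open>n\<close> have product weights \<open>prod_list (map p w)\<close> and that these
  weights are optimal in the variational sense (assumption \<open>optimal\<close>). The nonnegative function \<open>\<Phi>\<close>
  below is superharmonic, so along the random product the mean of
  \<open>ln (exp (- n P) \<Phi> (mprod A w) / prod_list (map p w))\<close> decreases; optimality bounds it from below,
  so its increments tend to zero. An increment is a mean of relative entropies between \<open>p\<close> and
  the transition weights of \<open>\<Phi>\<close>. In the limit one finds a nonzero matrix \<open>U\<close> on which these
  weights agree up to constants, and by irreducibility the resulting upper bound for the norms of
  \<open>mprod A v ** U\<close> extends to all vectors.\<close>

locale product_weights =
  fixes M :: nat and A :: "nat \<Rightarrow> real^'n^'n" and s P C :: real and p :: "nat \<Rightarrow> real"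
  assumes irr: "irreducible_tuple M A" and s: "s > 0" and C: "C > 0"
    and upper: "\<And>N. (\<Sum>w\<in>words M N. mnorm (mprod A w) powr s) \<le> C * exp (N * P)"
    and p: "\<And>i. i \<in> {1..M} \<Longrightarrow> 0 \<le> p i" "(\<Sum>i\<in>{1..M}. p i) = 1"
    and nonzero: "\<And>n w. w \<in> words M n \<Longrightarrow> prod_list (map p w) > 0 \<Longrightarrow> mprod A w \<noteq> 0"
    and optimal: "\<And>n. n * P \<le> (\<Sum>w\<in>words M n.
      prod_list (map p w) * (s * ln (mnorm (mprod A w)) - ln (prod_list (map p w))))"
begin

abbreviation weight :: "nat list \<Rightarrow> real" where
  "weight w \<equiv> prod_list (map p w)"

lemma weight_nonneg: "w \<in> words M n \<Longrightarrow> 0 \<le> weight w"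
  by (rule prod_list_nonneg) (use p(1) in \<open>auto simp: words_def subset_eq\<close>)

lemma sum_weight: "sum weight (words M n) = 1"
  using sum_words_prod_list[of p M n] p(2) by simp

text \<open>By \<open>upper\<close> and irreducibility these numbers lie between constant multiples of \<open>mnorm B powr s\<close>,
  uniformly in \<open>n\<close>.\<close>

definition a :: "nat \<Rightarrow> real^'n^'n \<Rightarrow> real" where
  "a n B = exp (- (n * P)) * (\<Sum>w\<in>words M n. mnorm (mprod A w ** B) powr s)"

lemma a_nonneg: "0 \<le> a n B"
  by (simp add: a_def sum_nonneg)

lemma a_add: "a (m + n) B = (\<Sum>v\<in>words M m. exp (- (m * P)) * a n (mprod A v ** B))"
proof -
  have "a (m + n) B = exp (- (m * P)) * exp (- (n * P))
      * (\<Sum>v\<in>words M m. \<Sum>w\<in>words M n. mnorm (mprod A w ** (mprod A v ** B)) powr s)"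
    by (simp add: a_def sum_words_add mprod_append matrix_mul_assoc ring_distribs exp_add[symmetric])
  then show ?thesis
    by (simp add: a_def sum_distrib_left mult.assoc)
qed

lemma a_le: "a n B \<le> C * mnorm B powr s"
proof -
  have "(\<Sum>w\<in>words M n. mnorm (mprod A w ** B) powr s)
      \<le> (\<Sum>w\<in>words M n. mnorm (mprod A w) powr s * mnorm B powr s)"
    using s by (intro sum_mono) (simp add: powr_mono2 mnorm_mult mnorm_nonneg flip: powr_mult)
  also have "\<dots> \<le> C * exp (n * P) * mnorm B powr s"
    using upper[of n] by (simp add: mult_right_mono flip: sum_distrib_right)
  finally have "a n B \<le> exp (- (n * P)) * (C * exp (n * P) * mnorm B powr s)"
    unfolding a_def by (intro mult_left_mono) auto
  also have "\<dots> = C * mnorm B powr s"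
    by (simp add: exp_minus)
  finally show ?thesis .
qed

text \<open>The Gibbs inequality turns optimality of the weights into a lower bound for the sum of norms.\<close>

lemma weights_le_norms: "1 \<le> (\<Sum>w\<in>words M n. exp (- (n * P)) * mnorm (mprod A w) powr s)"
proof -
  define Y where "Y w = exp (- (n * P)) * mnorm (mprod A w) powr s" for w
  define S where "S = (\<Sum>w\<in>words M n. Y w)"
  have Ypos: "Y w > 0" if "w \<in> words M n" "weight w > 0" for w
    using nonzero[OF that] mnorm_eq_0_iff[of "mprod A w"] by (simp add: Y_def)
  have "\<exists>w\<in>words M n. weight w > 0"
    using sum_weight[of n] weight_nonneg by (metis less_eq_real_def sum.neutral zero_neq_one)
  then have S: "S > 0"
    unfolding S_def using Ypos by (auto intro!: sum_pos2 simp: Y_def)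
  have "0 \<le> (\<Sum>w\<in>words M n. weight w * ln (weight w / (Y w / S)))"
    using weight_nonneg Ypos S
    by (intro relative_entropy_nonneg sum_weight) (auto simp: Y_def S_def simp flip: sum_divide_distrib)
  also have "\<dots> = (\<Sum>w\<in>words M n. weight w * (ln S + n * P)
      - weight w * (s * ln (mnorm (mprod A w)) - ln (weight w)))"
  proof (intro sum.cong refl)
    fix w assume w: "w \<in> words M n"
    show "weight w * ln (weight w / (Y w / S))
        = weight w * (ln S + n * P) - weight w * (s * ln (mnorm (mprod A w)) - ln (weight w))"
    proof (cases "weight w = 0")
      case False
      then have pos: "weight w > 0" using weight_nonneg[OF w] by simp
      have m: "mnorm (mprod A w) > 0" using nonzero[OF w pos] mnorm_pos_iff by blast
      have "ln (weight w / (Y w / S)) = ln (weight w) - (ln (Y w) - ln S)"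
        using pos Ypos[OF w pos] S by (simp add: ln_div ln_mult_pos)
      also have "ln (Y w) = - (n * P) + s * ln (mnorm (mprod A w))"
        using m by (simp add: Y_def ln_mult_pos ln_powr)
      finally have "ln (weight w / (Y w / S))
          = (ln S + n * P) - (s * ln (mnorm (mprod A w)) - ln (weight w))" by simp
      then show ?thesis by (simp only: right_diff_distrib)
    qed simp
  qed
  also have "\<dots> = ln S + n * P - (\<Sum>w\<in>words M n. weight w * (s * ln (mnorm (mprod A w)) - ln (weight w)))"
    by (simp add: sum_subtractf sum_weight flip: sum_distrib_right)
  finally have "0 \<le> ln S"
    using optimal[of n] by simp
  then show ?thesis
    using S unfolding S_def Y_def by simp
qed

text \<open>The sum of the norms of all words of length \<open>n\<close> is at least \<open>exp (n * P)\<close>. Connecting words \<open>k\<close>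
  link each of these words to \<open>B\<close> with a uniform constant. The word \<open>k @ w\<close> is longer than \<open>w\<close>;
  splitting it after \<open>n\<close> letters and bounding the last \<open>length k\<close> letters by \<open>upper\<close> costs only
  a constant factor.\<close>

lemma a_ge: obtains \<delta> where "\<delta> > 0" "\<And>n B. \<delta> * mnorm B powr s \<le> a n B"
proof -
  obtain K \<delta> where K: "finite K" "K \<subseteq> lists {1..M}" "\<delta> > 0"
    "\<And>X Y. \<exists>k\<in>K. \<delta> * mnorm X * mnorm Y \<le> mnorm (X ** mprod A k ** Y)"
    by (rule irreducible_uniform_connection[OF irr]) blast
  define D where "D = C * (\<Sum>k\<in>K. exp (length k * P)) + 1"
  have D: "D > 0"
    unfolding D_def using C by (intro add_nonneg_pos mult_nonneg_nonneg sum_nonneg) auto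
  have "\<delta> powr s / D * mnorm B powr s \<le> a n B" for n B
  proof -
    have word: "\<delta> powr s * mnorm (mprod A w) powr s * mnorm B powr s
        \<le> (\<Sum>k\<in>K. mnorm (mprod A w ** mprod A k ** B) powr s)" for w
    proof -
      obtain k where k: "k \<in> K" "\<delta> * mnorm (mprod A w) * mnorm B \<le> mnorm (mprod A w ** mprod A k ** B)"
        using K(4) by blast
      have "\<delta> powr s * mnorm (mprod A w) powr s * mnorm B powr s = (\<delta> * mnorm (mprod A w) * mnorm B) powr s"
        using K(3) by (simp add: powr_mult mnorm_nonneg)
      also have "\<dots> \<le> mnorm (mprod A w ** mprod A k ** B) powr s"
        using K(3) k(2) s by (intro powr_mono2 mult_nonneg_nonneg mnorm_nonneg) auto
      also have "\<dots> \<le> (\<Sum>k\<in>K. mnorm (mprod A w ** mprod A k ** B) powr s)"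
        using k(1) K(1) by (intro member_le_sum) auto
      finally show ?thesis .
    qed
    have bridge: "exp (- (n * P)) * (\<Sum>w\<in>words M n. mnorm (mprod A w ** mprod A k ** B) powr s)
        \<le> exp (length k * P) * (C * a n B)" if k: "k \<in> K" for k
    proof -
      define j where "j = length k"
      have kj: "k \<in> words M j" using K(2) k by (auto simp: words_def j_def)
      have "exp (- (j * P)) * a n (mprod A k ** B) \<le> (\<Sum>v\<in>words M j. exp (- (j * P)) * a n (mprod A v ** B))"
        using kj by (intro member_le_sum) (auto simp: a_nonneg)
      also have "\<dots> = a (n + j) B"
        by (simp add: a_add[symmetric] add.commute)
      also have "\<dots> = (\<Sum>v\<in>words M n. exp (- (n * P)) * a j (mprod A v ** B))"
        by (rule a_add)
      also have "\<dots> \<le> (\<Sum>v\<in>words M n. exp (- (n * P)) * (C * mnorm (mprod A v ** B) powr s))"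
        by (intro sum_mono mult_left_mono a_le) auto
      also have "\<dots> = C * a n B"
        by (simp add: a_def sum_distrib_left mult_ac)
      finally have "exp (j * P) * (exp (- (j * P)) * a n (mprod A k ** B)) \<le> exp (j * P) * (C * a n B)"
        by (intro mult_left_mono) auto
      then have "a n (mprod A k ** B) \<le> exp (j * P) * (C * a n B)"
        by (simp add: mult.assoc[symmetric] flip: exp_add)
      moreover have "exp (- (n * P)) * (\<Sum>w\<in>words M n. mnorm (mprod A w ** mprod A k ** B) powr s)
          = a n (mprod A k ** B)"
        by (simp add: a_def matrix_mul_assoc)
      ultimately show ?thesis
        by (simp add: j_def)
    qed
    have "\<delta> powr s * mnorm B powr s * 1
        \<le> \<delta> powr s * mnorm B powr s * (\<Sum>w\<in>words M n. exp (- (n * P)) * mnorm (mprod A w) powr s)"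
      using weights_le_norms[of n] by (intro mult_left_mono) auto
    also have "\<dots> = (\<Sum>w\<in>words M n. exp (- (n * P)) * (\<delta> powr s * mnorm (mprod A w) powr s * mnorm B powr s))"
      by (simp add: sum_distrib_left mult_ac)
    also have "\<dots> \<le> (\<Sum>w\<in>words M n. exp (- (n * P)) * (\<Sum>k\<in>K. mnorm (mprod A w ** mprod A k ** B) powr s))"
      by (intro sum_mono mult_left_mono word) auto
    also have "\<dots> = (\<Sum>k\<in>K. exp (- (n * P)) * (\<Sum>w\<in>words M n. mnorm (mprod A w ** mprod A k ** B) powr s))"
      by (simp add: sum_distrib_left sum.swap[of _ K])
    also have "\<dots> \<le> (\<Sum>k\<in>K. exp (length k * P) * (C * a n B))"
      by (intro sum_mono bridge)
    also have "\<dots> = (D - 1) * a n B"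
      by (simp add: D_def sum_distrib_right sum_distrib_left mult_ac)
    also have "\<dots> \<le> D * a n B"
      using a_nonneg[of n B] by (simp add: algebra_simps)
    finally show ?thesis
      using D by (simp add: pos_divide_le_eq mult.commute)
  qed
  moreover have "\<delta> powr s / D > 0" using K(3) D by simp
  ultimately show ?thesis using that by blast
qed

definition tail_inf :: "nat \<Rightarrow> real^'n^'n \<Rightarrow> real" where
  "tail_inf N B = (INF n\<in>{N..}. a n B)"

text \<open>The lower limit of \<open>a n B\<close>. It inherits the upper and lower bounds for \<open>a n B\<close>, and Fatou's lemma makes it
  superharmonic.\<close>

definition \<Phi> :: "real^'n^'n \<Rightarrow> real" where
  "\<Phi> B = (SUP N. tail_inf N B)"

lemma bdd_below_a: "bdd_below ((\<lambda>n. a n B) ` S)"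
  by (rule bdd_belowI[of _ 0]) (auto simp: a_nonneg)

lemma tail_inf_le: "N \<le> n \<Longrightarrow> tail_inf N B \<le> a n B"
  unfolding tail_inf_def by (rule cINF_lower[OF bdd_below_a]) simp

lemma tail_inf_tendsto: "(\<lambda>N. tail_inf N B) \<longlonglongrightarrow> \<Phi> B"
  unfolding \<Phi>_def
proof (rule LIMSEQ_incseq_SUP)
  show "bdd_above (range (\<lambda>N. tail_inf N B))"
    by (rule bdd_aboveI[of _ "C * mnorm B powr s"])
      (auto intro: order_trans[OF tail_inf_le a_le])
  show "incseq (\<lambda>N. tail_inf N B)"
    unfolding incseq_def tail_inf_def
    by (auto intro!: cINF_superset_mono bdd_below_a)
qed

lemma \<Phi>_le: "\<Phi> B \<le> C * mnorm B powr s"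
  by (rule LIMSEQ_le_const2[OF tail_inf_tendsto]) (auto intro: order_trans[OF tail_inf_le a_le])

lemma \<Phi>_ge:
  assumes "\<And>n. \<delta> \<le> a n B"
  shows "\<delta> \<le> \<Phi> B"
  by (rule LIMSEQ_le_const[OF tail_inf_tendsto])
    (auto simp: tail_inf_def intro!: cINF_greatest assms)

lemma \<Phi>_superharmonic: "(\<Sum>v\<in>words M m. exp (- (m * P)) * \<Phi> (mprod A v ** B)) \<le> \<Phi> B"
proof (rule LIMSEQ_le)
  show "(\<lambda>N. \<Sum>v\<in>words M m. exp (- (m * P)) * tail_inf N (mprod A v ** B))
      \<longlonglongrightarrow> (\<Sum>v\<in>words M m. exp (- (m * P)) * \<Phi> (mprod A v ** B))"
    by (intro tendsto_sum tendsto_mult tendsto_const tail_inf_tendsto)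
  show "(\<lambda>N. tail_inf (N + m) B) \<longlonglongrightarrow> \<Phi> B"
    using tail_inf_tendsto by (rule LIMSEQ_ignore_initial_segment)
  show "\<exists>N0. \<forall>N\<ge>N0. (\<Sum>v\<in>words M m. exp (- (m * P)) * tail_inf N (mprod A v ** B)) \<le> tail_inf (N + m) B"
  proof (intro exI allI impI)
    fix N
    show "(\<Sum>v\<in>words M m. exp (- (m * P)) * tail_inf N (mprod A v ** B)) \<le> tail_inf (N + m) B"
      unfolding tail_inf_def[of "N + m"]
    proof (rule cINF_greatest)
      fix n assume "n \<in> {N + m..}"
      then have n: "n = m + (n - m)" "N \<le> n - m" by auto
      have "(\<Sum>v\<in>words M m. exp (- (m * P)) * tail_inf N (mprod A v ** B))
          \<le> (\<Sum>v\<in>words M m. exp (- (m * P)) * a (n - m) (mprod A v ** B))"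
        by (intro sum_mono mult_left_mono tail_inf_le n(2)) auto
      also have "\<dots> = a n B"
        by (subst (2) n(1)) (rule a_add[symmetric])
      finally show "(\<Sum>v\<in>words M m. exp (- (m * P)) * tail_inf N (mprod A v ** B)) \<le> a n B" .
    qed simp
  qed
qed

text \<open>\<open>transition B\<close> are the weights of \<open>\<Phi>\<close> seen from \<open>B\<close>, and \<open>defect\<close> is the relative entropy of
  the product weights with respect to them.\<close>

definition transition :: "real^'n^'n \<Rightarrow> nat \<Rightarrow> nat list \<Rightarrow> real" where
  "transition B k v = exp (- (k * P)) * \<Phi> (mprod A v ** B) / \<Phi> B"

definition defect :: "real^'n^'n \<Rightarrow> nat \<Rightarrow> real" where
  "defect B k = (\<Sum>v\<in>words M k. weight v * ln (weight v / transition B k v))"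

definition potential :: "nat \<Rightarrow> real" where
  "potential n = (\<Sum>w\<in>words M n. weight w * ln (exp (- (n * P)) * \<Phi> (mprod A w) / weight w))"

lemma \<Phi>_nonneg: "0 \<le> \<Phi> B"
  by (rule \<Phi>_ge) (rule a_nonneg)

lemma \<Phi>_pos: "B \<noteq> 0 \<Longrightarrow> \<Phi> B > 0"
proof -
  assume "B \<noteq> 0"
  then have "mnorm B > 0" using mnorm_pos_iff by blast
  obtain \<delta> where "\<delta> > 0" "\<And>n B. \<delta> * mnorm B powr s \<le> a n B"
    by (rule a_ge) blast
  then have "\<delta> * mnorm B powr s \<le> \<Phi> B" by (intro \<Phi>_ge)
  moreover have "\<delta> * mnorm B powr s > 0"
    using \<open>\<delta> > 0\<close> \<open>mnorm B > 0\<close> by simp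
  ultimately show ?thesis by linarith
qed

lemma transition_facts:
  assumes "\<Phi> B > 0"
  shows "0 \<le> transition B k v" "sum (transition B k) (words M k) \<le> 1"
proof -
  show "0 \<le> transition B k v" using assms \<Phi>_nonneg by (simp add: transition_def)
  have "sum (transition B k) (words M k) = (\<Sum>v\<in>words M k. exp (- (k * P)) * \<Phi> (mprod A v ** B)) / \<Phi> B"
    by (simp add: transition_def sum_divide_distrib)
  also have "\<dots> \<le> 1"
    using \<Phi>_superharmonic[of k B] assms by (simp add: pos_divide_le_eq)
  finally show "sum (transition B k) (words M k) \<le> 1" .
qed

lemma transition_pos:
  assumes w: "w \<in> words M n" "weight w > 0" and v: "v \<in> words M k" "weight v > 0"
  shows "0 < transition (mprod A w) k v"
proof -
  have "w @ v \<in> words M (n + k)" "weight (w @ v) > 0"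
    using w v by (auto simp: words_def)
  then have "mprod A v ** mprod A w \<noteq> 0"
    using nonzero[of "w @ v"] by (simp add: mprod_append)
  then show ?thesis
    using \<Phi>_pos nonzero[OF w] by (simp add: transition_def)
qed

lemma defect_nonneg:
  assumes w: "w \<in> words M n" "weight w > 0"
  shows "0 \<le> defect (mprod A w) k"
  unfolding defect_def
  using transition_facts[OF \<Phi>_pos[OF nonzero[OF w]]] transition_pos[OF w] weight_nonneg
  by (intro relative_entropy_nonneg sum_weight) auto

lemma potential_decrease:
  "potential n - potential (n + k) = (\<Sum>w\<in>words M n. weight w * defect (mprod A w) k)"
proof -
  define \<phi> where "\<phi> n w = ln (exp (- (real n * P)) * \<Phi> (mprod A w) / weight w)" for n w
  have "potential (n + k) = (\<Sum>w\<in>words M n. \<Sum>v\<in>words M k. weight w * weight v * \<phi> (n + k) (w @ v))"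
    unfolding potential_def \<phi>_def by (simp only: sum_words_add map_append prod_list.append)
  also have "\<dots> = (\<Sum>w\<in>words M n. \<Sum>v\<in>words M k. weight w * \<phi> n w * weight v
      - weight w * (weight v * ln (weight v / transition (mprod A w) k v)))"
  proof (intro sum.cong refl)
    fix w v assume w: "w \<in> words M n" and v: "v \<in> words M k"
    show "weight w * weight v * \<phi> (n + k) (w @ v)
        = weight w * \<phi> n w * weight v - weight w * (weight v * ln (weight v / transition (mprod A w) k v))"
    proof (cases "weight w = 0 \<or> weight v = 0")
      case False
      then have pos: "weight w > 0" "weight v > 0"
        using weight_nonneg[OF w] weight_nonneg[OF v] by auto
      have "w @ v \<in> words M (n + k)" "weight (w @ v) > 0"
        using w v pos by (auto simp: words_def)
      then have "mprod A v ** mprod A w \<noteq> 0"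
        using nonzero[of "w @ v"] by (simp add: mprod_append)
      then have \<Phi>: "\<Phi> (mprod A v ** mprod A w) > 0" "\<Phi> (mprod A w) > 0"
        using \<Phi>_pos nonzero[OF w pos(1)] by auto
      have "\<phi> (n + k) (w @ v) = - ((n + k) * P) + ln (\<Phi> (mprod A v ** mprod A w)) - (ln (weight w) + ln (weight v))"
        using \<Phi> pos by (simp add: \<phi>_def mprod_append ln_div ln_mult_pos)
      moreover have "\<phi> n w = - (n * P) + ln (\<Phi> (mprod A w)) - ln (weight w)"
        using \<Phi> pos by (simp add: \<phi>_def ln_div ln_mult_pos)
      moreover have "ln (weight v / transition (mprod A w) k v)
          = ln (weight v) - (- (k * P) + ln (\<Phi> (mprod A v ** mprod A w)) - ln (\<Phi> (mprod A w)))"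
        using \<Phi> pos transition_pos[OF w pos(1) v pos(2)]
        by (simp add: transition_def ln_div ln_mult_pos)
      ultimately have "\<phi> (n + k) (w @ v) = \<phi> n w - ln (weight v / transition (mprod A w) k v)"
        by (simp add: algebra_simps)
      then show ?thesis by (simp add: right_diff_distrib mult_ac)
    qed auto
  qed
  also have "\<dots> = (\<Sum>w\<in>words M n. weight w * \<phi> n w * sum weight (words M k) - weight w * defect (mprod A w) k)"
    by (simp add: sum_subtractf sum_distrib_left defect_def)
  also have "\<dots> = potential n - (\<Sum>w\<in>words M n. weight w * defect (mprod A w) k)"
    by (simp add: sum_weight sum_subtractf potential_def \<phi>_def)
  finally show ?thesis by simp
qed

text \<open>As \<open>\<Phi> B\<close> is at least a multiple of \<open>mnorm B powr s\<close>, this is the optimality of the weights.\<close>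

lemma potential_bounded_below: obtains b where "\<And>n. b \<le> potential n"
proof -
  obtain \<delta> where \<delta>: "\<delta> > 0" "\<And>n B. \<delta> * mnorm B powr s \<le> a n B"
    by (rule a_ge) blast
  have "ln \<delta> \<le> potential n" for n
  proof -
    have "(\<Sum>w\<in>words M n. weight w * (ln \<delta> - n * P) + weight w * (s * ln (mnorm (mprod A w)) - ln (weight w)))
        \<le> potential n"
      unfolding potential_def
    proof (rule sum_mono)
      fix w assume w: "w \<in> words M n"
      show "weight w * (ln \<delta> - n * P) + weight w * (s * ln (mnorm (mprod A w)) - ln (weight w))
          \<le> weight w * ln (exp (- (n * P)) * \<Phi> (mprod A w) / weight w)"
      proof (cases "weight w = 0")
        case False
        then have pos: "weight w > 0" using weight_nonneg[OF w] by simp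
        have m: "mnorm (mprod A w) > 0" using nonzero[OF w pos] mnorm_pos_iff by blast
        have \<Phi>: "\<Phi> (mprod A w) > 0" using \<Phi>_pos nonzero[OF w pos] by blast
        have "ln (\<delta> * mnorm (mprod A w) powr s) \<le> ln (\<Phi> (mprod A w))"
          using \<delta> m \<Phi> by (intro ln_mono \<Phi>_ge) auto
        then have "ln \<delta> + s * ln (mnorm (mprod A w)) \<le> ln (\<Phi> (mprod A w))"
          using \<delta>(1) m by (simp add: ln_mult_pos ln_powr)
        moreover have "ln (exp (- (n * P)) * \<Phi> (mprod A w) / weight w)
            = - (n * P) + ln (\<Phi> (mprod A w)) - ln (weight w)"
          using \<Phi> pos by (simp add: ln_div ln_mult_pos)
        ultimately have "(ln \<delta> - n * P) + (s * ln (mnorm (mprod A w)) - ln (weight w))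
            \<le> ln (exp (- (n * P)) * \<Phi> (mprod A w) / weight w)" by linarith
        then show ?thesis
          unfolding distrib_left[symmetric] using pos by (intro mult_left_mono) auto
      qed simp
    qed
    moreover have "(\<Sum>w\<in>words M n. weight w * (ln \<delta> - n * P) + weight w * (s * ln (mnorm (mprod A w)) - ln (weight w)))
        = ln \<delta> - n * P + (\<Sum>w\<in>words M n. weight w * (s * ln (mnorm (mprod A w)) - ln (weight w)))"
      by (simp add: sum.distrib sum_weight flip: sum_distrib_right)
    ultimately show ?thesis using optimal[of n] by linarith
  qed
  then show ?thesis by (rule that)
qed

text \<open>The potential decreases and is bounded below, so its decrease over \<open>k \<le> j\<close> further letters becomes
  small. This decrease is a mean of defects, and some word is not worse than the mean.\<close>

lemma small_defects:
  assumes "\<epsilon> > 0"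
  obtains n w where "w \<in> words M n" "weight w > 0" "\<And>k. k \<le> j \<Longrightarrow> defect (mprod A w) k \<le> \<epsilon>"
proof -
  have dec: "decseq potential"
  proof (rule decseq_SucI)
    fix n
    have "0 \<le> (\<Sum>w\<in>words M n. weight w * defect (mprod A w) 1)"
    proof (rule sum_nonneg)
      fix w assume w: "w \<in> words M n"
      show "0 \<le> weight w * defect (mprod A w) 1"
        using weight_nonneg[OF w] defect_nonneg[OF w] by (cases "weight w = 0") auto
    qed
    then show "potential (Suc n) \<le> potential n"
      using potential_decrease[of n 1] by simp
  qed
  obtain b where b: "\<And>n. b \<le> potential n" by (rule potential_bounded_below) blast
  obtain L where L: "potential \<longlonglongrightarrow> L" "\<And>n. L \<le> potential n"
    using decseq_convergent[OF dec, of b] b by blast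
  define e where "e = \<epsilon> / (real j + 1)"
  have e: "e > 0" using assms by (simp add: e_def)
  obtain n where n: "potential n < L + e"
    using order_tendstoD(2)[OF L(1), of "L + e"] e by (auto simp: eventually_sequentially)
  define X where "X w = (\<Sum>k\<le>j. defect (mprod A w) k)" for w
  have "(\<Sum>w\<in>words M n. weight w * X w) = (\<Sum>k\<le>j. potential n - potential (n + k))"
    by (simp add: X_def potential_decrease sum_distrib_left sum.swap[of _ "{..j}"])
  also have "\<dots> \<le> (\<Sum>k\<le>j. e)"
    using n L(2) by (intro sum_mono) (smt (verit))
  also have "\<dots> = \<epsilon>" by (simp add: e_def add.commute)
  finally have le: "(\<Sum>w\<in>words M n. weight w * X w) \<le> \<epsilon>" .
  have "\<exists>w\<in>words M n. weight w > 0 \<and> X w \<le> \<epsilon>"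
  proof (rule ccontr)
    assume *: "\<not> ?thesis"
    have ge: "weight w * \<epsilon> \<le> weight w * X w" if "w \<in> words M n" for w
      using * that weight_nonneg[OF that] by (cases "weight w = 0") (auto intro!: mult_left_mono simp: not_le less_le)
    have "\<exists>w\<in>words M n. weight w \<noteq> 0"
      using sum_weight[of n] by (metis sum.neutral zero_neq_one)
    then obtain w where w: "w \<in> words M n" "weight w > 0"
      using weight_nonneg by (auto simp: less_le)
    then have strict: "weight w * \<epsilon> < weight w * X w" using * by auto
    have "(\<Sum>w\<in>words M n. weight w * \<epsilon>) < (\<Sum>w\<in>words M n. weight w * X w)"
      by (rule sum_strict_mono_ex1[OF finite_words]) (use w ge strict in blast)+
    then show False
      using le sum_weight[of n] by (simp flip: sum_distrib_right)
  qed
  then obtain w where w: "w \<in> words M n" "weight w > 0" "X w \<le> \<epsilon>" by blast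
  have "defect (mprod A w) k \<le> \<epsilon>" if "k \<le> j" for k
  proof -
    have "defect (mprod A w) k \<le> X w"
      unfolding X_def using that defect_nonneg[OF w(1,2)] by (intro member_le_sum) auto
    then show ?thesis using w(3) by simp
  qed
  then show ?thesis using that w by blast
qed

definition rate :: "nat \<Rightarrow> real" where
  "rate i = (p i * exp P) powr (1 / s)"

lemma rate_nonneg: "0 \<le> rate i"
  by (simp add: rate_def)

lemma prod_rate_powr: "v \<in> words M k \<Longrightarrow> prod_list (map rate v) powr s = weight v * exp (k * P)"
proof (induction v arbitrary: k)
  case Nil
  then show ?case by (simp add: words_def)
next
  case (Cons i v)
  then obtain k' where k: "k = Suc k'" "v \<in> words M k'" "i \<in> {1..M}"
    by (auto simp: words_def)
  have nonneg: "0 \<le> prod_list (map rate v)"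
    by (auto intro!: prod_list_nonneg simp: rate_nonneg)
  have "rate i powr s = p i * exp P"
    using p(1)[OF k(3)] s by (simp add: rate_def powr_powr)
  then show ?case
    using Cons.IH[OF k(2)] nonneg by (simp add: powr_mult rate_nonneg k(1) algebra_simps exp_add)
qed

text \<open>Small defects make the transition weights at a normalised matrix at most twice the product weights, up to an
  error. By compactness a limit exists as the defects tend to zero, and there the error disappears.\<close>

lemma limit_matrix:
  obtains U D where "U \<noteq> 0" "D \<ge> 0"
    "\<And>k v. v \<in> words M k \<Longrightarrow> mnorm (mprod A v ** U) powr s \<le> D * (weight v * exp (k * P))"
proof -
  obtain \<delta> where \<delta>: "\<delta> > 0" "\<And>n B. \<delta> * mnorm B powr s \<le> a n B"
    by (rule a_ge) blast
  define c where "c = C / \<delta>"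
  have c: "c > 0" using C \<delta>(1) by (simp add: c_def)
  have "\<exists>U. mnorm U = 1 \<and> (\<forall>k\<le>j. \<forall>v\<in>words M k.
      mnorm (mprod A v ** U) powr s \<le> c * exp (k * P) * (2 * weight v + 2 / (real j + 1)))" for j
  proof -
    obtain n w where w: "w \<in> words M n" "weight w > 0"
        "\<And>k. k \<le> j \<Longrightarrow> defect (mprod A w) k \<le> 1 / (real j + 1)"
      by (rule small_defects[of "1 / (real j + 1)" j]) (simp, blast)
    define B where "B = mprod A w"
    have B: "B \<noteq> 0" "mnorm B > 0" "\<Phi> B > 0"
      using nonzero[OF w(1,2)] mnorm_pos_iff[of B] \<Phi>_pos by (auto simp: B_def)
    have "mnorm (mprod A v ** (B /\<^sub>R mnorm B)) powr s
        \<le> c * exp (k * P) * (2 * weight v + 2 / (real j + 1))" if k: "k \<le> j" and v: "v \<in> words M k" for k v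
    proof -
      have "transition B k v \<le> 2 * weight v + 2 * (1 / (real j + 1))"
        using transition_facts[OF B(3)] transition_pos[OF w(1,2)] weight_nonneg w(3)[OF k] v
        unfolding defect_def B_def
        by (intro relative_entropy_imp_le[where I = "words M k"] sum_weight) auto
      then have "exp (- (k * P)) * \<Phi> (mprod A v ** B) \<le> (2 * weight v + 2 / (real j + 1)) * \<Phi> B"
        using B(3) by (simp add: transition_def pos_divide_le_eq)
      then have "exp (k * P) * (exp (- (k * P)) * \<Phi> (mprod A v ** B))
          \<le> exp (k * P) * ((2 * weight v + 2 / (real j + 1)) * \<Phi> B)"
        by (intro mult_left_mono) auto
      then have "\<Phi> (mprod A v ** B) \<le> exp (k * P) * (2 * weight v + 2 / (real j + 1)) * \<Phi> B"
        by (simp add: mult.assoc[symmetric] flip: exp_add)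
      also have "\<dots> \<le> exp (k * P) * (2 * weight v + 2 / (real j + 1)) * (C * mnorm B powr s)"
        using weight_nonneg[OF v] by (intro mult_left_mono \<Phi>_le mult_nonneg_nonneg add_nonneg_nonneg) auto
      finally have "\<delta> * mnorm (mprod A v ** B) powr s
          \<le> exp (k * P) * (2 * weight v + 2 / (real j + 1)) * (C * mnorm B powr s)"
        using \<Phi>_ge[of "\<delta> * mnorm (mprod A v ** B) powr s" "mprod A v ** B", OF \<delta>(2)] by linarith
      then have "mnorm (mprod A v ** B) powr s
          \<le> exp (k * P) * (2 * weight v + 2 / (real j + 1)) * (C * mnorm B powr s) / \<delta>"
        using \<delta>(1) by (simp only: pos_le_divide_eq mult.commute)
      also have "\<dots> = c * exp (k * P) * (2 * weight v + 2 / (real j + 1)) * mnorm B powr s"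
        by (simp add: c_def)
      finally have "mnorm (mprod A v ** B) powr s / mnorm B powr s
          \<le> c * exp (k * P) * (2 * weight v + 2 / (real j + 1))"
        using B(2) by (simp add: pos_divide_le_eq)
      moreover have "mnorm (mprod A v ** (B /\<^sub>R mnorm B)) = mnorm (mprod A v ** B) / mnorm B"
        using B(2) by (simp add: matrix_scalar_ac mnorm_scaleR divide_inverse mult.commute
            flip: scalar_matrix_assoc)
      ultimately show ?thesis
        using mnorm_nonneg by (simp add: powr_divide)
    qed
    moreover have "mnorm (B /\<^sub>R mnorm B) = 1"
      using B(2) by (simp add: mnorm_scaleR)
    ultimately show ?thesis by blast
  qed
  then obtain U where U: "\<And>j. mnorm (U j) = 1"
      "\<And>j k v. k \<le> j \<Longrightarrow> v \<in> words M k \<Longrightarrow>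
        mnorm (mprod A v ** U j) powr s \<le> c * exp (k * P) * (2 * weight v + 2 / (real j + 1))"
    by metis
  have "bounded (range U)"
    unfolding bounded_iff using norm_le_mnorm[of "U _"] U(1) by (metis (no_types, lifting) mult.right_neutral rangeE)
  then obtain V r where V: "strict_mono r" "(U \<circ> r) \<longlonglongrightarrow> V"
    using bounded_imp_convergent_subsequence[of U] by blast
  have "(\<lambda>j. mnorm ((U \<circ> r) j)) \<longlonglongrightarrow> mnorm V"
    by (rule mnorm_tendsto[OF V(2)])
  then have "mnorm V = 1"
    using U(1) by (simp add: LIMSEQ_const_iff)
  then have "V \<noteq> 0" using mnorm_eq_0_iff[of V] by auto
  moreover have "mnorm (mprod A v ** V) powr s \<le> 2 * c * (weight v * exp (k * P))" if v: "v \<in> words M k" for k v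
  proof -
    have "(\<lambda>j. mnorm (mprod A v ** (U \<circ> r) j) powr s) \<longlonglongrightarrow> mnorm (mprod A v ** V) powr s"
      using s
      by (intro tendsto_powr' mnorm_tendsto tendsto_matrix_matrix_mult tendsto_const V(2))
        (auto intro!: always_eventually simp: mnorm_nonneg)
    moreover have "(\<lambda>j. c * exp (k * P) * (2 * weight v + 2 / (real (r j) + 1)))
        \<longlonglongrightarrow> c * exp (k * P) * (2 * weight v + 0)"
    proof (intro tendsto_mult tendsto_add tendsto_const)
      have "(\<lambda>j. 2 / (real j + 1)) \<longlonglongrightarrow> 0"
        by real_asymp
      from LIMSEQ_subseq_LIMSEQ[OF this V(1)] show "(\<lambda>j. 2 / (real (r j) + 1)) \<longlonglongrightarrow> 0"
        by (simp add: o_def)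
    qed
    moreover have "\<exists>J. \<forall>j\<ge>J. mnorm (mprod A v ** (U \<circ> r) j) powr s
        \<le> c * exp (k * P) * (2 * weight v + 2 / (real (r j) + 1))"
    proof (intro exI[of _ k] allI impI)
      fix j assume "k \<le> j"
      then have "k \<le> r j" using seq_suble[OF V(1), of j] by simp
      then show "mnorm (mprod A v ** (U \<circ> r) j) powr s
          \<le> c * exp (k * P) * (2 * weight v + 2 / (real (r j) + 1))"
        using U(2)[OF _ v] by simp
    qed
    ultimately have "mnorm (mprod A v ** V) powr s \<le> c * exp (k * P) * (2 * weight v + 0)"
      by (rule LIMSEQ_le)
    then show ?thesis by (simp add: mult_ac)
  qed
  ultimately show ?thesis
    using that[of V "2 * c"] c by auto
qed

text \<open>The vectors whose orbits grow at most like the products of the rates form an invariant subspace. It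
  contains the range of the limit matrix, hence is the whole space.\<close>

lemma norm_le_prod_rate:
  obtains K where "K > 0" "\<And>v. v \<in> lists {1..M} \<Longrightarrow> mnorm (mprod A v) \<le> K * prod_list (map rate v)"
proof -
  obtain U D where U: "U \<noteq> 0" "D \<ge> 0"
    "\<And>k v. v \<in> words M k \<Longrightarrow> mnorm (mprod A v ** U) powr s \<le> D * (weight v * exp (k * P))"
    by (rule limit_matrix) blast
  have rate: "0 \<le> prod_list (map rate v)" for v
    by (auto intro!: prod_list_nonneg simp: rate_nonneg)
  have words: "v \<in> words M (length v)" if "v \<in> lists {1..M}" for v
    using that by (auto simp: words_def)
  have U': "mnorm (mprod A v ** U) \<le> D powr (1 / s) * prod_list (map rate v)" if v: "v \<in> lists {1..M}" for v
  proof -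
    have "mnorm (mprod A v ** U) powr s \<le> D * prod_list (map rate v) powr s"
      using U(3)[OF words[OF v]] prod_rate_powr[OF words[OF v]] by simp
    then have "(mnorm (mprod A v ** U) powr s) powr (1 / s) \<le> (D * prod_list (map rate v) powr s) powr (1 / s)"
      using s by (intro powr_mono2) auto
    then show ?thesis
      using s U(2) rate mnorm_nonneg by (simp add: powr_mult powr_powr)
  qed
  define X where "X = {x. \<exists>c. \<forall>v\<in>lists {1..M}. norm (mprod A v *v x) \<le> c * prod_list (map rate v)}"
  obtain y where y: "U *v y \<noteq> 0"
    using U(1) by (metis matrix_eq matrix_vector_mult_0)
  have "X = UNIV"
  proof (rule irreducible_invariant_subspace[OF irr _ _ y])
    show "subspace X"
    proof (rule subspaceI)
      show "0 \<in> X" unfolding X_def by (auto intro!: exI[of _ 0])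
      fix x z assume "x \<in> X" "z \<in> X"
      then obtain c d where "\<forall>v\<in>lists {1..M}. norm (mprod A v *v x) \<le> c * prod_list (map rate v)"
          "\<forall>v\<in>lists {1..M}. norm (mprod A v *v z) \<le> d * prod_list (map rate v)"
        unfolding X_def by blast
      then have cd: "norm (mprod A v *v x) \<le> c * prod_list (map rate v)"
          "norm (mprod A v *v z) \<le> d * prod_list (map rate v)" if "v \<in> lists {1..M}" for v
        using that by blast+
      have "norm (mprod A v *v (x + z)) \<le> (c + d) * prod_list (map rate v)" if "v \<in> lists {1..M}" for v
        using cd[OF that] norm_triangle_ineq[of "mprod A v *v x" "mprod A v *v z"]
        unfolding matrix_vector_right_distrib distrib_right by linarith
      then show "x + z \<in> X" unfolding X_def by blast
    next
      fix t :: real and x assume "x \<in> X"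
      then obtain c where c: "\<forall>v\<in>lists {1..M}. norm (mprod A v *v x) \<le> c * prod_list (map rate v)"
        unfolding X_def by blast
      have "norm (mprod A v *v (t *\<^sub>R x)) \<le> (\<bar>t\<bar> * c) * prod_list (map rate v)" if "v \<in> lists {1..M}" for v
        using mult_left_mono[OF c[rule_format, OF that], of "\<bar>t\<bar>"]
        by (simp add: matrix_vector_mult_scaleR mult.assoc)
      then show "t *\<^sub>R x \<in> X" unfolding X_def by blast
    qed
    have "norm (mprod A v *v (U *v y)) \<le> (D powr (1 / s) * norm y) * prod_list (map rate v)"
      if "v \<in> lists {1..M}" for v
      using mult_right_mono[OF U'[OF that], of "norm y"] norm_matrix_vector_le[of "mprod A v ** U" y]
      by (simp add: matrix_vector_mul_assoc mult_ac)
    then show "U *v y \<in> X" unfolding X_def by blast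
    fix i x assume i: "i \<in> {1..M}" and "x \<in> X"
    then obtain c where c: "\<forall>v\<in>lists {1..M}. norm (mprod A v *v x) \<le> c * prod_list (map rate v)"
      unfolding X_def by blast
    have "norm (mprod A v *v (A i *v x)) \<le> (c * rate i) * prod_list (map rate v)" if v: "v \<in> lists {1..M}" for v
    proof -
      have "i # v \<in> lists {1..M}" using i v by simp
      then have "norm (mprod A (i # v) *v x) \<le> c * prod_list (map rate (i # v))"
        using c by blast
      then show ?thesis by (simp add: matrix_vector_mul_assoc mult.assoc)
    qed
    then show "A i *v x \<in> X" unfolding X_def by blast
  qed
  then have all: "\<exists>c. \<forall>v\<in>lists {1..M}. norm (mprod A v *v x) \<le> c * prod_list (map rate v)" for x
    unfolding X_def by blast
  define G where "G = {mprod A v /\<^sub>R prod_list (map rate v) | v. v \<in> lists {1..M} \<and> prod_list (map rate v) > 0}"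
  have "\<exists>c. \<forall>g\<in>G. norm (g *v x) \<le> c" for x
  proof -
    obtain c where c: "\<forall>v\<in>lists {1..M}. norm (mprod A v *v x) \<le> c * prod_list (map rate v)"
      using all by blast
    have "norm (g *v x) \<le> c" if "g \<in> G" for g
    proof -
      obtain v where v: "g = mprod A v /\<^sub>R prod_list (map rate v)" "v \<in> lists {1..M}" "prod_list (map rate v) > 0"
        using \<open>g \<in> G\<close> unfolding G_def by blast
      have "norm (g *v x) = norm (mprod A v *v x) / prod_list (map rate v)"
        using v(3) by (simp add: v(1) divide_inverse mult.commute flip: scaleR_matrix_vector_assoc)
      then show ?thesis using c v by (simp add: pos_divide_le_eq)
    qed
    then show ?thesis by blast
  qed
  then obtain K where K: "K > 0" "\<And>g. g \<in> G \<Longrightarrow> mnorm g \<le> K"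
    using pointwise_bounded_imp_mnorm_bounded[of G] by blast
  have "mnorm (mprod A v) \<le> K * prod_list (map rate v)" if v: "v \<in> lists {1..M}" for v
  proof (cases "prod_list (map rate v) = 0")
    case True
    have "mprod A v *v x = 0" for x
    proof -
      obtain c where "\<forall>v\<in>lists {1..M}. norm (mprod A v *v x) \<le> c * prod_list (map rate v)"
        using all by blast
      then have "norm (mprod A v *v x) \<le> c * prod_list (map rate v)"
        using v by blast
      then show ?thesis using True by simp
    qed
    then have "mprod A v = 0" by (metis matrix_eq matrix_vector_mult_0)
    then have "mnorm (mprod A v) = 0" using mnorm_eq_0_iff by blast
    then show ?thesis using True by simp
  next
    case False
    then have pos: "prod_list (map rate v) > 0" using rate[of v] by simp
    then have "mprod A v /\<^sub>R prod_list (map rate v) \<in> G" unfolding G_def using v by blast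
    from K(2)[OF this] have "mnorm (mprod A v) / prod_list (map rate v) \<le> K"
      using pos by (simp add: mnorm_scaleR divide_inverse mult.commute)
    then show ?thesis using pos by (simp add: pos_divide_le_eq)
  qed
  then show ?thesis using that K(1) by blast
qed

end

section \<open>Spectral theorem and singular values\<close>

lemma inner_matrix_transpose: "x \<bullet> (A *v y) = (transpose A *v x) \<bullet> y" for A :: "real^'n^'n"
  by (metis dot_lmul_matrix transpose_transpose vector_transpose_matrix)

text \<open>A null vector minimises a nonnegative form, so the first variation vanishes there.\<close>

lemma nonneg_form_null_vector:
  fixes f :: "real^'n \<Rightarrow> real^'n"
  assumes f: "linear f" and V: "subspace V"
    and sym: "\<And>x y. x \<in> V \<Longrightarrow> y \<in> V \<Longrightarrow> x \<bullet> f y = y \<bullet> f x"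
    and nonneg: "\<And>x. x \<in> V \<Longrightarrow> 0 \<le> x \<bullet> f x"
    and u: "u \<in> V" "u \<bullet> f u = 0" and y: "y \<in> V"
  shows "y \<bullet> f u = 0"
proof (rule ccontr)
  assume "y \<bullet> f u \<noteq> 0"
  define a b t where "a = y \<bullet> f u" and "b = y \<bullet> f y" and "t = - a / (b + 1)"
  have b: "b \<ge> 0" using nonneg[OF y] by (simp add: b_def)
  have "u + t *\<^sub>R y \<in> V" using V u(1) y by (intro subspace_add subspace_scale)
  then have "0 \<le> (u + t *\<^sub>R y) \<bullet> f (u + t *\<^sub>R y)" by (rule nonneg)
  also have "\<dots> = 2 * t * a + t\<^sup>2 * b"
    using sym[OF u(1) y] u(2) f
    by (simp add: linear_add linear_scale inner_add_left inner_add_right a_def b_def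
        power2_eq_square algebra_simps)
  also have "\<dots> = a\<^sup>2 / (b + 1) * (b / (b + 1) - 2)"
    by (simp add: t_def divide_inverse power2_eq_square algebra_simps)
  also have "\<dots> < 0"
  proof (rule mult_pos_neg)
    show "0 < a\<^sup>2 / (b + 1)" using b \<open>y \<bullet> f u \<noteq> 0\<close> by (simp add: a_def)
    have "b / (b + 1) \<le> 1" using b by simp
    then show "b / (b + 1) - 2 < 0" by simp
  qed
  finally show False by simp
qed

text \<open>A maximum of \<open>x \<bullet> (A *v x)\<close> on the unit sphere of the orthogonal complement of the eigenvectors
  found so far is a further eigenvector.\<close>

lemma orthonormal_eigenvectors:
  fixes A :: "real^'n^'n"
  assumes sym: "transpose A = A" and k: "k \<le> CARD('n)"
  shows "\<exists>B. card B = k \<and> finite B \<and> pairwise orthogonal B \<and>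
    (\<forall>b\<in>B. norm b = 1 \<and> (\<exists>ev. A *v b = ev *\<^sub>R b))"
  using k
proof (induction k)
  case 0
  show ?case by (rule exI[of _ "{}"]) auto
next
  case (Suc k)
  then obtain B where B: "card B = k" "finite B" "pairwise orthogonal B"
      "\<And>b. b \<in> B \<Longrightarrow> norm b = 1 \<and> (\<exists>ev. A *v b = ev *\<^sub>R b)"
    by auto
  have A_sym: "x \<bullet> (A *v y) = (A *v x) \<bullet> y" for x y
    using inner_matrix_transpose[of x A y] sym by simp
  define V where "V = {x. \<forall>b\<in>B. b \<bullet> x = 0}"
  have V: "subspace V"
    by (auto simp: V_def subspace_def inner_add_right)
  have AV: "A *v x \<in> V" if x: "x \<in> V" for x
  proof -
    have "b \<bullet> (A *v x) = 0" if b: "b \<in> B" for b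
    proof -
      obtain ev where "A *v b = ev *\<^sub>R b" using B(4)[OF b] by blast
      then show ?thesis using x b by (simp add: A_sym V_def)
    qed
    then show ?thesis by (simp add: V_def)
  qed
  have "dim B \<le> card B" using B(2) by (rule dim_le_card')
  then have "dim B < DIM(real^'n)" using B(1) Suc.prems by simp
  then obtain x0 where x0: "x0 \<noteq> 0" "\<And>y. y \<in> span B \<Longrightarrow> orthogonal x0 y"
    using orthogonal_to_subspace_exists by blast
  have "x0 \<in> V"
    using x0(2) span_base[of _ B] by (auto simp: V_def orthogonal_def inner_commute)
  then have "x0 /\<^sub>R norm x0 \<in> V \<inter> sphere 0 1"
    using x0(1) V by (simp add: subspace_scale)
  then have "V \<inter> sphere 0 1 \<noteq> {}" by blast
  moreover have "compact (V \<inter> sphere 0 1)"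
    by (intro closed_Int_compact closed_subspace V compact_sphere)
  moreover have "continuous_on (V \<inter> sphere 0 1) (\<lambda>x. x \<bullet> (A *v x))"
    by (intro continuous_intros linear_continuous_on matrix_vector_mul_bounded_linear)
  ultimately obtain u where u: "u \<in> V \<inter> sphere 0 1"
      "\<And>x. x \<in> V \<inter> sphere 0 1 \<Longrightarrow> x \<bullet> (A *v x) \<le> u \<bullet> (A *v u)"
    using continuous_attains_sup[of "V \<inter> sphere 0 1" "\<lambda>x. x \<bullet> (A *v x)"] by blast
  define ev where "ev = u \<bullet> (A *v u)"
  define f where "f x = ev *\<^sub>R x - A *v x" for x
  have f: "linear f"
    unfolding f_def by (intro linear_compose_sub linear_scale_self matrix_vector_mul_linear)
  have "y \<bullet> f u = 0" if y: "y \<in> V" for y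
  proof (rule nonneg_form_null_vector[OF f V _ _ _ _ y])
    show "x \<bullet> f z = z \<bullet> f x" for x z
      using A_sym[of x z] by (simp add: f_def inner_diff_right inner_commute)
    show "0 \<le> x \<bullet> f x" if x: "x \<in> V" for x
    proof (cases "x = 0")
      case False
      have "(x /\<^sub>R norm x) \<bullet> (A *v (x /\<^sub>R norm x)) \<le> ev"
        unfolding ev_def using False x V by (intro u(2)) (simp add: subspace_scale)
      then have "x \<bullet> (A *v x) \<le> ev * (norm x)\<^sup>2"
        using False by (simp add: matrix_vector_mult_scaleR power2_eq_square field_simps)
      then show ?thesis by (simp add: f_def inner_diff_right power2_norm_eq_inner)
    qed simp
    have "u \<bullet> u = 1" using u(1) by (simp add: flip: power2_norm_eq_inner)
    then show "u \<bullet> f u = 0" by (simp add: f_def inner_diff_right ev_def)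
    show "u \<in> V" using u(1) by simp
  qed
  moreover have "f u \<in> V"
    unfolding f_def using u(1) by (intro subspace_diff[OF V] subspace_scale[OF V] AV) auto
  ultimately have "f u \<bullet> f u = 0" by blast
  then have eig: "A *v u = ev *\<^sub>R u" by (simp add: f_def)
  have "u \<notin> B"
  proof
    assume "u \<in> B"
    then have "u \<bullet> u = 0" using u(1) by (simp add: V_def)
    then show False using u(1) by simp
  qed
  then have "card (insert u B) = Suc k" using B by simp
  moreover have "pairwise orthogonal (insert u B)"
    using B(3) u(1) by (auto simp: pairwise_insert orthogonal_def V_def inner_commute)
  moreover have "\<forall>b\<in>insert u B. norm b = 1 \<and> (\<exists>ev. A *v b = ev *\<^sub>R b)"
    using B(4) u(1) eig by auto
  ultimately show ?case using B(2) by blast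
qed

definition diagonal :: "('n \<Rightarrow> 'a::zero) \<Rightarrow> 'a^'n^'n" where
  "diagonal d = (\<chi> i j. if i = j then d i else 0)"

theorem spectral_theorem:
  fixes A :: "real^'n^'n"
  assumes sym: "transpose A = A"
  obtains Q d where "orthogonal_matrix Q" "transpose Q ** A ** Q = diagonal d"
proof -
  obtain B where B: "card B = CARD('n)" "finite B" "pairwise orthogonal B"
      "\<And>b. b \<in> B \<Longrightarrow> norm b = 1 \<and> (\<exists>ev. A *v b = ev *\<^sub>R b)"
    using orthonormal_eigenvectors[OF sym order_refl] by blast
  obtain f :: "'n \<Rightarrow> real^'n" where f: "bij_betw f UNIV B"
    using B(1,2) finite_same_card_bij[of "UNIV :: 'n set" B] by auto
  have fB: "f i \<in> B" for i using f by (auto simp: bij_betw_def)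
  obtain d where d: "\<And>i. A *v f i = d i *\<^sub>R f i"
    using B(4)[OF fB] by metis
  define Q where "Q = (\<chi> i j. f j $ i)"
  have col: "column j Q = f j" for j
    by (simp add: column_def Q_def vec_eq_iff)
  have orth: "f i \<bullet> f j = (if i = j then 1 else 0)" for i j
  proof (cases "i = j")
    case True
    have "f j \<bullet> f j = (norm (f j))\<^sup>2" by (rule power2_norm_eq_inner[symmetric])
    then show ?thesis using True B(4)[OF fB] by simp
  next
    case False
    then have "f i \<noteq> f j" using f by (auto simp: bij_betw_def inj_def)
    then show ?thesis using False B(3) fB by (simp add: pairwise_def orthogonal_def)
  qed
  have "orthogonal_matrix Q"
    unfolding orthogonal_matrix_orthonormal_columns col orthogonal_def
    using orth B(4)[OF fB] by simp
  moreover have "transpose Q ** A ** Q = diagonal d"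
  proof -
    have "(transpose Q ** A ** Q) $ i $ j = f i \<bullet> (A *v f j)" for i j
    proof -
      have "A ** Q = (\<chi> i j. (A *v f j) $ i)"
        by (simp add: matrix_matrix_mult_def matrix_vector_mult_def Q_def vec_eq_iff)
      then have "(transpose Q ** (A ** Q)) $ i $ j = f i \<bullet> (A *v f j)"
        by (simp add: matrix_matrix_mult_def transpose_def Q_def inner_vec_def)
      then show ?thesis by (simp add: matrix_mul_assoc)
    qed
    then show ?thesis
      by (simp add: vec_eq_iff diagonal_def d orth)
  qed
  ultimately show ?thesis by (rule that)
qed

text \<open>The conjugation takes place over the polynomials, so the map \<open>c\<close> embeds real matrices as
  constant ones.\<close>

lemma charpoly_diagonalised:
  fixes A :: "real^'n^'n"
  assumes Q: "orthogonal_matrix Q" and D: "transpose Q ** A ** Q = diagonal d"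
  shows "charpoly A = (\<Prod>i\<in>UNIV. [:- d i, 1:])"
proof -
  define c :: "real^'n^'n \<Rightarrow> real poly^'n^'n" where "c X = (\<chi> i j. [:X $ i $ j:])" for X
  have sum_const: "(\<Sum>i\<in>S. [:g i:]) = [:\<Sum>i\<in>S. g i:]" for S and g :: "'n \<Rightarrow> real"
    by (induction S rule: infinite_finite_induct) auto
  have mult: "c (X ** Y) = c X ** c Y" for X Y
    by (simp add: c_def matrix_matrix_mult_def vec_eq_iff sum_const[symmetric] mult.commute)
  have one: "c (mat 1) = mat 1"
    by (simp add: c_def mat_def vec_eq_iff pCons_one)
  let ?X = "mat [:0, 1:] :: real poly^'n^'n"
  have scalar: "c Y ** ?X = ?X ** c Y" for Y
    by (simp add: matrix_matrix_mult_def mat_def vec_eq_iff if_distrib if_distribR cong: if_cong)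
  have QQ: "transpose Q ** Q = mat 1" "Q ** transpose Q = mat 1"
    using Q by (auto simp: orthogonal_matrix_def)
  have "c (transpose Q) ** (?X - c A) ** c Q = ?X - c (diagonal d)"
  proof -
    have "c (transpose Q) ** (?X - c A) ** c Q = c (transpose Q) ** ?X ** c Q - c (transpose Q) ** c A ** c Q"
      by (simp add: matrix_matrix_mult_def vec_eq_iff left_diff_distrib right_diff_distrib sum_subtractf)
    also have "c (transpose Q) ** ?X ** c Q = ?X ** c (transpose Q ** Q)"
      by (simp add: mult scalar matrix_mul_assoc)
    also have "\<dots> = ?X" by (simp add: QQ one)
    also have "c (transpose Q) ** c A ** c Q = c (diagonal d)"
      by (simp add: mult[symmetric] D)
    finally show ?thesis .
  qed
  then have "det (?X - c (diagonal d)) = det (c (transpose Q)) * det (?X - c A) * det (c Q)"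
    by (metis det_mul)
  also have "\<dots> = det (?X - c A) * det (c (transpose Q ** Q))"
    by (simp add: mult det_mul)
  also have "\<dots> = det (?X - c A)" by (simp add: QQ one)
  finally have "charpoly A = det (?X - c (diagonal d))"
    by (simp add: charpoly_def c_def)
  also have "\<dots> = (\<Prod>i\<in>UNIV. (?X - c (diagonal d)) $ i $ i)"
    by (rule det_diagonal) (simp add: c_def diagonal_def mat_def)
  also have "\<dots> = (\<Prod>i\<in>UNIV. [:- d i, 1:])"
    by (simp add: c_def diagonal_def mat_def)
  finally show ?thesis .
qed

lemma proots_prod_linear:
  "finite I \<Longrightarrow> proots (\<Prod>i\<in>I. [:- d i, 1:]) = image_mset d (mset_set I)" for d :: "'i \<Rightarrow> real"
proof (induction I rule: finite_induct)
  case (insert i I)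
  have "(\<Prod>i\<in>I. [:- d i, 1:]) \<noteq> 0"
    using insert(1) by (simp add: prod_zero_iff)
  then have "proots ([:- d i, 1:] * (\<Prod>i\<in>I. [:- d i, 1:])) = proots [:- d i, 1:] + proots (\<Prod>i\<in>I. [:- d i, 1:])"
    by (intro proots_mult) auto
  then show ?case
    using insert by simp
qed simp

text \<open>The singular values are the lengths of the images of an orthonormal eigenbasis of
  \<open>transpose A ** A\<close>, listed with multiplicity.\<close>

lemma singular_values:
  fixes A :: "real^'n^'n"
  obtains \<sigma> :: "'n \<Rightarrow> real" where "\<And>j. 0 \<le> \<sigma> j"
    "\<And>i. singular_value i A = rev (sorted_list_of_multiset (image_mset \<sigma> (mset_set UNIV))) ! (i - 1)"
    "\<bar>det A\<bar> = (\<Prod>j\<in>UNIV. \<sigma> j)"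
    "\<And>j. \<exists>x. norm x = 1 \<and> norm (A *v x) = \<sigma> j"
    "\<And>x. norm (A *v x) \<le> Max (range \<sigma>) * norm x"
    "\<And>x. Min (range \<sigma>) * norm x \<le> norm (A *v x)"
proof -
  have "transpose (transpose A ** A) = transpose A ** A"
    by (simp add: matrix_transpose_mul)
  then obtain Q d where Q: "orthogonal_matrix Q" and D: "transpose Q ** (transpose A ** A) ** Q = diagonal d"
    by (rule spectral_theorem)
  have QQ: "transpose Q ** Q = mat 1" "Q ** transpose Q = mat 1"
    using Q by (auto simp: orthogonal_matrix_def)
  have norm_Q: "norm (Q *v y) = norm y" for y
    using Q by (metis orthogonal_transformation_matrix matrix_vector_mul_linear matrix_of_matrix_vector_mul
        orthogonal_transformation_def orthogonal_transformation_norm)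
  have form: "(norm (A *v (Q *v y)))\<^sup>2 = (\<Sum>j\<in>UNIV. d j * (y $ j)\<^sup>2)" for y
  proof -
    have "(norm (A *v (Q *v y)))\<^sup>2 = (A *v (Q *v y)) \<bullet> (A *v (Q *v y))"
      by (rule power2_norm_eq_inner)
    also have "\<dots> = y \<bullet> ((transpose Q ** (transpose A ** A) ** Q) *v y)"
      by (simp add: inner_matrix_transpose matrix_vector_mul_assoc[symmetric])
        (metis inner_commute inner_matrix_transpose transpose_transpose)
    also have "\<dots> = (\<Sum>j\<in>UNIV. d j * (y $ j)\<^sup>2)"
      unfolding D by (simp add: inner_vec_def diagonal_def matrix_vector_mult_def if_distrib if_distribR
          power2_eq_square mult_ac cong: if_cong)
    finally show ?thesis .
  qed
  have axis: "(norm (A *v (Q *v axis j 1)))\<^sup>2 = d j" for j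
    unfolding form by (simp add: axis_def if_distrib if_distribR power2_eq_square cong: if_cong)
  define \<sigma> where "\<sigma> j = sqrt (d j)" for j
  have d: "d j \<ge> 0" for j
    unfolding axis[of j, symmetric] by simp
  have \<sigma>2: "(\<sigma> j)\<^sup>2 = d j" for j using d by (simp add: \<sigma>_def)
  have \<sigma>: "\<sigma> j \<ge> 0" for j using d by (simp add: \<sigma>_def)
  have norm_form: "(norm (A *v x))\<^sup>2 = (\<Sum>j\<in>UNIV. (\<sigma> j)\<^sup>2 * ((transpose Q *v x) $ j)\<^sup>2)"
    "(norm x)\<^sup>2 = (\<Sum>j\<in>UNIV. ((transpose Q *v x) $ j)\<^sup>2)" for x
  proof -
    have x: "x = Q *v (transpose Q *v x)"
      by (metis QQ(2) matrix_vector_mul_assoc matrix_vector_mul_lid)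
    show "(norm (A *v x))\<^sup>2 = (\<Sum>j\<in>UNIV. (\<sigma> j)\<^sup>2 * ((transpose Q *v x) $ j)\<^sup>2)"
      by (subst x, subst form) (simp add: \<sigma>2)
    have "norm x = norm (transpose Q *v x)"
      by (subst x) (rule norm_Q)
    moreover have "(norm y)\<^sup>2 = (\<Sum>j\<in>UNIV. (y $ j)\<^sup>2)" for y :: "real^'n"
      unfolding power2_norm_eq_inner inner_vec_def by (simp add: power2_eq_square)
    ultimately show "(norm x)\<^sup>2 = (\<Sum>j\<in>UNIV. ((transpose Q *v x) $ j)\<^sup>2)"
      by (simp only:)
  qed
  have fin: "finite (range \<sigma>)" "range \<sigma> \<noteq> {}" by auto
  have Max: "\<sigma> j \<le> Max (range \<sigma>)" "Min (range \<sigma>) \<le> \<sigma> j" for j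
    using fin by auto
  have Min0: "0 \<le> Min (range \<sigma>)" using \<sigma> by auto
  have Max0: "0 \<le> Max (range \<sigma>)" using \<sigma> Max order_trans by blast
  show ?thesis
  proof (rule that[of \<sigma>])
    show "singular_value i A = rev (sorted_list_of_multiset (image_mset \<sigma> (mset_set UNIV))) ! (i - 1)" for i
      unfolding singular_value_def charpoly_diagonalised[OF Q D]
      by (simp add: proots_prod_linear \<sigma>_def[abs_def] multiset.map_comp o_def)
    have "det (transpose Q ** (transpose A ** A) ** Q) = (det A)\<^sup>2 * (det (transpose Q ** Q))"
      by (simp add: det_mul det_transpose power2_eq_square mult_ac)
    then have "(det A)\<^sup>2 = det (diagonal d)"
      by (simp add: D QQ)
    also have "\<dots> = (\<Prod>j\<in>UNIV. d j)"
      by (subst det_diagonal) (auto simp: diagonal_def)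
    also have "\<dots> = (\<Prod>j\<in>UNIV. \<sigma> j)\<^sup>2"
      by (simp add: prod_power_distrib \<sigma>2)
    finally have "\<bar>det A\<bar> = \<bar>\<Prod>j\<in>UNIV. \<sigma> j\<bar>"
      by (simp add: power2_eq_iff abs_eq_iff)
    then show "\<bar>det A\<bar> = (\<Prod>j\<in>UNIV. \<sigma> j)"
      using \<sigma> by (simp add: prod_nonneg)
    show "\<exists>x. norm x = 1 \<and> norm (A *v x) = \<sigma> j" for j
    proof (intro exI conjI)
      show "norm (Q *v axis j 1) = 1" by (simp add: norm_Q norm_axis_1)
      show "norm (A *v (Q *v axis j 1)) = \<sigma> j"
        unfolding \<sigma>_def axis[of j, symmetric] by simp
    qed
    fix x
    have "(norm (A *v x))\<^sup>2 \<le> (\<Sum>j\<in>UNIV. (Max (range \<sigma>))\<^sup>2 * ((transpose Q *v x) $ j)\<^sup>2)"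
      unfolding norm_form(1) using Max \<sigma> by (intro sum_mono mult_right_mono power_mono) auto
    also have "\<dots> = (Max (range \<sigma>) * norm x)\<^sup>2"
      by (simp add: power_mult_distrib norm_form(2) sum_distrib_left)
    finally show "norm (A *v x) \<le> Max (range \<sigma>) * norm x"
      using Max0 by (simp add: power2_le_iff_abs_le)
    have "(Min (range \<sigma>) * norm x)\<^sup>2 = (\<Sum>j\<in>UNIV. (Min (range \<sigma>))\<^sup>2 * ((transpose Q *v x) $ j)\<^sup>2)"
      by (simp add: power_mult_distrib norm_form(2) sum_distrib_left)
    also have "\<dots> \<le> (norm (A *v x))\<^sup>2"
      unfolding norm_form(1) using Max Min0 by (intro sum_mono mult_right_mono power_mono) auto
    finally show "Min (range \<sigma>) * norm x \<le> norm (A *v x)"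
      using Min0 by (simp add: power2_le_iff_abs_le)
  qed (rule \<sigma>)
qed

lemma sorted_list_bounds:
  fixes \<sigma> :: "'n::finite \<Rightarrow> real"
  defines "l \<equiv> rev (sorted_list_of_multiset (image_mset \<sigma> (mset_set UNIV)))"
  shows "length l = CARD('n)" "set l = range \<sigma>" "l ! 0 = Max (range \<sigma>)" "l ! (CARD('n) - 1) = Min (range \<sigma>)"
proof -
  let ?s = "sorted_list_of_multiset (image_mset \<sigma> (mset_set (UNIV :: 'n set)))"
  have "length ?s = size (image_mset \<sigma> (mset_set (UNIV :: 'n set)))"
    by (metis mset_sorted_list_of_multiset size_mset)
  then have len: "length ?s = CARD('n)" by simp
  have set: "set ?s = range \<sigma>" by simp
  have sorted: "sorted ?s" by simp
  have pos: "CARD('n) > 0" by simp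
  show "length l = CARD('n)" "set l = range \<sigma>" using len set by (auto simp: l_def)
  have "l ! 0 = ?s ! (CARD('n) - 1)"
    unfolding l_def using len pos by (simp add: rev_nth)
  moreover have "?s ! (CARD('n) - 1) = Max (range \<sigma>)"
  proof (rule Max_eqI[symmetric])
    show "?s ! (CARD('n) - 1) \<in> range \<sigma>" using len pos nth_mem[of "CARD('n) - 1" ?s] set by auto
    fix y assume "y \<in> range \<sigma>"
    then obtain i where "i < CARD('n)" "y = ?s ! i" using set len by (metis in_set_conv_nth)
    then show "y \<le> ?s ! (CARD('n) - 1)" using sorted len by (simp add: sorted_nth_mono)
  qed simp
  ultimately show "l ! 0 = Max (range \<sigma>)" by simp
  have "l ! (CARD('n) - 1) = ?s ! 0"
    unfolding l_def using len pos by (simp add: rev_nth)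
  moreover have "?s ! 0 = Min (range \<sigma>)"
  proof (rule Min_eqI[symmetric])
    show "?s ! 0 \<in> range \<sigma>" using len pos nth_mem[of 0 ?s] set by auto
    fix y assume "y \<in> range \<sigma>"
    then obtain i where "i < CARD('n)" "y = ?s ! i" using set len by (metis in_set_conv_nth)
    then show "?s ! 0 \<le> y" using sorted len by (simp add: sorted_nth_mono)
  qed simp
  ultimately show "l ! (CARD('n) - 1) = Min (range \<sigma>)" by simp
qed

lemma singular_value_attained:
  fixes A :: "real^'n^'n"
  assumes "i \<in> {1..CARD('n)}"
  obtains x where "norm x = 1" "norm (A *v x) = singular_value i A"
proof -
  obtain \<sigma> :: "'n \<Rightarrow> real" where \<sigma>:
    "\<And>i. singular_value i A = rev (sorted_list_of_multiset (image_mset \<sigma> (mset_set UNIV))) ! (i - 1)"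
    "\<And>j. \<exists>x. norm x = 1 \<and> norm (A *v x) = \<sigma> j"
    using singular_values[of A] by metis
  have "singular_value i A \<in> range \<sigma>"
    unfolding \<sigma>(1) sorted_list_bounds(2)[of \<sigma>, symmetric]
    using assms sorted_list_bounds(1)[of \<sigma>] by (intro nth_mem) auto
  then show ?thesis using \<sigma>(2) that by (metis rangeE)
qed

lemma singular_value_1: "singular_value 1 A = mnorm A" for A :: "real^'n^'n"
proof (rule antisym)
  obtain \<sigma> :: "'n \<Rightarrow> real" where \<sigma>:
    "\<And>i. singular_value i A = rev (sorted_list_of_multiset (image_mset \<sigma> (mset_set UNIV))) ! (i - 1)"
    "\<And>x. norm (A *v x) \<le> Max (range \<sigma>) * norm x"
    using singular_values[of A] by metis
  have "singular_value 1 A = Max (range \<sigma>)"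
    unfolding \<sigma>(1) using sorted_list_bounds(3)[of \<sigma>] by simp
  then show "mnorm A \<le> singular_value 1 A"
    using \<sigma>(2) by (intro mnorm_least) simp
  obtain x where "norm x = 1" "norm (A *v x) = singular_value 1 A"
    by (rule singular_value_attained[of 1 A]) (auto simp: Suc_le_eq)
  then show "singular_value 1 A \<le> mnorm A"
    using norm_matrix_vector_le[of A x] by simp
qed

abbreviation least_sv :: "real^'n^'n \<Rightarrow> real" where
  "least_sv A \<equiv> singular_value CARD('n) A"

lemma least_sv_facts:
  fixes A :: "real^'n^'n"
  shows "least_sv A * norm x \<le> norm (A *v x)" "0 \<le> least_sv A" "least_sv A ^ CARD('n) \<le> \<bar>det A\<bar>"
    "least_sv A = 0 \<longleftrightarrow> det A = 0"
proof -
  obtain \<sigma> :: "'n \<Rightarrow> real" where \<sigma>: "\<And>j. 0 \<le> \<sigma> j"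
    "\<And>i. singular_value i A = rev (sorted_list_of_multiset (image_mset \<sigma> (mset_set UNIV))) ! (i - 1)"
    "\<bar>det A\<bar> = (\<Prod>j\<in>UNIV. \<sigma> j)"
    "\<And>x. Min (range \<sigma>) * norm x \<le> norm (A *v x)"
    using singular_values[of A] by metis
  have Min: "least_sv A = Min (range \<sigma>)"
    unfolding \<sigma>(2) using sorted_list_bounds(4)[of \<sigma>] by simp
  show "least_sv A * norm x \<le> norm (A *v x)" unfolding Min by (rule \<sigma>(4))
  show nonneg: "0 \<le> least_sv A" unfolding Min using \<sigma>(1) by auto
  have "(\<Prod>j\<in>(UNIV::'n set). least_sv A) \<le> (\<Prod>j\<in>UNIV. \<sigma> j)"
    using nonneg unfolding Min by (intro prod_mono) auto
  then show "least_sv A ^ CARD('n) \<le> \<bar>det A\<bar>" by (simp add: \<sigma>(3))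
  have "Min (range \<sigma>) \<in> range \<sigma>" by (intro Min_in) auto
  then obtain j where "Min (range \<sigma>) = \<sigma> j" by (rule rangeE)
  then show "least_sv A = 0 \<longleftrightarrow> det A = 0"
  proof -
    have "det A = 0 \<longleftrightarrow> (\<Prod>j\<in>UNIV. \<sigma> j) = 0"
      using \<sigma>(3) by linarith
    then have "det A = 0 \<longleftrightarrow> (\<exists>j. \<sigma> j = 0)"
      by (simp add: prod_zero_iff)
    moreover have "Min (range \<sigma>) \<le> \<sigma> j" for j by simp
    then have "Min (range \<sigma>) = 0 \<longleftrightarrow> (\<exists>j. \<sigma> j = 0)"
      using \<open>Min (range \<sigma>) = \<sigma> j\<close> nonneg Min by (metis order_antisym)
    ultimately show ?thesis using Min by simp
  qed
qed

lemma least_sv_mult: "least_sv A * least_sv B \<le> least_sv (A ** B)" for A B :: "real^'n^'n"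
proof -
  obtain x where x: "norm x = 1" "norm ((A ** B) *v x) = least_sv (A ** B)"
    by (rule singular_value_attained[of "CARD('n)" "A ** B"]) (auto simp: Suc_le_eq)
  have "least_sv A * (least_sv B * norm x) \<le> least_sv A * norm (B *v x)"
    by (intro mult_left_mono least_sv_facts)
  also have "\<dots> \<le> norm (A *v (B *v x))" by (rule least_sv_facts)
  finally show ?thesis using x by (simp add: matrix_vector_mul_assoc)
qed

section \<open>Bounded irreducible semigroups preserve a quadratic form\<close>

lemma
  fixes S :: "real^'n^'n"
  assumes "invertible S"
  shows matrix_inv_left: "matrix_inv S ** S = mat 1" and matrix_inv_right: "S ** matrix_inv S = mat 1"
  using someI_ex[OF assms[unfolded invertible_def]] by (auto simp: matrix_inv_def)

text \<open>A linear functional that vanishes along a forward orbit of an injective linear map also vanishes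
  one step before the orbit starts: in finite dimension the forward orbit spans an invariant space.\<close>

lemma functional_vanishes_backwards:
  fixes f :: "'a::euclidean_space \<Rightarrow> 'a" and l :: "'a \<Rightarrow> real"
  assumes f: "linear f" "inj f" and l: "linear l" and zero: "\<And>n. l ((f ^^ n) (f y)) = 0"
  shows "l y = 0"
proof -
  define V where "V = span (range (\<lambda>n. (f ^^ n) y))"
  have "f ` V = span (range (\<lambda>n. (f ^^ n) (f y)))"
  proof -
    have "f ` V = span (f ` range (\<lambda>n. (f ^^ n) y))"
      unfolding V_def using f(1) by (simp add: linear_span_image)
    also have "f ` range (\<lambda>n. (f ^^ n) y) = range (\<lambda>n. (f ^^ n) (f y))"
      by (simp add: image_image funpow_swap1)
    finally show ?thesis .
  qed
  moreover have "span (range (\<lambda>n. (f ^^ n) (f y))) \<subseteq> V"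
    unfolding V_def
  proof (rule span_mono, rule image_subsetI)
    fix n show "(f ^^ n) (f y) \<in> range (\<lambda>n. (f ^^ n) y)"
      by (rule range_eqI[of _ _ "Suc n"]) (simp add: funpow_swap1)
  qed
  moreover have "dim (f ` V) = dim V"
    using f by (intro dim_image_eq) (auto intro: inj_on_subset)
  ultimately have "f ` V = V"
    by (metis V_def order_refl span_subspace subspace_dim_equal subspace_span)
  have "y \<in> V"
    unfolding V_def by (rule span_base) (auto intro: range_eqI[of _ _ 0])
  then have "y \<in> span (range (\<lambda>n. (f ^^ n) (f y)))"
    using \<open>f ` V = V\<close> \<open>f ` V = span (range (\<lambda>n. (f ^^ n) (f y)))\<close> by simp
  then show ?thesis
    by (rule linear_eq_0_on_span[OF l, rotated]) (use zero in auto)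
qed

definition outer :: "real^'n \<Rightarrow> real^'n^'n" where
  "outer v = (\<chi> i j. v $ i * v $ j)"

lemma outer_image: "S ** outer v ** transpose S = outer (S *v v)" for S :: "real^'n^'n"
  by (simp add: vec_eq_iff outer_def matrix_matrix_mult_def matrix_vector_mult_def transpose_def
      sum_product sum_distrib_left sum_distrib_right mult_ac)

text \<open>If a quadratic form is constant along a forward orbit of an invertible matrix, it has the same
  value one step earlier. Quadratic forms are linear in \<open>outer v\<close>, and the second component
  of the pair below carries the constant.\<close>

lemma quadratic_form_constant_backwards:
  fixes S Q W :: "real^'n^'n"
  assumes S: "invertible S" and const: "\<And>n. (W *v (((*v) S ^^ n) (S *v v))) \<bullet> (Q *v (W *v (((*v) S ^^ n) (S *v v)))) = c"
  shows "(W *v v) \<bullet> (Q *v (W *v v)) = c"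
proof -
  define f where "f p = (S ** fst p ** transpose S, snd p)" for p :: "(real^'n^'n) \<times> real"
  define T where "T = transpose W ** Q ** W"
  define l where "l p = (\<Sum>i\<in>UNIV. \<Sum>j\<in>UNIV. T $ i $ j * fst p $ i $ j) - c * snd p"
    for p :: "(real^'n^'n) \<times> real"
  have "linear f"
    unfolding f_def
    by (rule linearI) (auto simp: matrix_add_ldistrib matrix_add_rdistrib matrix_scalar_ac
        simp flip: scalar_matrix_assoc)
  moreover have "inj f"
  proof (rule injI)
    fix p p' assume "f p = f p'"
    then have eq: "S ** fst p ** transpose S = S ** fst p' ** transpose S" "snd p = snd p'"
      by (auto simp: f_def)
    have inv: "matrix_inv S ** S = mat 1" "transpose S ** matrix_inv (transpose S) = mat 1"
      using S matrix_inv_left matrix_inv_right transpose_invertible by blast+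
    have "matrix_inv S ** (S ** X ** transpose S) ** matrix_inv (transpose S) = X" for X
      using inv by (metis matrix_mul_assoc matrix_mul_lid matrix_mul_rid)
    then have "fst p = fst p'" using eq(1) by metis
    then show "p = p'" using eq(2) by (simp add: prod_eq_iff)
  qed
  moreover have "linear l"
    unfolding l_def
    by (rule linearI)
      (auto simp: sum.distrib algebra_simps sum_distrib_left)
  moreover have f_outer: "(f ^^ n) (outer x, 1) = (outer (((*v) S ^^ n) x), 1)" for n x
    by (induction n) (auto simp: f_def outer_image)
  moreover have l_outer: "l (outer x, 1) = (W *v x) \<bullet> (Q *v (W *v x)) - c" for x
  proof -
    have "(W *v x) \<bullet> (Q *v (W *v x)) = x \<bullet> (T *v x)"
      by (simp add: T_def matrix_vector_mul_assoc[symmetric] del: transpose_matrix_vector)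
        (metis inner_matrix_transpose transpose_transpose)
    also have "\<dots> = (\<Sum>i\<in>UNIV. \<Sum>j\<in>UNIV. T $ i $ j * outer x $ i $ j)"
      by (simp add: inner_vec_def matrix_vector_mult_def outer_def sum_distrib_left mult_ac)
    finally show ?thesis by (simp add: l_def)
  qed
  have "l (outer v, 1) = 0"
  proof (rule functional_vanishes_backwards[OF \<open>linear f\<close> \<open>inj f\<close> \<open>linear l\<close>])
    fix n
    have "f (outer v, 1) = (outer (S *v v), 1)"
      using f_outer[of 1 v] by simp
    then show "l ((f ^^ n) (f (outer v, 1))) = 0"
      using const[of n] by (simp add: f_outer l_outer)
  qed
  then show ?thesis by (simp add: l_outer)
qed

text \<open>\<open>Q\<close> is a limit of Cesaro means of the forms \<open>H n\<close>, the averages of \<open>(norm (mprod S w *v x))\<^sup>2\<close>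
  over the words of length \<open>n\<close>. Averaging over one more letter turns \<open>H n\<close> into \<open>H (Suc n)\<close>, so the Cesaro
  limit is invariant in the mean, and the assumption \<open>large\<close> keeps its trace away from zero.\<close>

lemma bounded_semigroup_average_form:
  fixes S :: "nat \<Rightarrow> real^'n^'n" and p :: "nat \<Rightarrow> real"
  assumes K: "\<And>v. v \<in> lists {1..M} \<Longrightarrow> mnorm (mprod S v) \<le> K"
    and p: "\<And>i. i \<in> {1..M} \<Longrightarrow> 0 \<le> p i" "(\<Sum>i\<in>{1..M}. p i) = 1"
    and large: "\<And>n. 1 \<le> (\<Sum>w\<in>words M n. prod_list (map p w) * (mnorm (mprod S w))\<^sup>2)"
  obtains Q where "\<And>x y. x \<bullet> (Q *v y) = y \<bullet> (Q *v x)" "\<And>x. 0 \<le> x \<bullet> (Q *v x)"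
    "\<exists>x. x \<bullet> (Q *v x) \<noteq> 0"
    "\<And>x. (\<Sum>i\<in>{1..M}. p i * ((S i *v x) \<bullet> (Q *v (S i *v x)))) = x \<bullet> (Q *v x)"
proof -
  define N where "N = real (CARD('n) * CARD('n))"
  have N: "N > 0" by (simp add: N_def)
  define H where "H n = (\<Sum>w\<in>words M n. prod_list (map p w) *\<^sub>R (transpose (mprod S w) ** mprod S w))" for n
  have sum_mv: "(\<Sum>i\<in>I. F i) *v x = (\<Sum>i\<in>I. F i *v x)" for I :: "'b set" and F :: "'b \<Rightarrow> real^'n^'n" and x
    by (induction I rule: infinite_finite_induct) (auto simp: matrix_vector_mult_add_rdistrib)
  have H_form: "x \<bullet> (H n *v y) = (\<Sum>w\<in>words M n. prod_list (map p w) * ((mprod S w *v x) \<bullet> (mprod S w *v y)))" for n x y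
  proof -
    have "x \<bullet> ((transpose X ** X) *v y) = (X *v x) \<bullet> (X *v y)" for X :: "real^'n^'n"
      using inner_matrix_transpose[of x "transpose X" "X *v y"]
      by (simp add: matrix_vector_mul_assoc del: transpose_matrix_vector)
    then show ?thesis
      by (simp add: H_def sum_mv inner_sum_right scaleR_matrix_vector_assoc[symmetric] del: transpose_matrix_vector)
  qed
  have w_nonneg: "0 \<le> prod_list (map p w)" if "w \<in> words M n" for w n
    by (rule prod_list_nonneg) (use that p(1) in \<open>auto simp: words_def subset_eq\<close>)
  have w_sum: "(\<Sum>w\<in>words M n. prod_list (map p w)) = 1" for n
    using sum_words_prod_list[of p M n] p(2) by simp
  have K0: "0 \<le> K" using order_trans[OF mnorm_nonneg K[of "[]"]] by simp
  have H_bound: "norm (H n) \<le> N * (N * K\<^sup>2)" for n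
  proof -
    have entry: "\<bar>H n $ i $ j\<bar> \<le> K\<^sup>2" for i j
    proof -
      have "H n $ i $ j = axis i 1 \<bullet> (H n *v axis j 1)"
        by (simp add: inner_axis' matrix_vector_mul_component inner_axis)
      also have "\<dots> = (\<Sum>w\<in>words M n. prod_list (map p w) * ((mprod S w *v axis i 1) \<bullet> (mprod S w *v axis j 1)))"
        by (rule H_form)
      also have "\<bar>\<dots>\<bar> \<le> (\<Sum>w\<in>words M n. prod_list (map p w) * K\<^sup>2)"
      proof (rule order_trans[OF sum_abs], rule sum_mono)
        fix w assume w: "w \<in> words M n"
        have "mnorm (mprod S w) \<le> K" using w by (intro K) (auto simp: words_def)
        then have le: "norm (mprod S w *v axis k 1) \<le> K" for k
          using norm_matrix_vector_le[of "mprod S w" "axis k 1"] by (simp add: norm_axis_1)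
        have "\<bar>(mprod S w *v axis i 1) \<bullet> (mprod S w *v axis j 1)\<bar> \<le> norm (mprod S w *v axis i 1) * norm (mprod S w *v axis j 1)"
          by (rule Cauchy_Schwarz_ineq2)
        also have "\<dots> \<le> K * K" using le K0 by (intro mult_mono) auto
        finally show "\<bar>prod_list (map p w) * ((mprod S w *v axis i 1) \<bullet> (mprod S w *v axis j 1))\<bar>
            \<le> prod_list (map p w) * K\<^sup>2"
          using w_nonneg[OF w] by (simp add: abs_mult power2_eq_square mult_left_mono)
      qed
      also have "\<dots> = K\<^sup>2" by (simp add: w_sum flip: sum_distrib_right)
      finally show ?thesis .
    qed
    have "norm (H n) \<le> (\<Sum>i\<in>UNIV. norm (H n $ i))"
      unfolding norm_vec_def[of "H n"] by (rule L2_set_le_sum) simp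
    also have "\<dots> \<le> (\<Sum>i\<in>(UNIV::'n set). \<Sum>j\<in>(UNIV::'n set). \<bar>H n $ i $ j\<bar>)"
      by (intro sum_mono norm_le_l1_cart)
    also have "\<dots> \<le> (\<Sum>i\<in>(UNIV::'n set). \<Sum>j\<in>(UNIV::'n set). K\<^sup>2)"
      by (intro sum_mono entry)
    also have "\<dots> = N * K\<^sup>2" by (simp add: N_def)
    also have "\<dots> \<le> N * (N * K\<^sup>2)"
    proof -
      have "1 \<le> CARD('n) * CARD('n)" by (simp add: Suc_le_eq)
      then have "1 \<le> N" unfolding N_def by linarith
      then have "1 * (N * K\<^sup>2) \<le> N * (N * K\<^sup>2)" using N by (intro mult_right_mono) auto
      then show ?thesis by simp
    qed
    finally show ?thesis .
  qed
  have H_step: "x \<bullet> (H (Suc n) *v y) = (\<Sum>i\<in>{1..M}. p i * ((S i *v x) \<bullet> (H n *v (S i *v y))))" for n x y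
    unfolding H_form sum_words_Suc
    by (simp add: sum_distrib_left matrix_vector_mul_assoc mult.assoc)
  define C where "C n = (\<Sum>k<Suc n. H k) /\<^sub>R real (Suc n)" for n
  have C_form: "x \<bullet> (C n *v y) = (\<Sum>k<Suc n. x \<bullet> (H k *v y)) / real (Suc n)" for n x y
    by (simp add: C_def sum_mv inner_sum_right divide_inverse mult.commute
        del: sum.lessThan_Suc flip: scaleR_matrix_vector_assoc)
  have "norm (C n) \<le> N * (N * K\<^sup>2)" for n
  proof -
    have "norm (C n) = norm (\<Sum>k<Suc n. H k) / real (Suc n)"
      by (simp add: C_def divide_inverse mult.commute del: sum.lessThan_Suc)
    also have "\<dots> \<le> (\<Sum>k<Suc n. N * (N * K\<^sup>2)) / real (Suc n)"
      by (intro divide_right_mono sum_norm_le H_bound) auto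
    also have "\<dots> = N * (N * K\<^sup>2)"
      by (simp del: sum.lessThan_Suc)
    finally show ?thesis .
  qed
  then have "bounded (range C)"
    unfolding bounded_iff by auto
  then obtain Q r where Q: "strict_mono r" "(C \<circ> r) \<longlonglongrightarrow> Q"
    using bounded_imp_convergent_subsequence[of C] by blast
  have Q_lim: "(\<lambda>n. x \<bullet> (C (r n) *v y)) \<longlonglongrightarrow> x \<bullet> (Q *v y)" for x y
  proof -
    have "linear (\<lambda>X :: real^'n^'n. X *v y)"
      by (rule linearI) (auto simp: matrix_vector_mult_add_rdistrib scaleR_matrix_vector_assoc)
    then have "bounded_linear (\<lambda>X :: real^'n^'n. X *v y)"
      by (simp add: linear_conv_bounded_linear)
    from bounded_linear.tendsto[OF this Q(2)]
    have "(\<lambda>n. (C \<circ> r) n *v y) \<longlonglongrightarrow> Q *v y" .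
    then show ?thesis
      by (intro tendsto_inner tendsto_const) (simp add: o_def)
  qed
  show ?thesis
  proof (rule that)
    fix x y
    show "x \<bullet> (Q *v y) = y \<bullet> (Q *v x)"
    proof (rule LIMSEQ_unique[OF Q_lim])
      have "x \<bullet> (C n *v y) = y \<bullet> (C n *v x)" for n
        unfolding C_form H_form by (simp add: inner_commute)
      then show "(\<lambda>n. x \<bullet> (C (r n) *v y)) \<longlonglongrightarrow> y \<bullet> (Q *v x)"
        using Q_lim[of y x] by simp
    qed
    show "0 \<le> x \<bullet> (Q *v x)"
    proof (rule LIMSEQ_le_const[OF Q_lim], intro exI allI impI)
      fix n show "0 \<le> x \<bullet> (C (r n) *v x)"
        unfolding C_form H_form using w_nonneg
        by (intro divide_nonneg_nonneg sum_nonneg mult_nonneg_nonneg) auto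
    qed
    show "(\<Sum>i\<in>{1..M}. p i * ((S i *v x) \<bullet> (Q *v (S i *v x)))) = x \<bullet> (Q *v x)"
    proof -
      define h where "h n = x \<bullet> (H n *v x)" for n
      have h_bound: "\<bar>h n\<bar> \<le> N * (N * K\<^sup>2) * (norm x * norm x)" for n
      proof -
        have "\<bar>h n\<bar> \<le> norm x * norm (H n *v x)"
          unfolding h_def by (rule Cauchy_Schwarz_ineq2)
        also have "\<dots> \<le> norm x * (norm (H n) * norm x)"
          using norm_matrix_vector_le[of "H n" x] mnorm_le_norm[of "H n"]
          by (meson mult_left_mono mult_right_mono norm_ge_zero order_trans)
        also have "\<dots> \<le> norm x * ((N * (N * K\<^sup>2)) * norm x)"
          by (intro mult_left_mono mult_right_mono H_bound) auto
        finally show ?thesis by (simp add: mult_ac)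
      qed
      have diff: "(\<Sum>i\<in>{1..M}. p i * ((S i *v x) \<bullet> (C n *v (S i *v x)))) - x \<bullet> (C n *v x)
          = (h (Suc n) - h 0) / real (Suc n)" for n
      proof -
        have "(\<Sum>i\<in>{1..M}. p i * ((S i *v x) \<bullet> (C n *v (S i *v x)))) = (\<Sum>k<Suc n. h (Suc k)) / real (Suc n)"
          unfolding C_form h_def H_step
          by (simp add: sum_distrib_left sum_divide_distrib sum.swap[of _ "{..<Suc n}"] del: sum.lessThan_Suc)
        moreover have "x \<bullet> (C n *v x) = (\<Sum>k<Suc n. h k) / real (Suc n)"
          unfolding C_form h_def ..
        moreover have "(\<Sum>k<Suc n. h (Suc k)) - (\<Sum>k<Suc n. h k) = h (Suc n) - h 0"
          using sum_lessThan_telescope[of h "Suc n"] by (simp only: sum_subtractf)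
        ultimately show ?thesis by (simp only: diff_divide_distrib[symmetric])
      qed
      have "(\<lambda>n. (h (Suc (r n)) - h 0) / real (Suc (r n))) \<longlonglongrightarrow> 0"
      proof (rule tendsto_rabs_zero_cancel, rule tendsto_sandwich[OF always_eventually always_eventually tendsto_const])
        define c where "c = 2 * (N * (N * K\<^sup>2) * (norm x * norm x))"
        show "\<forall>n. 0 \<le> \<bar>(h (Suc (r n)) - h 0) / real (Suc (r n))\<bar>" by simp
        show "\<forall>n. \<bar>(h (Suc (r n)) - h 0) / real (Suc (r n))\<bar> \<le> c / real (Suc (r n))"
        proof
          fix n
          have "\<bar>h (Suc (r n)) - h 0\<bar> \<le> c"
            unfolding c_def using h_bound[of "Suc (r n)"] h_bound[of 0] by linarith
          then show "\<bar>(h (Suc (r n)) - h 0) / real (Suc (r n))\<bar> \<le> c / real (Suc (r n))"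
            by (simp add: divide_right_mono)
        qed
        have "(\<lambda>n. c / real (Suc n)) \<longlonglongrightarrow> 0"
          using lim_const_over_n[of c] by (rule LIMSEQ_Suc)
        from LIMSEQ_subseq_LIMSEQ[OF this Q(1)]
        show "(\<lambda>n. c / real (Suc (r n))) \<longlonglongrightarrow> 0" by (simp add: o_def)
      qed
      moreover have "(\<lambda>n. (h (Suc (r n)) - h 0) / real (Suc (r n)))
          \<longlonglongrightarrow> (\<Sum>i\<in>{1..M}. p i * ((S i *v x) \<bullet> (Q *v (S i *v x)))) - x \<bullet> (Q *v x)"
        unfolding diff[symmetric] by (intro tendsto_diff tendsto_sum tendsto_mult tendsto_const Q_lim)
      ultimately show ?thesis
        using LIMSEQ_unique by fastforce
    qed
  next
    define trace where "trace X = (\<Sum>b\<in>Basis. b \<bullet> (X *v b))" for X :: "real^'n^'n"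
    have "1 / DIM(real^'n) \<le> trace (C n)" for n
    proof -
      have "1 / DIM(real^'n) \<le> trace (H k)" for k
      proof -
        have norm_le: "(mnorm X)\<^sup>2 \<le> DIM(real^'n) * (\<Sum>b\<in>Basis. (X *v b) \<bullet> (X *v b))" for X :: "real^'n^'n"
        proof -
          have "mnorm X \<le> (\<Sum>b\<in>Basis. norm (X *v b))"
          proof (rule mnorm_least)
            fix z :: "real^'n"
            have "X *v z = X *v (\<Sum>b\<in>Basis. (z \<bullet> b) *\<^sub>R b)"
              by (simp add: euclidean_representation)
            also have "\<dots> = (\<Sum>b\<in>Basis. (z \<bullet> b) *\<^sub>R (X *v b))"
              by (simp add: linear_sum[OF matrix_vector_mul_linear] matrix_vector_mult_scaleR)
            also have "norm \<dots> \<le> (\<Sum>b\<in>Basis. norm (X *v b) * norm z)"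
              by (rule sum_norm_le) (auto simp: mult.commute intro!: mult_right_mono Basis_le_norm)
            finally show "norm (X *v z) \<le> (\<Sum>b\<in>Basis. norm (X *v b)) * norm z"
              by (simp add: sum_distrib_right)
          qed
          then have "(mnorm X)\<^sup>2 \<le> (\<Sum>b\<in>Basis. norm (X *v b))\<^sup>2"
            by (intro power_mono mnorm_nonneg)
          also have "\<dots> \<le> (\<Sum>b\<in>Basis. (norm (X *v b))\<^sup>2) * DIM(real^'n)"
            by (rule sum_squared_le_sum_of_squares)
          finally show ?thesis
            by (simp only: power2_norm_eq_inner mult.commute)
        qed
        have "1 \<le> (\<Sum>w\<in>words M k. prod_list (map p w) * (mnorm (mprod S w))\<^sup>2)" by (rule large)
        also have "\<dots> \<le> (\<Sum>w\<in>words M k. prod_list (map p w) * (DIM(real^'n) * (\<Sum>b\<in>Basis. (mprod S w *v b) \<bullet> (mprod S w *v b))))"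
          by (intro sum_mono mult_left_mono norm_le w_nonneg)
        also have "\<dots> = DIM(real^'n) * trace (H k)"
          unfolding trace_def H_form sum_distrib_left
          by (subst sum.swap) (simp only: mult.left_commute)
        finally show ?thesis by (simp add: pos_divide_le_eq mult.commute)
      qed
      moreover have scaled: "real (Suc n) * (b \<bullet> (C n *v b)) = (\<Sum>k<Suc n. b \<bullet> (H k *v b))" for b
        by (simp add: C_form del: sum.lessThan_Suc of_nat_Suc)
      ultimately have "(\<Sum>k<Suc n. 1 / DIM(real^'n)) \<le> (\<Sum>k<Suc n. trace (H k))"
        by (intro sum_mono)
      also have "\<dots> = real (Suc n) * trace (C n)"
        unfolding trace_def sum_distrib_left scaled by (rule sum.swap)
      finally have "real (Suc n) * (1 / DIM(real^'n)) \<le> real (Suc n) * trace (C n)"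
        by (simp del: sum.lessThan_Suc of_nat_Suc)
      then show ?thesis by (simp only: mult_le_cancel_left_pos of_nat_0_less_iff zero_less_Suc)
    qed
    moreover have "(\<lambda>n. trace (C (r n))) \<longlonglongrightarrow> trace Q"
      unfolding trace_def by (intro tendsto_sum Q_lim)
    ultimately have "1 / DIM(real^'n) \<le> trace Q"
      by (intro LIMSEQ_le_const) auto
    moreover have "1 / real (DIM(real^'n)) > 0" by simp
    ultimately have "trace Q \<noteq> 0" by linarith
    then show "\<exists>x. x \<bullet> (Q *v x) \<noteq> 0"
      unfolding trace_def by (meson sum.neutral)
  qed
qed

text \<open>The averaged form \<open>q\<close> is harmonic, so it is constant on the orbit of a point where it is
  maximal on an orbit closure. Such points span the space by irreducibility. As \<open>q\<close> is also
  constant along backward orbits of such points, the inverses of the products are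
  bounded, and every point can be approximated by them.\<close>

theorem bounded_irreducible_invariant_form:
  fixes S :: "nat \<Rightarrow> real^'n^'n" and p :: "nat \<Rightarrow> real"
  assumes irr: "irreducible_tuple M S" and inv: "\<And>i. i \<in> {1..M} \<Longrightarrow> invertible (S i)"
    and K: "\<And>v. v \<in> lists {1..M} \<Longrightarrow> mnorm (mprod S v) \<le> K"
    and p: "\<And>i. i \<in> {1..M} \<Longrightarrow> 0 < p i" "(\<Sum>i\<in>{1..M}. p i) = 1"
    and large: "\<And>n. 1 \<le> (\<Sum>w\<in>words M n. prod_list (map p w) * (mnorm (mprod S w))\<^sup>2)"
  obtains Q where "transpose Q = Q" "\<And>x. x \<noteq> 0 \<Longrightarrow> 0 < x \<bullet> (Q *v x)"
    "\<And>i. i \<in> {1..M} \<Longrightarrow> transpose (S i) ** Q ** S i = Q"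
proof -
  obtain Q where sym: "\<And>x y. x \<bullet> (Q *v y) = y \<bullet> (Q *v x)" and nonneg: "\<And>x. 0 \<le> x \<bullet> (Q *v x)"
    and nz: "\<exists>x. x \<bullet> (Q *v x) \<noteq> 0"
    and harmonic: "\<And>x. (\<Sum>i\<in>{1..M}. p i * ((S i *v x) \<bullet> (Q *v (S i *v x)))) = x \<bullet> (Q *v x)"
  proof (rule bounded_semigroup_average_form[of M S K p])
    show "\<And>v. v \<in> lists {1..M} \<Longrightarrow> mnorm (mprod S v) \<le> K" by (rule K)
    show "\<And>i. i \<in> {1..M} \<Longrightarrow> 0 \<le> p i" using p(1) less_imp_le by blast
  qed (rule p(2) large | (rule that, assumption+))+
  define q where "q x = x \<bullet> (Q *v x)" for x
  have form: "u \<bullet> (Q *v u) = q u" for u by (simp add: q_def)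
  have kernel: "Q *v x = 0" if "q x = 0" for x
  proof -
    have "(Q *v x) \<bullet> (Q *v x) = 0"
      by (rule nonneg_form_null_vector[OF matrix_vector_mul_linear subspace_UNIV sym nonneg])
        (use that in \<open>auto simp: q_def\<close>)
    then show ?thesis by simp
  qed
  have q_pos: "q x > 0" if "x \<noteq> 0" for x
  proof (rule ccontr)
    assume "\<not> q x > 0"
    then have qx: "q x = 0" using nonneg[of x] by (simp add: q_def)
    have "{x. Q *v x = 0} = UNIV"
    proof (rule irreducible_invariant_subspace[OF irr _ _ that])
      show "subspace {x. Q *v x = 0}"
        by (rule subspaceI) (auto simp: matrix_vector_right_distrib matrix_vector_mult_scaleR)
      show "x \<in> {x. Q *v x = 0}" using kernel[OF qx] by simp
      fix i y assume i: "i \<in> {1..M}" and "y \<in> {x. Q *v x = 0}"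
      then have "(\<Sum>i\<in>{1..M}. p i * q (S i *v y)) = 0"
        using harmonic[of y] by (simp add: q_def)
      moreover have "0 \<le> p j * q (S j *v y)" if "j \<in> {1..M}" for j
        using nonneg p(1)[OF that] by (simp add: q_def)
      ultimately have "p i * q (S i *v y) = 0"
        using i by (subst (asm) sum_nonneg_eq_0_iff) auto
      then have "q (S i *v y) = 0" using p(1)[OF i] by simp
      then show "S i *v y \<in> {x. Q *v x = 0}" using kernel by simp
    qed
    then have "Q *v y = 0" for y by blast
    then show False using nz by simp
  qed
  have q_cont: "continuous_on X q" for X
    unfolding q_def
    by (intro continuous_intros linear_continuous_on matrix_vector_mul_bounded_linear)
  have q_scale: "q (t *\<^sub>R x) = t\<^sup>2 * q x" for t x
    by (simp add: q_def matrix_vector_mult_scaleR power2_eq_square)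
  obtain m where m: "m > 0" "\<And>x. m * (norm x)\<^sup>2 \<le> q x"
  proof -
    have "sphere (0::real^'n) 1 \<noteq> {}" by (simp add: sphere_eq_empty)
    from continuous_attains_inf[OF compact_sphere this q_cont]
    obtain u where u: "u \<in> sphere (0::real^'n) 1" "\<And>x. x \<in> sphere 0 1 \<Longrightarrow> q u \<le> q x"
      by auto
    have "q u * (norm x)\<^sup>2 \<le> q x" for x
    proof (cases "x = 0")
      case False
      have "q u \<le> q (x /\<^sub>R norm x)" using False by (intro u(2)) simp
      also have "\<dots> = q x / (norm x)\<^sup>2"
        by (simp add: q_scale divide_inverse power_inverse mult.commute)
      finally show ?thesis using False by (simp add: pos_le_divide_eq)
    qed (simp add: q_def)
    moreover have "q u > 0" using u(1) by (intro q_pos) auto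
    ultimately show ?thesis using that by blast
  qed
  define \<U> where "\<U> = {u. \<forall>w\<in>lists {1..M}. q (mprod S w *v u) = q u}"
  have \<U>_step: "S i *v u \<in> \<U>" if u: "u \<in> \<U>" and i: "i \<in> {1..M}" for u i
  proof -
    have "q (mprod S w *v (S i *v u)) = q (S i *v u)" if w: "w \<in> lists {1..M}" for w
    proof -
      have "i # w \<in> lists {1..M}" "[i] \<in> lists {1..M}" using i w by auto
      then have "q (mprod S (i # w) *v u) = q u" "q (mprod S [i] *v u) = q u"
        using u unfolding \<U>_def by blast+
      then show ?thesis by (simp add: matrix_vector_mul_assoc)
    qed
    then show ?thesis by (simp add: \<U>_def)
  qed
  (* a maximum of q on the closure of an orbit lies in U *)
  have maximum: "\<exists>u w. u \<in> \<U> \<and> q x \<le> q u \<and> (\<forall>k. w k \<in> lists {1..M}) \<and> (\<lambda>k. mprod S (w k) *v x) \<longlonglongrightarrow> u" for x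
  proof -
    define \<O> where "\<O> = closure ((\<lambda>w. mprod S w *v x) ` lists {1..M})"
    have "norm (mprod S w *v x) \<le> K * norm x" if "w \<in> lists {1..M}" for w
      using norm_matrix_vector_le[of "mprod S w" x] mult_right_mono[OF K[OF that], of "norm x"] by simp
    then have "bounded ((\<lambda>w. mprod S w *v x) ` lists {1..M})"
      unfolding bounded_iff by blast
    then have "compact \<O>" by (simp add: \<O>_def compact_closure)
    moreover have x_in: "x \<in> \<O>"
      unfolding \<O>_def by (rule subsetD[OF closure_subset]) (auto intro!: image_eqI[of _ _ "[]"])
    ultimately have "compact \<O>" "\<O> \<noteq> {}" by auto
    from continuous_attains_sup[OF this q_cont]
    obtain u where u: "u \<in> \<O>" "\<And>y. y \<in> \<O> \<Longrightarrow> q y \<le> q u"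
      by auto
    have step: "S i *v y \<in> \<O>" if y: "y \<in> \<O>" and i: "i \<in> {1..M}" for y i
    proof -
      have "continuous_on UNIV ((*v) (S i))"
        by (intro linear_continuous_on matrix_vector_mul_bounded_linear)
      then have "(*v) (S i) ` \<O> \<subseteq> closure ((*v) (S i) ` (\<lambda>w. mprod S w *v x) ` lists {1..M})"
        unfolding \<O>_def by (intro image_closure_subset) (auto intro: continuous_on_subset closure_subset[THEN subsetD])
      also have "\<dots> \<subseteq> \<O>"
        unfolding \<O>_def
      proof (rule closure_mono, rule subsetI)
        fix z assume "z \<in> (*v) (S i) ` (\<lambda>w. mprod S w *v x) ` lists {1..M}"
        then obtain w where w: "w \<in> lists {1..M}" "z = S i *v (mprod S w *v x)" by blast
        have "w @ [i] \<in> lists {1..M}" using w(1) i by auto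
        moreover have "z = mprod S (w @ [i]) *v x"
          by (simp add: w(2) mprod_append matrix_vector_mul_assoc)
        ultimately show "z \<in> (\<lambda>w. mprod S w *v x) ` lists {1..M}" by blast
      qed
      finally show ?thesis using y by blast
    qed
    have max_step: "q (S i *v y) = q u" if y: "y \<in> \<O>" "q y = q u" and i: "i \<in> {1..M}" for y i
    proof -
      have "(\<Sum>i\<in>{1..M}. p i * (q u - q (S i *v y))) = 0"
        using harmonic[of y] y(2) p(2)
        by (simp add: form right_diff_distrib sum_subtractf flip: sum_distrib_right)
      moreover have "0 \<le> p j * (q u - q (S j *v y))" if "j \<in> {1..M}" for j
        using u(2)[OF step[OF y(1) that]] p(1)[OF that] by simp
      ultimately have "p i * (q u - q (S i *v y)) = 0"
        using i by (subst (asm) sum_nonneg_eq_0_iff) auto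
      then show ?thesis using p(1)[OF i] by simp
    qed
    have "mprod S w *v y \<in> \<O> \<and> q (mprod S w *v y) = q u"
      if "w \<in> lists {1..M}" "y \<in> \<O>" "q y = q u" for w y
      using that
    proof (induction w arbitrary: y)
      case (Cons i w)
      then have "S i *v y \<in> \<O>" "q (S i *v y) = q u"
        using step max_step by auto
      then show ?case
        using Cons by (simp add: matrix_vector_mul_assoc[symmetric])
    qed simp
    then have "u \<in> \<U>" using u(1) by (auto simp: \<U>_def)
    moreover have "q x \<le> q u" by (rule u(2)[OF x_in])
    moreover have "\<exists>w. (\<forall>k. w k \<in> lists {1..M}) \<and> (\<lambda>k. mprod S (w k) *v x) \<longlonglongrightarrow> u"
    proof -
      obtain z where z: "\<And>k. z k \<in> (\<lambda>w. mprod S w *v x) ` lists {1..M}" "z \<longlonglongrightarrow> u"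
        using u(1) unfolding \<O>_def closure_sequential by blast
      then have "\<forall>k. \<exists>w\<in>lists {1..M}. z k = mprod S w *v x" by blast
      then obtain w where w: "\<And>k. w k \<in> lists {1..M} \<and> z k = mprod S (w k) *v x" by metis
      then have "z = (\<lambda>k. mprod S (w k) *v x)" by auto
      then show ?thesis using z(2) w by blast
    qed
    ultimately show ?thesis by blast
  qed
  obtain x0 :: "real^'n" where x0: "x0 \<noteq> 0"
    using nz by (metis inner_zero_left)
  obtain u0 where u0: "u0 \<in> \<U>" "q x0 \<le> q u0" using maximum[of x0] by blast
  then have "u0 \<noteq> 0" using q_pos[OF x0] by (auto simp: q_def)
  have span_\<U>: "span \<U> = UNIV"
  proof (rule irreducible_invariant_subspace[OF irr subspace_span _ \<open>u0 \<noteq> 0\<close>])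
    show "u0 \<in> span \<U>" using u0(1) by (rule span_base)
    fix i y assume i: "i \<in> {1..M}" and "y \<in> span \<U>"
    then have "S i *v y \<in> span ((*v) (S i) ` \<U>)"
      by (simp add: linear_span_image)
    also have "\<dots> \<subseteq> span \<U>"
      using \<U>_step i by (intro span_mono) blast
    finally show "S i *v y \<in> span \<U>" .
  qed
  (* q is constant on the forward orbit of S i *v v, hence has the same value at v *)
  have \<U>_back: "v \<in> \<U>" if v: "S i *v v \<in> \<U>" and i: "i \<in> {1..M}" for v i
  proof -
    let ?c = "q (S i *v v)"
    have pow: "(((*v) (S i)) ^^ n) (S i *v v) \<in> \<U> \<and> q ((((*v) (S i)) ^^ n) (S i *v v)) = ?c" for n
    proof (induction n)
      case (Suc n)
      let ?y = "(((*v) (S i)) ^^ n) (S i *v v)"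
      have "[i] \<in> lists {1..M}" using i by simp
      then have "q (mprod S [i] *v ?y) = q ?y" using Suc unfolding \<U>_def by blast
      then show ?case using Suc \<U>_step[OF _ i, of ?y] by simp
    qed (use v in simp)
    have "q (mprod S w *v v) = ?c" if w: "w \<in> lists {1..M}" for w
      unfolding q_def
    proof (rule quadratic_form_constant_backwards[OF inv[OF i]])
      fix n
      show "(mprod S w *v (((*v) (S i) ^^ n) (S i *v v))) \<bullet> (Q *v (mprod S w *v (((*v) (S i) ^^ n) (S i *v v))))
          = (S i *v v) \<bullet> (Q *v (S i *v v))"
        using pow[of n] w unfolding \<U>_def form by auto
    qed
    moreover from this[of "[]"] have "q v = ?c" by simp
    ultimately show ?thesis by (simp add: \<U>_def)
  qed
  have inv_prod: "invertible (mprod S w)" if "w \<in> lists {1..M}" for w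
    using that
  proof (induction w)
    case Nil
    then show ?case by (simp add: invertible_def)
  next
    case (Cons i w)
    then show ?case using inv[of i] by (simp add: invertible_mult)
  qed
  have \<U>_inv: "u \<in> \<U>" if "mprod S w *v u \<in> \<U>" "w \<in> lists {1..M}" for w u
    using that
  proof (induction w arbitrary: u)
    case (Cons i w)
    then have "mprod S w *v (S i *v u) \<in> \<U>" "w \<in> lists {1..M}" "i \<in> {1..M}"
      by (auto simp: matrix_vector_mul_assoc)
    from \<U>_back[OF Cons.IH[OF this(1,2)] this(3)] show ?case .
  qed simp
  have inv_apply: "mprod S w *v (matrix_inv (mprod S w) *v y) = y"
    "matrix_inv (mprod S w) *v (mprod S w *v y) = y" if "w \<in> lists {1..M}" for w y
    using matrix_inv_right[OF inv_prod[OF that]] matrix_inv_left[OF inv_prod[OF that]]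
    by (simp_all add: matrix_vector_mul_assoc)
  (* q is comparable to the squared norm, so the inverses are bounded on U and then on its span *)
  have \<U>_inv_norm: "norm (matrix_inv (mprod S w) *v u) \<le> sqrt (q u / m)" if u: "u \<in> \<U>" and w: "w \<in> lists {1..M}" for u w
  proof -
    let ?v = "matrix_inv (mprod S w) *v u"
    have "mprod S w *v ?v \<in> \<U>" using u inv_apply(1)[OF w] by simp
    then have "?v \<in> \<U>" by (rule \<U>_inv[OF _ w])
    then have "q (mprod S w *v ?v) = q ?v" using w unfolding \<U>_def by blast
    then have "q ?v = q u" using inv_apply(1)[OF w] by simp
    then have "(norm ?v)\<^sup>2 \<le> q u / m"
      using m(2)[of ?v] m(1) by (simp add: pos_le_divide_eq mult.commute)
    then show ?thesis by (rule real_le_rsqrt)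
  qed
  have "\<exists>c. \<forall>w\<in>lists {1..M}. norm (matrix_inv (mprod S w) *v x) \<le> c" for x
  proof -
    define X where "X = {x. \<exists>c. \<forall>w\<in>lists {1..M}. norm (matrix_inv (mprod S w) *v x) \<le> c}"
    have "subspace X"
    proof (rule subspaceI)
      show "0 \<in> X" unfolding X_def by auto
      fix y z assume "y \<in> X" "z \<in> X"
      then obtain c d where cd: "\<And>w. w \<in> lists {1..M} \<Longrightarrow> norm (matrix_inv (mprod S w) *v y) \<le> c"
          "\<And>w. w \<in> lists {1..M} \<Longrightarrow> norm (matrix_inv (mprod S w) *v z) \<le> d"
        unfolding X_def by blast
      have "norm (matrix_inv (mprod S w) *v (y + z)) \<le> c + d" if "w \<in> lists {1..M}" for w
        using cd[OF that] norm_triangle_ineq[of "matrix_inv (mprod S w) *v y" "matrix_inv (mprod S w) *v z"]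
        unfolding matrix_vector_right_distrib by linarith
      then show "y + z \<in> X" unfolding X_def by blast
    next
      fix t :: real and y assume "y \<in> X"
      then obtain c where c: "\<And>w. w \<in> lists {1..M} \<Longrightarrow> norm (matrix_inv (mprod S w) *v y) \<le> c"
        unfolding X_def by blast
      have "norm (matrix_inv (mprod S w) *v (t *\<^sub>R y)) \<le> \<bar>t\<bar> * c" if "w \<in> lists {1..M}" for w
        using mult_left_mono[OF c[OF that], of "\<bar>t\<bar>"] by (simp add: matrix_vector_mult_scaleR)
      then show "t *\<^sub>R y \<in> X" unfolding X_def by blast
    qed
    moreover have "\<U> \<subseteq> X" using \<U>_inv_norm unfolding X_def by blast
    ultimately have "span \<U> \<subseteq> X" by (simp add: span_minimal)
    then show ?thesis using span_\<U> unfolding X_def by blast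
  qed
  then have "\<exists>c. \<forall>g\<in>(\<lambda>w. matrix_inv (mprod S w)) ` lists {1..M}. norm (g *v x) \<le> c" for x
    by (simp add: ball_simps del: One_nat_def)
  then obtain K' where "K' > 0" "\<And>g. g \<in> (\<lambda>w. matrix_inv (mprod S w)) ` lists {1..M} \<Longrightarrow> mnorm g \<le> K'"
    by (rule pointwise_bounded_imp_mnorm_bounded) blast
  then have K': "K' > 0" "\<And>w. w \<in> lists {1..M} \<Longrightarrow> mnorm (matrix_inv (mprod S w)) \<le> K'"
    by blast+
  (* x is the limit of images of points of U under inverses of products, which lie in U again *)
  have all: "q (S i *v x) = q x" if i: "i \<in> {1..M}" for i x
  proof -
    obtain u w where u: "u \<in> \<U>" and w: "\<And>k. w k \<in> lists {1..M}" "(\<lambda>k. mprod S (w k) *v x) \<longlonglongrightarrow> u"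
      using maximum[of x] by blast
    define v where "v k = matrix_inv (mprod S (w k)) *v u" for k
    have v: "v k \<in> \<U>" for k
      unfolding v_def by (rule \<U>_inv[OF _ w(1)[of k]]) (simp add: inv_apply(1)[OF w(1)] u)
    have "(\<lambda>k. norm (mprod S (w k) *v x - u)) \<longlonglongrightarrow> 0"
      using w(2) by (simp add: LIM_zero tendsto_norm_zero)
    then have null: "(\<lambda>k. K' * norm (mprod S (w k) *v x - u)) \<longlonglongrightarrow> 0"
      by (rule tendsto_mult_right_zero)
    have close: "\<forall>k. norm (v k - x) \<le> K' * norm (mprod S (w k) *v x - u)"
    proof
      fix k
      have "x - v k = matrix_inv (mprod S (w k)) *v (mprod S (w k) *v x - u)"
        using inv_apply(2)[OF w(1)] by (simp add: v_def matrix_vector_mult_diff_distrib)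
      then have "norm (x - v k) \<le> mnorm (matrix_inv (mprod S (w k))) * norm (mprod S (w k) *v x - u)"
        using norm_matrix_vector_le by metis
      also have "\<dots> \<le> K' * norm (mprod S (w k) *v x - u)"
        by (intro mult_right_mono K' w) simp
      finally show "norm (v k - x) \<le> K' * norm (mprod S (w k) *v x - u)"
        by (simp add: norm_minus_commute)
    qed
    have "(\<lambda>k. v k - x) \<longlonglongrightarrow> 0"
      by (rule Lim_null_comparison[OF always_eventually[OF close] null])
    then have vx: "v \<longlonglongrightarrow> x" by (simp add: LIM_zero_iff)
    have q_lim: "(\<lambda>k. q (y k)) \<longlonglongrightarrow> q z" if "y \<longlonglongrightarrow> z" for y z
      using continuous_on_tendsto_compose[OF q_cont[of UNIV] that] by simp
    have "(\<lambda>k. S i *v v k) \<longlonglongrightarrow> S i *v x"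
      by (rule continuous_on_tendsto_compose[OF linear_continuous_on[OF matrix_vector_mul_bounded_linear, of UNIV] vx]) auto
    then have "(\<lambda>k. q (S i *v v k)) \<longlonglongrightarrow> q (S i *v x)"
      by (rule q_lim)
    moreover have "q (S i *v v k) = q (v k)" for k
    proof -
      have "[i] \<in> lists {1..M}" using i by simp
      then have "q (mprod S [i] *v v k) = q (v k)" using v[of k] unfolding \<U>_def by blast
      then show ?thesis by simp
    qed
    ultimately show ?thesis
      using LIMSEQ_unique[OF _ q_lim[OF vx]] by simp
  qed
  have matrix_eqI: "X = Y" if "\<And>x y. x \<bullet> (X *v y) = x \<bullet> (Y *v y)" for X Y :: "real^'n^'n"
  proof -
    have "X *v y = Y *v y" for y
    proof -
      have "(X *v y - Y *v y) \<bullet> (X *v y - Y *v y) = 0"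
        using that[of "X *v y - Y *v y" y] by (simp only: inner_diff_right diff_self)
      then show ?thesis by simp
    qed
    then show ?thesis by (simp add: matrix_eq)
  qed
  show ?thesis
  proof (rule that[of Q])
    show "transpose Q = Q"
    proof (rule matrix_eqI)
      fix x y
      show "x \<bullet> (transpose Q *v y) = x \<bullet> (Q *v y)"
        using inner_matrix_transpose[of y Q x] sym[of x y]
        by (simp add: inner_commute del: transpose_matrix_vector)
    qed
    show "0 < x \<bullet> (Q *v x)" if "x \<noteq> 0" for x
      using q_pos[OF that] by (simp add: q_def)
    fix i assume i: "i \<in> {1..M}"
    have polar: "q (x + y) = q x + q y + 2 * (x \<bullet> (Q *v y))" for x y
      using sym[of x y] by (simp add: q_def matrix_vector_right_distrib inner_add_left inner_add_right)
    show "transpose (S i) ** Q ** S i = Q"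
    proof (rule matrix_eqI)
      fix x y
      have "q (S i *v (x + y)) = q (x + y)" by (rule all[OF i])
      then have "(S i *v x) \<bullet> (Q *v (S i *v y)) = x \<bullet> (Q *v y)"
        unfolding matrix_vector_right_distrib polar using all[OF i, of x] all[OF i, of y] by simp
      moreover have "x \<bullet> ((transpose (S i) ** Q ** S i) *v y) = (S i *v x) \<bullet> (Q *v (S i *v y))"
        using inner_matrix_transpose[of x "transpose (S i)" "Q *v (S i *v y)"]
        by (simp add: matrix_vector_mul_assoc[symmetric] del: transpose_matrix_vector)
      ultimately show "x \<bullet> ((transpose (S i) ** Q ** S i) *v y) = x \<bullet> (Q *v y)" by simp
    qed
  qed
qed

lemma positive_form_standard:
  fixes Q :: "real^'n^'n"
  assumes sym: "transpose Q = Q" and pos: "\<And>x. x \<noteq> 0 \<Longrightarrow> 0 < x \<bullet> (Q *v x)"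
  obtains B :: "real^'n^'n" where "invertible B" "transpose B ** Q ** B = mat 1"
proof -
  obtain R d where R: "orthogonal_matrix R" "transpose R ** Q ** R = diagonal d"
    by (rule spectral_theorem[OF sym])
  have RR: "transpose R ** R = mat 1" "R ** transpose R = mat 1"
    using R(1) by (auto simp: orthogonal_matrix_def)
  have d: "d i > 0" for i
  proof -
    have "R *v axis i 1 \<noteq> 0"
    proof
      assume "R *v axis i 1 = 0"
      then have "transpose R *v (R *v axis i 1) = 0" by (simp del: transpose_matrix_vector)
      then have "axis i 1 = (0 :: real^'n)"
        by (simp add: matrix_vector_mul_assoc RR del: transpose_matrix_vector)
      then show False by (simp add: axis_eq_0_iff)
    qed
    then have "0 < (R *v axis i 1) \<bullet> (Q *v (R *v axis i 1))" by (rule pos)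
    also have "\<dots> = axis i 1 \<bullet> ((transpose R ** Q ** R) *v axis i 1)"
      using inner_matrix_transpose[of "axis i 1" "transpose R" "Q *v (R *v axis i 1)"]
      by (simp add: matrix_vector_mul_assoc[symmetric] del: transpose_matrix_vector)
    also have "\<dots> = d i"
      unfolding R(2) by (simp add: inner_axis' matrix_vector_mul_component inner_axis diagonal_def)
    finally show ?thesis .
  qed
  define E :: "real^'n^'n" where "E = diagonal (\<lambda>i. 1 / sqrt (d i))"
  define F :: "real^'n^'n" where "F = diagonal (\<lambda>i. sqrt (d i))"
  have diag_mult: "diagonal a ** diagonal b = (diagonal (\<lambda>i. a i * b i) :: real^'n^'n)" for a b
    by (simp add: diagonal_def matrix_matrix_mult_def vec_eq_iff mult_delta_left mult_delta_right)
  have diag_one: "diagonal (\<lambda>i. 1) = (mat 1 :: real^'n^'n)"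
    by (simp add: diagonal_def mat_def)
  have ET: "transpose E = E"
    by (simp add: E_def diagonal_def transpose_def vec_eq_iff)
  have sq: "sqrt (d i) * sqrt (d i) = d i" "sqrt (d i) \<noteq> 0" for i
    using d[of i] by auto
  have EF: "E ** F = mat 1" "F ** E = mat 1"
    unfolding E_def F_def diag_mult diag_one[symmetric] using sq(2) by simp_all
  show ?thesis
  proof (rule that[of "R ** E"])
    have "invertible R" "invertible E"
      using RR EF unfolding invertible_def by blast+
    then show "invertible (R ** E)" by (rule invertible_mult)
    have "transpose (R ** E) ** Q ** (R ** E) = E ** (transpose R ** Q ** R) ** E"
      by (simp add: matrix_transpose_mul ET matrix_mul_assoc)
    also have "\<dots> = diagonal (\<lambda>i. 1 / sqrt (d i) * d i * (1 / sqrt (d i)))"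
      by (simp add: R(2) E_def diag_mult)
    also have "(\<lambda>i. 1 / sqrt (d i) * d i * (1 / sqrt (d i))) = (\<lambda>i. 1)"
      using sq d by (auto simp: fun_eq_iff field_simps)
    finally show "transpose (R ** E) ** Q ** (R ** E) = mat 1"
      by (simp add: diag_one)
  qed
qed

section \<open>Tuples similar to multiples of orthogonal matrices\<close>

lemma orthogonal_matrix_norm: "orthogonal_matrix X \<Longrightarrow> norm (X *v x) = norm x" for X :: "real^'n^'n"
  using orthogonal_transformation_matrix[of "(*v) X"]
  by (simp add: orthogonal_transformation_norm)

lemma det_scaleR: "det (c *\<^sub>R A) = c ^ CARD('n) * det A" for A :: "real^'n^'n"
  by (simp add: det_def prod.distrib sum_distrib_left mult_ac)

text \<open>The norm \<open>\<lambda>x. norm (matrix_inv B *v x)\<close> is multiplied by exactly \<open>r i\<close> under \<open>A i\<close>, and it is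
  equivalent to the Euclidean norm.\<close>

lemma conformal_singular_value_bounds:
  fixes A :: "nat \<Rightarrow> real^'n^'n" and B :: "real^'n^'n"
  assumes B: "invertible B" and r: "\<And>i. i \<in> {1..M} \<Longrightarrow> r i > 0"
    and orth: "\<And>i. i \<in> {1..M} \<Longrightarrow> orthogonal_matrix (matrix_inv B ** (A i /\<^sub>R r i) ** B)"
  obtains C where "C > 0"
    "\<And>w i. w \<in> lists {1..M} \<Longrightarrow> i \<in> {1..CARD('n)} \<Longrightarrow> prod_list (map r w) / C \<le> singular_value i (mprod A w)"
    "\<And>w i. w \<in> lists {1..M} \<Longrightarrow> i \<in> {1..CARD('n)} \<Longrightarrow> singular_value i (mprod A w) \<le> C * prod_list (map r w)"
proof -
  define N where "N x = norm (matrix_inv B *v x)" for x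
  define b where "b = mnorm B"
  define b' where "b' = mnorm (matrix_inv B)"
  have bb: "0 \<le> b" "0 \<le> b'" by (simp_all add: b_def b'_def mnorm_nonneg)
  have inv: "B *v (matrix_inv B *v x) = x" for x
    using matrix_inv_right[OF B] by (simp add: matrix_vector_mul_assoc)
  have step: "N (A i *v x) = r i * N x" if i: "i \<in> {1..M}" for i x
  proof -
    have "(matrix_inv B ** (A i /\<^sub>R r i) ** B) *v (matrix_inv B *v x)
        = matrix_inv B *v ((A i /\<^sub>R r i) *v (B *v (matrix_inv B *v x)))"
      by (simp add: matrix_vector_mul_assoc matrix_mul_assoc)
    also have "\<dots> = (matrix_inv B *v (A i *v x)) /\<^sub>R r i"
      unfolding inv by (simp add: matrix_vector_mult_scaleR flip: scaleR_matrix_vector_assoc)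
    finally have "norm ((matrix_inv B *v (A i *v x)) /\<^sub>R r i) = N x"
      using orthogonal_matrix_norm[OF orth[OF i], of "matrix_inv B *v x"] by (simp only: N_def)
    then show ?thesis using r[OF i] by (simp add: N_def field_simps)
  qed
  have N_prod: "N (mprod A w *v x) = prod_list (map r w) * N x" if "w \<in> lists {1..M}" for w x
    using that
  proof (induction w arbitrary: x)
    case (Cons i w)
    have "N (mprod A (i # w) *v x) = N (mprod A w *v (A i *v x))"
      by (simp add: matrix_vector_mul_assoc)
    then show ?case using Cons step[of i x] by simp
  qed simp
  have N_ge: "norm x \<le> b * N x" for x
    using norm_matrix_vector_le[of B "matrix_inv B *v x"] by (simp add: inv N_def b_def)
  have N_le: "N x \<le> b' * norm x" for x
    using norm_matrix_vector_le[of "matrix_inv B" x] by (simp add: N_def b'_def)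
  define C where "C = b * b' + 1"
  have C: "C > 0" "b * b' \<le> C" using bb by (simp_all add: C_def add_nonneg_pos)
  show ?thesis
  proof (rule that[OF C(1)])
    fix w i assume w: "w \<in> lists {1..M}" and i: "i \<in> {1..CARD('n)}"
    let ?R = "prod_list (map r w)" and ?\<sigma> = "singular_value i (mprod A w)"
    have R: "0 \<le> ?R" by (rule prod_list_nonneg) (use w r in \<open>force simp: less_imp_le\<close>)
    obtain x where x: "norm x = 1" "norm (mprod A w *v x) = ?\<sigma>"
      by (rule singular_value_attained[OF i])
    have "?R = ?R * norm x" by (simp add: x)
    also have "\<dots> \<le> ?R * (b * N x)" by (intro mult_left_mono N_ge R)
    also have "\<dots> = b * N (mprod A w *v x)" by (simp add: N_prod[OF w])
    also have "\<dots> \<le> b * (b' * norm (mprod A w *v x))" by (intro mult_left_mono N_le bb)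
    also have "\<dots> = b * b' * ?\<sigma>" by (simp add: x)
    also have "\<dots> \<le> C * ?\<sigma>" using C(2) x(2)[symmetric] by (intro mult_right_mono) auto
    finally show "?R / C \<le> ?\<sigma>" using C(1) by (simp add: pos_divide_le_eq mult.commute)
    have "?\<sigma> \<le> b * N (mprod A w *v x)" unfolding x(2)[symmetric] by (rule N_ge)
    also have "\<dots> = b * (?R * N x)" by (simp add: N_prod[OF w])
    also have "\<dots> \<le> b * (?R * (b' * norm x))" by (intro mult_left_mono N_le bb R)
    also have "\<dots> = b * b' * ?R" by (simp add: x)
    also have "\<dots> \<le> C * ?R" by (intro mult_right_mono C R)
    finally show "?\<sigma> \<le> C * ?R" .
  qed
qed

lemma ln_prod_list:
  fixes r :: "'a \<Rightarrow> real"
  assumes "\<And>i. i \<in> set w \<Longrightarrow> r i > 0"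
  shows "prod_list (map r w) > 0" "ln (prod_list (map r w)) = sum_list (map (\<lambda>i. ln (r i)) w)"
proof -
  have "prod_list (map r w) > 0 \<and> ln (prod_list (map r w)) = sum_list (map (\<lambda>i. ln (r i)) w)"
    using assms
  proof (induction w)
    case (Cons a w)
    then have "r a > 0" "prod_list (map r w) > 0" "ln (prod_list (map r w)) = sum_list (map (\<lambda>i. ln (r i)) w)"
      by auto
    then show ?case by (simp add: ln_mult)
  qed simp
  then show "prod_list (map r w) > 0" "ln (prod_list (map r w)) = sum_list (map (\<lambda>i. ln (r i)) w)"
    by auto
qed

text \<open>Up to an additive constant, \<open>ln (G w)\<close> is a sum over the letters of \<open>w\<close>, whose mean is
  proportional to the length by invariance.\<close>

lemma (in shift_invariant) exponent_of_comparable: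
  assumes r: "\<And>i. i \<in> {1..M} \<Longrightarrow> r i > 0" and C: "C > 0"
    and bounds: "\<And>w. w \<in> lists {1..M} \<Longrightarrow> prod_list (map r w) / C \<le> G w"
      "\<And>w. w \<in> lists {1..M} \<Longrightarrow> G w \<le> C * prod_list (map r w)"
  shows "(\<lambda>n. ereal (1 / n) * extended_integral \<nu> (\<lambda>x. elog (G (wordof n x))))
    \<longlonglongrightarrow> ereal (word_mean 1 (\<lambda>w. ln (r (hd w))))"
proof -
  define \<rho> where "\<rho> = word_mean 1 (\<lambda>w. ln (r (hd w)))"
  define m where "m n = word_mean n (\<lambda>w. ln (G w))" for n
  have R: "prod_list (map r w) > 0" "ln (prod_list (map r w)) = sum_list (map (\<lambda>i. ln (r i)) w)"
    if "w \<in> words M n" for w n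
  proof -
    have "\<And>i. i \<in> set w \<Longrightarrow> r i > 0" using that r by (auto simp: words_def)
    from ln_prod_list[of w r, OF this] show "prod_list (map r w) > 0"
      "ln (prod_list (map r w)) = sum_list (map (\<lambda>i. ln (r i)) w)" by auto
  qed
  have list: "w \<in> lists {1..M}" if "w \<in> words M n" for w n
    using that by (auto simp: words_def)
  have G: "G w > 0" if w: "w \<in> words M n" for w n
    using bounds(1)[OF list[OF w]] R(1)[OF w] C by (meson divide_pos_pos less_le_trans)
  have mean: "word_mean n (\<lambda>w. c + sum_list (map (\<lambda>i. ln (r i)) w)) = c + n * \<rho>" for n c
    unfolding word_mean_add word_mean_const word_mean_sum_list \<rho>_def ..
  have lower: "n * \<rho> - ln C \<le> m n" for n
  proof -
    have "- ln C + sum_list (map (\<lambda>i. ln (r i)) w) \<le> ln (G w)" if w: "w \<in> words M n" for w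
    proof -
      have "ln (prod_list (map r w) / C) \<le> ln (G w)"
        using bounds(1)[OF list[OF w]] R(1)[OF w] G[OF w] C by simp
      then show ?thesis using R[OF w] C by (simp add: ln_div)
    qed
    then have "word_mean n (\<lambda>w. - ln C + sum_list (map (\<lambda>i. ln (r i)) w)) \<le> m n"
      unfolding m_def by (intro word_mean_mono)
    then show ?thesis unfolding mean by simp
  qed
  have upper: "m n \<le> n * \<rho> + ln C" for n
  proof -
    have "ln (G w) \<le> ln C + sum_list (map (\<lambda>i. ln (r i)) w)" if w: "w \<in> words M n" for w
    proof -
      have "ln (G w) \<le> ln (C * prod_list (map r w))"
        using bounds(2)[OF list[OF w]] R(1)[OF w] G[OF w] C by simp
      then show ?thesis using R[OF w] C by (simp add: ln_mult)
    qed
    then have "m n \<le> word_mean n (\<lambda>w. ln C + sum_list (map (\<lambda>i. ln (r i)) w))"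
      unfolding m_def by (intro word_mean_mono)
    then show ?thesis unfolding mean by simp
  qed
  have "(\<lambda>n. m n / n) \<longlonglongrightarrow> \<rho>"
  proof (rule tendsto_sandwich)
    show "\<forall>\<^sub>F n in sequentially. \<rho> - ln C / n \<le> m n / n"
      using eventually_gt_at_top[of 0]
    proof eventually_elim
      case (elim n)
      then show ?case using divide_right_mono[OF lower[of n], of "real n"] by (simp add: diff_divide_distrib)
    qed
    show "\<forall>\<^sub>F n in sequentially. m n / n \<le> \<rho> + ln C / n"
      using eventually_gt_at_top[of 0]
    proof eventually_elim
      case (elim n)
      then show ?case using divide_right_mono[OF upper[of n], of "real n"] by (simp add: add_divide_distrib)
    qed
    show "(\<lambda>n. \<rho> - ln C / real n) \<longlonglongrightarrow> \<rho>" "(\<lambda>n. \<rho> + ln C / real n) \<longlonglongrightarrow> \<rho>"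
      using tendsto_diff[OF tendsto_const[of \<rho>] lim_const_over_n[of "ln C"]]
        tendsto_add[OF tendsto_const[of \<rho>] lim_const_over_n[of "ln C"]] by simp_all
  qed
  then have "(\<lambda>n. ereal (m n / n)) \<longlonglongrightarrow> ereal \<rho>" by simp
  moreover have "ereal (1 / n) * extended_integral \<nu> (\<lambda>x. elog (G (wordof n x))) = ereal (m n / n)" for n
    using extended_integral_elog[of n G] G unfolding m_def by (simp add: less_imp_neq[symmetric])
  ultimately show ?thesis by (simp only: \<rho>_def)
qed

lemma (in shift_invariant) conformal_exponents_equal:
  fixes A :: "nat \<Rightarrow> real^'n^'n" and B :: "real^'n^'n"
  assumes "invertible B" and r: "\<And>i. i \<in> {1..M} \<Longrightarrow> r i > 0"
    and "\<And>i. i \<in> {1..M} \<Longrightarrow> orthogonal_matrix (matrix_inv B ** (A i /\<^sub>R r i) ** B)"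
    and i: "i \<in> {1..CARD('n)}"
  shows "lyapunov_exponent A \<nu> i = ereal (word_mean 1 (\<lambda>w. ln (r (hd w))))"
proof -
  obtain C where C: "C > 0"
    "\<And>w i. w \<in> lists {1..M} \<Longrightarrow> i \<in> {1..CARD('n)} \<Longrightarrow> prod_list (map r w) / C \<le> singular_value i (mprod A w)"
    "\<And>w i. w \<in> lists {1..M} \<Longrightarrow> i \<in> {1..CARD('n)} \<Longrightarrow> singular_value i (mprod A w) \<le> C * prod_list (map r w)"
    by (rule conformal_singular_value_bounds[OF assms(1-3)]) blast+
  show ?thesis
    unfolding lyapunov_exponent_def cocycle_wordof
    by (rule limI, rule exponent_of_comparable[OF r C(1) C(2)[OF _ i] C(3)[OF _ i]])
qed


section \<open>Optimal product weights force conformality\<close>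

context product_weights
begin

text \<open>If \<open>p i\<close> vanished, so would \<open>rate i\<close>, and the growth bound for the word \<open>[i]\<close> would give \<open>A i = 0\<close>.\<close>

lemma weight_positive:
  assumes i: "i \<in> {1..M}" and nz: "A i \<noteq> 0"
  shows "p i > 0"
proof -
  obtain K where K: "\<And>v. v \<in> lists {1..M} \<Longrightarrow> mnorm (mprod A v) \<le> K * prod_list (map rate v)"
    by (rule norm_le_prod_rate) blast
  have "0 < K * rate i"
    using K[of "[i]"] i nz mnorm_pos_iff[of "A i"] by simp
  then have "p i \<noteq> 0" by (auto simp: rate_def)
  then show ?thesis using p(1)[OF i] by simp
qed

text \<open>Dividing \<open>A i\<close> by \<open>rate i\<close> gives a bounded semigroup. By optimality of the weights the norms of its
  products have nonnegative mean logarithm, so the products do not shrink and the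
  semigroup preserves a definite quadratic form.\<close>

lemma conformal:
  assumes inv: "\<And>i. i \<in> {1..M} \<Longrightarrow> invertible (A i)"
  obtains B :: "real^'n^'n" where "invertible B"
    "\<And>i. i \<in> {1..M} \<Longrightarrow> rate i > 0"
    "\<And>i. i \<in> {1..M} \<Longrightarrow> orthogonal_matrix (matrix_inv B ** (A i /\<^sub>R rate i) ** B)"
proof -
  have nz: "A i \<noteq> 0" if "i \<in> {1..M}" for i
  proof
    assume "A i = 0"
    then have "det (A i) = 0" using det_scaleR[of 0 "A i"] by (simp add: power_0_left)
    then show False using inv[OF that] by (simp add: invertible_det_nz)
  qed
  have p_pos: "p i > 0" if "i \<in> {1..M}" for i
    by (rule weight_positive[OF that nz[OF that]])
  have rate: "rate i > 0" if "i \<in> {1..M}" for i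
    using p_pos[OF that] by (simp add: rate_def)
  define S where "S i = A i /\<^sub>R rate i" for i
  have S_prod: "mprod S w = mprod A w /\<^sub>R prod_list (map rate w)" for w
    by (induction w) (auto simp: S_def matrix_scalar_ac mult.commute simp flip: scalar_matrix_assoc)
  have irrS: "irreducible_tuple M S"
    unfolding irreducible_tuple_def
  proof (rule notI, elim exE conjE)
    fix U :: "(real^'n) set"
    assume U: "subspace U" "0 < dim U" "dim U < CARD('n)" "\<forall>i\<in>{1..M}. (*v) (S i) ` U \<subseteq> U"
    have "A i *v u \<in> U" if i: "i \<in> {1..M}" and u: "u \<in> U" for i u
    proof -
      have "A i = rate i *\<^sub>R S i" using rate[OF i] by (simp add: S_def)
      then have "A i *v u = rate i *\<^sub>R (S i *v u)"
        by (simp add: scaleR_matrix_vector_assoc)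
      moreover have "S i *v u \<in> U" using U(4) i u by blast
      ultimately show ?thesis using U(1) by (simp add: subspace_scale)
    qed
    then show False using irr U(1-3) unfolding irreducible_tuple_def by blast
  qed
  have invS: "invertible (S i)" if "i \<in> {1..M}" for i
    using inv[OF that] rate[OF that] unfolding S_def by (intro scalar_invertible) auto
  obtain K where K: "\<And>v. v \<in> lists {1..M} \<Longrightarrow> mnorm (mprod A v) \<le> K * prod_list (map rate v)"
    by (rule norm_le_prod_rate) blast
  have R: "prod_list (map rate v) > 0" if "v \<in> lists {1..M}" for v
    by (rule ln_prod_list(1)) (use rate that in auto)
  have norm_S: "mnorm (mprod S v) = mnorm (mprod A v) / prod_list (map rate v)" if "v \<in> lists {1..M}" for v
    using R[OF that] by (simp add: S_prod mnorm_scaleR divide_inverse mult.commute)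
  have bound: "mnorm (mprod S v) \<le> K" if "v \<in> lists {1..M}" for v
    using K[OF that] R[OF that] by (simp add: norm_S[OF that] pos_divide_le_eq)
  (* t^2 is at least 1 + 2 * ln t, and by optimality the mean of ln t is not negative *)
  have large: "1 \<le> (\<Sum>w\<in>words M n. weight w * (mnorm (mprod S w))\<^sup>2)" for n
  proof -
    define c where "c = 2 / s"
    have "weight w + c * (weight w * (s * ln (mnorm (mprod A w)) - ln (weight w)) - weight w * (n * P))
        \<le> weight w * (mnorm (mprod S w))\<^sup>2" if w: "w \<in> words M n" for w
    proof -
      have list: "w \<in> lists {1..M}" using w by (auto simp: words_def)
      have W: "weight w > 0" by (rule ln_prod_list(1)) (use p_pos list in auto)
      have A: "mnorm (mprod A w) > 0"
        using nonzero[OF w W] mnorm_pos_iff by blast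
      have S: "mnorm (mprod S w) > 0" using A R[OF list] by (simp add: norm_S[OF list])
      have "s * ln (prod_list (map rate w)) = ln (weight w * exp (n * P))"
        using prod_rate_powr[OF w] R[OF list] by (metis ln_powr less_imp_neq)
      also have "\<dots> = ln (weight w) + n * P" using W by (simp add: ln_mult)
      finally have "s * ln (mnorm (mprod S w)) = s * ln (mnorm (mprod A w)) - ln (weight w) - n * P"
        using A R[OF list] by (simp add: norm_S[OF list] ln_div right_diff_distrib)
      moreover have "2 * ln (mnorm (mprod S w)) \<le> (mnorm (mprod S w))\<^sup>2 - 1"
        using ln_le_minus_one[of "(mnorm (mprod S w))\<^sup>2"] S by (simp add: ln_realpow)
      moreover have "c * (s * ln (mnorm (mprod S w))) = 2 * ln (mnorm (mprod S w))" using s by (simp add: c_def)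
      ultimately have "1 + c * (s * ln (mnorm (mprod A w)) - ln (weight w) - n * P) \<le> (mnorm (mprod S w))\<^sup>2"
        by (simp only:)
      from mult_left_mono[OF this, of "weight w"] W show ?thesis
        by (simp add: algebra_simps)
    qed
    then have "(\<Sum>w\<in>words M n. weight w + c * (weight w * (s * ln (mnorm (mprod A w)) - ln (weight w)) - weight w * (n * P)))
        \<le> (\<Sum>w\<in>words M n. weight w * (mnorm (mprod S w))\<^sup>2)"
      by (rule sum_mono)
    moreover have "(\<Sum>w\<in>words M n. weight w + c * (weight w * (s * ln (mnorm (mprod A w)) - ln (weight w)) - weight w * (n * P)))
        = 1 + c * ((\<Sum>w\<in>words M n. weight w * (s * ln (mnorm (mprod A w)) - ln (weight w))) - n * P)"
      using sum_weight[of n]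
      by (simp only: sum.distrib sum_distrib_left[symmetric] sum_subtractf sum_distrib_right[symmetric] mult_1)
    moreover have "0 \<le> c * ((\<Sum>w\<in>words M n. weight w * (s * ln (mnorm (mprod A w)) - ln (weight w))) - n * P)"
      using optimal[of n] s by (intro mult_nonneg_nonneg) (auto simp: c_def)
    ultimately show ?thesis by linarith
  qed
  obtain Q where Q: "transpose Q = Q" "\<And>x. x \<noteq> 0 \<Longrightarrow> 0 < x \<bullet> (Q *v x)"
    "\<And>i. i \<in> {1..M} \<Longrightarrow> transpose (S i) ** Q ** S i = Q"
    by (rule bounded_irreducible_invariant_form[of M S K p, OF irrS invS bound p_pos p(2) large]) blast+
  obtain B :: "real^'n^'n" where B: "invertible B" "transpose B ** Q ** B = mat 1"
    by (rule positive_form_standard[OF Q(1,2)])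
  show ?thesis
  proof (rule that[OF B(1) rate])
    fix i assume i: "i \<in> {1..M}"
    let ?I = "matrix_inv B"
    have inv: "B ** ?I = mat 1" by (rule matrix_inv_right[OF B(1)])
    have "transpose ?I ** ?I = transpose ?I ** (transpose B ** Q ** B) ** ?I"
      by (simp add: B(2))
    also have "\<dots> = transpose (B ** ?I) ** Q ** (B ** ?I)"
      by (simp only: matrix_transpose_mul matrix_mul_assoc)
    also have "\<dots> = Q" by (simp add: inv transpose_mat)
    finally have II: "transpose ?I ** ?I = Q" .
    have "transpose (?I ** S i ** B) ** (?I ** S i ** B)
        = transpose B ** (transpose (S i) ** (transpose ?I ** ?I) ** S i) ** B"
      by (simp only: matrix_transpose_mul matrix_mul_assoc)
    also have "\<dots> = mat 1" by (simp only: II Q(3)[OF i] B(2))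
    finally show "orthogonal_matrix (?I ** (A i /\<^sub>R rate i) ** B)"
      unfolding S_def by (simp add: orthogonal_matrix)
  qed
qed

end

text \<open>Orthogonal matrices have determinant \<open>1\<close> or \<open>- 1\<close>, which determines the factor \<open>r\<close>.\<close>

lemma conformal_factor:
  fixes A B :: "real^'n^'n"
  assumes B: "invertible B" and r: "r > 0" and orth: "orthogonal_matrix (matrix_inv B ** (A /\<^sub>R r) ** B)"
  shows "det A \<noteq> 0" "\<bar>det A\<bar> powr (- 1 / CARD('n)) = inverse r"
proof -
  have "det (matrix_inv B) * det B = 1"
    using matrix_inv_left[OF B] by (metis det_I det_mul)
  then have "det (matrix_inv B ** (A /\<^sub>R r) ** B) = det (A /\<^sub>R r)"
    by (simp add: det_mul mult.assoc mult.left_commute)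
  then have "\<bar>det (A /\<^sub>R r)\<bar> = 1"
    using det_orthogonal_matrix[OF orth] by auto
  then have "\<bar>det A\<bar> = r ^ CARD('n)"
    using r by (simp add: det_scaleR abs_mult power_divide field_simps)
  then have det: "\<bar>det A\<bar> = r powr CARD('n)"
    using r by (simp add: powr_realpow)
  then show "det A \<noteq> 0" using r by auto
  show "\<bar>det A\<bar> powr (- 1 / CARD('n)) = inverse r"
    unfolding det using r by (simp add: powr_powr powr_minus)
qed

section \<open>Coinciding exponents force a product measure\<close>

lemma abs_det_le_mnorm_power: "\<bar>det A\<bar> \<le> mnorm A ^ CARD('n)" for A :: "real^'n^'n"
proof -
  obtain \<sigma> :: "'n \<Rightarrow> real" where \<sigma>: "\<And>j. 0 \<le> \<sigma> j" "\<bar>det A\<bar> = (\<Prod>j\<in>UNIV. \<sigma> j)"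
    "\<And>j. \<exists>x. norm x = 1 \<and> norm (A *v x) = \<sigma> j"
    using singular_values[of A] by metis
  have "\<sigma> j \<le> mnorm A" for j
  proof -
    obtain x where "norm x = 1" "norm (A *v x) = \<sigma> j" using \<sigma>(3) by blast
    then show ?thesis using norm_matrix_vector_le[of A x] by simp
  qed
  then have "(\<Prod>j\<in>UNIV. \<sigma> j) \<le> (\<Prod>j\<in>(UNIV::'n set). mnorm A)"
    using \<sigma>(1) by (intro prod_mono) auto
  then show ?thesis by (simp add: \<sigma>(2))
qed

lemma power_le_geometric_imp_le:
  fixes a b C :: real
  assumes a: "0 \<le> a" and b: "b > 0" and le: "\<And>n. a ^ n \<le> C * b ^ n"
  shows "a \<le> b"
proof (rule ccontr)
  assume "\<not> a \<le> b"
  then have "1 < a / b" using b by simp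
  then obtain n where "C < (a / b) ^ n" using real_arch_pow by blast
  then have "C * b ^ n < a ^ n" using b by (simp add: power_divide pos_less_divide_eq)
  then show False using le[of n] by simp
qed

lemma abs_det_mprod: "\<bar>det (mprod A w)\<bar> = prod_list (map (\<lambda>i. \<bar>det (A i)\<bar>) w)"
  by (induction w) (auto simp: det_mul abs_mult)

lemma prod_list_powr:
  assumes "\<And>i. i \<in> set w \<Longrightarrow> 0 \<le> f i"
  shows "prod_list (map (\<lambda>i. f i powr t) w) = prod_list (map f w) powr (t::real)"
  using assms by (induction w) (auto simp: powr_mult prod_list_nonneg)

context shift_invariant
begin

text \<open>If the smallest exponent equals the largest one, then both equal the mean growth rate of
  \<open>\<bar>det\<bar>\<close> divided by the dimension, and a word of positive mass cannot be singular.\<close>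

lemma equal_exponents_growth:
  fixes A :: "nat \<Rightarrow> real^'n^'n" and l :: real
  assumes l: "top_lyapunov A \<nu> = ereal l"
    and eq: "lyapunov_exponent A \<nu> 1 = lyapunov_exponent A \<nu> CARD('n)"
  shows "w \<in> words M n \<Longrightarrow> law \<nu> (wordof n) w > 0 \<Longrightarrow> det (mprod A w) \<noteq> 0"
    and "CARD('n) * l \<le> word_mean 1 (\<lambda>w. ln \<bar>det (A (hd w))\<bar>)"
proof -
  define G where "G w = least_sv (mprod A w)" for w
  define E where "E n = extended_integral \<nu> (\<lambda>x. elog (G (wordof n x)))" for n
  have super: "G u * G v \<le> G (u @ v)" for u v
    using least_sv_mult[of "mprod A v" "mprod A u"] by (simp add: G_def mprod_append mult.commute)
  have zero: "G u = 0 \<Longrightarrow> G (u @ v) = 0" "G v = 0 \<Longrightarrow> G (u @ v) = 0" for u v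
    by (auto simp: G_def least_sv_facts(4) mprod_append det_mul)
  obtain L where L: "(\<lambda>n. ereal (1 / n) * E n) \<longlonglongrightarrow> L"
    unfolding E_def
    by (rule supermultiplicative_exponent_converges[of G]) (use least_sv_facts(2) super zero in \<open>auto simp: G_def\<close>)
  have "lyapunov_exponent A \<nu> CARD('n) = L"
    unfolding lyapunov_exponent_def cocycle_wordof using L by (intro limI) (simp add: E_def G_def)
  moreover have "lyapunov_exponent A \<nu> 1 = top_lyapunov A \<nu>"
    unfolding lyapunov_exponent_def top_lyapunov_def singular_value_1 ..
  ultimately have lim: "(\<lambda>n. ereal (1 / n) * E n) \<longlonglongrightarrow> ereal l"
    using L eq l by simp
  show nonsing: "det (mprod A w) \<noteq> 0" if w: "w \<in> words M n" "law \<nu> (wordof n) w > 0" for w n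
  proof
    assume "det (mprod A w) = 0"
    then have "G w = 0" by (simp add: G_def least_sv_facts(4))
    have "ereal (1 / m) * E m = - \<infinity>" if m: "m \<ge> max n 1" for m
    proof -
      obtain v where v: "v \<in> words M (m - n)" "law \<nu> (wordof (n + (m - n))) (w @ v) > 0"
        using positive_extension[OF w] by blast
      have "w @ v \<in> words M m" using w(1) v(1) m by (auto simp: words_def)
      then have "E m = - \<infinity>"
        unfolding E_def using v(2) m zero(1)[OF \<open>G w = 0\<close>]
        by (intro extended_integral_elog_minfty[of "w @ v"]) auto
      then show ?thesis using m by simp
    qed
    then have "(\<lambda>m. ereal (1 / m) * E m) \<longlonglongrightarrow> - \<infinity>"
      by (intro tendsto_eventually eventually_sequentiallyI[of "max n 1"])
    from LIMSEQ_unique[OF lim this] show False by simp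
  qed
  let ?\<delta> = "word_mean 1 (\<lambda>w. ln \<bar>det (A (hd w))\<bar>)"
  have ln_det: "ln \<bar>det (mprod A w)\<bar> = sum_list (map (\<lambda>i. ln \<bar>det (A i)\<bar>) w)" if "det (mprod A w) \<noteq> 0" for w
    using that by (induction w) (auto simp: det_mul abs_mult ln_mult)
  have "ereal (1 / n) * E n \<le> ereal (?\<delta> / CARD('n))" if n: "n > 0" for n
  proof -
    have E: "E n = ereal (word_mean n (\<lambda>w. ln (G w)))"
      unfolding E_def by (rule extended_integral_elog) (use nonsing in \<open>auto simp: G_def least_sv_facts(4)\<close>)
    have "CARD('n) * ln (G w) \<le> sum_list (map (\<lambda>i. ln \<bar>det (A i)\<bar>) w)"
      if w: "w \<in> words M n" "law \<nu> (wordof n) w > 0" for w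
    proof -
      have pos: "G w > 0"
        using nonsing[OF w] least_sv_facts(2)[of "mprod A w"] least_sv_facts(4)[of "mprod A w"]
        by (auto simp: G_def less_le)
      have "CARD('n) * ln (G w) = ln (G w ^ CARD('n))" using pos by (simp add: ln_realpow)
      also have "\<dots> \<le> ln \<bar>det (mprod A w)\<bar>"
        using pos least_sv_facts(3)[of "mprod A w"] nonsing[OF w] by (simp add: G_def)
      finally show ?thesis by (simp only: ln_det[OF nonsing[OF w]])
    qed
    then have "word_mean n (\<lambda>w. CARD('n) * ln (G w)) \<le> word_mean n (\<lambda>w. sum_list (map (\<lambda>i. ln \<bar>det (A i)\<bar>) w))"
      by (rule word_mean_mono)
    then have "CARD('n) * word_mean n (\<lambda>w. ln (G w)) \<le> n * ?\<delta>"
      by (simp only: word_mean_cmult word_mean_sum_list)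
    then have "word_mean n (\<lambda>w. ln (G w)) / n \<le> ?\<delta> / CARD('n)"
      using n by (simp add: divide_simps mult.commute)
    then show ?thesis unfolding E by simp
  qed
  then have "ereal l \<le> ereal (?\<delta> / CARD('n))"
    by (intro Lim_bounded[OF lim, of 1]) auto
  then show "CARD('n) * l \<le> ?\<delta>" by (simp add: pos_le_divide_eq mult.commute)
qed

text \<open>The weights \<open>exp (- P) * \<bar>det (A i)\<bar> powr (s / d)\<close> have total mass at most one, because the
  determinant is dominated by the norm. If the exponents coincide, the relative entropy of the
  measure with respect to these weights is not positive, so the two agree.\<close>

lemma equal_exponents_product_law:
  fixes A :: "nat \<Rightarrow> real^'n^'n"
  assumes fe: "free_energy A s \<nu> = ereal P" and s: "s > 0"
    and upper: "\<And>N. (\<Sum>w\<in>words M N. mnorm (mprod A w) powr s) \<le> C * exp (N * P)"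
    and eq: "lyapunov_exponent A \<nu> 1 = lyapunov_exponent A \<nu> CARD('n)"
  defines "p \<equiv> \<lambda>i. exp (- P) * \<bar>det (A i)\<bar> powr (s / CARD('n))"
  shows "w \<in> words M n \<Longrightarrow> law \<nu> (wordof n) w = prod_list (map p w)"
    and "(\<Sum>i\<in>{1..M}. p i) = 1"
proof -
  define g where "g i = \<bar>det (A i)\<bar> powr (s / CARD('n))" for i
  define \<phi> where "\<phi> i = s / CARD('n) * ln \<bar>det (A i)\<bar> - P" for i
  obtain l where l: "top_lyapunov A \<nu> = ereal l"
    using finite_free_energy_bounds(3)[OF fe s] by auto
  obtain h where h: "metric_entropy \<nu> shift = ereal h"
    using metric_entropy_bounds by (cases "metric_entropy \<nu> shift") auto
  have P: "P = h + s * l"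
    using fe unfolding free_energy_def h l by simp
  have g_le: "prod_list (map g w) \<le> mnorm (mprod A w) powr s" for w
  proof -
    have "prod_list (map g w) = \<bar>det (mprod A w)\<bar> powr (s / CARD('n))"
      unfolding g_def abs_det_mprod by (rule prod_list_powr) auto
    also have "\<dots> \<le> (mnorm (mprod A w) ^ CARD('n)) powr (s / CARD('n))"
      using s by (intro powr_mono2 abs_det_le_mnorm_power) auto
    also have "\<dots> = mnorm (mprod A w) powr s"
    proof (cases "mnorm (mprod A w) = 0")
      case False
      then have "mnorm (mprod A w) > 0" using mnorm_nonneg[of "mprod A w"] by simp
      then show ?thesis by (simp add: powr_powr flip: powr_realpow)
    qed simp
    finally show ?thesis .
  qed
  have "(\<Sum>i\<in>{1..M}. g i) \<le> exp P"
  proof (rule power_le_geometric_imp_le)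
    show "0 \<le> (\<Sum>i\<in>{1..M}. g i)" by (simp add: g_def sum_nonneg)
    fix n
    have "(\<Sum>i\<in>{1..M}. g i) ^ n = (\<Sum>w\<in>words M n. prod_list (map g w))"
      by (rule sum_words_prod_list[symmetric])
    also have "\<dots> \<le> (\<Sum>w\<in>words M n. mnorm (mprod A w) powr s)"
      by (intro sum_mono g_le)
    also have "\<dots> \<le> C * exp P ^ n" using upper[of n] by (simp add: exp_of_nat_mult)
    finally show "(\<Sum>i\<in>{1..M}. g i) ^ n \<le> C * exp P ^ n" .
  qed simp
  then have "exp (- P) * (\<Sum>i\<in>{1..M}. g i) \<le> exp (- P) * exp P"
    by (rule mult_left_mono) simp
  then have p_sum: "(\<Sum>i\<in>{1..M}. p i) \<le> 1"
    by (simp add: p_def g_def sum_distrib_left flip: exp_add)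
  have p_nonneg: "0 \<le> p i" for i by (simp add: p_def)
  have p_pos: "p i > 0 \<and> ln (p i) = \<phi> i" if "det (A i) \<noteq> 0" for i
    using that by (simp add: p_def \<phi>_def ln_mult ln_powr)
  have law_eq: "law \<nu> (wordof n) w = prod_list (map p w)" if w: "w \<in> words M n" for w n
  proof -
    have positive: "prod_list (map p w) > 0" "ln (prod_list (map p w)) = sum_list (map \<phi> w)"
      if "w \<in> words M n" "law \<nu> (wordof n) w > 0" for w
    proof -
      have "prod_list (map (\<lambda>i. \<bar>det (A i)\<bar>) w) \<noteq> 0"
        using equal_exponents_growth(1)[OF l eq that] unfolding abs_det_mprod[symmetric] by simp
      then have nz: "det (A i) \<noteq> 0" if "i \<in> set w" for i
        using that by (auto simp: prod_list_zero_iff)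
      then show "prod_list (map p w) > 0" "ln (prod_list (map p w)) = sum_list (map \<phi> w)"
        using ln_prod_list[of w p] p_pos by (auto cong: map_cong)
    qed
    have "prod_list (map p w) = law \<nu> (wordof n) w"
    proof (rule relative_entropy_nonpos_imp_eq[OF finite_words law_nonneg sum_law_words _ _ _ _ w])
      show "0 \<le> prod_list (map p w)" for w by (auto intro!: prod_list_nonneg simp: p_nonneg)
      show "(\<Sum>w\<in>words M n. prod_list (map p w)) \<le> 1"
        unfolding sum_words_prod_list by (intro power_le_one p_sum sum_nonneg p_nonneg)
      show "prod_list (map p w) > 0" if "w \<in> words M n" "law \<nu> (wordof n) w > 0" for w
        by (rule positive(1)[OF that])
      have "(\<Sum>w\<in>words M n. law \<nu> (wordof n) w * ln (law \<nu> (wordof n) w / prod_list (map p w)))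
          = (\<Sum>w\<in>words M n. law \<nu> (wordof n) w * ln (law \<nu> (wordof n) w)
              - law \<nu> (wordof n) w * sum_list (map \<phi> w))"
      proof (rule sum.cong[OF refl])
        fix w assume w: "w \<in> words M n"
        show "law \<nu> (wordof n) w * ln (law \<nu> (wordof n) w / prod_list (map p w))
          = law \<nu> (wordof n) w * ln (law \<nu> (wordof n) w) - law \<nu> (wordof n) w * sum_list (map \<phi> w)"
        proof (cases "law \<nu> (wordof n) w = 0")
          case False
          then have pos: "law \<nu> (wordof n) w > 0" using law_nonneg[of \<nu> "wordof n" w] by linarith
          show ?thesis
            using pos positive[OF w pos] by (simp add: ln_div right_diff_distrib)
        qed simp
      qed
      also have "\<dots> = - block_entropy n - word_mean n (\<lambda>w. sum_list (map \<phi> w))"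
        by (simp add: block_entropy_eq word_mean_def sum_subtractf)
      also have "word_mean n (\<lambda>w. sum_list (map \<phi> w)) = n * word_mean 1 (\<lambda>w. \<phi> (hd w))"
        by (rule word_mean_sum_list)
      also have "word_mean 1 (\<lambda>w. \<phi> (hd w)) = s / CARD('n) * word_mean 1 (\<lambda>w. ln \<bar>det (A (hd w))\<bar>) - P"
        using word_mean_add[of 1 "\<lambda>w. s / CARD('n) * ln \<bar>det (A (hd w))\<bar>" "\<lambda>w. - P"]
        unfolding \<phi>_def word_mean_cmult word_mean_const by (simp del: One_nat_def)
      also have "- block_entropy n - n * (s / CARD('n) * word_mean 1 (\<lambda>w. ln \<bar>det (A (hd w))\<bar>) - P) \<le> 0"
      proof -
        have "n * h \<le> block_entropy n"
        proof (cases "n = 0")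
          case True
          then show ?thesis by (simp add: rv_entropy_nonneg)
        next
          case False
          then show ?thesis
            using metric_entropy_le_block_entropy[of n] by (simp add: h pos_le_divide_eq mult.commute)
        qed
        moreover have "n * (s * l) \<le> n * (s / CARD('n) * word_mean 1 (\<lambda>w. ln \<bar>det (A (hd w))\<bar>))"
        proof (rule mult_left_mono)
          have "s / CARD('n) * (CARD('n) * l) \<le> s / CARD('n) * word_mean 1 (\<lambda>w. ln \<bar>det (A (hd w))\<bar>)"
            using s by (intro mult_left_mono equal_exponents_growth(2)[OF l eq]) auto
          then show "s * l \<le> s / CARD('n) * word_mean 1 (\<lambda>w. ln \<bar>det (A (hd w))\<bar>)"
            by simp
        qed simp
        ultimately show ?thesis unfolding P right_diff_distrib distrib_left by linarith
      qed
      finally show "(\<Sum>w\<in>words M n. law \<nu> (wordof n) w * ln (law \<nu> (wordof n) w / prod_list (map p w))) \<le> 0" .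
    qed
    then show ?thesis ..
  qed
  then show "w \<in> words M n \<Longrightarrow> law \<nu> (wordof n) w = prod_list (map p w)" .
  have "(\<Sum>i\<in>{1..M}. p i) ^ 1 = (\<Sum>w\<in>words M 1. law \<nu> (wordof 1) w)"
    unfolding sum_words_prod_list[symmetric] by (intro sum.cong refl law_eq[symmetric])
  then show "(\<Sum>i\<in>{1..M}. p i) = 1" by (simp only: sum_law_words power_one_right)
qed

lemma product_law_weights:
  fixes A :: "nat \<Rightarrow> real^'n^'n"
  assumes "irreducible_tuple M A" "s > 0" "C > 0"
    and "\<And>N. (\<Sum>w\<in>words M N. mnorm (mprod A w) powr s) \<le> C * exp (N * P)"
    and p: "\<And>i. i \<in> {1..M} \<Longrightarrow> 0 \<le> p i" "(\<Sum>i\<in>{1..M}. p i) = 1"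
    and law: "\<And>n w. w \<in> words M n \<Longrightarrow> law \<nu> (wordof n) w = prod_list (map p w)"
    and fe: "free_energy A s \<nu> = ereal P"
  shows "product_weights M A s P C p"
proof (rule product_weights.intro[OF assms(1-4) p])
  show "mprod A w \<noteq> 0" if "w \<in> words M n" "0 < prod_list (map p w)" for n w
    using finite_free_energy_bounds(1)[OF fe \<open>s > 0\<close> that(1)] law[OF that(1)] that(2) by simp
  fix n
  have "n * P \<le> block_entropy n + s * word_mean n (\<lambda>w. ln (mnorm (mprod A w)))"
    by (rule finite_free_energy_bounds(2)[OF fe \<open>s > 0\<close>])
  also have "\<dots> = (\<Sum>w\<in>words M n. law \<nu> (wordof n) w * (s * ln (mnorm (mprod A w)) - ln (law \<nu> (wordof n) w)))"
    by (simp add: block_entropy_eq word_mean_def sum_distrib_left right_diff_distrib sum_subtractf mult.left_commute)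
  also have "\<dots> = (\<Sum>w\<in>words M n. prod_list (map p w) * (s * ln (mnorm (mprod A w)) - ln (prod_list (map p w))))"
    by (rule sum.cong) (simp_all add: law)
  finally show "n * P \<le> (\<Sum>w\<in>words M n. prod_list (map p w) * (s * ln (mnorm (mprod A w)) - ln (prod_list (map p w))))" .
qed

lemma emeasure_cylinder: "w \<in> words M n \<Longrightarrow> emeasure \<nu> (cylinder M w) = ennreal (law \<nu> (wordof n) w)"
proof -
  assume "w \<in> words M n"
  then have "cylinder M w = wordof n -` {w} \<inter> space \<nu>"
    by (auto simp: cylinder_def wordof_def space_eq words_def)
  then show ?thesis by (simp add: law_def emeasure_eq_measure)
qed

lemma product_law_fully_supported:
  assumes p: "\<And>i. i \<in> {1..M} \<Longrightarrow> 0 < p i"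
    and law: "\<And>n w. w \<in> words M n \<Longrightarrow> law \<nu> (wordof n) w = prod_list (map p w)"
  shows "fully_supported M \<nu>"
  unfolding fully_supported_def
proof (intro allI impI, elim conjE)
  fix U assume U: "openin (full_shift M) U" and "U \<noteq> {}"
  then obtain x where x: "x \<in> U" by blast
  then have "x \<in> space \<nu>" using openin_subset[OF U] by (auto simp: space_eq)
  obtain n where n: "cylinder M (wordof n x) \<subseteq> U"
    using open_contains_cylinder[OF U x] by (auto simp: wordof_def)
  have w: "wordof n x \<in> words M n" by (rule wordof_in_words) fact
  have "0 < law \<nu> (wordof n) (wordof n x)"
    unfolding law[OF w] by (rule ln_prod_list(1)) (use w p in \<open>auto simp: words_def\<close>)
  then have "0 < emeasure \<nu> (cylinder M (wordof n x))"
    by (simp add: emeasure_cylinder[OF w])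
  also have "\<dots> \<le> emeasure \<nu> U"
    using n U by (intro emeasure_mono) (auto simp: sets_eq sets_borel_shift_opens intro: sigma_sets.Basic)
  finally show "0 < emeasure \<nu> U" .
qed

text \<open>Both measures agree on cylinders, which are closed under intersection and generate the Borel sets.\<close>

lemma product_law_bernoulli:
  assumes p: "\<And>i. i \<in> {1..M} \<Longrightarrow> 0 \<le> p i" "(\<Sum>i\<in>{1..M}. p i) = 1"
    and law: "\<And>n w. w \<in> words M n \<Longrightarrow> law \<nu> (wordof n) w = prod_list (map p w)"
  shows "bernoulli_measure M \<nu>"
proof -
  define N where "N = point_measure {1..M} (\<lambda>i. ennreal (p i))"
  define \<pi> where "\<pi> = PiM UNIV (\<lambda>_::nat. N)"
  have N: "prob_space N"
    unfolding N_def by (rule prob_space_point_measure) (use p sum_ennreal[of "{1..M}" p] in auto)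
  interpret N: prob_space N by (rule N)
  interpret \<pi>: product_prob_space "\<lambda>_::nat. N" UNIV by unfold_locales
  have sets_N: "sets N = sets (count_space {1..M})"
    by (simp add: N_def sets_point_measure)
  have N_single: "measure N {i} = p i" if "i \<in> {1..M}" for i
    using that p(1)[OF that] by (simp add: N_def measure_def emeasure_point_measure_finite)
  have sets_\<pi>: "sets \<pi> = sets (borel_shift M)"
    unfolding \<pi>_def sets_borel_shift_eq_PiM by (rule sets_PiM_cong) (simp_all add: sets_N)
  then have space_\<pi>: "space \<pi> = topspace (full_shift M)"
    using sets_eq_imp_space_eq[OF sets_\<pi>] by (simp add: space_borel_shift)
  have cyl: "emeasure \<nu> (cylinder M w) = emeasure \<pi> (cylinder M w)" for w
  proof (cases "set w \<subseteq> {1..M}")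
    case True
    then have w: "w \<in> words M (length w)" by (simp add: words_def)
    have "cylinder M w = (\<lambda>x. map x [0..<0 + length w]) -` {w} \<inter> space \<pi>"
      by (auto simp: cylinder_def space_\<pi>)
    then have "emeasure \<pi> (cylinder M w) = ennreal (law \<pi> (\<lambda>x. map x [0..<0 + length w]) w)"
      by (simp add: law_def \<pi>_def \<pi>.P.emeasure_eq_measure)
    also have "law \<pi> (\<lambda>x. map x [0..<0 + length w]) w = prod_list (map (\<lambda>b. measure N {b}) w)"
      unfolding \<pi>_def by (rule law_PiM_map[OF N]) (use True in \<open>auto simp: sets_N\<close>)
    also have "\<dots> = prod_list (map p w)"
      using True by (intro arg_cong[of _ _ prod_list] map_cong refl N_single) auto
    finally show ?thesis using emeasure_cylinder[OF w] law[OF w] by simp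
  next
    case False
    have "cylinder M w = {}"
    proof (rule ccontr)
      assume "cylinder M w \<noteq> {}"
      then obtain x where x: "x \<in> topspace (full_shift M)" "map x [0..<length w] = w"
        by (auto simp: cylinder_def)
      have "set (map x [0..<length w]) \<subseteq> {1..M}" using x(1) by (auto simp: topspace_full_shift)
      then have "set w \<subseteq> {1..M}" by (simp only: x(2))
      then show False using False by simp
    qed
    then show ?thesis by simp
  qed
  have "\<nu> = \<pi>"
  proof (rule measure_eqI_generator_eq[of "range (cylinder M)" "topspace (full_shift M)" _ _ "\<lambda>_. cylinder M []"])
    have nested: "cylinder M u \<inter> cylinder M v = (if take (length u) v = u then cylinder M v else {})"
      if "length u \<le> length v" for u v
    proof -
      have "map x [0..<length u] = take (length u) (map x [0..<length v])" for x :: "nat \<Rightarrow> nat"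
        using that by (simp add: take_map)
      then show ?thesis unfolding cylinder_def by auto
    qed
    have "{} = cylinder M [0]" by (force simp: cylinder_def topspace_full_shift intro: exI[of _ 0])
    then have "{} \<in> range (cylinder M)" by blast
    then have "cylinder M u \<inter> cylinder M v \<in> range (cylinder M)" for u v
      using nested[of u v] nested[of v u] by (cases "length u \<le> length v") (auto simp: Int_commute)
    then show "Int_stable (range (cylinder M))"
      unfolding Int_stable_def by blast
    show "range (cylinder M) \<subseteq> Pow (topspace (full_shift M))"
      by (auto simp: cylinder_def)
    show "emeasure \<nu> X = emeasure \<pi> X" if "X \<in> range (cylinder M)" for X
      using that cyl by blast
    show "sets \<nu> = sigma_sets (topspace (full_shift M)) (range (cylinder M))"
      "sets \<pi> = sigma_sets (topspace (full_shift M)) (range (cylinder M))"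
      by (simp_all add: sets_eq sets_\<pi> sets_borel_shift)
    show "range (\<lambda>_::nat. cylinder M []) \<subseteq> range (cylinder M)" by blast
    show "(\<Union>i::nat. cylinder M []) = topspace (full_shift M)" by (simp add: cylinder_def)
    show "emeasure \<nu> (cylinder M []) \<noteq> \<infinity>" by simp
  qed
  then show ?thesis
    unfolding bernoulli_measure_def using N sets_N \<pi>_def by blast
qed

lemma bernoulli_product_law:
  assumes "prob_space N" "sets N = sets (count_space {1..M})" "\<nu> = PiM UNIV (\<lambda>_. N)"
    and w: "w \<in> words M n"
  shows "law \<nu> (wordof n) w = prod_list (map (\<lambda>i. measure N {i}) w)"
proof -
  have "wordof n = (\<lambda>x. map x [0..<0 + length w])"
    using w by (auto simp: wordof_def words_def fun_eq_iff)
  then show ?thesis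
    unfolding assms(3)
    by (simp only:, intro law_PiM_map[OF assms(1)]) (use w assms(2) in \<open>auto simp: words_def\<close>)
qed

end


section \<open>The equivalence\<close>

text \<open>All that the equivalence uses about equilibrium states besides invariance.\<close>

lemma equilibrium_state_pressure:
  fixes A :: "nat \<Rightarrow> real^'n^'n"
  assumes irr: "irreducible_tuple M A" and s: "s > 0" and i: "i \<in> {1..M}" "A i \<noteq> 0"
    and eq: "equilibrium_state M A s \<mu>"
  obtains P C where "free_energy A s \<mu> = ereal P" "C > 0"
    "\<And>N. (\<Sum>w\<in>words M N. mnorm (mprod A w) powr s) \<le> C * exp (N * P)"
proof -
  have \<mu>: "\<mu> \<in> invariant_measures M"
    and max: "free_energy A s \<mu> = (SUP \<nu>\<in>invariant_measures M. free_energy A s \<nu>)"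
    using eq by (auto simp: equilibrium_state_def)
  interpret shift_invariant M \<mu> by unfold_locales (rule \<mu>)
  have le: "free_energy A s \<nu> \<le> free_energy A s \<mu>" if "\<nu> \<in> invariant_measures M" for \<nu>
    unfolding max using that by (rule SUP_upper)
  obtain \<nu> p where \<nu>: "\<nu> \<in> invariant_measures M" "ereal p \<le> free_energy A s \<nu>"
    by (rule exists_finite_free_energy[OF irr s i])
  have "ereal p \<le> free_energy A s \<mu>" using \<nu>(2) le[OF \<nu>(1)] by (rule order_trans)
  then obtain P where P: "free_energy A s \<mu> = ereal P"
    using free_energy_less_top[OF s, of A] by (cases "free_energy A s \<mu>") auto
  show ?thesis
    by (rule sum_norms_le_exp_pressure[OF irr s le[unfolded P]]) (assumption, rule that[OF P])
qed

theorem theorem13: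
  fixes M :: nat
    and A :: "nat \<Rightarrow> real^'n^'n"
    and s :: real
    and \<mu> :: "(nat \<Rightarrow> nat) measure"
  assumes "M \<ge> 2"
    and "irreducible_tuple M A"
    and "\<forall>i\<in>{1..M}. A i \<noteq> 0"
    and "s > 0"
    and "equilibrium_state M A s \<mu>"
  defines "cond_i \<equiv>
      bernoulli_measure M \<mu> \<and> fully_supported M \<mu> \<and> (\<forall>i\<in>{1..M}. invertible (A i))"
    and "cond_ii \<equiv>
      (\<forall>i\<in>{1..CARD('n)}. \<forall>j\<in>{1..CARD('n)}. lyapunov_exponent A \<mu> i = lyapunov_exponent A \<mu> j)"
    and "cond_iii \<equiv>
      (\<exists>B :: real^'n^'n. invertible B \<and>
         (\<forall>i\<in>{1..M}. det (A i) \<noteq> 0 \<and>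
            orthogonal_matrix
              (\<bar>det (A i)\<bar> powr (- 1 / real CARD('n)) *\<^sub>R (matrix_inv B ** A i ** B))))"
  shows "(cond_i \<longleftrightarrow> cond_ii) \<and> (cond_ii \<longleftrightarrow> cond_iii)"
proof -
  interpret shift_invariant M \<mu>
    using assms(5) by unfold_locales (simp add: equilibrium_state_def)
  have one: "1 \<in> {1..M}" using assms(1) by simp
  obtain P C where fe: "free_energy A s \<mu> = ereal P" and C: "C > 0"
    and upper: "\<And>N. (\<Sum>w\<in>words M N. mnorm (mprod A w) powr s) \<le> C * exp (N * P)"
    using equilibrium_state_pressure[OF assms(2,4) one _ assms(5)] assms(3) one by blast
  have scale: "matrix_inv B ** (c *\<^sub>R X) ** B = c *\<^sub>R (matrix_inv B ** X ** B)" for B X :: "real^'n^'n" and c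
    by (simp add: matrix_scalar_ac flip: scalar_matrix_assoc)
  have "cond_iii" if "cond_i"
  proof -
    have inv: "invertible (A i)" if "i \<in> {1..M}" for i
      using \<open>cond_i\<close> that unfolding cond_i_def by blast
    obtain N where N: "prob_space N" "sets N = sets (count_space {1..M})" "\<mu> = PiM UNIV (\<lambda>_. N)"
      using \<open>cond_i\<close> unfolding cond_i_def bernoulli_measure_def by blast
    define p where "p i = measure N {i}" for i
    have law: "law \<mu> (wordof n) w = prod_list (map p w)" if "w \<in> words M n" for n w
      unfolding p_def by (rule bernoulli_product_law[OF N that])
    have "(\<Sum>i\<in>{1..M}. p i) ^ 1 = (\<Sum>w\<in>words M 1. law \<mu> (wordof 1) w)"
      unfolding sum_words_prod_list[symmetric] by (intro sum.cong refl law[symmetric])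
    then have "(\<Sum>i\<in>{1..M}. p i) = 1" by (simp only: sum_law_words power_one_right)
    then interpret product_weights M A s P C p
      by (intro product_law_weights[OF assms(2,4) C upper _ _ law fe]) (simp_all add: p_def)
    obtain B :: "real^'n^'n" where B: "invertible B" "\<And>i. i \<in> {1..M} \<Longrightarrow> rate i > 0"
      "\<And>i. i \<in> {1..M} \<Longrightarrow> orthogonal_matrix (matrix_inv B ** (A i /\<^sub>R rate i) ** B)"
      by (rule conformal[OF inv]) blast+
    have "det (A i) \<noteq> 0 \<and> orthogonal_matrix
        (\<bar>det (A i)\<bar> powr (- 1 / real CARD('n)) *\<^sub>R (matrix_inv B ** A i ** B))" if i: "i \<in> {1..M}" for i
      using conformal_factor[OF B(1) B(2)[OF i] B(3)[OF i]] B(3)[OF i] by (simp only: scale) simp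
    then show cond_iii unfolding cond_iii_def using B(1) by blast
  qed
  moreover have "cond_ii" if "cond_iii"
  proof -
    obtain B :: "real^'n^'n" where B: "invertible B" "\<And>i. i \<in> {1..M} \<Longrightarrow> det (A i) \<noteq> 0"
      "\<And>i. i \<in> {1..M} \<Longrightarrow> orthogonal_matrix
        (\<bar>det (A i)\<bar> powr (- 1 / real CARD('n)) *\<^sub>R (matrix_inv B ** A i ** B))"
      using \<open>cond_iii\<close> unfolding cond_iii_def by blast
    define r where "r i = \<bar>det (A i)\<bar> powr (1 / CARD('n))" for i
    have inverse_r: "inverse (r i) = \<bar>det (A i)\<bar> powr (- 1 / CARD('n))" for i
      by (simp add: r_def flip: powr_minus)
    have "r i > 0" if "i \<in> {1..M}" for i
      using B(2)[OF that] by (simp add: r_def)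
    moreover have "orthogonal_matrix (matrix_inv B ** (A i /\<^sub>R r i) ** B)" if "i \<in> {1..M}" for i
      using B(3)[OF that] by (simp only: scale inverse_r)
    ultimately show cond_ii
      unfolding cond_ii_def using conformal_exponents_equal[OF B(1), of r A] by simp
  qed
  moreover have "cond_i" if "cond_ii"
  proof -
    have eq: "lyapunov_exponent A \<mu> 1 = lyapunov_exponent A \<mu> CARD('n)"
      using \<open>cond_ii\<close> unfolding cond_ii_def by (simp add: Suc_le_eq)
    define p where "p i = exp (- P) * \<bar>det (A i)\<bar> powr (s / CARD('n))" for i
    have nonneg: "0 \<le> p i" for i by (simp add: p_def)
    note law = equal_exponents_product_law[OF fe assms(4) upper eq, folded p_def]
    interpret product_weights M A s P C p
      by (rule product_law_weights[OF assms(2,4) C upper nonneg law(2) law(1) fe])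
    have pos: "p i > 0" if "i \<in> {1..M}" for i
      using weight_positive[OF that] assms(3) that by blast
    have "invertible (A i)" if "i \<in> {1..M}" for i
      using pos[OF that] by (auto simp: p_def invertible_det_nz)
    then show cond_i
      unfolding cond_i_def
      using product_law_bernoulli[OF nonneg law(2,1)] product_law_fully_supported[OF pos law(1)] by blast
  qed
  ultimately show ?thesis by blast
qed

end
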